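(* Let $1 \le n \le 15$ and let $G$ be a group of minimal order in which all groups of order $n$ can be embedded. Then the isomorphism class of $G$ is given by the following list, which for each $n$ gives the group(s) of least order (up to isomorphism) in which all groups of order $n$ can be embedded: \begin{itemize} \item $n=1$: $C_1$; \item $n=2$: $C_2$; \item $n=3$: $C_3$; \item $n=4$: $C_2\times C_4$ and $D_4$; \item $n=5$: $C_5$; \item $n=6$: $D_6$; \item $n=7$: $C_7$; \item $n=8$: $C_2\times H_1$ and $H_2$; \item $n=9$: $C_3\times C_9$ and $H_3$; \item $n=10$: $D_{10}$; \item $n=11$: $C_{11}$; \item $n=12$: $S_3\times S_4$; \item $n=13$: $C_{13}$; \item $n=14$: $D_{14}$; \item $n=15$: $C_{15}$. \end{itemize}
   Context: All groups are finite. A group $K$ can be embedded in a group $G$ if $G$ has a subgroup isomorphic to $K$; "all groups of order $n$ can be embedded in $G$" means that every group of order $n$ is isomorphic to some subgroup of $G$. $C_n$ is the cyclic group of order $n$, $S_n$ is the symmetric group of degree $n$, and $D_n$ is the dihedral group of order $2n$, $D_n=\langle a,b \mid a^n=1=b^2,\ bab=a^{-1}\rangle$. The remaining groups are $$H_1=\langle x_2,y \mid x_2^2=y^8=1,\ x_2yx_2=y^3\rangle$$ (the quasi-dihedral group of order 16), $$H_2=\langle x_1,x_2,y \mid x_1^2=x_2^2=y^8=1,\ [x_1,x_2]=1,\ x_1yx_1=y^5,\ x_2yx_2=y^3\rangle$$ (of order 32, isomorphic to the holomorph of $C_8$, i.e. the semidirect product of $C_8$ by $\mathrm{Aut}(C_8)$),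 and $$H_3=\langle a,b \mid a^9=1=b^3,\ b^{-1}ab=a^4\rangle$$ (the non-abelian group of order 27 and exponent 9). *)

theory Defs
  imports "HOL-Algebra.Elementary_Groups" "HOL-Algebra.Sym_Groups"
begin

section \<open>Embeddings\<close>

definition embeds :: "('a, 'm) monoid_scheme \<Rightarrow> ('b, 'n) monoid_scheme \<Rightarrow> bool"
  where "embeds K G \<longleftrightarrow> (\<exists>H. subgroup H G \<and> K \<cong> G\<lparr>carrier := H\<rparr>)"

text \<open>
  A formula cannot quantify over types, so the groups of order \<open>n\<close> range over those with
  elements in \<open>nat\<close>. For \<open>n > 0\<close> this loses nothing, since every finite group is isomorphic
  to one of them (see \<open>all_embedD\<close> and \<open>least_order_le\<close> below).
\<close>

definition all_embed :: "nat \<Rightarrow> ('a, 'm) monoid_scheme \<Rightarrow> bool"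
  where "all_embed n G \<longleftrightarrow> (\<forall>K :: nat monoid. group K \<and> order K = n \<longrightarrow> embeds K G)"

definition least_order_all_embed :: "nat \<Rightarrow> ('a, 'm) monoid_scheme \<Rightarrow> bool"
  where "least_order_all_embed n G \<longleftrightarrow>
    group G \<and> finite (carrier G) \<and> all_embed n G \<and>
    (\<forall>H :: nat monoid. group H \<and> finite (carrier H) \<and> all_embed n H \<longrightarrow> order G \<le> order H)"

lemma embeds_iso_left:
  assumes "K \<cong> K'" "embeds K' G"
  shows "embeds K G"
proof -
  obtain H where "subgroup H G" "K' \<cong> G\<lparr>carrier := H\<rparr>"
    using assms(2) unfolding embeds_def by blast
  with iso_trans[OF assms(1)] show ?thesis
    unfolding embeds_def by blast
qed

lemma embeds_iso_right:
  assumes "group G" "group G'" "G \<cong> G'" "embeds K G"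
  shows "embeds K G'"
proof -
  obtain H where H: "subgroup H G" "K \<cong> G\<lparr>carrier := H\<rparr>"
    using assms(4) unfolding embeds_def by blast
  obtain h where h: "h \<in> iso G G'"
    using assms(3) unfolding is_iso_def by blast
  have hom: "group_hom G G' h"
    using assms(1,2) h by (simp add: group_hom_def group_hom_axioms_def iso_def)
  have "subgroup (h ` H) G'"
    using group_hom.subgroup_img_is_subgroup[OF hom H(1)] .
  moreover have "h \<in> iso (G\<lparr>carrier := H\<rparr>) (G'\<lparr>carrier := h ` H\<rparr>)"
    using h subgroup.subset[OF H(1)]
    by (auto simp: iso_def hom_def subset_iff intro: bij_betw_subset)
  then have "K \<cong> G'\<lparr>carrier := h ` H\<rparr>"
    using iso_trans[OF H(2)] unfolding is_iso_def by blast
  ultimately show ?thesis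
    unfolding embeds_def by blast
qed

lemma finite_group_iso_nat:
  assumes "group K" "finite (carrier K)"
  obtains L :: "nat monoid" where "group L" "K \<cong> L" "finite (carrier L)" "order L = order K"
proof -
  obtain e where e: "bij_betw e {0..<card (carrier K)} (carrier K)"
    using ex_bij_betw_nat_finite[OF assms(2)] by blast
  define f where "f = the_inv_into {0..<card (carrier K)} e"
  have f: "bij_betw f (carrier K) {0..<card (carrier K)}"
    unfolding f_def using bij_betw_the_inv_into[OF e] .
  have ef: "e (f x) = x" if "x \<in> carrier K" for x
    unfolding f_def using that f_the_inv_into_f_bij_betw[OF e] by blast
  define L :: "nat monoid" where
    "L = \<lparr>carrier = {0..<card (carrier K)}, monoid.mult = (\<lambda>x y. f (e x \<otimes>\<^bsub>K\<^esub> e y)), one = f \<one>\<^bsub>K\<^esub>\<rparr>"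
  have hom: "f \<in> hom K L"
    using f ef by (auto simp: hom_def L_def bij_betw_def)
  have iso: "f \<in> iso K L"
    using hom f by (simp add: iso_def L_def)
  have img: "L\<lparr>carrier := f ` carrier K, one := f \<one>\<^bsub>K\<^esub>\<rparr> = L"
    using f by (simp add: L_def bij_betw_def)
  have "group L"
    using group.hom_imp_img_group[OF assms(1) hom] unfolding img .
  moreover have "K \<cong> L"
    using iso unfolding is_iso_def by blast
  ultimately show thesis
    by (intro that) (auto simp: L_def order_def)
qed

lemma all_embedD:
  assumes "all_embed n G" "group K" "order K = n" "n > 0"
  shows "embeds K G"
proof -
  have "finite (carrier K)"
    using assms(3,4) by (simp add: order_def card_ge_0_finite)
  then obtain L :: "nat monoid" where L: "group L" "K \<cong> L" "order L = order K"
    by (rule finite_group_iso_nat[OF assms(2)])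
  have "embeds L G"
    using assms(1,3) L(1,3) unfolding all_embed_def by simp
  then show ?thesis
    by (rule embeds_iso_left[OF L(2)])
qed

lemma least_order_le:
  assumes "least_order_all_embed n G" "group H" "finite (carrier H)" "all_embed n H"
  shows "order G \<le> order H"
proof -
  obtain L :: "nat monoid"
    where L: "group L" "H \<cong> L" "finite (carrier L)" "order L = order H"
    by (rule finite_group_iso_nat[OF assms(2,3)])
  then have "all_embed n L"
    using embeds_iso_right[OF assms(2) L(1,2)] assms(4) unfolding all_embed_def by blast
  then show ?thesis
    using assms(1) L(1,3,4) unfolding least_order_all_embed_def by fastforce
qed


section \<open>Groups given by generators and relations\<close>

text \<open>
  A word is a list of letters: \<open>(x, True)\<close> stands for the generator \<open>x\<close> and \<open>(x, False)\<close>
  for its inverse. A relation \<open>(u, v)\<close> means \<open>u = v\<close>.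
\<close>

type_synonym 'x word = "('x \<times> bool) list"

definition words :: "'x set \<Rightarrow> 'x word set"
  where "words X = lists (X \<times> UNIV)"

definition gen :: "'x \<Rightarrow> 'x word"
  where "gen x = [(x, True)]"

definition winv :: "'x word \<Rightarrow> 'x word"
  where "winv w = rev (map (\<lambda>(x, s). (x, \<not> s)) w)"

definition wpow :: "'x word \<Rightarrow> nat \<Rightarrow> 'x word"
  where "wpow w k = concat (replicate k w)"

inductive_set word_cong :: "'x set \<Rightarrow> ('x word \<times> 'x word) set \<Rightarrow> ('x word \<times> 'x word) set"
  for X R where
    refl: "w \<in> words X \<Longrightarrow> (w, w) \<in> word_cong X R"
  | sym: "(u, v) \<in> word_cong X R \<Longrightarrow> (v, u) \<in> word_cong X R"
  | trans: "(u, v) \<in> word_cong X R \<Longrightarrow> (v, w) \<in> word_cong X R \<Longrightarrow> (u, w) \<in> word_cong X R"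
  | append: "(u, u') \<in> word_cong X R \<Longrightarrow> (v, v') \<in> word_cong X R \<Longrightarrow>
      (u @ v, u' @ v') \<in> word_cong X R"
  | cancel: "x \<in> X \<Longrightarrow> ([(x, s), (x, \<not> s)], []) \<in> word_cong X R"
  | rel: "(u, v) \<in> R \<Longrightarrow> u \<in> words X \<Longrightarrow> v \<in> words X \<Longrightarrow> (u, v) \<in> word_cong X R"

definition presented_group :: "'x set \<Rightarrow> ('x word \<times> 'x word) set \<Rightarrow> 'x word set monoid"
  where "presented_group X R =
    \<lparr>carrier = words X // word_cong X R,
     monoid.mult = (\<lambda>A B. \<Union>u\<in>A. \<Union>v\<in>B. word_cong X R `` {u @ v}),
     one = word_cong X R `` {[]}\<rparr>"

lemma words_Nil [simp]: "[] \<in> words X"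
  and words_append [simp]: "u @ v \<in> words X \<longleftrightarrow> u \<in> words X \<and> v \<in> words X"
  and words_Cons [simp]: "(x, s) # u \<in> words X \<longleftrightarrow> x \<in> X \<and> u \<in> words X"
  by (auto simp: words_def)

lemma winv_in_words [simp]: "winv w \<in> words X \<longleftrightarrow> w \<in> words X"
  by (induction w) (auto simp: winv_def)

lemma word_cong_words: "(u, v) \<in> word_cong X R \<Longrightarrow> u \<in> words X \<and> v \<in> words X"
  by (induction rule: word_cong.induct) auto

lemma equiv_word_cong: "equiv (words X) (word_cong X R)"
proof (rule equivI)
  show "word_cong X R \<subseteq> words X \<times> words X"
    by (auto dest: word_cong_words)
  show "refl_on (words X) (word_cong X R)"
    by (intro refl_onI word_cong.refl)
  show "Relation.sym (word_cong X R)"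
    by (rule symI) (rule word_cong.sym)
  show "Relation.trans (word_cong X R)"
    by (rule transI) (rule word_cong.trans)
qed

lemma presented_group_mult:
  assumes "u \<in> words X" "v \<in> words X"
  shows "word_cong X R `` {u} \<otimes>\<^bsub>presented_group X R\<^esub> word_cong X R `` {v} = word_cong X R `` {u @ v}"
proof -
  have "word_cong X R `` {u' @ v'} = word_cong X R `` {u @ v}"
    if "(u, u') \<in> word_cong X R" "(v, v') \<in> word_cong X R" for u' v'
    using equiv_class_eq[OF equiv_word_cong word_cong.append[OF that]] by simp
  then have "(\<Union>u'\<in>word_cong X R `` {u}. \<Union>v'\<in>word_cong X R `` {v}. word_cong X R `` {u' @ v'}) =
      (\<Union>u'\<in>word_cong X R `` {u}. \<Union>v'\<in>word_cong X R `` {v}. word_cong X R `` {u @ v})"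
    by (intro SUP_cong HOL.refl) simp
  also have "\<dots> = word_cong X R `` {u @ v}"
    using equiv_class_self[OF equiv_word_cong] assms by blast
  finally show ?thesis
    by (simp add: presented_group_def)
qed

lemma winv_cong: "w \<in> words X \<Longrightarrow> (winv w @ w, []) \<in> word_cong X R"
proof (induction w)
  case Nil
  then show ?case by (auto simp: winv_def intro: word_cong.refl)
next
  case (Cons a w)
  obtain x s where a: "a = (x, s)" by force
  have w: "x \<in> X" "w \<in> words X" using Cons.prems a by auto
  have "([(x, \<not> s), (x, s)], []) \<in> word_cong X R"
    using word_cong.cancel[OF w(1), of "\<not> s"] by simp
  then have "(winv w @ ([(x, \<not> s), (x, s)] @ w), winv w @ ([] @ w)) \<in> word_cong X R"
    using w by (intro word_cong.append word_cong.refl) auto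
  then have "(winv (a # w) @ a # w, winv w @ w) \<in> word_cong X R"
    by (simp add: winv_def a)
  then show ?case
    using Cons.IH[OF w(2)] by (rule word_cong.trans)
qed

lemma group_presented_group: "group (presented_group X R)"
proof (rule groupI)
  have rep: "\<exists>u\<in>words X. A = word_cong X R `` {u}" if "A \<in> carrier (presented_group X R)" for A
    using that by (auto simp: presented_group_def elim: quotientE)
  have cls: "word_cong X R `` {u} \<in> carrier (presented_group X R)" if "u \<in> words X" for u
    using that by (auto simp: presented_group_def intro: quotientI)
  have one: "\<one>\<^bsub>presented_group X R\<^esub> = word_cong X R `` {[]}"
    by (simp add: presented_group_def)
  show "\<one>\<^bsub>presented_group X R\<^esub> \<in> carrier (presented_group X R)"
    using cls one by simp
  fix A assume "A \<in> carrier (presented_group X R)"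
  then obtain u where u: "u \<in> words X" "A = word_cong X R `` {u}" using rep by blast
  show "\<one>\<^bsub>presented_group X R\<^esub> \<otimes>\<^bsub>presented_group X R\<^esub> A = A"
    using u by (simp add: one presented_group_mult)
  show "\<exists>B\<in>carrier (presented_group X R). B \<otimes>\<^bsub>presented_group X R\<^esub> A = \<one>\<^bsub>presented_group X R\<^esub>"
  proof
    show "word_cong X R `` {winv u} \<in> carrier (presented_group X R)"
      using u cls by simp
    show "word_cong X R `` {winv u} \<otimes>\<^bsub>presented_group X R\<^esub> A = \<one>\<^bsub>presented_group X R\<^esub>"
      using u equiv_class_eq[OF equiv_word_cong winv_cong] by (simp add: one presented_group_mult)
  qed
  fix B assume "B \<in> carrier (presented_group X R)"
  then obtain v where v: "v \<in> words X" "B = word_cong X R `` {v}" using rep by blast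
  show "A \<otimes>\<^bsub>presented_group X R\<^esub> B \<in> carrier (presented_group X R)"
    using u v cls by (simp add: presented_group_mult)
  fix C assume "C \<in> carrier (presented_group X R)"
  then obtain w where w: "w \<in> words X" "C = word_cong X R `` {w}" using rep by blast
  show "A \<otimes>\<^bsub>presented_group X R\<^esub> B \<otimes>\<^bsub>presented_group X R\<^esub> C =
        A \<otimes>\<^bsub>presented_group X R\<^esub> (B \<otimes>\<^bsub>presented_group X R\<^esub> C)"
    using u v w by (simp add: presented_group_mult)
qed

definition word_eval :: "('a, 'm) monoid_scheme \<Rightarrow> ('x \<Rightarrow> 'a) \<Rightarrow> 'x word \<Rightarrow> 'a"
  where "word_eval G f w =
    foldr (\<lambda>(x, s) g. (if s then f x else inv\<^bsub>G\<^esub> f x) \<otimes>\<^bsub>G\<^esub> g) w \<one>\<^bsub>G\<^esub>"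

lemma word_eval_closed:
  assumes "group G" "f \<in> X \<rightarrow> carrier G" "w \<in> words X"
  shows "word_eval G f w \<in> carrier G"
proof -
  interpret group G by fact
  show ?thesis using assms(2,3)
    by (induction w) (auto simp: word_eval_def Pi_iff)
qed

lemma word_eval_append:
  assumes "group G" "f \<in> X \<rightarrow> carrier G" "u \<in> words X" "v \<in> words X"
  shows "word_eval G f (u @ v) = word_eval G f u \<otimes>\<^bsub>G\<^esub> word_eval G f v"
proof -
  interpret group G by fact
  show ?thesis using assms(3)
  proof (induction u)
    case Nil
    then show ?case using word_eval_closed[OF assms(1,2,4)] by (simp add: word_eval_def)
  next
    case (Cons a u)
    obtain x s where a: "a = (x, s)" by force
    have u: "x \<in> X" "u \<in> words X" using Cons.prems a by auto
    have f: "f x \<in> carrier G" using assms(2) u(1) by auto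
    have step: "word_eval G f (a # w) = (if s then f x else inv\<^bsub>G\<^esub> f x) \<otimes>\<^bsub>G\<^esub> word_eval G f w" for w
      by (simp add: word_eval_def a)
    show ?case
      using Cons.IH[OF u(2)] f word_eval_closed[OF assms(1,2) u(2)] word_eval_closed[OF assms(1,2,4)]
      by (simp add: step m_assoc)
  qed
qed

lemma word_eval_cong:
  assumes "group G" "f \<in> X \<rightarrow> carrier G"
    and "\<And>u v. (u, v) \<in> R \<Longrightarrow> word_eval G f u = word_eval G f v"
    and "(u, v) \<in> word_cong X R"
  shows "word_eval G f u = word_eval G f v"
  using assms(4)
proof induction
  case (append u u' v v')
  then show ?case
    using word_eval_append[OF assms(1,2)] word_cong_words by metis
next
  case (cancel x s)
  interpret group G by fact
  have "f x \<in> carrier G" using assms(2) cancel by auto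
  then show ?case by (auto simp: word_eval_def)
qed (use assms(3) in auto)

lemma presented_group_universal:
  assumes "group G" "f \<in> X \<rightarrow> carrier G"
    and "\<And>u v. (u, v) \<in> R \<Longrightarrow> word_eval G f u = word_eval G f v"
  shows "\<exists>h\<in>hom (presented_group X R) G. \<forall>w\<in>words X. h (word_cong X R `` {w}) = word_eval G f w"
proof -
  define h where "h A = word_eval G f (SOME u. u \<in> A)" for A
  have h: "h (word_cong X R `` {w}) = word_eval G f w" if "w \<in> words X" for w
  proof -
    have "w \<in> word_cong X R `` {w}" using that by (auto intro: word_cong.refl)
    then have "(SOME u. u \<in> word_cong X R `` {w}) \<in> word_cong X R `` {w}"
      by (metis someI)
    then show ?thesis
      using word_eval_cong[OF assms] unfolding h_def by simp
  qed
  have "h \<in> hom (presented_group X R) G"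
  proof (rule homI)
    fix A assume "A \<in> carrier (presented_group X R)"
    then obtain u where u: "u \<in> words X" "A = word_cong X R `` {u}"
      by (auto simp: presented_group_def elim: quotientE)
    then show "h A \<in> carrier G" using h word_eval_closed[OF assms(1,2)] by simp
    fix B assume "B \<in> carrier (presented_group X R)"
    then obtain v where v: "v \<in> words X" "B = word_cong X R `` {v}"
      by (auto simp: presented_group_def elim: quotientE)
    show "h (A \<otimes>\<^bsub>presented_group X R\<^esub> B) = h A \<otimes>\<^bsub>G\<^esub> h B"
      using u v h word_eval_append[OF assms(1,2)] by (simp add: presented_group_mult)
  qed
  then show ?thesis using h by blast
qed


section \<open>The groups in the classification\<close>

definition dihedral_group :: "nat \<Rightarrow> string word set monoid"
  where "dihedral_group n =
    (let a = gen ''a''; b = gen ''b''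
     in presented_group {''a'', ''b''}
          {(wpow a n, []), (wpow b 2, []), (b @ a @ b, winv a)})"

definition H\<^sub>1 :: "string word set monoid"
  where "H\<^sub>1 =
    (let x\<^sub>2 = gen ''x2''; y = gen ''y''
     in presented_group {''x2'', ''y''}
          {(wpow x\<^sub>2 2, []), (wpow y 8, []), (x\<^sub>2 @ y @ x\<^sub>2, wpow y 3)})"

definition H\<^sub>2 :: "string word set monoid"
  where "H\<^sub>2 =
    (let x\<^sub>1 = gen ''x1''; x\<^sub>2 = gen ''x2''; y = gen ''y''
     in presented_group {''x1'', ''x2'', ''y''}
          {(wpow x\<^sub>1 2, []), (wpow x\<^sub>2 2, []), (wpow y 8, []),
           (winv x\<^sub>1 @ winv x\<^sub>2 @ x\<^sub>1 @ x\<^sub>2, []),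
           (x\<^sub>1 @ y @ x\<^sub>1, wpow y 5), (x\<^sub>2 @ y @ x\<^sub>2, wpow y 3)})"

definition H\<^sub>3 :: "string word set monoid"
  where "H\<^sub>3 =
    (let a = gen ''a''; b = gen ''b''
     in presented_group {''a'', ''b''}
          {(wpow a 9, []), (wpow b 3, []), (winv b @ a @ b, wpow a 4)})"

end

theory Submission
  imports Defs "HOL-Algebra.Group_Action" "HOL-Algebra.Multiplicative_Group" "HOL-Algebra.Sylow" "HOL-Algebra.Sym_Groups"
begin

text \<open>
  If \<open>G\<close> contains all groups of order \<open>n\<close>, products of suitable subgroups with trivial intersection
  bound its order from below, and when the bound is attained the product decomposition of \<open>G\<close>
  yields a presentation. For \<open>n = p\<^sup>2\<close> a cyclic group of order \<open>p\<^sup>2\<close> misses some element of order \<open>p\<close>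
  of an elementary abelian subgroup, so \<open>G\<close> has order at least \<open>p\<^sup>3\<close>. For \<open>n = 8\<close> a cyclic group of
  order 8 meets some Klein four-group inside a subgroup \<open>C\<^sub>2\<^sup>3\<close> trivially, so \<open>G\<close> has order at least 32.
  The candidates with a cyclic normal subgroup are identified with groups of affine maps modulo \<open>N\<close>.

  For \<open>n = 12\<close> let \<open>S\<close> be a Sylow 3-subgroup and \<open>N\<close> its normalizer. The four-group \<open>V\<close> of a subgroup
  \<open>A\<^sub>4\<close> meets \<open>N\<close> trivially, so \<open>|G| \<ge> 4 |N|\<close>, and counting fixed points modulo 3 leaves only orders
  with \<open>|G| = 4 |N|\<close>, \<open>G = V N\<close> and \<open>|S| = 9\<close>. The core \<open>T\<close> of \<open>S\<close> in \<open>G\<close> has order 3, since otherwise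
  \<open>S\<close> would embed in \<open>S\<^sub>4\<close>. The subgroups \<open>C\<^sub>1\<^sub>2\<close>, \<open>D\<^sub>6\<close> and \<open>C\<^sub>3 : C\<^sub>4\<close> force \<open>|N| = 36\<close> and provide an
  involution \<open>r\<close> inverting \<open>T\<close> and centralizing \<open>V\<close>. Then \<open>N\<close> and the centralizer of \<open>r\<close> are subgroups
  of index 4 and 3 with trivial common core, whence \<open>G\<close> embeds in \<open>S\<^sub>3 \<times> S\<^sub>4\<close>.
\<close>

text \<open>For \<open>n = 12\<close> nothing is known about how the embedded subgroups lie relative
  to each other. Each embedding is therefore conjugated separately, so that a chosen element of
  order 3 lands in the fixed subgroup \<open>S\<close>; then all five types of groups of order 12
  speak about one \<open>S\<close>, one \<open>N\<close> and one core. The four-group meets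
  \<open>N\<close> trivially because a commutator of \<open>x\<close> in \<open>V\<close> with the
  three-cycle \<open>d\<close> lies in \<open>V\<close> and, if \<open>x\<close> normalizes
  \<open>S\<close>, also in \<open>S\<close>. Conversely every element of \<open>V\<close> is such a
  commutator, so statements about conjugates of \<open>d\<close> carry over to \<open>V\<close>;
  this makes \<open>T\<close> centralize \<open>V\<close> and finally makes \<open>V\<close> normal.
  For \<open>n = 8\<close> a factorization of a group of order 32 into the powers of
  \<open>a\<close> and a four-group still leaves many possible actions.\<close>

definition cj :: "('a, 'm) monoid_scheme \<Rightarrow> 'a \<Rightarrow> 'a \<Rightarrow> 'a"
  where "cj G g x = g \<otimes>\<^bsub>G\<^esub> x \<otimes>\<^bsub>G\<^esub> inv\<^bsub>G\<^esub> g"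

section \<open>Conjugation and finite subgroups\<close>

context group
begin

lemma cj_closed [simp, intro]: "g \<in> carrier G \<Longrightarrow> x \<in> carrier G \<Longrightarrow> cj G g x \<in> carrier G"
  by (simp add: cj_def)

lemma cj_m:
  assumes "g \<in> carrier G" "x \<in> carrier G" "y \<in> carrier G"
  shows "cj G g (x \<otimes> y) = cj G g x \<otimes> cj G g y"
  using assms by (simp add: cj_def m_assoc inv_solve_left)

lemma cj_one [simp]: "g \<in> carrier G \<Longrightarrow> cj G g \<one> = \<one>"
  by (simp add: cj_def)

lemma cj_by_one [simp]: "x \<in> carrier G \<Longrightarrow> cj G \<one> x = x"
  by (simp add: cj_def)

lemma cj_cj:
  assumes "g \<in> carrier G" "h \<in> carrier G" "x \<in> carrier G"
  shows "cj G (g \<otimes> h) x = cj G g (cj G h x)"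
  using assms by (simp add: cj_def m_assoc inv_mult_group)

lemma cj_hom: "g \<in> carrier G \<Longrightarrow> cj G g \<in> hom G G"
  by (simp add: hom_def cj_m)

lemma cj_group_hom: "g \<in> carrier G \<Longrightarrow> group_hom G G (cj G g)"
  by (simp add: group_hom_def group_hom_axioms_def cj_hom)

lemma cj_inv: "g \<in> carrier G \<Longrightarrow> x \<in> carrier G \<Longrightarrow> cj G g (inv x) = inv (cj G g x)"
  using group_hom.hom_inv[OF cj_group_hom] by simp

lemma cj_pow: "g \<in> carrier G \<Longrightarrow> x \<in> carrier G \<Longrightarrow> cj G g (x [^] (n::nat)) = cj G g x [^] n"
  using group_hom.hom_nat_pow[OF cj_group_hom] by simp

lemma cj_inv_cj [simp]: "g \<in> carrier G \<Longrightarrow> x \<in> carrier G \<Longrightarrow> cj G (inv g) (cj G g x) = x"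
  by (simp add: cj_cj[symmetric])

lemma cj_cj_inv [simp]: "g \<in> carrier G \<Longrightarrow> x \<in> carrier G \<Longrightarrow> cj G g (cj G (inv g) x) = x"
  by (simp add: cj_cj[symmetric])

lemma cj_inj [simp]:
  "g \<in> carrier G \<Longrightarrow> x \<in> carrier G \<Longrightarrow> y \<in> carrier G \<Longrightarrow> cj G g x = cj G g y \<longleftrightarrow> x = y"
  by (metis cj_inv_cj)

lemma cj_eq_one [simp]: "g \<in> carrier G \<Longrightarrow> x \<in> carrier G \<Longrightarrow> cj G g x = \<one> \<longleftrightarrow> x = \<one>"
  by (metis cj_inj cj_one one_closed)

lemma cj_eq_iff:
  assumes "g \<in> carrier G" "x \<in> carrier G" "y \<in> carrier G"
  shows "cj G g x = y \<longleftrightarrow> g \<otimes> x = y \<otimes> g"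
proof
  assume "cj G g x = y"
  then have "y \<otimes> g = g \<otimes> x \<otimes> inv g \<otimes> g" by (simp add: cj_def)
  then show "g \<otimes> x = y \<otimes> g" using assms by (simp add: m_assoc)
qed (use assms in \<open>simp add: cj_def m_assoc\<close>)

lemma cj_fix_sym:
  "g \<in> carrier G \<Longrightarrow> x \<in> carrier G \<Longrightarrow> cj G g x = x \<Longrightarrow> cj G x g = g"
  by (simp add: cj_eq_iff)

lemma cj_sub:
  assumes "subgroup M G" "g \<in> M"
  shows "cj (G\<lparr>carrier := M\<rparr>) g x = cj G g x"
  using assms by (simp add: cj_def)

lemma pow_sub:
  fixes n :: nat
  shows "x [^]\<^bsub>G\<lparr>carrier := M\<rparr>\<^esub> n = x [^] n"
  by (simp add: nat_pow_def)

text \<open>Left translation by \<open>a\<close> is injective and maps the finite set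
  \<open>H\<close> into itself, so it is onto; a preimage of \<one> is the inverse of
  \<open>a\<close>.\<close>

lemma finite_subgroupI:
  assumes "finite H" "H \<subseteq> carrier G" "\<one> \<in> H" "\<And>x y. x \<in> H \<Longrightarrow> y \<in> H \<Longrightarrow> x \<otimes> y \<in> H"
  shows "subgroup H G"
proof (rule subgroupI)
  fix a assume a: "a \<in> H"
  have "inj_on (\<lambda>x. a \<otimes> x) H"
    using assms(2) a by (intro inj_onI) (auto simp: subset_iff)
  then have "(\<lambda>x. a \<otimes> x) ` H = H"
    using assms(1,4) a by (intro endo_inj_surj) auto
  then obtain x where "x \<in> H" "a \<otimes> x = \<one>"
    using assms(3) by (metis imageE)
  then show "inv a \<in> H"
    using assms(2) a by (metis inv_equality inv_comm subsetD)
qed (use assms in auto)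

lemma card_dvd_subgroup:
  assumes "subgroup H G" "subgroup K G" "H \<subseteq> K"
  shows "card H dvd card K"
proof -
  interpret K: group "G\<lparr>carrier := K\<rparr>"
    using assms(2) by (simp add: subgroup_imp_group)
  have "subgroup H (G\<lparr>carrier := K\<rparr>)"
    using assms by (simp add: subgroup_incl)
  from K.lagrange[OF this] show ?thesis
    by (metis dvd_triv_right order_def partial_object.select_convs(1) partial_object.update_convs(1) monoid.surjective)
qed

lemma card_dvd_order:
  "subgroup H G \<Longrightarrow> card H dvd order G"
  using lagrange by (metis dvd_triv_right)

end


subsection \<open>Fixed cosets of p-groups\<close>

text \<open>The non-fixed points are a union of orbits, and each such orbit has a size dividing a
  power of \<open>p\<close> but different from 1.\<close>

lemma (in group_action) dvd_card_non_fixed: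
  assumes "finite E" "prime p" "order G = p ^ e"
  shows "p dvd card {x \<in> E. \<exists>g\<in>carrier G. \<phi> g x \<noteq> x}"
proof -
  let ?N = "{x \<in> E. \<exists>g\<in>carrier G. \<phi> g x \<noteq> x}"
  let ?C = "orbit G \<phi> ` ?N"
  interpret G: group G using group_hom group_hom.axioms(1) by auto
  have sub: "orbit G \<phi> x \<subseteq> E" if "x \<in> E" for x
    using that element_image unfolding orbit_def by auto
  have un: "\<Union> ?C = ?N"
  proof
    show "?N \<subseteq> \<Union> ?C" using orbit_refl by auto
    show "\<Union> ?C \<subseteq> ?N"
    proof
      fix y assume "y \<in> \<Union> ?C"
      then obtain x g where x: "x \<in> E" "g \<in> carrier G" "\<phi> g x \<noteq> x" and y: "y \<in> orbit G \<phi> x" by auto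
      have yE: "y \<in> E" using x y sub by blast
      show "y \<in> ?N"
      proof (rule ccontr)
        assume "y \<notin> ?N"
        then have fixd: "\<forall>g\<in>carrier G. \<phi> g y = y" using yE by auto
        have "x \<in> orbit G \<phi> y" using orbit_sym x(1) yE y by auto
        then have "x = y" using fixd unfolding orbit_def by auto
        then show False using fixd x by auto
      qed
    qed
  qed
  have "p dvd card (\<Union> ?C)"
  proof (rule dvd_partition)
    show "finite (\<Union> ?C)" using assms(1) un by simp
    show "\<forall>c\<in>?C. p dvd card c"
    proof
      fix c assume "c \<in> ?C"
      then obtain x g where x: "x \<in> E" "g \<in> carrier G" "\<phi> g x \<noteq> x" "c = orbit G \<phi> x" by auto
      have "card c dvd p ^ e"
        using orbit_stabilizer_theorem[OF x(1)] assms(3) x(4) by (metis dvd_triv_left)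
      then obtain i where i: "card c = p ^ i"
        using divides_primepow_nat[OF assms(2)] by blast
      have "x \<in> c" "\<phi> g x \<in> c" using x orbit_refl unfolding orbit_def by auto
      then have "card c \<noteq> 1" using x(3) by (auto simp: card_1_singleton_iff)
      then have "i \<noteq> 0" using i by (metis power_0)
      then show "p dvd card c" using i by (simp add: dvd_power)
    qed
    show "\<forall>c1\<in>?C. \<forall>c2\<in>?C. c1 \<noteq> c2 \<longrightarrow> c1 \<inter> c2 = {}"
      using disjoint_union unfolding orbits_def by blast
  qed
  then show ?thesis using un by simp
qed

context group
begin

text \<open>Right multiplication on right cosets reverses products; multiplying by
  \<open>inv q\<close> turns it into a left action. The maps are restricted to the cosets because
  the elements of \<open>Bij\<close> are extensional.\<close>

lemma coset_action:
  assumes "subgroup Q G" "subgroup H G"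
  shows "group_action (G\<lparr>carrier := Q\<rparr>) (rcosets H) (\<lambda>q. \<lambda>C\<in>rcosets H. C #> inv q)"
proof -
  let ?\<phi> = "\<lambda>q. \<lambda>C\<in>rcosets H. C #> inv q"
  interpret Q: subgroup Q G by fact
  interpret H: subgroup H G by fact
  have sub: "C \<subseteq> carrier G" if "C \<in> rcosets H" for C
    using H.rcosets_carrier[OF is_group that] .
  have cl: "C #> x \<in> rcosets H" if C: "C \<in> rcosets H" "x \<in> carrier G" for C x
  proof -
    obtain g where "g \<in> carrier G" "C = H #> g" using C(1) unfolding RCOSETS_def by blast
    then show ?thesis using C(2) H.subset by (simp add: coset_mult_assoc rcosetsI)
  qed
  have bij: "?\<phi> q \<in> Bij (rcosets H)" if q: "q \<in> Q" for q
  proof -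
    have "bij_betw (\<lambda>C. C #> inv q) (rcosets H) (rcosets H)"
      by (rule bij_betwI[where g = "\<lambda>C. C #> q"])
        (use q cl sub in \<open>auto simp: coset_mult_assoc\<close>)
    then show ?thesis
      unfolding Bij_def by (simp add: bij_betw_restrict_eq)
  qed
  have "group_hom (G\<lparr>carrier := Q\<rparr>) (BijGroup (rcosets H)) ?\<phi>"
    unfolding group_hom_def group_hom_axioms_def
  proof (intro conjI homI)
    show "group (G\<lparr>carrier := Q\<rparr>)" by (rule Q.subgroup_is_group) (rule is_group)
    show "group (BijGroup (rcosets H))" by (rule group_BijGroup)
    fix x y assume "x \<in> carrier (G\<lparr>carrier := Q\<rparr>)" "y \<in> carrier (G\<lparr>carrier := Q\<rparr>)"
    then have xy: "x \<in> Q" "y \<in> Q" by auto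
    then have xy': "x \<in> carrier G" "y \<in> carrier G" by auto
    have "?\<phi> (x \<otimes> y) = compose (rcosets H) (?\<phi> x) (?\<phi> y)"
      by (rule ext)
        (use xy' cl sub in \<open>auto simp: compose_def restrict_def coset_mult_assoc inv_mult_group\<close>)
    then show "?\<phi> (x \<otimes>\<^bsub>G\<lparr>carrier := Q\<rparr>\<^esub> y) = ?\<phi> x \<otimes>\<^bsub>BijGroup (rcosets H)\<^esub> ?\<phi> y"
      using bij xy by (simp add: BijGroup_def)
  qed (use bij in \<open>simp add: BijGroup_def\<close>)
  then show ?thesis by (rule group_action.intro)
qed

lemma dvd_card_non_fixed_cosets:
  assumes "finite (carrier G)" "prime p" "subgroup Q G" "card Q = p ^ e" "subgroup H G"
  shows "p dvd card {C \<in> rcosets H. \<exists>q\<in>Q. C #> q \<noteq> C}"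
proof -
  interpret group_action "G\<lparr>carrier := Q\<rparr>" "rcosets H" "\<lambda>q. \<lambda>C\<in>rcosets H. C #> inv q"
    using coset_action[OF assms(3,5)] .
  interpret Q: subgroup Q G by fact
  have fin: "finite (rcosets H)"
    using assms(1,5) by (metis rcosets_part_G finite_UnionD)
  have "p dvd card {C \<in> rcosets H. \<exists>q\<in>carrier (G\<lparr>carrier := Q\<rparr>). (\<lambda>C\<in>rcosets H. C #> inv q) C \<noteq> C}"
    using dvd_card_non_fixed[OF fin assms(2)] assms(4) by (simp add: order_def)
  also have "{C \<in> rcosets H. \<exists>q\<in>carrier (G\<lparr>carrier := Q\<rparr>). (\<lambda>C\<in>rcosets H. C #> inv q) C \<noteq> C} =
      {C \<in> rcosets H. \<exists>q\<in>Q. C #> q \<noteq> C}" (is "?A = ?B")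
  proof
    show "?A \<subseteq> ?B" using Q.m_inv_closed by fastforce
    show "?B \<subseteq> ?A"
    proof
      fix C assume "C \<in> ?B"
      then obtain q where q: "C \<in> rcosets H" "q \<in> Q" "C #> q \<noteq> C" by auto
      then have "(\<lambda>C\<in>rcosets H. C #> inv (inv q)) C \<noteq> C" "inv q \<in> Q" by auto
      with q(1) show "C \<in> ?A" by auto
    qed
  qed
  finally show ?thesis .
qed

text \<open>The bridge from fixed points to conjugation: H g q = H (g q g^-1) g, which equals H g
  exactly when g q g^-1 lies in H.\<close>

lemma fixed_coset_iff:
  assumes "subgroup Q G" "subgroup H G" "g \<in> carrier G"
  shows "(\<forall>q\<in>Q. (H #> g) #> q = H #> g) \<longleftrightarrow> (\<forall>q\<in>Q. cj G g q \<in> H)"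
proof -
  interpret H: subgroup H G by fact
  interpret Q: subgroup Q G by fact
  have "(H #> g) #> q = H #> g \<longleftrightarrow> cj G g q \<in> H" if "q \<in> Q" for q
  proof -
    have q: "q \<in> carrier G" using that by simp
    have "(H #> g) #> q = H #> (cj G g q \<otimes> g)"
      using assms(3) q H.subset by (simp add: coset_mult_assoc cj_def m_assoc)
    also have "\<dots> = (H #> cj G g q) #> g"
      using assms(3) q H.subset by (simp add: coset_mult_assoc)
    finally have 1: "(H #> g) #> q = (H #> cj G g q) #> g" .
    have "(H #> cj G g q) #> g = H #> g \<longleftrightarrow> H #> cj G g q = H"
    proof
      assume "(H #> cj G g q) #> g = H #> g"
      then have "((H #> cj G g q) #> g) #> inv g = (H #> g) #> inv g" by simp
      then show "H #> cj G g q = H"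
        using assms(3) q H.subset by (simp add: coset_mult_assoc m_assoc)
    qed simp
    also have "\<dots> \<longleftrightarrow> cj G g q \<in> H"
      using assms(2,3) q by (meson cj_closed coset_join1 coset_join2 H.subset)
    finally show ?thesis using 1 by simp
  qed
  then show ?thesis by blast
qed

text \<open>If no coset were fixed, \<open>p\<close> would divide the number of all cosets. A fixed
  coset is a conjugate of \<open>Q\<close> inside \<open>H\<close>, so this is Sylow conjugacy for
  any \<open>H\<close> of index prime to \<open>p\<close>.\<close>

lemma conj_into:
  assumes "finite (carrier G)" "prime p" "subgroup Q G" "card Q = p ^ e" "subgroup H G"
    "\<not> p dvd card (rcosets H)"
  shows "\<exists>g\<in>carrier G. \<forall>q\<in>Q. cj G g q \<in> H"
proof (rule ccontr)
  assume "\<not> ?thesis"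
  then have "{C \<in> rcosets H. \<exists>q\<in>Q. C #> q \<noteq> C} = rcosets H"
    using fixed_coset_iff[OF assms(3,5)] unfolding RCOSETS_def by fastforce
  then show False
    using dvd_card_non_fixed_cosets[OF assms(1-5)] assms(6) by simp
qed

end

text \<open>The normalizer. Inclusion suffices: conjugation is injective, hence onto on a finite
  \<open>S\<close>.\<close>

definition nrm :: "('a, 'm) monoid_scheme \<Rightarrow> 'a set \<Rightarrow> 'a set"
  where "nrm G S = {g \<in> carrier G. \<forall>s\<in>S. cj G g s \<in> S}"

section \<open>Normalizers and Sylow counting\<close>

context group
begin

lemma nrm_subgroup:
  assumes "finite (carrier G)" "subgroup S G"
  shows "subgroup (nrm G S) G"
proof (rule finite_subgroupI)
  interpret S: subgroup S G by fact
  show "finite (nrm G S)" using assms(1) by (auto simp: nrm_def)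
  show "\<And>x y. x \<in> nrm G S \<Longrightarrow> y \<in> nrm G S \<Longrightarrow> x \<otimes> y \<in> nrm G S"
    by (auto simp: nrm_def cj_cj)
  show "\<one> \<in> nrm G S" using assms(2) by (simp add: nrm_def)
qed (auto simp: nrm_def)

lemma subset_nrm: "subgroup S G \<Longrightarrow> S \<subseteq> nrm G S"
  by (auto simp: nrm_def cj_def subgroup.m_closed subgroup.m_inv_closed subgroup.mem_carrier)

text \<open>Let \<open>S\<close> act on its own cosets. The fixed ones are the cosets inside the
  normalizer, and all others contribute a multiple of \<open>p\<close>.\<close>

lemma card_rcosets_nrm:
  assumes "finite (carrier G)" "prime p" "subgroup S G" "card S = p ^ e"
  shows "card (rcosets S) mod p = (card (nrm G S) div card S) mod p"
proof -
  interpret S: subgroup S G by fact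
  let ?N = "{C \<in> rcosets S. \<exists>q\<in>S. C #> q \<noteq> C}"
  let ?F = "(\<lambda>g. S #> g) ` nrm G S"
  have fin: "finite (rcosets S)"
    using assms(1,3) by (metis rcosets_part_G finite_UnionD)
  have fx: "(\<forall>q\<in>S. (S #> g) #> q = S #> g) \<longleftrightarrow> g \<in> nrm G S" if "g \<in> carrier G" for g
    using fixed_coset_iff[OF assms(3,3) that] that by (simp add: nrm_def)
  have "?F \<subseteq> rcosets S"
    by (auto simp: nrm_def intro: rcosetsI[OF S.subset])
  moreover have "rcosets S - ?F = ?N"
    using fx unfolding RCOSETS_def by (auto simp: nrm_def) blast+
  ultimately have "card (rcosets S) = card ?F + card ?N"
    using fin by (metis card_Diff_subset card_mono finite_subset le_add_diff_inverse)
  moreover have "card ?F = card (nrm G S) div card S"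
  proof -
    interpret N: group "G\<lparr>carrier := nrm G S\<rparr>"
      using nrm_subgroup[OF assms(1,3)] by (simp add: subgroup_imp_group)
    have "subgroup S (G\<lparr>carrier := nrm G S\<rparr>)"
      using assms(1,3) by (simp add: subgroup_incl nrm_subgroup subset_nrm)
    moreover have "rcosets\<^bsub>G\<lparr>carrier := nrm G S\<rparr>\<^esub> S = ?F"
      unfolding RCOSETS_def r_coset_def by auto
    ultimately have "card ?F * card S = card (nrm G S)"
      using N.lagrange[of S] by (simp add: order_def)
    moreover have "card S > 0" using assms(4) prime_gt_0_nat[OF assms(2)] by simp
    ultimately show ?thesis by (metis div_mult_self_is_m)
  qed
  moreover have "p dvd card ?N"
    using dvd_card_non_fixed_cosets[OF assms assms(3)] .
  ultimately show ?thesis by (auto elim!: dvdE)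
qed

text \<open>The same count inside \<open>M\<close>, where the normalizer of \<open>S\<close> is the
  intersection with \<open>M\<close>. The restrictions on orders modulo 2 and 3 come from this
  congruence.\<close>

lemma index_mod_nrm:
  assumes "finite (carrier G)" "prime p" "subgroup M G" "subgroup S G" "S \<subseteq> M" "card S = p ^ e"
  shows "(card M div card S) mod p = (card (nrm G S \<inter> M) div card S) mod p"
proof -
  interpret M: group "G\<lparr>carrier := M\<rparr>"
    using assms(3) by (simp add: subgroup_imp_group)
  have S: "subgroup S (G\<lparr>carrier := M\<rparr>)"
    using assms by (simp add: subgroup_incl)
  have fin: "finite M" using assms(1,3) subgroup.subset finite_subset by blast
  have "nrm (G\<lparr>carrier := M\<rparr>) S = nrm G S \<inter> M"
    using assms(3) by (auto simp: nrm_def cj_sub subgroup.mem_carrier)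
  moreover have "card (rcosets\<^bsub>G\<lparr>carrier := M\<rparr>\<^esub> S) = card M div card S"
    using M.lagrange[OF S] assms(6) prime_gt_0_nat[OF assms(2)] unfolding order_def
    by (metis div_mult_self_is_m partial_object.select_convs(1) partial_object.update_convs(1) monoid.surjective zero_less_power)
  ultimately show ?thesis
    using M.card_rcosets_nrm[OF _ assms(2) S assms(6)] fin by simp
qed

lemma conj_into_within:
  assumes "finite (carrier G)" "prime p" "subgroup M G" "subgroup Q G" "Q \<subseteq> M" "card Q = p ^ e"
    "subgroup H G" "H \<subseteq> M" "\<not> p dvd card M div card H"
  shows "\<exists>g\<in>M. \<forall>q\<in>Q. cj G g q \<in> H"
proof -
  interpret M: group "G\<lparr>carrier := M\<rparr>"
    using assms(3) by (simp add: subgroup_imp_group)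
  have Q: "subgroup Q (G\<lparr>carrier := M\<rparr>)" and H: "subgroup H (G\<lparr>carrier := M\<rparr>)"
    using assms by (simp_all add: subgroup_incl)
  have fin: "finite M" using assms(1,3) subgroup.subset finite_subset by blast
  have "card H > 0" using subgroup.finite_imp_card_positive[OF assms(7,1)] .
  then have "card (rcosets\<^bsub>G\<lparr>carrier := M\<rparr>\<^esub> H) = card M div card H"
    using M.lagrange[OF H] unfolding order_def
    by (metis div_mult_self_is_m partial_object.select_convs(1) partial_object.update_convs(1) monoid.surjective)
  then show ?thesis
    using M.conj_into[OF _ assms(2) Q assms(6) H] fin assms(9) cj_sub[OF assms(3)] by auto
qed

end

subsection \<open>Homomorphisms and embeddings\<close>

lemma embedsI:
  assumes "group K" "group G" "\<phi> \<in> hom K G" "inj_on \<phi> (carrier K)"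
  shows "embeds K G"
proof -
  interpret group_hom K G \<phi>
    using assms by (simp add: group_hom_def group_hom_axioms_def)
  have "\<phi> \<in> iso K (G\<lparr>carrier := \<phi> ` carrier K\<rparr>)"
    using assms(3,4) by (auto simp: iso_def hom_def bij_betw_def)
  then show ?thesis
    unfolding embeds_def is_iso_def using img_is_subgroup by blast
qed

lemma embedsE:
  assumes "embeds K G" "group G"
  obtains \<phi> where "\<phi> \<in> hom K G" "inj_on \<phi> (carrier K)"
proof -
  obtain H where H: "subgroup H G" "K \<cong> G\<lparr>carrier := H\<rparr>"
    using assms(1) unfolding embeds_def by blast
  then obtain \<phi> where \<phi>: "\<phi> \<in> iso K (G\<lparr>carrier := H\<rparr>)"
    unfolding is_iso_def by blast
  have "\<phi> \<in> hom K G" "inj_on \<phi> (carrier K)"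
    using \<phi> subgroup.subset[OF H(1)] by (auto simp: iso_def hom_def bij_betw_def Pi_iff)
  then show thesis by (rule that)
qed

lemma inj_hom_iso:
  assumes "\<phi> \<in> hom K G" "inj_on \<phi> (carrier K)" "finite (carrier G)" "order K = order G"
  shows "K \<cong> G"
proof (rule is_isoI)
  have "\<phi> ` carrier K = carrier G"
    using assms by (intro card_subset_eq) (auto simp: hom_def order_def card_image)
  then show "\<phi> \<in> iso K G"
    using assms by (simp add: iso_def bij_betw_def)
qed

text \<open>Only an upper bound for the order of the source is asked for; for a presented group this
  is what a covering set of normal forms supplies.\<close>

lemma surj_hom_iso:
  assumes "\<phi> \<in> hom K G" "carrier G \<subseteq> \<phi> ` carrier K" "finite (carrier K)" "order K \<le> order G"
  shows "K \<cong> G"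
proof (rule is_isoI)
  have im: "\<phi> ` carrier K = carrier G"
    using assms by (auto simp: hom_def)
  moreover have "card (\<phi> ` carrier K) = card (carrier K)"
    using assms(3,4) im card_image_le[OF assms(3), of \<phi>] by (simp add: order_def)
  ultimately show "\<phi> \<in> iso K G"
    using assms(1,3) by (simp add: iso_def bij_betw_def eq_card_imp_inj_on)
qed

lemma embeds_iso:
  assumes "embeds K G" "group G" "finite (carrier G)" "order K = order G"
  shows "K \<cong> G"
  using embedsE[OF assms(1,2)] inj_hom_iso[OF _ _ assms(3,4)] by metis

lemma embeds_order_dvd:
  assumes "embeds K G" "group G"
  shows "order K dvd order G"
proof -
  obtain H where "subgroup H G" "K \<cong> G\<lparr>carrier := H\<rparr>"
    using assms(1) unfolding embeds_def by blast
  then show ?thesis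
    using group.card_dvd_order[OF assms(2)] iso_same_card unfolding order_def by fastforce
qed

text \<open>Extension of a homomorphism along a cyclic extension: \<open>G\<close> consists of the
  cosets of \<open>H\<close> by the powers of \<open>b\<close> below \<open>m\<close>, and
  \<open>y\<close> imitates both the action of \<open>b\<close> on \<open>H\<close> and the value of
  its \<open>m\<close>-th power. Iterating it proves that maps respecting the relations of
  \<open>mc\<close> and \<open>tri\<close> are homomorphisms.\<close>

lemma (in group) hom_extend:
  assumes H: "subgroup H G" and b: "b \<in> carrier G" and m: "m > 0"
    and nrm: "\<And>h. h \<in> H \<Longrightarrow> cj G b h \<in> H" and bm: "b [^] m \<in> H"
    and bj: "\<And>j. 0 < j \<Longrightarrow> j < m \<Longrightarrow> b [^] j \<notin> H"
    and car: "carrier G \<subseteq> {h \<otimes> b [^] j | h j. h \<in> H \<and> j < m}"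
    and L: "group L" and \<phi>: "\<phi> \<in> hom (G\<lparr>carrier := H\<rparr>) L" and y: "y \<in> carrier L"
    and yc: "\<And>h. h \<in> H \<Longrightarrow> cj L y (\<phi> h) = \<phi> (cj G b h)" and ym: "y [^]\<^bsub>L\<^esub> m = \<phi> (b [^] (m::nat))"
  shows "\<exists>\<psi>\<in>hom G L. (\<forall>h\<in>H. \<psi> h = \<phi> h) \<and> \<psi> b = y"
proof -
  interpret H: subgroup H G by fact
  interpret L: group L by fact
  interpret HG: group "G\<lparr>carrier := H\<rparr>" using H by (rule subgroup_imp_group)
  interpret \<phi>: group_hom "G\<lparr>carrier := H\<rparr>" L \<phi>
    using \<phi> by unfold_locales
  have \<phi>c: "\<phi> h \<in> carrier L" if "h \<in> H" for h using \<phi>.hom_closed that by simp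
  have \<phi>m: "\<phi> (h \<otimes> h') = \<phi> h \<otimes>\<^bsub>L\<^esub> \<phi> h'" if "h \<in> H" "h' \<in> H" for h h'
    using \<phi>.hom_mult that by simp
  have \<phi>p: "\<phi> (h [^] (q::nat)) = \<phi> h [^]\<^bsub>L\<^esub> q" if "h \<in> H" for h q
    using \<phi>.hom_nat_pow that by (simp add: pow_sub)
  have pc: "h [^] (q::nat) \<in> H" if "h \<in> H" for h q
    using HG.nat_pow_closed that by (simp add: pow_sub)
  have uniq1: "j = j'" if "h \<otimes> b [^] j = h' \<otimes> b [^] j'" "h \<in> H" "h' \<in> H" "j \<le> j'" "j' < m" for h h' j j'
  proof (rule ccontr)
    assume "j \<noteq> j'"
    have "h \<otimes> b [^] j = h' \<otimes> b [^] (j' - j) \<otimes> b [^] j"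
      using that b by (simp add: m_assoc nat_pow_mult)
    then have "h = h' \<otimes> b [^] (j' - j)"
      using that b by simp
    then have "b [^] (j' - j) = inv h' \<otimes> h"
      using that b by (simp add: inv_solve_left)
    then have "b [^] (j' - j) \<in> H" using that by simp
    then show False using bj[of "j' - j"] that \<open>j \<noteq> j'\<close> by simp
  qed
  have uniq: "j = j' \<and> h = h'" if "h \<otimes> b [^] j = h' \<otimes> b [^] j'" "h \<in> H" "h' \<in> H" "j < m" "j' < m" for h h' j j'
  proof -
    have "j = j'"
      using uniq1[of h j h' j'] uniq1[of h' j' h j] that by (metis linorder_le_cases)
    then show ?thesis using that b by simp
  qed
  \<comment> \<open>By \<open>uniq\<close> the pair is determined by \<open>x\<close>, so the choice
    operator only reads it off.\<close>
  define \<psi> where "\<psi> x = (let p = (SOME p. fst p \<in> H \<and> snd p < m \<and> x = fst p \<otimes> b [^] snd p)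
      in \<phi> (fst p) \<otimes>\<^bsub>L\<^esub> y [^]\<^bsub>L\<^esub> snd p)" for x
  have \<psi>1: "\<psi> (h \<otimes> b [^] j) = \<phi> h \<otimes>\<^bsub>L\<^esub> y [^]\<^bsub>L\<^esub> j" if "h \<in> H" "j < m" for h j
  proof -
    let ?P = "\<lambda>p. fst p \<in> H \<and> snd p < m \<and> h \<otimes> b [^] j = fst p \<otimes> b [^] snd p"
    define p where "p = (SOME p. ?P p)"
    have "?P p"
      unfolding p_def by (rule someI[of ?P "(h, j)"]) (use that in simp)
    then have "j = snd p \<and> h = fst p"
      using uniq[of h j "fst p" "snd p"] that by blast
    moreover have "\<psi> (h \<otimes> b [^] j) = \<phi> (fst p) \<otimes>\<^bsub>L\<^esub> y [^]\<^bsub>L\<^esub> snd p"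
      unfolding \<psi>_def p_def Let_def ..
    ultimately show ?thesis by simp
  qed
  \<comment> \<open>The formula is extended to all exponents by moving full powers
    \<open>b [^] m\<close> into \<open>H\<close>; the product of two normal forms then needs no case
    split on overflow.\<close>
  have \<psi>2: "\<psi> (h \<otimes> b [^] j) = \<phi> h \<otimes>\<^bsub>L\<^esub> y [^]\<^bsub>L\<^esub> j" if "h \<in> H" for h and j :: nat
  proof -
    define q r where "q = j div m" and "r = j mod m"
    have j: "j = m * q + r" "r < m" using m by (simp_all add: q_def r_def)
    have "h \<otimes> b [^] j = (h \<otimes> (b [^] m) [^] q) \<otimes> b [^] r"
      using that b unfolding j(1) by (simp add: nat_pow_pow nat_pow_mult m_assoc)
    then have "\<psi> (h \<otimes> b [^] j) = \<phi> (h \<otimes> (b [^] m) [^] q) \<otimes>\<^bsub>L\<^esub> y [^]\<^bsub>L\<^esub> r"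
      using \<psi>1[of "h \<otimes> (b [^] m) [^] q" r] that bm pc j(2) by simp
    also have "\<dots> = \<phi> h \<otimes>\<^bsub>L\<^esub> (y [^]\<^bsub>L\<^esub> m) [^]\<^bsub>L\<^esub> q \<otimes>\<^bsub>L\<^esub> y [^]\<^bsub>L\<^esub> r"
      using that bm pc by (simp add: \<phi>m \<phi>p ym)
    also have "\<dots> = \<phi> h \<otimes>\<^bsub>L\<^esub> y [^]\<^bsub>L\<^esub> j"
      using that y \<phi>c unfolding j(1) by (simp add: L.nat_pow_pow L.nat_pow_mult L.m_assoc)
    finally show ?thesis .
  qed
  have cjH: "cj G (b [^] j) h \<in> H \<and> \<phi> (cj G (b [^] j) h) = cj L (y [^]\<^bsub>L\<^esub> j) (\<phi> h)" if "h \<in> H" for h and j :: nat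
    using that
  proof (induction j arbitrary: h)
    case 0
    then show ?case using \<phi>c by simp
  next
    case (Suc j)
    have "cj G (b [^] Suc j) h = cj G (b [^] j) (cj G b h)"
      using Suc.prems b by (simp add: cj_cj)
    moreover have "cj L (y [^]\<^bsub>L\<^esub> Suc j) (\<phi> h) = cj L (y [^]\<^bsub>L\<^esub> j) (cj L y (\<phi> h))"
      using Suc.prems y \<phi>c by (simp add: L.cj_cj)
    ultimately show ?case using Suc.IH[of "cj G b h"] nrm[OF Suc.prems] yc[OF Suc.prems] by simp
  qed
  have "\<psi> \<in> hom G L"
  proof (rule homI)
    fix u assume "u \<in> carrier G"
    then obtain h j where u: "h \<in> H" "j < m" "u = h \<otimes> b [^] j" using car by blast
    then show "\<psi> u \<in> carrier L" using \<psi>2 \<phi>c y by simp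
    fix v assume "v \<in> carrier G"
    then obtain h' j' where v: "h' \<in> H" "j' < m" "v = h' \<otimes> b [^] j'" using car by blast
    have "u \<otimes> v = (h \<otimes> cj G (b [^] j) h') \<otimes> b [^] (j + j')"
      using u v b unfolding cj_def nat_pow_mult[OF b, symmetric] by (simp add: m_assoc inv_solve_left)
    then have "\<psi> (u \<otimes> v) = \<phi> h \<otimes>\<^bsub>L\<^esub> cj L (y [^]\<^bsub>L\<^esub> j) (\<phi> h') \<otimes>\<^bsub>L\<^esub> y [^]\<^bsub>L\<^esub> (j + j')"
      using \<psi>2[of "h \<otimes> cj G (b [^] j) h'" "j + j'"] u v cjH by (simp add: \<phi>m)
    also have "\<dots> = \<psi> u \<otimes>\<^bsub>L\<^esub> \<psi> v"
      using u v y \<phi>c \<psi>2 unfolding cj_def L.nat_pow_mult[OF y, symmetric] by (simp add: L.m_assoc L.m_assoc[symmetric, of "inv\<^bsub>L\<^esub> (y [^]\<^bsub>L\<^esub> j)"])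
    finally show "\<psi> (u \<otimes> v) = \<psi> u \<otimes>\<^bsub>L\<^esub> \<psi> v" .
  qed
  moreover have "\<psi> h = \<phi> h" if "h \<in> H" for h
    using \<psi>2[of h 0] that \<phi>c by simp
  moreover have "\<psi> b = y"
    using \<psi>2[of \<one> 1] b y \<phi>.hom_one by simp
  ultimately show ?thesis by blast
qed


subsection \<open>Groups with a normal form\<close>

text \<open>
  \<open>mc\<close> says that \<open>K\<close> is the metacyclic group of order \<open>n m\<close> given by \<open>a\<^sup>n = 1\<close>, \<open>b a b\<^sup>-\<^sup>1 = a\<^sup>k\<close> and
  \<open>b\<^sup>m = a\<^sup>l\<close>; \<open>tri\<close> says that \<open>K\<close> is the semidirect product of \<open>\<langle>a\<rangle>\<close> by the four-group \<open>\<langle>s, t\<rangle>\<close>.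
  As the order is part of the predicate, a map respecting the relations is a homomorphism.
\<close>

definition mc :: "('a, 'm) monoid_scheme \<Rightarrow> 'a \<Rightarrow> 'a \<Rightarrow> nat \<Rightarrow> nat \<Rightarrow> nat \<Rightarrow> nat \<Rightarrow> bool"
  where "mc K a b n k m l \<longleftrightarrow> group K \<and> a \<in> carrier K \<and> b \<in> carrier K \<and> n > 0 \<and> m > 0 \<and>
    order K = n * m \<and> a [^]\<^bsub>K\<^esub> n = \<one>\<^bsub>K\<^esub> \<and> cj K b a = a [^]\<^bsub>K\<^esub> k \<and> b [^]\<^bsub>K\<^esub> m = a [^]\<^bsub>K\<^esub> l \<and>
    carrier K \<subseteq> {a [^]\<^bsub>K\<^esub> i \<otimes>\<^bsub>K\<^esub> b [^]\<^bsub>K\<^esub> j | i j. i < n \<and> j < m}"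

definition tri :: "('a, 'm) monoid_scheme \<Rightarrow> 'a \<Rightarrow> 'a \<Rightarrow> 'a \<Rightarrow> nat \<Rightarrow> nat \<Rightarrow> nat \<Rightarrow> bool"
  where "tri K a s t n k k' \<longleftrightarrow> group K \<and> a \<in> carrier K \<and> s \<in> carrier K \<and> t \<in> carrier K \<and> n > 0 \<and>
    order K = 4 * n \<and> a [^]\<^bsub>K\<^esub> n = \<one>\<^bsub>K\<^esub> \<and> s [^]\<^bsub>K\<^esub> (2::nat) = \<one>\<^bsub>K\<^esub> \<and> t [^]\<^bsub>K\<^esub> (2::nat) = \<one>\<^bsub>K\<^esub> \<and>
    cj K s a = a [^]\<^bsub>K\<^esub> k \<and> cj K t a = a [^]\<^bsub>K\<^esub> k' \<and> cj K t s = s \<and>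
    carrier K \<subseteq> {a [^]\<^bsub>K\<^esub> i \<otimes>\<^bsub>K\<^esub> s [^]\<^bsub>K\<^esub> j \<otimes>\<^bsub>K\<^esub> t [^]\<^bsub>K\<^esub> l | i j l. i < n \<and> j < (2::nat) \<and> l < (2::nat)}"

lemma (in group) pow_mod:
  assumes "a \<in> carrier G" "a [^] n = \<one>"
  shows "a [^] (i mod n) = a [^] (i::nat)"
proof -
  have "a [^] i = a [^] (n * (i div n) + i mod n)" by simp
  also have "\<dots> = (a [^] n) [^] (i div n) \<otimes> a [^] (i mod n)"
    using assms(1) by (simp add: nat_pow_pow nat_pow_mult)
  finally show ?thesis using assms by simp
qed

lemma (in group) powers_subgroup:
  assumes "a \<in> carrier G" "a [^] n = \<one>" "n > (0::nat)"
  shows "subgroup ((\<lambda>i. a [^] i) ` {..<n}) G"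
proof (rule finite_subgroupI)
  fix x y assume "x \<in> (\<lambda>i. a [^] i) ` {..<n}" "y \<in> (\<lambda>i. a [^] i) ` {..<n}"
  then obtain i j where "x = a [^] (i::nat)" "y = a [^] (j::nat)" by auto
  then have "x \<otimes> y = a [^] ((i + j) mod n)"
    using assms by (simp add: pow_mod nat_pow_mult)
  then show "x \<otimes> y \<in> (\<lambda>i. a [^] i) ` {..<n}" using assms(3) by auto
qed (use assms in \<open>auto intro!: image_eqI[where x = 0]\<close>)

lemma (in group) pow_in_powers:
  assumes "a \<in> carrier G" "a [^] n = \<one>" "n > (0::nat)"
  shows "a [^] (i::nat) \<in> (\<lambda>i. a [^] i) ` {..<n}"
  using pow_mod[OF assms(1,2), of i] assms(3) by (metis image_eqI lessThan_iff mod_less_divisor)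

text \<open>There are as many normal forms as group elements and they cover the group, so no two
  coincide.\<close>

lemma mc_inj:
  assumes "mc K a b n k m l"
  shows "inj_on (\<lambda>(i, j). a [^]\<^bsub>K\<^esub> i \<otimes>\<^bsub>K\<^esub> b [^]\<^bsub>K\<^esub> j) ({..<n} \<times> {..<m})"
proof (rule eq_card_imp_inj_on)
  interpret group K using assms by (simp add: mc_def)
  have "(\<lambda>(i, j). a [^]\<^bsub>K\<^esub> i \<otimes>\<^bsub>K\<^esub> b [^]\<^bsub>K\<^esub> j) ` ({..<n} \<times> {..<m}) = carrier K"
    using assms by (fastforce simp: mc_def)
  then show "card ((\<lambda>(i, j). a [^]\<^bsub>K\<^esub> i \<otimes>\<^bsub>K\<^esub> b [^]\<^bsub>K\<^esub> j) ` ({..<n} \<times> {..<m})) = card ({..<n} \<times> {..<m})"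
    using assms by (simp add: mc_def order_def card_cartesian_product)
qed simp

lemma mc_eq_one:
  assumes "mc K a b n k m l" "i < n" "j < m" "a [^]\<^bsub>K\<^esub> i \<otimes>\<^bsub>K\<^esub> b [^]\<^bsub>K\<^esub> j = \<one>\<^bsub>K\<^esub>"
  shows "i = 0 \<and> j = 0"
proof -
  interpret group K using assms by (simp add: mc_def)
  have "(i, j) = (0, 0)"
    by (rule inj_onD[OF mc_inj[OF assms(1)]]) (use assms in \<open>auto simp: mc_def\<close>)
  then show ?thesis by simp
qed

text \<open>\<open>hom_extend\<close> is applied twice: from the trivial subgroup to the powers of
  \<open>a\<close>, and from these to \<open>K\<close>. That no smaller power falls into the
  subgroup is the uniqueness of normal forms.\<close>

lemma mc_hom:
  assumes "mc K a b n k m l" "group L" "x \<in> carrier L" "y \<in> carrier L"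
    "x [^]\<^bsub>L\<^esub> n = \<one>\<^bsub>L\<^esub>" "cj L y x = x [^]\<^bsub>L\<^esub> k" "y [^]\<^bsub>L\<^esub> m = x [^]\<^bsub>L\<^esub> l"
  shows "\<exists>\<psi>\<in>hom K L. \<psi> a = x \<and> \<psi> b = y"
proof -
  interpret K: group K using assms by (simp add: mc_def)
  interpret L: group L by fact
  have a: "a \<in> carrier K" "b \<in> carrier K" "a [^]\<^bsub>K\<^esub> n = \<one>\<^bsub>K\<^esub>" "n > 0" "m > 0"
    "cj K b a = a [^]\<^bsub>K\<^esub> k" "b [^]\<^bsub>K\<^esub> m = a [^]\<^bsub>K\<^esub> l"
    and car: "carrier K \<subseteq> {a [^]\<^bsub>K\<^esub> i \<otimes>\<^bsub>K\<^esub> b [^]\<^bsub>K\<^esub> j | i j. i < n \<and> j < m}"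
    using assms(1) by (auto simp: mc_def)
  let ?H = "(\<lambda>i. a [^]\<^bsub>K\<^esub> i) ` {..<n}"
  let ?KH = "K\<lparr>carrier := ?H\<rparr>"
  have H: "subgroup ?H K" using K.powers_subgroup[OF a(1,3,4)] .
  interpret KH: group ?KH using H by (rule K.subgroup_imp_group)
  have aH: "a \<in> ?H" using K.pow_in_powers[OF a(1,3,4), of 1] a(1) by simp
  have nz: "a [^]\<^bsub>K\<^esub> i \<noteq> \<one>\<^bsub>K\<^esub>" if "0 < i" "i < n" for i :: nat
    using mc_eq_one[OF assms(1) that(2), of 0] a that by auto
  have "\<exists>\<phi>\<in>hom ?KH L. (\<forall>h\<in>{\<one>\<^bsub>K\<^esub>}. \<phi> h = (\<lambda>_. \<one>\<^bsub>L\<^esub>) h) \<and> \<phi> a = x"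
  proof (rule KH.hom_extend[where m = n])
    show "subgroup {\<one>\<^bsub>K\<^esub>} ?KH" using KH.triv_subgroup by simp
    show "carrier ?KH \<subseteq> {h \<otimes>\<^bsub>?KH\<^esub> a [^]\<^bsub>?KH\<^esub> j |h j. h \<in> {\<one>\<^bsub>K\<^esub>} \<and> j < n}"
      using a(1) by (auto simp: K.pow_sub)
    show "(\<lambda>_. \<one>\<^bsub>L\<^esub>) \<in> hom (?KH\<lparr>carrier := {\<one>\<^bsub>K\<^esub>}\<rparr>) L" by (simp add: hom_def)
    show "\<And>h. h \<in> {\<one>\<^bsub>K\<^esub>} \<Longrightarrow> cj ?KH a h \<in> {\<one>\<^bsub>K\<^esub>}" using K.cj_sub[OF H aH] a(1) by simp
    show "\<And>h. h \<in> {\<one>\<^bsub>K\<^esub>} \<Longrightarrow> cj L x ((\<lambda>_. \<one>\<^bsub>L\<^esub>) h) = (\<lambda>_. \<one>\<^bsub>L\<^esub>) (cj ?KH a h)" using assms(3) by simp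
  qed (use a aH assms nz in \<open>auto simp: K.pow_sub\<close>)
  then obtain \<phi> where \<phi>: "\<phi> \<in> hom ?KH L" "\<phi> a = x" by auto
  interpret \<phi>: group_hom ?KH L \<phi> using \<phi>(1) by unfold_locales
  have \<phi>p: "\<phi> (a [^]\<^bsub>K\<^esub> i) = x [^]\<^bsub>L\<^esub> i" for i :: nat
    using \<phi>.hom_nat_pow[of a i] aH \<phi>(2) by (simp add: K.pow_sub)
  have cjb: "cj K b (a [^]\<^bsub>K\<^esub> i) = a [^]\<^bsub>K\<^esub> (k * i)" for i :: nat
    using a by (simp add: K.cj_pow K.nat_pow_pow)
  have cjy: "cj L y (x [^]\<^bsub>L\<^esub> i) = x [^]\<^bsub>L\<^esub> (k * i)" for i :: nat
    using assms by (simp add: L.cj_pow L.nat_pow_pow)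
  have "\<exists>\<psi>\<in>hom K L. (\<forall>h\<in>?H. \<psi> h = \<phi> h) \<and> \<psi> b = y"
  proof (rule K.hom_extend[OF H a(2) a(5)])
    show "b [^]\<^bsub>K\<^esub> m \<in> ?H" using a K.pow_in_powers by simp
    show "\<And>h. h \<in> ?H \<Longrightarrow> cj K b h \<in> ?H" using cjb K.pow_in_powers[OF a(1,3,4)] by auto
    show "carrier K \<subseteq> {h \<otimes>\<^bsub>K\<^esub> b [^]\<^bsub>K\<^esub> j |h j. h \<in> ?H \<and> j < m}" using car by fastforce
    show "\<And>h. h \<in> ?H \<Longrightarrow> cj L y (\<phi> h) = \<phi> (cj K b h)" using cjb cjy \<phi>p by auto
    show "y [^]\<^bsub>L\<^esub> m = \<phi> (b [^]\<^bsub>K\<^esub> m)" using a assms(7) \<phi>p by simp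
    fix j assume j: "0 < j" "j < m"
    show "b [^]\<^bsub>K\<^esub> j \<notin> ?H"
    proof
      assume "b [^]\<^bsub>K\<^esub> j \<in> ?H"
      then obtain i where i: "i < n" "b [^]\<^bsub>K\<^esub> j = a [^]\<^bsub>K\<^esub> i" by auto
      have "(0, j) = (i, 0)"
        by (rule inj_onD[OF mc_inj[OF assms(1)]]) (use i j a in auto)
      then show False using j by simp
    qed
  qed (use assms \<phi>(1) in auto)
  then show ?thesis using aH \<phi>(2) by metis
qed

lemma mc_hom_inj:
  assumes "mc K a b n k m l" "group L" "\<psi> \<in> hom K L"
    "\<And>i j. i < n \<Longrightarrow> j < m \<Longrightarrow> \<psi> a [^]\<^bsub>L\<^esub> i \<otimes>\<^bsub>L\<^esub> \<psi> b [^]\<^bsub>L\<^esub> j = \<one>\<^bsub>L\<^esub> \<Longrightarrow> i = 0 \<and> j = 0"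
  shows "inj_on \<psi> (carrier K)"
proof -
  interpret K: group K using assms by (simp add: mc_def)
  interpret \<psi>: group_hom K L \<psi>
    using assms(2,3) by (simp add: group_hom_def group_hom_axioms_def)
  have "u = \<one>\<^bsub>K\<^esub>" if u: "u \<in> carrier K" "\<psi> u = \<one>\<^bsub>L\<^esub>" for u
  proof -
    obtain i j where ij: "i < n" "j < m" "u = a [^]\<^bsub>K\<^esub> i \<otimes>\<^bsub>K\<^esub> b [^]\<^bsub>K\<^esub> j"
      using u assms(1) unfolding mc_def by blast
    have "a \<in> carrier K" "b \<in> carrier K" using assms(1) by (auto simp: mc_def)
    then have "i = 0 \<and> j = 0"
      using assms(4)[OF ij(1,2)] u(2) ij(3) by (simp add: \<psi>.hom_nat_pow)
    then show ?thesis using ij(3) by simp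
  qed
  then show ?thesis using \<psi>.inj_on_one_iff by blast
qed

text \<open>For concrete \<open>x\<close> and \<open>y\<close> every hypothesis is a finite
  computation; the last one, over all normal forms, says that the kernel is trivial.\<close>

lemma mc_embeds:
  assumes "mc K a b n k m l" "group L" "x \<in> carrier L" "y \<in> carrier L"
    "x [^]\<^bsub>L\<^esub> n = \<one>\<^bsub>L\<^esub>" "cj L y x = x [^]\<^bsub>L\<^esub> k" "y [^]\<^bsub>L\<^esub> m = x [^]\<^bsub>L\<^esub> l"
    "\<And>i j. i < n \<Longrightarrow> j < m \<Longrightarrow> x [^]\<^bsub>L\<^esub> i \<otimes>\<^bsub>L\<^esub> y [^]\<^bsub>L\<^esub> j = \<one>\<^bsub>L\<^esub> \<Longrightarrow> i = 0 \<and> j = 0"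
  shows "embeds K L"
proof -
  obtain \<psi> where \<psi>: "\<psi> \<in> hom K L" "\<psi> a = x" "\<psi> b = y"
    using mc_hom[OF assms(1-7)] by blast
  have "inj_on \<psi> (carrier K)"
    using mc_hom_inj[OF assms(1,2) \<psi>(1)] assms(8) \<psi> by simp
  then show ?thesis
    using assms(1,2) \<psi>(1) by (intro embedsI) (auto simp: mc_def)
qed

lemma mc_iso:
  assumes "mc K a b n k m l" "mc L x y n k m l"
  shows "K \<cong> L"
proof (rule embeds_iso)
  show "embeds K L"
    by (rule mc_embeds[OF assms(1), where x = x and y = y]) (use mc_eq_one[OF assms(2)] assms(2) in \<open>auto simp: mc_def\<close>)
  show "finite (carrier L)"
    using assms(2) by (auto simp: mc_def order_def intro: card_ge_0_finite)
qed (use assms in \<open>auto simp: mc_def\<close>)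

lemma tri_inj:
  assumes "tri K a s t n k k'"
  shows "inj_on (\<lambda>(i, j, l). a [^]\<^bsub>K\<^esub> i \<otimes>\<^bsub>K\<^esub> s [^]\<^bsub>K\<^esub> j \<otimes>\<^bsub>K\<^esub> t [^]\<^bsub>K\<^esub> l) ({..<n} \<times> {..<2::nat} \<times> {..<2::nat})"
proof (rule eq_card_imp_inj_on)
  interpret group K using assms by (simp add: tri_def)
  have "(\<lambda>(i, j, l). a [^]\<^bsub>K\<^esub> i \<otimes>\<^bsub>K\<^esub> s [^]\<^bsub>K\<^esub> j \<otimes>\<^bsub>K\<^esub> t [^]\<^bsub>K\<^esub> l) ` ({..<n} \<times> {..<2::nat} \<times> {..<2::nat}) = carrier K" (is "?f ` ?A = _")
  proof
    show "?f ` ?A \<subseteq> carrier K" using assms by (auto simp: tri_def)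
    show "carrier K \<subseteq> ?f ` ?A"
    proof
      fix u assume "u \<in> carrier K"
      then obtain i j l where "i < n" "j < (2::nat)" "l < (2::nat)" "u = ?f (i, j, l)"
        using assms unfolding tri_def by auto
      then show "u \<in> ?f ` ?A" by blast
    qed
  qed
  then show "card ((\<lambda>(i, j, l). a [^]\<^bsub>K\<^esub> i \<otimes>\<^bsub>K\<^esub> s [^]\<^bsub>K\<^esub> j \<otimes>\<^bsub>K\<^esub> t [^]\<^bsub>K\<^esub> l) ` ({..<n} \<times> {..<2::nat} \<times> {..<2::nat})) = card ({..<n} \<times> {..<2::nat} \<times> {..<2::nat})"
    using assms by (simp add: tri_def order_def card_cartesian_product)
qed simp

lemma tri_eq_one:
  assumes "tri K a s t n k k'" "i < n" "j < (2::nat)" "l < (2::nat)" "a [^]\<^bsub>K\<^esub> i \<otimes>\<^bsub>K\<^esub> s [^]\<^bsub>K\<^esub> j \<otimes>\<^bsub>K\<^esub> t [^]\<^bsub>K\<^esub> l = \<one>\<^bsub>K\<^esub>"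
  shows "i = 0 \<and> j = 0 \<and> l = (0::nat)"
proof -
  interpret group K using assms by (simp add: tri_def)
  have "(i, j, l) = (0, 0, 0)"
    by (rule inj_onD[OF tri_inj[OF assms(1)]]) (use assms in \<open>auto simp: tri_def\<close>)
  then show ?thesis by simp
qed

text \<open>The subgroup of \<open>a\<close> and \<open>s\<close> satisfies \<open>mc\<close> with
  parameters \<open>n k 2 0\<close>, so \<open>mc_hom\<close> defines the map there; one more use of
  \<open>hom_extend\<close> adds \<open>t\<close>.\<close>

lemma tri_hom:
  assumes "tri K a s t n k k'" "group L" "x \<in> carrier L" "y \<in> carrier L" "z \<in> carrier L"
    "x [^]\<^bsub>L\<^esub> n = \<one>\<^bsub>L\<^esub>" "y [^]\<^bsub>L\<^esub> (2::nat) = \<one>\<^bsub>L\<^esub>" "z [^]\<^bsub>L\<^esub> (2::nat) = \<one>\<^bsub>L\<^esub>"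
    "cj L y x = x [^]\<^bsub>L\<^esub> k" "cj L z x = x [^]\<^bsub>L\<^esub> k'" "cj L z y = y"
  shows "\<exists>\<psi>\<in>hom K L. \<psi> a = x \<and> \<psi> s = y \<and> \<psi> t = z"
proof -
  interpret K: group K using assms by (simp add: tri_def)
  interpret L: group L by fact
  have a: "a \<in> carrier K" "s \<in> carrier K" "t \<in> carrier K" "a [^]\<^bsub>K\<^esub> n = \<one>\<^bsub>K\<^esub>" "n > 0"
    "s [^]\<^bsub>K\<^esub> (2::nat) = \<one>\<^bsub>K\<^esub>" "t [^]\<^bsub>K\<^esub> (2::nat) = \<one>\<^bsub>K\<^esub>"
    "cj K s a = a [^]\<^bsub>K\<^esub> k" "cj K t a = a [^]\<^bsub>K\<^esub> k'" "cj K t s = s"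
    and car: "carrier K \<subseteq> {a [^]\<^bsub>K\<^esub> i \<otimes>\<^bsub>K\<^esub> s [^]\<^bsub>K\<^esub> j \<otimes>\<^bsub>K\<^esub> t [^]\<^bsub>K\<^esub> l | i j l. i < n \<and> j < (2::nat) \<and> l < (2::nat)}"
    using assms(1) by (auto simp: tri_def)
  let ?f = "\<lambda>(i, j). a [^]\<^bsub>K\<^esub> i \<otimes>\<^bsub>K\<^esub> s [^]\<^bsub>K\<^esub> j"
  let ?H = "?f ` ({..<n} \<times> {..<2::nat})"
  let ?KH = "K\<lparr>carrier := ?H\<rparr>"
  have inH: "a [^]\<^bsub>K\<^esub> i \<otimes>\<^bsub>K\<^esub> s [^]\<^bsub>K\<^esub> j \<in> ?H" for i j :: nat
  proof -
    have "a [^]\<^bsub>K\<^esub> i \<otimes>\<^bsub>K\<^esub> s [^]\<^bsub>K\<^esub> j = ?f (i mod n, j mod 2)"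
      using K.pow_mod[OF a(1,4)] K.pow_mod[OF a(2,6)] by simp
    then show ?thesis using a(5) by (metis (no_types, lifting) SigmaI image_eqI lessThan_iff mod_less_divisor zero_less_numeral)
  qed
  have cjs: "cj K (s [^]\<^bsub>K\<^esub> j) (a [^]\<^bsub>K\<^esub> i) = a [^]\<^bsub>K\<^esub> (k ^ j * i)" for i j :: nat
  proof (induction j arbitrary: i)
    case (Suc j)
    have "cj K (s [^]\<^bsub>K\<^esub> Suc j) (a [^]\<^bsub>K\<^esub> i) = cj K (s [^]\<^bsub>K\<^esub> j) (cj K s (a [^]\<^bsub>K\<^esub> i))"
      using a by (simp add: K.cj_cj)
    also have "cj K s (a [^]\<^bsub>K\<^esub> i) = a [^]\<^bsub>K\<^esub> (k * i)" using a by (simp add: K.cj_pow K.nat_pow_pow)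
    finally show ?case using Suc.IH[of "k * i"] by (simp add: ac_simps)
  qed (use a in simp)
  have H: "subgroup ?H K"
  proof (rule K.finite_subgroupI)
    fix u v assume "u \<in> ?H" "v \<in> ?H"
    then obtain i j i' j' where uv: "u = a [^]\<^bsub>K\<^esub> (i::nat) \<otimes>\<^bsub>K\<^esub> s [^]\<^bsub>K\<^esub> (j::nat)" "v = a [^]\<^bsub>K\<^esub> (i'::nat) \<otimes>\<^bsub>K\<^esub> s [^]\<^bsub>K\<^esub> (j'::nat)"
      by auto
    have "u \<otimes>\<^bsub>K\<^esub> v = (a [^]\<^bsub>K\<^esub> i \<otimes>\<^bsub>K\<^esub> cj K (s [^]\<^bsub>K\<^esub> j) (a [^]\<^bsub>K\<^esub> i')) \<otimes>\<^bsub>K\<^esub> s [^]\<^bsub>K\<^esub> (j + j')"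
      using a unfolding uv cj_def K.nat_pow_mult[OF a(2), symmetric] by (simp add: K.m_assoc K.inv_solve_left)
    also have "\<dots> = a [^]\<^bsub>K\<^esub> (i + k ^ j * i') \<otimes>\<^bsub>K\<^esub> s [^]\<^bsub>K\<^esub> (j + j')"
      using a by (simp add: cjs K.nat_pow_mult)
    finally show "u \<otimes>\<^bsub>K\<^esub> v \<in> ?H" using inH by metis
  next
    show "\<one>\<^bsub>K\<^esub> \<in> ?H" using inH[of 0 0] by simp
  qed (use a in auto)
  have aH: "a \<in> ?H" using inH[of 1 0] a by simp
  have sH: "s \<in> ?H" using inH[of 0 1] a by simp
  interpret KH: group ?KH using H by (rule K.subgroup_imp_group)
  have injf: "inj_on ?f ({..<n} \<times> {..<2::nat})"
  proof (rule inj_onI)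
    fix p q assume pq: "p \<in> {..<n} \<times> {..<2::nat}" "q \<in> {..<n} \<times> {..<2::nat}" "?f p = ?f q"
    then have "(fst p, snd p, 0::nat) = (fst q, snd q, 0)"
      by (intro inj_onD[OF tri_inj[OF assms(1)]]) (use a in \<open>auto split: prod.splits\<close>)
    then show "p = q" by (simp add: prod_eq_iff)
  qed
  have mc: "mc ?KH a s n k 2 0"
    unfolding mc_def
  proof (intro conjI)
    show "order ?KH = n * 2"
      using injf by (simp add: order_def card_image card_cartesian_product)
    show "cj ?KH s a = a [^]\<^bsub>?KH\<^esub> k" using K.cj_sub[OF H sH] a by (simp add: K.pow_sub)
    show "carrier ?KH \<subseteq> {a [^]\<^bsub>?KH\<^esub> i \<otimes>\<^bsub>?KH\<^esub> s [^]\<^bsub>?KH\<^esub> j |i j. i < n \<and> j < (2::nat)}"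
      by (auto simp: K.pow_sub)
  qed (use a aH sH in \<open>auto simp: K.pow_sub KH.is_group\<close>)
  obtain \<phi> where \<phi>: "\<phi> \<in> hom ?KH L" "\<phi> a = x" "\<phi> s = y"
    using mc_hom[OF mc assms(2,3,4,6,9)] assms(7) by auto
  interpret \<phi>: group_hom ?KH L \<phi> using \<phi>(1) by unfold_locales
  have aiH: "a [^]\<^bsub>K\<^esub> i \<in> ?H" for i :: nat using inH[of i 0] a by simp
  have siH: "s [^]\<^bsub>K\<^esub> i \<in> ?H" for i :: nat using inH[of 0 i] a by simp
  have \<phi>p: "\<phi> (a [^]\<^bsub>K\<^esub> i \<otimes>\<^bsub>K\<^esub> s [^]\<^bsub>K\<^esub> j) = x [^]\<^bsub>L\<^esub> i \<otimes>\<^bsub>L\<^esub> y [^]\<^bsub>L\<^esub> j" for i j :: nat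
    using \<phi>.hom_mult[of "a [^]\<^bsub>K\<^esub> i" "s [^]\<^bsub>K\<^esub> j"] \<phi>.hom_nat_pow[of a i] \<phi>.hom_nat_pow[of s j] aiH siH aH sH \<phi>(2,3)
    by (simp add: K.pow_sub)
  have cjt: "cj K t (a [^]\<^bsub>K\<^esub> i \<otimes>\<^bsub>K\<^esub> s [^]\<^bsub>K\<^esub> j) = a [^]\<^bsub>K\<^esub> (k' * i) \<otimes>\<^bsub>K\<^esub> s [^]\<^bsub>K\<^esub> j" for i j :: nat
    using a by (simp add: K.cj_m K.cj_pow K.nat_pow_pow)
  have cjz: "cj L z (x [^]\<^bsub>L\<^esub> i \<otimes>\<^bsub>L\<^esub> y [^]\<^bsub>L\<^esub> j) = x [^]\<^bsub>L\<^esub> (k' * i) \<otimes>\<^bsub>L\<^esub> y [^]\<^bsub>L\<^esub> j" for i j :: nat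
    using assms by (simp add: L.cj_m L.cj_pow L.nat_pow_pow)
  have "\<exists>\<psi>\<in>hom K L. (\<forall>h\<in>?H. \<psi> h = \<phi> h) \<and> \<psi> t = z"
  proof (rule K.hom_extend[OF H a(3), where m = 2])
    show "t [^]\<^bsub>K\<^esub> (2::nat) \<in> ?H" using a(7) subgroup.one_closed[OF H] by simp
    show "\<And>h. h \<in> ?H \<Longrightarrow> cj K t h \<in> ?H" using cjt inH by auto
    show "carrier K \<subseteq> {h \<otimes>\<^bsub>K\<^esub> t [^]\<^bsub>K\<^esub> j |h j. h \<in> ?H \<and> j < (2::nat)}"
    proof
      fix u assume "u \<in> carrier K"
      then obtain i j l where u: "i < n" "j < (2::nat)" "l < (2::nat)"
        "u = a [^]\<^bsub>K\<^esub> i \<otimes>\<^bsub>K\<^esub> s [^]\<^bsub>K\<^esub> j \<otimes>\<^bsub>K\<^esub> t [^]\<^bsub>K\<^esub> l"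
        using car by blast
      then show "u \<in> {h \<otimes>\<^bsub>K\<^esub> t [^]\<^bsub>K\<^esub> j |h j. h \<in> ?H \<and> j < (2::nat)}"
        using inH[of i j] by blast
    qed
    show "\<And>h. h \<in> ?H \<Longrightarrow> cj L z (\<phi> h) = \<phi> (cj K t h)" using cjt cjz \<phi>p by auto
    show "z [^]\<^bsub>L\<^esub> (2::nat) = \<phi> (t [^]\<^bsub>K\<^esub> (2::nat))" using a assms(8) \<phi>.hom_one by simp
    fix j :: nat assume j: "0 < j" "j < 2"
    show "t [^]\<^bsub>K\<^esub> j \<notin> ?H"
    proof
      assume "t [^]\<^bsub>K\<^esub> j \<in> ?H"
      then obtain i i' where i: "i < n" "i' < (2::nat)" "t [^]\<^bsub>K\<^esub> j = a [^]\<^bsub>K\<^esub> i \<otimes>\<^bsub>K\<^esub> s [^]\<^bsub>K\<^esub> i'" by auto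
      have "(0, 0, j) = (i, i', 0)"
        by (rule inj_onD[OF tri_inj[OF assms(1)]]) (use i j a in auto)
      then show False using j by simp
    qed
  qed (use assms \<phi>(1) in auto)
  then show ?thesis using aH sH \<phi>(2,3) by metis
qed

lemma tri_embeds:
  assumes "tri K a s t n k k'" "group L" "x \<in> carrier L" "y \<in> carrier L" "z \<in> carrier L"
    "x [^]\<^bsub>L\<^esub> n = \<one>\<^bsub>L\<^esub>" "y [^]\<^bsub>L\<^esub> (2::nat) = \<one>\<^bsub>L\<^esub>" "z [^]\<^bsub>L\<^esub> (2::nat) = \<one>\<^bsub>L\<^esub>"
    "cj L y x = x [^]\<^bsub>L\<^esub> k" "cj L z x = x [^]\<^bsub>L\<^esub> k'" "cj L z y = y"
    "\<And>i j l. i < n \<Longrightarrow> j < (2::nat) \<Longrightarrow> l < (2::nat) \<Longrightarrow> x [^]\<^bsub>L\<^esub> i \<otimes>\<^bsub>L\<^esub> y [^]\<^bsub>L\<^esub> j \<otimes>\<^bsub>L\<^esub> z [^]\<^bsub>L\<^esub> l = \<one>\<^bsub>L\<^esub> \<Longrightarrow> i = 0 \<and> j = 0 \<and> l = (0::nat)"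
  shows "embeds K L"
proof -
  interpret K: group K using assms by (simp add: tri_def)
  obtain \<psi> where \<psi>: "\<psi> \<in> hom K L" "\<psi> a = x" "\<psi> s = y" "\<psi> t = z"
    using tri_hom[OF assms(1-11)] by blast
  interpret \<psi>: group_hom K L \<psi>
    using assms(2) \<psi>(1) by (simp add: group_hom_def group_hom_axioms_def)
  have "u = \<one>\<^bsub>K\<^esub>" if u: "u \<in> carrier K" "\<psi> u = \<one>\<^bsub>L\<^esub>" for u
  proof -
    obtain i j l where ij: "i < n" "j < (2::nat)" "l < (2::nat)" "u = a [^]\<^bsub>K\<^esub> i \<otimes>\<^bsub>K\<^esub> s [^]\<^bsub>K\<^esub> j \<otimes>\<^bsub>K\<^esub> t [^]\<^bsub>K\<^esub> (l::nat)"
      using u assms(1) unfolding tri_def by blast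
    have "a \<in> carrier K" "s \<in> carrier K" "t \<in> carrier K" using assms(1) by (auto simp: tri_def)
    then have "i = 0 \<and> j = 0 \<and> l = 0"
      using assms(12)[OF ij(1,2,3)] u(2) ij(4) \<psi> by (simp add: \<psi>.hom_nat_pow)
    then show ?thesis using ij(4) by simp
  qed
  then have "inj_on \<psi> (carrier K)" using \<psi>.inj_on_one_iff by blast
  then show ?thesis
    using assms(1,2) \<psi>(1) by (intro embedsI) (auto simp: tri_def)
qed

lemma tri_iso:
  assumes "tri K a s t n k k'" "tri L x y z n k k'"
  shows "K \<cong> L"
proof (rule embeds_iso)
  show "embeds K L"
    by (rule tri_embeds[OF assms(1), where x = x and y = y and z = z])
      (use tri_eq_one[OF assms(2)] assms(2) in \<open>auto simp: tri_def\<close>)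
  show "finite (carrier L)"
    using assms(2) by (auto simp: tri_def order_def intro: card_ge_0_finite)
qed (use assms in \<open>auto simp: tri_def\<close>)

subsection \<open>Presented groups\<close>

abbreviation cls :: "'x set \<Rightarrow> ('x word \<times> 'x word) set \<Rightarrow> 'x word \<Rightarrow> 'x word set"
  where "cls X R w \<equiv> word_cong X R `` {w}"

lemma cls_carrier: "w \<in> words X \<Longrightarrow> cls X R w \<in> carrier (presented_group X R)"
  by (auto simp: presented_group_def intro: quotientI)

lemma cls_Nil: "cls X R [] = \<one>\<^bsub>presented_group X R\<^esub>"
  by (simp add: presented_group_def)

lemma cls_append:
  "u \<in> words X \<Longrightarrow> v \<in> words X \<Longrightarrow> cls X R (u @ v) = cls X R u \<otimes>\<^bsub>presented_group X R\<^esub> cls X R v"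
  by (simp add: presented_group_mult)

lemma cls_eqI: "(u, v) \<in> R \<Longrightarrow> u \<in> words X \<Longrightarrow> v \<in> words X \<Longrightarrow> cls X R u = cls X R v"
  by (intro equiv_class_eq[OF equiv_word_cong] word_cong.rel)

lemma cls_winv:
  assumes "w \<in> words X"
  shows "cls X R (winv w) = inv\<^bsub>presented_group X R\<^esub> cls X R w"
proof (rule group.inv_equality[OF group_presented_group, symmetric])
  show "cls X R (winv w) \<otimes>\<^bsub>presented_group X R\<^esub> cls X R w = \<one>\<^bsub>presented_group X R\<^esub>"
    using assms equiv_class_eq[OF equiv_word_cong winv_cong]
    by (simp add: cls_append[symmetric] cls_Nil[symmetric])
qed (use assms in \<open>simp_all add: cls_carrier\<close>)

lemma wpow_words [simp]: "w \<in> words X \<Longrightarrow> wpow w k \<in> words X"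
  by (induction k) (auto simp: wpow_def)

lemma gen_words [simp]: "gen x \<in> words X \<longleftrightarrow> x \<in> X"
  by (simp add: gen_def)

lemma cls_wpow:
  assumes "w \<in> words X"
  shows "cls X R (wpow w k) = cls X R w [^]\<^bsub>presented_group X R\<^esub> k"
proof (induction k)
  case 0
  then show ?case by (simp add: wpow_def cls_Nil)
next
  case (Suc k)
  interpret group "presented_group X R" by (rule group_presented_group)
  have "wpow w (Suc k) = w @ wpow w k" by (simp add: wpow_def)
  then show ?case
    using Suc assms cls_carrier[OF assms, of R] nat_pow_Suc2 by (simp add: cls_append)
qed

lemma word_eval_gen:
  assumes "group G" "f x \<in> carrier G"
  shows "word_eval G f (gen x) = f x"
proof -
  interpret group G by fact
  show ?thesis using assms(2) by (simp add: word_eval_def gen_def)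
qed

lemma word_eval_Nil: "word_eval G f [] = \<one>\<^bsub>G\<^esub>"
  by (simp add: word_eval_def)

lemma word_eval_winv:
  assumes "group G" "f \<in> X \<rightarrow> carrier G" "w \<in> words X"
  shows "word_eval G f (winv w) = inv\<^bsub>G\<^esub> word_eval G f w"
proof -
  interpret group G by fact
  have "word_eval G f (winv w @ w) = \<one>\<^bsub>G\<^esub>"
    using word_eval_cong[OF assms(1,2) _ winv_cong[OF assms(3), of "{}"]] by (simp add: word_eval_Nil)
  then show ?thesis
    using word_eval_append[OF assms(1,2)] word_eval_closed[OF assms(1,2)] assms(3)
    by (metis inv_equality winv_in_words)
qed

lemma word_eval_wpow:
  assumes "group G" "f \<in> X \<rightarrow> carrier G" "w \<in> words X"
  shows "word_eval G f (wpow w k) = word_eval G f w [^]\<^bsub>G\<^esub> k"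
proof (induction k)
  case 0
  then show ?case by (simp add: wpow_def word_eval_Nil)
next
  case (Suc k)
  interpret group G by fact
  have "wpow w (Suc k) = w @ wpow w k" by (simp add: wpow_def)
  then show ?case
    using Suc assms(3) word_eval_append[OF assms(1,2)] word_eval_closed[OF assms] nat_pow_Suc2 by simp
qed

text \<open>Multiplication by a generator permutes the finite set \<open>S\<close>, hence
  \<open>S\<close> is closed under the inverse generators too, and induction on words reaches every
  class.\<close>

lemma presented_subset:
  fixes S :: "'x word set set"
  assumes "finite S" "S \<subseteq> carrier (presented_group X R)" "\<one>\<^bsub>presented_group X R\<^esub> \<in> S"
    "\<And>x g. x \<in> X \<Longrightarrow> g \<in> S \<Longrightarrow> cls X R (gen x) \<otimes>\<^bsub>presented_group X R\<^esub> g \<in> S"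
  shows "carrier (presented_group X R) \<subseteq> S"
proof -
  let ?P = "presented_group X R"
  interpret P: group ?P by (rule group_presented_group)
  have inv: "inv\<^bsub>?P\<^esub> cls X R (gen x) \<otimes>\<^bsub>?P\<^esub> g \<in> S" if x: "x \<in> X" and g: "g \<in> S" for x g
  proof -
    let ?c = "cls X R (gen x)"
    have c: "?c \<in> carrier ?P" using x cls_carrier[of "gen x" X R] by simp
    have "inj_on (\<lambda>g. ?c \<otimes>\<^bsub>?P\<^esub> g) S"
      using c assms(2) by (intro inj_onI) (auto simp: subset_iff)
    then have "(\<lambda>g. ?c \<otimes>\<^bsub>?P\<^esub> g) ` S = S"
      using assms(1,4) x by (intro endo_inj_surj) auto
    then obtain h where h: "h \<in> S" "?c \<otimes>\<^bsub>?P\<^esub> h = g" using g by (metis imageE)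
    then have "inv\<^bsub>?P\<^esub> ?c \<otimes>\<^bsub>?P\<^esub> g = h"
      using c assms(2) by (auto simp: P.m_assoc[symmetric])
    then show ?thesis using h by simp
  qed
  have "cls X R w \<in> S" if "w \<in> words X" for w
    using that
  proof (induction w)
    case Nil
    then show ?case using assms(3) by (simp add: cls_Nil)
  next
    case (Cons p w)
    obtain x b where p: "p = (x, b)" by force
    have w: "x \<in> X" "w \<in> words X" using Cons.prems p by auto
    define l where "l = (if b then gen x else winv (gen x))"
    have pw: "p # w = l @ w" and l: "l \<in> words X"
      using w by (simp_all add: p l_def gen_def winv_def)
    have "cls X R (p # w) = (if b then cls X R (gen x) else inv\<^bsub>?P\<^esub> cls X R (gen x)) \<otimes>\<^bsub>?P\<^esub> cls X R w"
      unfolding pw cls_append[OF l w(2)] using w by (simp add: l_def cls_winv)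
    then show ?case using Cons.IH[OF w(2)] w(1) assms(4) inv by simp
  qed
  then show ?thesis
    by (auto simp: presented_group_def elim!: quotientE)
qed

text \<open>Two bounds meet: the relations reduce every element to one of \<open>n * m\<close>
  normal forms, while the universal property maps the presented group onto \<open>M\<close>, which
  has exactly \<open>n * m\<close> elements.\<close>

lemma presented_mc_iso:
  assumes "X = {x, y}" "mc M a b n k m 0"
    and hom: "\<And>u v f. (u, v) \<in> R \<Longrightarrow> f x = a \<Longrightarrow> f y = b \<Longrightarrow> word_eval M f u = word_eval M f v"
    and ne: "x \<noteq> y"
    and rel: "cls X R (gen x) [^]\<^bsub>presented_group X R\<^esub> n = \<one>\<^bsub>presented_group X R\<^esub>"
      "cls X R (gen y) [^]\<^bsub>presented_group X R\<^esub> m = \<one>\<^bsub>presented_group X R\<^esub>"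
      "cj (presented_group X R) (cls X R (gen y)) (cls X R (gen x)) = cls X R (gen x) [^]\<^bsub>presented_group X R\<^esub> k"
  shows "presented_group X R \<cong> M"
proof -
  let ?P = "presented_group X R"
  interpret P: group ?P by (rule group_presented_group)
  interpret M: group M using assms(2) by (simp add: mc_def)
  define A where "A = cls X R (gen x)"
  define B where "B = cls X R (gen y)"
  have AB: "A \<in> carrier ?P" "B \<in> carrier ?P"
    using cls_carrier[of "gen x" X R] cls_carrier[of "gen y" X R] assms(1) by (simp_all add: A_def B_def)
  have rel': "A [^]\<^bsub>?P\<^esub> n = \<one>\<^bsub>?P\<^esub>" "B [^]\<^bsub>?P\<^esub> m = \<one>\<^bsub>?P\<^esub>" "cj ?P B A = A [^]\<^bsub>?P\<^esub> k"
    using rel by (simp_all add: A_def B_def)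
  have nm: "n > 0" "m > 0" using assms(2) by (simp_all add: mc_def)
  let ?S = "(\<lambda>(i, j). A [^]\<^bsub>?P\<^esub> i \<otimes>\<^bsub>?P\<^esub> B [^]\<^bsub>?P\<^esub> j) ` ({..<n} \<times> {..<m})"
  have inS: "A [^]\<^bsub>?P\<^esub> i \<otimes>\<^bsub>?P\<^esub> B [^]\<^bsub>?P\<^esub> j \<in> ?S" for i j :: nat
    using P.pow_mod[OF AB(1) rel'(1), of i] P.pow_mod[OF AB(2) rel'(2), of j] nm
    by (intro image_eqI[where x = "(i mod n, j mod m)"]) auto
  have sub: "carrier ?P \<subseteq> ?S"
  proof (rule presented_subset)
    show "\<one>\<^bsub>?P\<^esub> \<in> ?S" using inS[of 0 0] AB by simp
    fix z g assume z: "z \<in> X" and "g \<in> ?S"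
    then obtain i j where g: "g = A [^]\<^bsub>?P\<^esub> (i::nat) \<otimes>\<^bsub>?P\<^esub> B [^]\<^bsub>?P\<^esub> (j::nat)" by auto
    have "A \<otimes>\<^bsub>?P\<^esub> g = A [^]\<^bsub>?P\<^esub> Suc i \<otimes>\<^bsub>?P\<^esub> B [^]\<^bsub>?P\<^esub> j"
      using AB g unfolding P.nat_pow_Suc2[OF AB(1)] by (simp add: P.m_assoc)
    moreover have "B \<otimes>\<^bsub>?P\<^esub> g = cj ?P B (A [^]\<^bsub>?P\<^esub> i) \<otimes>\<^bsub>?P\<^esub> B [^]\<^bsub>?P\<^esub> Suc j"
      using AB g unfolding P.nat_pow_Suc2[OF AB(2)] cj_def by (simp add: P.m_assoc P.inv_solve_left)
    moreover have "cj ?P B (A [^]\<^bsub>?P\<^esub> i) = A [^]\<^bsub>?P\<^esub> (k * i)"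
      using AB rel' by (simp add: P.cj_pow P.nat_pow_pow)
    ultimately have "A \<otimes>\<^bsub>?P\<^esub> g \<in> ?S" "B \<otimes>\<^bsub>?P\<^esub> g \<in> ?S"
      using inS by metis+
    then show "cls X R (gen z) \<otimes>\<^bsub>?P\<^esub> g \<in> ?S"
      using z assms(1) by (auto simp: A_def B_def)
  qed (use AB in auto)
  have ab: "a \<in> carrier M" "b \<in> carrier M" using assms(2) by (simp_all add: mc_def)
  define f where "f = (\<lambda>z. if z = x then a else b)"
  have f: "f \<in> X \<rightarrow> carrier M" "f x = a" "f y = b" using ab ne by (auto simp: f_def)
  obtain h where h: "h \<in> hom ?P M" "\<And>w. w \<in> words X \<Longrightarrow> h (cls X R w) = word_eval M f w"
    using presented_group_universal[OF M.is_group f(1), of R] hom[OF _ f(2,3)] by blast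
  interpret h: group_hom ?P M h using h(1) by unfold_locales
  have hAB: "h A = a" "h B = b"
    using h(2) assms(1) f ab by (simp_all add: A_def B_def word_eval_gen)
  show ?thesis
  proof (rule surj_hom_iso[OF h(1)])
    show "carrier M \<subseteq> h ` carrier ?P"
    proof
      fix g assume "g \<in> carrier M"
      then obtain i j where "g = a [^]\<^bsub>M\<^esub> (i::nat) \<otimes>\<^bsub>M\<^esub> b [^]\<^bsub>M\<^esub> (j::nat)"
        using assms(2) unfolding mc_def by blast
      then have "g = h (A [^]\<^bsub>?P\<^esub> i \<otimes>\<^bsub>?P\<^esub> B [^]\<^bsub>?P\<^esub> j)"
        using AB by (simp add: h.hom_nat_pow hAB)
      then show "g \<in> h ` carrier ?P" using AB by blast
    qed
    show "finite (carrier ?P)" by (rule finite_subset[OF sub]) simp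
    have "order ?P \<le> card ?S" unfolding order_def by (intro card_mono sub) simp
    also have "\<dots> \<le> n * m" by (rule order_trans[OF card_image_le]) (simp_all add: card_cartesian_product)
    finally show "order ?P \<le> order M" using assms(2) by (simp add: mc_def)
  qed
qed

lemma presented_tri_iso:
  assumes "X = {x, y, z}" "tri M a s t n k k'" "distinct [x, y, z]"
    and hom: "\<And>u v f. (u, v) \<in> R \<Longrightarrow> f x = a \<Longrightarrow> f y = s \<Longrightarrow> f z = t \<Longrightarrow> word_eval M f u = word_eval M f v"
    and rel: "cls X R (gen x) [^]\<^bsub>presented_group X R\<^esub> n = \<one>\<^bsub>presented_group X R\<^esub>"
      "cls X R (gen y) [^]\<^bsub>presented_group X R\<^esub> (2::nat) = \<one>\<^bsub>presented_group X R\<^esub>"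
      "cls X R (gen z) [^]\<^bsub>presented_group X R\<^esub> (2::nat) = \<one>\<^bsub>presented_group X R\<^esub>"
      "cj (presented_group X R) (cls X R (gen y)) (cls X R (gen x)) = cls X R (gen x) [^]\<^bsub>presented_group X R\<^esub> k"
      "cj (presented_group X R) (cls X R (gen z)) (cls X R (gen x)) = cls X R (gen x) [^]\<^bsub>presented_group X R\<^esub> k'"
      "cj (presented_group X R) (cls X R (gen z)) (cls X R (gen y)) = cls X R (gen y)"
  shows "presented_group X R \<cong> M"
proof -
  let ?P = "presented_group X R"
  interpret P: group ?P by (rule group_presented_group)
  interpret M: group M using assms(2) by (simp add: tri_def)
  define A where "A = cls X R (gen x)"
  define B where "B = cls X R (gen y)"
  define C where "C = cls X R (gen z)"
  have AB: "A \<in> carrier ?P" "B \<in> carrier ?P" "C \<in> carrier ?P"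
    using cls_carrier[of "gen x" X R] cls_carrier[of "gen y" X R] cls_carrier[of "gen z" X R] assms(1)
    by (simp_all add: A_def B_def C_def)
  have rel': "A [^]\<^bsub>?P\<^esub> n = \<one>\<^bsub>?P\<^esub>" "B [^]\<^bsub>?P\<^esub> (2::nat) = \<one>\<^bsub>?P\<^esub>" "C [^]\<^bsub>?P\<^esub> (2::nat) = \<one>\<^bsub>?P\<^esub>"
      "cj ?P B A = A [^]\<^bsub>?P\<^esub> k" "cj ?P C A = A [^]\<^bsub>?P\<^esub> k'" "cj ?P C B = B"
    using rel by (simp_all add: A_def B_def C_def)
  have n: "n > 0" using assms(2) by (simp add: tri_def)
  let ?D = "{..<n} \<times> {..<2::nat} \<times> {..<2::nat}"
  let ?S = "(\<lambda>(i, j, l). A [^]\<^bsub>?P\<^esub> i \<otimes>\<^bsub>?P\<^esub> B [^]\<^bsub>?P\<^esub> j \<otimes>\<^bsub>?P\<^esub> C [^]\<^bsub>?P\<^esub> l) ` ?D"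
  have inS: "A [^]\<^bsub>?P\<^esub> i \<otimes>\<^bsub>?P\<^esub> B [^]\<^bsub>?P\<^esub> j \<otimes>\<^bsub>?P\<^esub> C [^]\<^bsub>?P\<^esub> l \<in> ?S" for i j l :: nat
    using P.pow_mod[OF AB(1) rel'(1), of i] P.pow_mod[OF AB(2) rel'(2), of j] P.pow_mod[OF AB(3) rel'(3), of l] n
    by (intro image_eqI[where x = "(i mod n, j mod 2, l mod 2)"]) auto
  have sub: "carrier ?P \<subseteq> ?S"
  proof (rule presented_subset)
    show "\<one>\<^bsub>?P\<^esub> \<in> ?S" using inS[of 0 0 0] AB by simp
    fix w g assume w: "w \<in> X" and "g \<in> ?S"
    then obtain i j l where g: "g = A [^]\<^bsub>?P\<^esub> (i::nat) \<otimes>\<^bsub>?P\<^esub> B [^]\<^bsub>?P\<^esub> (j::nat) \<otimes>\<^bsub>?P\<^esub> C [^]\<^bsub>?P\<^esub> (l::nat)" by auto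
    have "A \<otimes>\<^bsub>?P\<^esub> g = A [^]\<^bsub>?P\<^esub> Suc i \<otimes>\<^bsub>?P\<^esub> B [^]\<^bsub>?P\<^esub> j \<otimes>\<^bsub>?P\<^esub> C [^]\<^bsub>?P\<^esub> l"
      using AB g unfolding P.nat_pow_Suc2[OF AB(1)] by (simp add: P.m_assoc)
    moreover have "B \<otimes>\<^bsub>?P\<^esub> g = cj ?P B (A [^]\<^bsub>?P\<^esub> i) \<otimes>\<^bsub>?P\<^esub> B [^]\<^bsub>?P\<^esub> Suc j \<otimes>\<^bsub>?P\<^esub> C [^]\<^bsub>?P\<^esub> l"
      using AB g unfolding P.nat_pow_Suc2[OF AB(2)] cj_def by (simp add: P.m_assoc P.inv_solve_left)
    moreover have "cj ?P B (A [^]\<^bsub>?P\<^esub> i) = A [^]\<^bsub>?P\<^esub> (k * i)"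
      using AB rel' by (simp add: P.cj_pow P.nat_pow_pow)
    moreover have "C \<otimes>\<^bsub>?P\<^esub> g = cj ?P C (A [^]\<^bsub>?P\<^esub> i \<otimes>\<^bsub>?P\<^esub> B [^]\<^bsub>?P\<^esub> j) \<otimes>\<^bsub>?P\<^esub> C [^]\<^bsub>?P\<^esub> Suc l"
      using AB g unfolding P.nat_pow_Suc2[OF AB(3)] cj_def by (simp add: P.m_assoc P.inv_solve_left)
    moreover have "cj ?P C (A [^]\<^bsub>?P\<^esub> i \<otimes>\<^bsub>?P\<^esub> B [^]\<^bsub>?P\<^esub> j) = A [^]\<^bsub>?P\<^esub> (k' * i) \<otimes>\<^bsub>?P\<^esub> B [^]\<^bsub>?P\<^esub> j"
      using AB rel' by (simp add: P.cj_m P.cj_pow P.nat_pow_pow)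
    ultimately have "A \<otimes>\<^bsub>?P\<^esub> g \<in> ?S" "B \<otimes>\<^bsub>?P\<^esub> g \<in> ?S" "C \<otimes>\<^bsub>?P\<^esub> g \<in> ?S"
      using inS by metis+
    moreover have "cls X R (gen w) \<in> {A, B, C}"
      using w assms(1) by (auto simp: A_def B_def C_def)
    ultimately show "cls X R (gen w) \<otimes>\<^bsub>?P\<^esub> g \<in> ?S"
      by (metis insertE singletonD)
  qed (use AB in auto)
  have ab: "a \<in> carrier M" "s \<in> carrier M" "t \<in> carrier M" using assms(2) by (simp_all add: tri_def)
  define f where "f = (\<lambda>w. if w = x then a else if w = y then s else t)"
  have f: "f \<in> X \<rightarrow> carrier M" "f x = a" "f y = s" "f z = t" using ab assms(3) by (auto simp: f_def)
  obtain h where h: "h \<in> hom ?P M" "\<And>w. w \<in> words X \<Longrightarrow> h (cls X R w) = word_eval M f w"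
    using presented_group_universal[OF M.is_group f(1), of R] hom[OF _ f(2,3,4)] by blast
  interpret h: group_hom ?P M h using h(1) by unfold_locales
  have hAB: "h A = a" "h B = s" "h C = t"
    using h(2) assms(1) f ab by (simp_all add: A_def B_def C_def word_eval_gen)
  show ?thesis
  proof (rule surj_hom_iso[OF h(1)])
    show "carrier M \<subseteq> h ` carrier ?P"
    proof
      fix g assume "g \<in> carrier M"
      then obtain i j l where "g = a [^]\<^bsub>M\<^esub> (i::nat) \<otimes>\<^bsub>M\<^esub> s [^]\<^bsub>M\<^esub> (j::nat) \<otimes>\<^bsub>M\<^esub> t [^]\<^bsub>M\<^esub> (l::nat)"
        using assms(2) unfolding tri_def by blast
      then have "g = h (A [^]\<^bsub>?P\<^esub> i \<otimes>\<^bsub>?P\<^esub> B [^]\<^bsub>?P\<^esub> j \<otimes>\<^bsub>?P\<^esub> C [^]\<^bsub>?P\<^esub> l)"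
        using AB by (simp add: h.hom_nat_pow hAB)
      then show "g \<in> h ` carrier ?P" using AB by blast
    qed
    show "finite (carrier ?P)" by (rule finite_subset[OF sub]) simp
    have "order ?P \<le> card ?S" unfolding order_def by (intro card_mono sub) simp
    also have "\<dots> \<le> 4 * n" by (rule order_trans[OF card_image_le]) (simp_all add: card_cartesian_product)
    finally show "order ?P \<le> order M" using assms(2) by (simp add: tri_def)
  qed
qed

section \<open>Relations as conjugation, and the presented groups of the list\<close>

context group
begin

lemma pow2_inv: "b \<in> carrier G \<Longrightarrow> b [^] (2::nat) = \<one> \<Longrightarrow> inv b = b"
  by (metis inv_equality nat_pow_Suc nat_pow_eone numeral_2_eq_2 One_nat_def)

text \<open>The presentations write b a b on the left of a relation. For an involution this is
  conjugation, the form in which \<open>mc\<close> and \<open>tri\<close> state it.\<close>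

lemma cj_involution_iff:
  "a \<in> carrier G \<Longrightarrow> b \<in> carrier G \<Longrightarrow> b [^] (2::nat) = \<one> \<Longrightarrow> b \<otimes> (a \<otimes> b) = c \<longleftrightarrow> cj G b a = c"
  by (simp add: cj_def pow2_inv m_assoc)

lemma commutator_eq_one_iff:
  assumes "c \<in> carrier G" "b \<in> carrier G"
  shows "inv c \<otimes> (inv b \<otimes> (c \<otimes> b)) = \<one> \<longleftrightarrow> cj G c b = b"
proof -
  have "inv c \<otimes> (inv b \<otimes> (c \<otimes> b)) = inv (b \<otimes> c) \<otimes> (c \<otimes> b)"
    using assms by (simp add: inv_mult_group m_assoc)
  then show ?thesis
    using assms by (metis cj_eq_iff inv_closed inv_equality inv_inv l_inv m_closed)
qed

lemma pow_pred_inv: "a \<in> carrier G \<Longrightarrow> a [^] n = \<one> \<Longrightarrow> n > 0 \<Longrightarrow> a [^] (n - 1 :: nat) = inv a"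
  by (metis Suc_diff_1 inv_equality nat_pow_Suc nat_pow_closed)

end

text \<open>Exponents are natural numbers, so inversion of \<open>a\<close> is written as the power
  \<open>n - 1\<close>.\<close>

lemma dihedral_group_iso:
  assumes "mc M a b n (n - 1) 2 0"
  shows "dihedral_group n \<cong> M"
proof -
  define X :: "string set" where "X = {''a'', ''b''}"
  define R :: "(string word \<times> string word) set" where "R = {(wpow (gen ''a'') n, []), (wpow (gen ''b'') 2, []), (gen ''b'' @ gen ''a'' @ gen ''b'', winv (gen ''a''))}"
  define P where "P = presented_group X R"
  interpret P: group P unfolding P_def by (rule group_presented_group)
  interpret M: group M using assms by (simp add: mc_def)
  have m: "n > 0" "a \<in> carrier M" "b \<in> carrier M" "a [^]\<^bsub>M\<^esub> (n::nat) = \<one>\<^bsub>M\<^esub>" "b [^]\<^bsub>M\<^esub> (2::nat) = \<one>\<^bsub>M\<^esub>"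
    "cj M b a = a [^]\<^bsub>M\<^esub> (n - 1::nat)"
    using assms by (simp_all add: mc_def)
  have RR: "(wpow (gen ''a'') n, []) \<in> R" "(wpow (gen ''b'') 2, []) \<in> R" "(gen ''b'' @ gen ''a'' @ gen ''b'', winv (gen ''a'')) \<in> R" by (simp_all add: R_def)
  define A where "A = cls X R (gen ''a'')"
  define B where "B = cls X R (gen ''b'')"
  have g: "gen ''a'' \<in> words X" "gen ''b'' \<in> words X" by (simp_all add: X_def)
  have c: "A \<in> carrier P" "B \<in> carrier P"
    using cls_carrier[of _ X R] g by (simp_all add: P_def A_def B_def)
  note cl = cls_append[of _ X _ R, folded P_def] cls_wpow[of _ X R, folded P_def] cls_winv[of _ X R, folded P_def] cls_Nil[of X R, folded P_def]
  note eq = cls_eqI[of _ _ R X]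
  have A: "A [^]\<^bsub>P\<^esub> (n::nat) = \<one>\<^bsub>P\<^esub>"
    using eq[of "wpow (gen ''a'') n" "[]"] g RR by (simp add: cl A_def)
  have B: "B [^]\<^bsub>P\<^esub> (2::nat) = \<one>\<^bsub>P\<^esub>"
    using eq[of "wpow (gen ''b'') 2" "[]"] g RR by (simp add: cl B_def)
  have "B \<otimes>\<^bsub>P\<^esub> (A \<otimes>\<^bsub>P\<^esub> B) = inv\<^bsub>P\<^esub> A"
    using eq[of "gen ''b'' @ gen ''a'' @ gen ''b''" "winv (gen ''a'')"] g RR by (simp add: cl A_def B_def)
  then have rel1: "cj P B A = A [^]\<^bsub>P\<^esub> (n - 1)"
    using c B P.cj_involution_iff P.pow_pred_inv[OF c(1) A m(1)] by simp
  note rel = A B rel1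
  have "P \<cong> M"
    unfolding P_def
  proof (rule presented_mc_iso[OF _ assms])
    fix u v and f :: "string \<Rightarrow> _" assume uv: "(u, v) \<in> R" and f: "f ''a'' = a" "f ''b'' = b"
    then have fX: "f \<in> X \<rightarrow> carrier M" using m by (auto simp: X_def)
    note w = word_eval_append[OF M.is_group fX] word_eval_winv[OF M.is_group fX]
      word_eval_wpow[OF M.is_group fX] word_eval_gen[OF M.is_group] word_eval_Nil
    have r: "b \<otimes>\<^bsub>M\<^esub> (a \<otimes>\<^bsub>M\<^esub> b) = inv\<^bsub>M\<^esub> a"
      using m M.cj_involution_iff M.pow_pred_inv[of a n] by simp
    show "word_eval M f u = word_eval M f v"
      using uv r f m g unfolding R_def by (auto simp: w)
  qed (use rel in \<open>auto simp: X_def P_def A_def B_def\<close>)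
  then show ?thesis by (simp add: dihedral_group_def P_def X_def R_def Let_def)
qed

lemma H\<^sub>1_iso:
  assumes "mc M a b 8 3 2 0"
  shows "H\<^sub>1 \<cong> M"
proof -
  define X :: "string set" where "X = {''x2'', ''y''}"
  define R :: "(string word \<times> string word) set" where "R = {(wpow (gen ''x2'') 2, []), (wpow (gen ''y'') 8, []), (gen ''x2'' @ gen ''y'' @ gen ''x2'', wpow (gen ''y'') 3)}"
  define P where "P = presented_group X R"
  interpret P: group P unfolding P_def by (rule group_presented_group)
  interpret M: group M using assms by (simp add: mc_def)
  have m: "a \<in> carrier M" "b \<in> carrier M" "a [^]\<^bsub>M\<^esub> (8::nat) = \<one>\<^bsub>M\<^esub>" "b [^]\<^bsub>M\<^esub> (2::nat) = \<one>\<^bsub>M\<^esub>"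
    "cj M b a = a [^]\<^bsub>M\<^esub> (3::nat)"
    using assms by (simp_all add: mc_def)
  have RR: "(wpow (gen ''x2'') 2, []) \<in> R" "(wpow (gen ''y'') 8, []) \<in> R" "(gen ''x2'' @ gen ''y'' @ gen ''x2'', wpow (gen ''y'') 3) \<in> R" by (simp_all add: R_def)
  define A where "A = cls X R (gen ''y'')"
  define B where "B = cls X R (gen ''x2'')"
  have g: "gen ''y'' \<in> words X" "gen ''x2'' \<in> words X" by (simp_all add: X_def)
  have c: "A \<in> carrier P" "B \<in> carrier P"
    using cls_carrier[of _ X R] g by (simp_all add: P_def A_def B_def)
  note cl = cls_append[of _ X _ R, folded P_def] cls_wpow[of _ X R, folded P_def] cls_winv[of _ X R, folded P_def] cls_Nil[of X R, folded P_def]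
  note eq = cls_eqI[of _ _ R X]
  have A: "A [^]\<^bsub>P\<^esub> (8::nat) = \<one>\<^bsub>P\<^esub>"
    using eq[of "wpow (gen ''y'') 8" "[]"] g RR by (simp add: cl A_def)
  have B: "B [^]\<^bsub>P\<^esub> (2::nat) = \<one>\<^bsub>P\<^esub>"
    using eq[of "wpow (gen ''x2'') 2" "[]"] g RR by (simp add: cl B_def)
  have "B \<otimes>\<^bsub>P\<^esub> (A \<otimes>\<^bsub>P\<^esub> B) = A [^]\<^bsub>P\<^esub> (3::nat)"
    using eq[of "gen ''x2'' @ gen ''y'' @ gen ''x2''" "wpow (gen ''y'') 3"] g RR by (simp add: cl A_def B_def)
  then have rel1: "cj P B A = A [^]\<^bsub>P\<^esub> (3::nat)"
    using c B P.cj_involution_iff by simp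
  note rel = A B rel1
  have "P \<cong> M"
    unfolding P_def
  proof (rule presented_mc_iso[OF _ assms])
    fix u v and f :: "string \<Rightarrow> _" assume uv: "(u, v) \<in> R" and f: "f ''y'' = a" "f ''x2'' = b"
    then have fX: "f \<in> X \<rightarrow> carrier M" using m by (auto simp: X_def)
    note w = word_eval_append[OF M.is_group fX] word_eval_winv[OF M.is_group fX]
      word_eval_wpow[OF M.is_group fX] word_eval_gen[OF M.is_group] word_eval_Nil
    have r: "b \<otimes>\<^bsub>M\<^esub> (a \<otimes>\<^bsub>M\<^esub> b) = a [^]\<^bsub>M\<^esub> (3::nat)"
      using m M.cj_involution_iff by simp
    show "word_eval M f u = word_eval M f v"
      using uv r f m g unfolding R_def by (auto simp: w)
  qed (use rel in \<open>auto simp: X_def P_def A_def B_def\<close>)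
  then show ?thesis by (simp add: H\<^sub>1_def P_def X_def R_def Let_def)
qed

text \<open>Here \<open>s\<close> plays the role of \<open>x2\<close> and \<open>t\<close> that of
  \<open>x1\<close>, whence the exponents 3 and 5 in this order; the commutator relation becomes
  \<open>cj M t s = s\<close>.\<close>

lemma H\<^sub>2_iso:
  assumes "tri M a s t 8 3 5"
  shows "H\<^sub>2 \<cong> M"
proof -
  define X :: "string set" where "X = {''x1'', ''x2'', ''y''}"
  define R :: "(string word \<times> string word) set" where "R = {(wpow (gen ''x1'') 2, []), (wpow (gen ''x2'') 2, []), (wpow (gen ''y'') 8, []),
    (winv (gen ''x1'') @ winv (gen ''x2'') @ gen ''x1'' @ gen ''x2'', []),
    (gen ''x1'' @ gen ''y'' @ gen ''x1'', wpow (gen ''y'') 5), (gen ''x2'' @ gen ''y'' @ gen ''x2'', wpow (gen ''y'') 3)}"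
  define P where "P = presented_group X R"
  interpret P: group P unfolding P_def by (rule group_presented_group)
  interpret M: group M using assms by (simp add: tri_def)
  have m: "t \<in> carrier M" "t [^]\<^bsub>M\<^esub> (2::nat) = \<one>\<^bsub>M\<^esub>" "cj M t a = a [^]\<^bsub>M\<^esub> (5::nat)" "cj M t s = s" "a \<in> carrier M" "s \<in> carrier M" "a [^]\<^bsub>M\<^esub> (8::nat) = \<one>\<^bsub>M\<^esub>" "s [^]\<^bsub>M\<^esub> (2::nat) = \<one>\<^bsub>M\<^esub>"
    "cj M s a = a [^]\<^bsub>M\<^esub> (3::nat)"
    using assms by (simp_all add: tri_def)
  have RR: "(wpow (gen ''x1'') 2, []) \<in> R" "(wpow (gen ''x2'') 2, []) \<in> R" "(wpow (gen ''y'') 8, []) \<in> R" "(winv (gen ''x1'') @ winv (gen ''x2'') @ gen ''x1'' @ gen ''x2'', []) \<in> R" "(gen ''x1'' @ gen ''y'' @ gen ''x1'', wpow (gen ''y'') 5) \<in> R" "(gen ''x2'' @ gen ''y'' @ gen ''x2'', wpow (gen ''y'') 3) \<in> R" by (simp_all add: R_def)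
  define A where "A = cls X R (gen ''y'')"
  define B where "B = cls X R (gen ''x2'')"
  define C where "C = cls X R (gen ''x1'')"
  have g: "gen ''y'' \<in> words X" "gen ''x2'' \<in> words X" "gen ''x1'' \<in> words X" by (simp_all add: X_def)
  have c: "A \<in> carrier P" "B \<in> carrier P" "C \<in> carrier P"
    using cls_carrier[of _ X R] g by (simp_all add: P_def A_def B_def C_def)
  note cl = cls_append[of _ X _ R, folded P_def] cls_wpow[of _ X R, folded P_def] cls_winv[of _ X R, folded P_def] cls_Nil[of X R, folded P_def]
  note eq = cls_eqI[of _ _ R X]
  have A: "A [^]\<^bsub>P\<^esub> (8::nat) = \<one>\<^bsub>P\<^esub>"
    using eq[of "wpow (gen ''y'') 8" "[]"] g RR by (simp add: cl A_def)
  have B: "B [^]\<^bsub>P\<^esub> (2::nat) = \<one>\<^bsub>P\<^esub>"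
    using eq[of "wpow (gen ''x2'') 2" "[]"] g RR by (simp add: cl B_def)
  have C: "C [^]\<^bsub>P\<^esub> (2::nat) = \<one>\<^bsub>P\<^esub>"
    using eq[of "wpow (gen ''x1'') 2" "[]"] g RR by (simp add: cl C_def)
  have "B \<otimes>\<^bsub>P\<^esub> (A \<otimes>\<^bsub>P\<^esub> B) = A [^]\<^bsub>P\<^esub> (3::nat)"
    using eq[of "gen ''x2'' @ gen ''y'' @ gen ''x2''" "wpow (gen ''y'') 3"] g RR by (simp add: cl A_def B_def)
  then have rel1: "cj P B A = A [^]\<^bsub>P\<^esub> (3::nat)"
    using c B P.cj_involution_iff by simp
  have "C \<otimes>\<^bsub>P\<^esub> (A \<otimes>\<^bsub>P\<^esub> C) = A [^]\<^bsub>P\<^esub> (5::nat)"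
    using eq[of "gen ''x1'' @ gen ''y'' @ gen ''x1''" "wpow (gen ''y'') 5"] g RR by (simp add: cl A_def C_def)
  then have rel2: "cj P C A = A [^]\<^bsub>P\<^esub> (5::nat)"
    using c C P.cj_involution_iff by simp
  have "inv\<^bsub>P\<^esub> C \<otimes>\<^bsub>P\<^esub> (inv\<^bsub>P\<^esub> B \<otimes>\<^bsub>P\<^esub> (C \<otimes>\<^bsub>P\<^esub> B)) = \<one>\<^bsub>P\<^esub>"
    using eq[of "winv (gen ''x1'') @ winv (gen ''x2'') @ gen ''x1'' @ gen ''x2''" "[]"] g RR
    by (simp add: cl B_def C_def)
  then have rel3: "cj P C B = B"
    using c P.commutator_eq_one_iff by simp
  note rel = A B C rel1 rel2 rel3
  have "P \<cong> M"
    unfolding P_def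
  proof (rule presented_tri_iso[OF _ assms])
    fix u v and f :: "string \<Rightarrow> _" assume uv: "(u, v) \<in> R" and f: "f ''y'' = a" "f ''x2'' = s" "f ''x1'' = t"
    then have fX: "f \<in> X \<rightarrow> carrier M" using m by (auto simp: X_def)
    note w = word_eval_append[OF M.is_group fX] word_eval_winv[OF M.is_group fX]
      word_eval_wpow[OF M.is_group fX] word_eval_gen[OF M.is_group] word_eval_Nil
    have r: "s \<otimes>\<^bsub>M\<^esub> (a \<otimes>\<^bsub>M\<^esub> s) = a [^]\<^bsub>M\<^esub> (3::nat)" "t \<otimes>\<^bsub>M\<^esub> (a \<otimes>\<^bsub>M\<^esub> t) = a [^]\<^bsub>M\<^esub> (5::nat)"
      "inv\<^bsub>M\<^esub> t \<otimes>\<^bsub>M\<^esub> (inv\<^bsub>M\<^esub> s \<otimes>\<^bsub>M\<^esub> (t \<otimes>\<^bsub>M\<^esub> s)) = \<one>\<^bsub>M\<^esub>"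
      using m M.cj_involution_iff M.commutator_eq_one_iff by simp_all
    show "word_eval M f u = word_eval M f v"
      using uv r f m g unfolding R_def by (auto simp: w)
  qed (use rel in \<open>auto simp: X_def P_def A_def B_def C_def\<close>)
  then show ?thesis by (simp add: H\<^sub>2_def P_def X_def R_def Let_def)
qed

text \<open>The presentation conjugates by the inverse of \<open>b\<close>, \<open>mc\<close> by
  \<open>b\<close> itself. Modulo 9 the inverse of 4 is 7, since 4 * 7 = 28.\<close>

lemma cj_pow_7_iff:
  assumes N: "group N" "a \<in> carrier N" "b \<in> carrier N" "a [^]\<^bsub>N\<^esub> (9::nat) = \<one>\<^bsub>N\<^esub>"
  shows "cj N b a = a [^]\<^bsub>N\<^esub> (7::nat) \<longleftrightarrow> inv\<^bsub>N\<^esub> b \<otimes>\<^bsub>N\<^esub> (a \<otimes>\<^bsub>N\<^esub> b) = a [^]\<^bsub>N\<^esub> (4::nat)"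
proof -
  interpret N: group N by fact
  have c: "inv\<^bsub>N\<^esub> b \<otimes>\<^bsub>N\<^esub> (a \<otimes>\<^bsub>N\<^esub> b) = cj N (inv\<^bsub>N\<^esub> b) a"
    using N by (simp add: cj_def N.m_assoc)
  have 28: "a [^]\<^bsub>N\<^esub> (28::nat) = a" using N.pow_mod[OF N(2,4), of 28] N(2) by simp
  show ?thesis
  proof
    assume h: "cj N b a = a [^]\<^bsub>N\<^esub> (7::nat)"
    have "cj N b (a [^]\<^bsub>N\<^esub> (4::nat)) = a"
      using N h 28 by (simp add: N.cj_pow N.nat_pow_pow)
    then show "inv\<^bsub>N\<^esub> b \<otimes>\<^bsub>N\<^esub> (a \<otimes>\<^bsub>N\<^esub> b) = a [^]\<^bsub>N\<^esub> (4::nat)"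
      using N c by (metis N.cj_inv_cj N.nat_pow_closed)
  next
    assume h: "inv\<^bsub>N\<^esub> b \<otimes>\<^bsub>N\<^esub> (a \<otimes>\<^bsub>N\<^esub> b) = a [^]\<^bsub>N\<^esub> (4::nat)"
    have "cj N (inv\<^bsub>N\<^esub> b) (a [^]\<^bsub>N\<^esub> (7::nat)) = a"
      using N h c 28 by (simp add: N.cj_pow N.nat_pow_pow)
    then show "cj N b a = a [^]\<^bsub>N\<^esub> (7::nat)"
      using N by (metis N.cj_cj_inv N.nat_pow_closed)
  qed
qed

lemma H\<^sub>3_iso:
  assumes "mc M a b 9 7 3 0"
  shows "H\<^sub>3 \<cong> M"
proof -
  define X :: "string set" where "X = {''a'', ''b''}"
  define R :: "(string word \<times> string word) set" where "R = {(wpow (gen ''a'') 9, []), (wpow (gen ''b'') 3, []), (winv (gen ''b'') @ gen ''a'' @ gen ''b'', wpow (gen ''a'') 4)}"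
  define P where "P = presented_group X R"
  interpret P: group P unfolding P_def by (rule group_presented_group)
  interpret M: group M using assms by (simp add: mc_def)
  have m: "a \<in> carrier M" "b \<in> carrier M" "a [^]\<^bsub>M\<^esub> (9::nat) = \<one>\<^bsub>M\<^esub>" "b [^]\<^bsub>M\<^esub> (3::nat) = \<one>\<^bsub>M\<^esub>"
    "cj M b a = a [^]\<^bsub>M\<^esub> (7::nat)"
    using assms by (simp_all add: mc_def)
  have RR: "(wpow (gen ''a'') 9, []) \<in> R" "(wpow (gen ''b'') 3, []) \<in> R" "(winv (gen ''b'') @ gen ''a'' @ gen ''b'', wpow (gen ''a'') 4) \<in> R" by (simp_all add: R_def)
  define A where "A = cls X R (gen ''a'')"
  define B where "B = cls X R (gen ''b'')"
  have g: "gen ''a'' \<in> words X" "gen ''b'' \<in> words X" by (simp_all add: X_def)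
  have c: "A \<in> carrier P" "B \<in> carrier P"
    using cls_carrier[of _ X R] g by (simp_all add: P_def A_def B_def)
  note cl = cls_append[of _ X _ R, folded P_def] cls_wpow[of _ X R, folded P_def] cls_winv[of _ X R, folded P_def] cls_Nil[of X R, folded P_def]
  note eq = cls_eqI[of _ _ R X]
  have A: "A [^]\<^bsub>P\<^esub> (9::nat) = \<one>\<^bsub>P\<^esub>"
    using eq[of "wpow (gen ''a'') 9" "[]"] g RR by (simp add: cl A_def)
  have B: "B [^]\<^bsub>P\<^esub> (3::nat) = \<one>\<^bsub>P\<^esub>"
    using eq[of "wpow (gen ''b'') 3" "[]"] g RR by (simp add: cl B_def)
  have "inv\<^bsub>P\<^esub> B \<otimes>\<^bsub>P\<^esub> (A \<otimes>\<^bsub>P\<^esub> B) = A [^]\<^bsub>P\<^esub> (4::nat)"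
    using eq[of "winv (gen ''b'') @ gen ''a'' @ gen ''b''" "wpow (gen ''a'') 4"] g RR by (simp add: cl A_def B_def)
  then have rel1: "cj P B A = A [^]\<^bsub>P\<^esub> (7::nat)"
    using cj_pow_7_iff[OF P.is_group c A] by simp
  note rel = A B rel1
  have "P \<cong> M"
    unfolding P_def
  proof (rule presented_mc_iso[OF _ assms])
    fix u v and f :: "string \<Rightarrow> _" assume uv: "(u, v) \<in> R" and f: "f ''a'' = a" "f ''b'' = b"
    then have fX: "f \<in> X \<rightarrow> carrier M" using m by (auto simp: X_def)
    note w = word_eval_append[OF M.is_group fX] word_eval_winv[OF M.is_group fX]
      word_eval_wpow[OF M.is_group fX] word_eval_gen[OF M.is_group] word_eval_Nil
    have r: "inv\<^bsub>M\<^esub> b \<otimes>\<^bsub>M\<^esub> (a \<otimes>\<^bsub>M\<^esub> b) = a [^]\<^bsub>M\<^esub> (4::nat)"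
      using m cj_pow_7_iff[OF M.is_group m(1,2,3)] by simp
    show "word_eval M f u = word_eval M f v"
      using uv r f m g unfolding R_def by (auto simp: w)
  qed (use rel in \<open>auto simp: X_def P_def A_def B_def\<close>)
  then show ?thesis by (simp add: H\<^sub>3_def P_def X_def R_def Let_def)
qed

subsection \<open>Groups of small order\<close>

context group
begin

abbreviation powers :: "'a \<Rightarrow> 'a set"
  where "powers a \<equiv> range (\<lambda>i::nat. a [^] i)"

lemma powers_eq:
  assumes "a \<in> carrier G" "a [^] n = \<one>" "n > (0::nat)"
  shows "powers a = (\<lambda>i. a [^] i) ` {..<n}"
  using pow_in_powers[OF assms] by auto

lemma self_in_powers: "a \<in> carrier G \<Longrightarrow> a \<in> powers a"
  by (intro image_eqI[where x = 1]) auto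

lemma finite_ord_pos: "finite (carrier G) \<Longrightarrow> a \<in> carrier G \<Longrightarrow> ord a > 0"
  using ord_ge_1[of a] by simp

lemma subgroup_powers:
  assumes "finite (carrier G)" "a \<in> carrier G"
  shows "subgroup (powers a) G"
  using powers_subgroup[of a "ord a"] powers_eq[of a "ord a"] finite_ord_pos assms by simp

lemma pow_eq_iff_mod:
  assumes "finite (carrier G)" "a \<in> carrier G"
  shows "a [^] i = a [^] (j::nat) \<longleftrightarrow> i mod ord a = j mod ord a"
proof
  assume "a [^] i = a [^] j"
  then have "a [^] (i mod ord a) = a [^] (j mod ord a)"
    using assms by (simp add: pow_mod)
  moreover have "r mod ord a \<in> {0..ord a - 1}" for r
    using mod_less_divisor[OF finite_ord_pos[OF assms], of r] by simp
  ultimately show "i mod ord a = j mod ord a"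
    using inj_onD[OF ord_inj[OF assms(2)], of "i mod ord a" "j mod ord a"] by blast
next
  assume "i mod ord a = j mod ord a"
  moreover have "a [^] r = a [^] (r mod ord a)" for r
    using assms by (simp add: pow_mod)
  ultimately show "a [^] i = a [^] j" by metis
qed

lemma card_powers:
  assumes "finite (carrier G)" "a \<in> carrier G"
  shows "card (powers a) = ord a"
proof -
  have "powers a = (\<lambda>i. a [^] i) ` {..<ord a}"
    using powers_eq[of a "ord a"] finite_ord_pos assms by simp
  moreover have "inj_on (\<lambda>i. a [^] i) {..<ord a}"
    using pow_eq_iff_mod[OF assms] by (auto simp: inj_on_def)
  ultimately show ?thesis by (simp add: card_image)
qed

lemma powers_commute: "a \<in> carrier G \<Longrightarrow> x \<in> powers a \<Longrightarrow> y \<in> powers a \<Longrightarrow> x \<otimes> y = y \<otimes> x"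
  by (auto simp: nat_pow_mult add.commute)

lemma powers_subset_subgroup: "subgroup H G \<Longrightarrow> a \<in> H \<Longrightarrow> powers a \<subseteq> H"
  using subgroup_imp_group[of H] group.is_monoid monoid.nat_pow_closed[of "G\<lparr>carrier := H\<rparr>" a]
  by (auto simp: pow_sub)

lemma subgroup_pow_closed: "subgroup H G \<Longrightarrow> a \<in> H \<Longrightarrow> a [^] (i::nat) \<in> H"
  using powers_subset_subgroup by blast

lemma ord_dvd_card:
  assumes "finite (carrier G)" "subgroup H G" "x \<in> H"
  shows "ord x dvd card H"
proof -
  have x: "x \<in> carrier G" using assms(2,3) by (rule subgroup.mem_carrier)
  show ?thesis
    using card_dvd_subgroup[OF subgroup_powers[OF assms(1) x] assms(2) powers_subset_subgroup[OF assms(2,3)]]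
    by (simp add: card_powers[OF assms(1) x])
qed

text \<open>Cauchy's theorem, read off from a subgroup of order \<open>p\<close>.\<close>

lemma exists_ord_prime:
  assumes "finite (carrier G)" "prime p" "p dvd order G"
  obtains x where "x \<in> carrier G" "ord x = p"
proof -
  obtain m where "order G = p ^ 1 * m" using assms(3) by auto
  then obtain H where H: "subgroup H G" "card H = p"
    using sylow_thm[OF assms(2) is_group _ assms(1), of 1 m] by auto
  have "\<exists>x\<in>H. x \<noteq> \<one>"
  proof (rule ccontr)
    assume "\<not> ?thesis"
    then have "H \<subseteq> {\<one>}" by auto
    then have "card H \<le> 1" using card_mono[of "{\<one>}" H] by simp
    then show False using H(2) prime_gt_1_nat[OF assms(2)] by simp
  qed
  then obtain x where x: "x \<in> H" "x \<noteq> \<one>" by blast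
  have xc: "x \<in> carrier G" using x H by (simp add: subgroup.mem_carrier)
  have "ord x dvd p" using ord_dvd_card[OF assms(1) H(1) x(1)] H(2) by simp
  moreover have "ord x \<noteq> 1" using x xc ord_eq_1 by simp
  ultimately have "ord x = p" using assms(2) by (metis prime_nat_iff)
  then show thesis using that xc by blast
qed

text \<open>\<open>H\<close> and the coset of \<open>t\<close> are disjoint and have together as
  many elements as \<open>G\<close>, so an element outside \<open>H\<close> lies in that
  coset.\<close>

lemma index_2_cover:
  assumes "finite (carrier G)" "subgroup H G" "order G = 2 * card H" "t \<in> carrier G" "t \<notin> H" "x \<in> carrier G" "x \<notin> H"
  shows "x \<otimes> inv t \<in> H"
proof -
  have dis: "H \<inter> (H #> t) = {}"
  proof (rule ccontr)
    assume "H \<inter> (H #> t) \<noteq> {}"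
    then obtain h where h: "h \<in> H" "h \<otimes> t \<in> H" by (auto simp: r_coset_def)
    then have "inv h \<otimes> (h \<otimes> t) \<in> H" using assms(2) by (simp add: subgroup.m_closed subgroup.m_inv_closed)
    moreover have "inv h \<otimes> (h \<otimes> t) = t"
      using assms(2,4) h subgroup.mem_carrier[OF assms(2)] by (simp add: m_assoc[symmetric])
    ultimately show False using assms(5) by simp
  qed
  have sub: "H \<subseteq> carrier G" "H #> t \<subseteq> carrier G"
    using assms(2,4) by (auto simp: subgroup.subset r_coset_subset_G)
  have "card (H #> t) = card H"
    using card_rcosets_equal[OF rcosetsI[OF sub(1) assms(4)] sub(1)] by simp
  then have "card (H \<union> (H #> t)) = order G"
    using dis sub assms(1,3) finite_subset by (subst card_Un_disjoint) auto
  then have "H \<union> (H #> t) = carrier G"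
    using sub assms(1) unfolding order_def by (intro card_subset_eq) auto
  then obtain h where "h \<in> H" "x = h \<otimes> t" using assms(6,7) by (auto simp: r_coset_def)
  then show ?thesis
    using assms(4) subgroup.mem_carrier[OF assms(2)] by (simp add: m_assoc)
qed

lemma index_2_normal:
  assumes "finite (carrier G)" "subgroup H G" "order G = 2 * card H" "t \<in> carrier G" "h \<in> H"
  shows "cj G t h \<in> H"
proof (cases "t \<in> H")
  case True
  then show ?thesis using assms by (simp add: cj_def subgroup.m_closed subgroup.m_inv_closed)
next
  case False
  have h: "h \<in> carrier G" using assms subgroup.mem_carrier by metis
  have "t \<otimes> h \<notin> H"
  proof
    assume "t \<otimes> h \<in> H"
    then have "(t \<otimes> h) \<otimes> inv h \<in> H" using assms by (simp add: subgroup.m_closed subgroup.m_inv_closed)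
    then show False using False h assms(4) by (simp add: m_assoc)
  qed
  then show ?thesis
    using index_2_cover[OF assms(1-4) False, of "t \<otimes> h"] h assms(4) by (simp add: cj_def)
qed

text \<open>The step behind all classifications of small groups below: a cyclic subgroup of prime
  index together with an outside element normalizing it determines the group up to the two numbers
  \<open>k\<close> and \<open>l\<close>.\<close>

lemma mc_of_prime_index:
  assumes fin: "finite (carrier G)" and a: "a \<in> carrier G" and b: "b \<in> carrier G"
    and q: "prime q" "order G = ord a * q" "b \<notin> powers a" "cj G b a \<in> powers a"
  shows "\<exists>k l. k < ord a \<and> l < ord a \<and> mc G a b (ord a) k q l"
proof -
  define n where "n = ord a"
  have n: "n > 0" "a [^] n = \<one>" using finite_ord_pos[OF fin a] a by (simp_all add: n_def)
  have H: "subgroup (powers a) G" using subgroup_powers[OF fin a] .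
  have red: "\<exists>i<n. x = a [^] i" if "x \<in> powers a" for x
    using that powers_eq[OF a n(2,1)] by auto
  obtain k where k: "k < n" "cj G b a = a [^] k" using red[OF q(4)] by auto
  \<comment> \<open>\<open>d\<close> is the order of \<open>b\<close> modulo the powers of
    \<open>a\<close>; the products with exponents below \<open>ord a\<close> and \<open>d\<close>
    form a subgroup of order \<open>n * d\<close>.\<close>
  define d :: nat where "d = (LEAST d. d > 0 \<and> b [^] d \<in> powers a)"
  have "ord b > 0 \<and> b [^] ord b \<in> powers a"
    using finite_ord_pos[OF fin b] b subgroup.one_closed[OF H] by simp
  then have "d > 0 \<and> b [^] d \<in> powers a"
    unfolding d_def by (rule LeastI[where P = "\<lambda>d. d > 0 \<and> b [^] d \<in> powers a"])
  then have d: "d > 0" "b [^] d \<in> powers a" by auto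
  have dmin: "b [^] j \<notin> powers a" if "0 < j" "j < d" for j
    using that not_less_Least[of j "\<lambda>d. d > 0 \<and> b [^] d \<in> powers a"] unfolding d_def by auto
  obtain l where l: "l < n" "b [^] d = a [^] l" using red[OF d(2)] by auto
  let ?S = "(\<lambda>(i, j). a [^] i \<otimes> b [^] j) ` ({..<n} \<times> {..<d})"
  have inS: "a [^] i \<otimes> b [^] j \<in> ?S" for i j :: nat
  proof -
    have "b [^] j = b [^] (d * (j div d) + j mod d)" by simp
    also have "\<dots> = (b [^] d) [^] (j div d) \<otimes> b [^] (j mod d)"
      using b by (simp add: nat_pow_mult nat_pow_pow)
    finally have "a [^] i \<otimes> b [^] j = a [^] (i + l * (j div d)) \<otimes> b [^] (j mod d)"
      using a b l(2) by (simp add: nat_pow_pow nat_pow_mult m_assoc[symmetric])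
    also have "\<dots> = a [^] ((i + l * (j div d)) mod n) \<otimes> b [^] (j mod d)"
      using pow_mod[OF a n(2)] by simp
    finally show ?thesis using n d by (intro image_eqI[where x = "((i + l * (j div d)) mod n, j mod d)"]) auto
  qed
  have cjb: "cj G (b [^] j) (a [^] i) = a [^] (k ^ j * i)" for i j :: nat
  proof (induction j arbitrary: i)
    case (Suc j)
    have "cj G (b [^] Suc j) (a [^] i) = cj G (b [^] j) (cj G b (a [^] i))"
      using a b by (simp add: cj_cj)
    also have "cj G b (a [^] i) = a [^] (k * i)" using a b k by (simp add: cj_pow nat_pow_pow)
    finally show ?case using Suc.IH[of "k * i"] by (simp add: ac_simps)
  qed (use a in simp)
  have S: "subgroup ?S G"
  proof (rule finite_subgroupI)
    show "\<one> \<in> ?S" using inS[of 0 0] by simp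
    fix u v assume "u \<in> ?S" "v \<in> ?S"
    then obtain i j i' j' where uv: "u = a [^] (i::nat) \<otimes> b [^] (j::nat)" "v = a [^] (i'::nat) \<otimes> b [^] (j'::nat)"
      by auto
    have "u \<otimes> v = (a [^] i \<otimes> cj G (b [^] j) (a [^] i')) \<otimes> b [^] (j + j')"
      using a b unfolding uv cj_def nat_pow_mult[OF b, symmetric] by (simp add: m_assoc inv_solve_left)
    also have "\<dots> = a [^] (i + k ^ j * i') \<otimes> b [^] (j + j')"
      using a by (simp add: cjb nat_pow_mult)
    finally show "u \<otimes> v \<in> ?S" using inS by metis
  qed (use a b in auto)
  have uniq: "j = j'" if "a [^] i \<otimes> b [^] j = a [^] i' \<otimes> b [^] j'" "j \<le> j'" "j' < d" for i j i' j' :: nat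
  proof (rule ccontr)
    assume "j \<noteq> j'"
    have "a [^] i \<otimes> b [^] j = a [^] i' \<otimes> b [^] (j' - j) \<otimes> b [^] j"
      using that a b by (simp add: m_assoc nat_pow_mult)
    then have "a [^] i = a [^] i' \<otimes> b [^] (j' - j)"
      using a b by simp
    then have "b [^] (j' - j) = inv (a [^] i') \<otimes> a [^] i"
      using a b by (simp add: inv_solve_left)
    also have "\<dots> \<in> powers a" using H by (simp add: subgroup.m_closed subgroup.m_inv_closed)
    finally show False using dmin[of "j' - j"] that \<open>j \<noteq> j'\<close> by simp
  qed
  have inj: "inj_on (\<lambda>(i, j). a [^] i \<otimes> b [^] j) ({..<n} \<times> {..<d})"
  proof (rule inj_onI, clarify)
    fix i j i' j' assume h: "i < n" "j < d" "i' < n" "j' < d" "a [^] i \<otimes> b [^] j = a [^] i' \<otimes> b [^] j'"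
    have j: "j = j'"
      using uniq[of i j i' j'] uniq[of i' j' i j] h by (metis nat_le_linear)
    then have "a [^] i = a [^] i'" using h a b by simp
    then show "i = i' \<and> j = j'" using j h pow_eq_iff_mod[OF fin a] by (simp add: n_def)
  qed
  have cardS: "card ?S = n * d" using card_image[OF inj] by (simp add: card_cartesian_product)
  \<comment> \<open>Lagrange gives that \<open>d\<close> divides the prime \<open>q\<close>, and
    \<open>d\<close> is not 1 because \<open>b\<close> is outside the powers of
    \<open>a\<close>.\<close>
  then have "n * d dvd n * q" using card_dvd_order[OF S] q(2) by (simp add: n_def)
  then have "d dvd q" using n by simp
  moreover have "d \<noteq> 1" using d(2) q(3) b by auto
  ultimately have dq: "d = q" using q(1) by (metis prime_nat_iff)
  have "?S = carrier G"
    using fin subgroup.subset[OF S] cardS dq q(2) by (intro card_subset_eq) (auto simp: order_def n_def)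
  then have car: "carrier G \<subseteq> {a [^] i \<otimes> b [^] j |i j. i < n \<and> j < q}"
  proof -
    have "x \<in> {a [^] i \<otimes> b [^] j |i j. i < n \<and> j < q}" if "x \<in> ?S" for x
      using that dq by auto
    then show ?thesis using \<open>?S = carrier G\<close> by blast
  qed
  have "mc G a b n k q l"
    unfolding mc_def using a b n k l d q(2) car dq by (simp add: n_def)
  then show ?thesis using k l by (auto simp: n_def)
qed

text \<open>Cyclic groups are the degenerate case \<open>m = 1\<close>, \<open>b = \<one>\<close> of
  the normal form.\<close>

lemma mc_cyclic:
  assumes "finite (carrier G)" "a \<in> carrier G" "ord a = order G"
  shows "mc G a \<one> (order G) 1 1 0"
proof -
  have pos: "order G > 0" using assms(1) order_gt_0_iff_finite by simp
  have "powers a = carrier G"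
    using assms card_powers[OF assms(1,2)] by (intro card_subset_eq) (auto simp: order_def)
  then have "carrier G \<subseteq> (\<lambda>i. a [^] i) ` {..<order G}"
    using powers_eq[of a "order G"] assms pos pow_ord_eq_1[of a] by simp
  then show ?thesis
    using assms pos pow_ord_eq_1[of a] unfolding mc_def by fastforce
qed

end

lemma mc_pow_eq_iff:
  assumes "mc K a b n k m l"
  shows "a [^]\<^bsub>K\<^esub> i = a [^]\<^bsub>K\<^esub> j \<longleftrightarrow> i mod n = j mod (n::nat)"
proof -
  interpret group K using assms by (simp add: mc_def)
  have a: "a \<in> carrier K" "b \<in> carrier K" "a [^]\<^bsub>K\<^esub> n = \<one>\<^bsub>K\<^esub>" "n > 0" "m > 0" using assms by (simp_all add: mc_def)
  have "i mod n = j mod n" if "a [^]\<^bsub>K\<^esub> (i mod n) = a [^]\<^bsub>K\<^esub> (j mod n)"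
  proof -
    have "(i mod n, 0::nat) = (j mod n, 0)"
      by (rule inj_onD[OF mc_inj[OF assms]]) (use a that in auto)
    then show ?thesis by simp
  qed
  then show ?thesis using pow_mod[OF a(1,3)] by metis
qed

text \<open>\<open>b [^] m\<close> is a power of \<open>a\<close> and so commutes with
  \<open>a\<close>, while conjugation by it raises \<open>a\<close> to the power
  \<open>k ^ m\<close>. This congruence leaves only a few \<open>k\<close> in each
  classification.\<close>

lemma mc_exponent:
  assumes "mc K a b n k m l"
  shows "k ^ m mod n = 1 mod n"
proof -
  interpret group K using assms by (simp add: mc_def)
  have a: "a \<in> carrier K" "b \<in> carrier K" "cj K b a = a [^]\<^bsub>K\<^esub> k" "b [^]\<^bsub>K\<^esub> m = a [^]\<^bsub>K\<^esub> l" using assms by (simp_all add: mc_def)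
  have "cj K (b [^]\<^bsub>K\<^esub> j) a = a [^]\<^bsub>K\<^esub> (k ^ j)" for j :: nat
  proof (induction j)
    case (Suc j)
    have "cj K (b [^]\<^bsub>K\<^esub> Suc j) a = cj K (b [^]\<^bsub>K\<^esub> j) a [^]\<^bsub>K\<^esub> k"
      using a by (simp add: cj_cj cj_pow)
    then show ?case using a Suc by (simp add: nat_pow_pow mult.commute)
  qed (use a in simp)
  then have "a [^]\<^bsub>K\<^esub> (k ^ m) = cj K (a [^]\<^bsub>K\<^esub> l) a" using a by metis
  also have "\<dots> = a" using a by (simp add: cj_eq_iff nat_pow_comm[of a l 1, simplified])
  also have "\<dots> = a [^]\<^bsub>K\<^esub> (1::nat)" using a by simp
  finally show ?thesis using mc_pow_eq_iff[OF assms] by blast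
qed

context group
begin

lemma order_finite: "order G > 0 \<Longrightarrow> finite (carrier G)"
  using order_gt_0_iff_finite by simp

lemma ord_dvd: "a \<in> carrier G \<Longrightarrow> ord a dvd order G"
  by (rule ord_dvd_group_order)

lemma exists_not_in: "finite (carrier G) \<Longrightarrow> H \<subseteq> carrier G \<Longrightarrow> card H < order G \<Longrightarrow> \<exists>b\<in>carrier G. b \<notin> H"
  unfolding order_def by (metis card_mono finite_subset leD subsetI)

lemma group_prime_order:
  assumes "prime p" "order G = p"
  shows "\<exists>a. mc G a \<one> p 1 1 0"
proof -
  have fin: "finite (carrier G)" by (intro order_finite) (simp add: assms prime_gt_0_nat)
  obtain a where "a \<in> carrier G" "ord a = p"
    using exists_ord_prime[OF fin assms(1)] assms(2) by auto
  then show ?thesis using mc_cyclic[OF fin, of a] assms(2) by auto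
qed

text \<open>The index \<open>r\<close> of \<open>S\<close> in its normalizer divides
  \<open>m\<close> and is congruent to \<open>m\<close> modulo \<open>p\<close>. The last hypothesis
  says that arithmetic allows only \<open>r = m\<close>.\<close>

lemma nrm_eq_carrier:
  assumes "finite (carrier G)" "subgroup S G" "prime p" "card S = p ^ e" "order G = card S * m"
    "\<And>r. r dvd m \<Longrightarrow> m mod p = r mod p \<Longrightarrow> r = m"
  shows "nrm G S = carrier G"
proof -
  have N: "subgroup (nrm G S) G" using nrm_subgroup[OF assms(1,2)] .
  have pos: "card S > 0" using subgroup.finite_imp_card_positive[OF assms(2,1)] .
  obtain r where r: "card (nrm G S) = card S * r"
    using card_dvd_subgroup[OF assms(2) N subset_nrm[OF assms(2)]] by auto
  have "r dvd m" using card_dvd_order[OF N] r assms(5) pos by simp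
  moreover have "m mod p = r mod p"
    using index_mod_nrm[OF assms(1,3) subgroup_self assms(2) subgroup.subset[OF assms(2)] assms(4)]
      subgroup.subset[OF N] r assms(5) pos by (simp add: order_def[symmetric] Int_absorb2)
  ultimately have "r = m" by (rule assms(6))
  then show ?thesis
    using r assms(1,5) subgroup.subset[OF N] by (intro card_subset_eq) (auto simp: order_def)
qed

lemma cj_in_powers:
  assumes "finite (carrier G)" "a \<in> carrier G" "b \<in> carrier G" "prime p" "ord a = p ^ e" "order G = ord a * m"
    "\<And>r. r dvd m \<Longrightarrow> m mod p = r mod p \<Longrightarrow> r = m"
  shows "cj G b a \<in> powers a"
proof -
  have "nrm G (powers a) = carrier G"
    by (rule nrm_eq_carrier[OF assms(1) subgroup_powers[OF assms(1,2)] assms(4)])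
      (use assms card_powers[OF assms(1,2)] in auto)
  then have "\<forall>s\<in>powers a. cj G b s \<in> powers a" using assms(3) unfolding nrm_def by blast
  moreover have "a \<in> powers a" using assms(2) by (rule self_in_powers)
  ultimately show ?thesis by blast
qed

text \<open>Modulo an odd prime the square roots of 1 are 1 and \<open>p - 1\<close>; they give the
  cyclic and the dihedral group.\<close>

lemma group_order_2p:
  assumes "prime p" "odd p" "order G = 2 * p"
  shows "\<exists>a b k. (k = 1 \<or> k = p - 1) \<and> mc G a b p k 2 0"
proof -
  have p: "p > 2" using assms(1,2) prime_ge_2_nat[OF assms(1)] by (metis even_numeral le_neq_implies_less)
  have fin: "finite (carrier G)" using assms(3) p order_finite by simp
  obtain a where a: "a \<in> carrier G" "ord a = p"
    using exists_ord_prime[OF fin assms(1)] assms(3) by auto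
  obtain b where b: "b \<in> carrier G" "ord b = 2"
    using exists_ord_prime[OF fin two_is_prime_nat] assms(3) by auto
  have "b \<notin> powers a"
  proof
    assume "b \<in> powers a"
    then have "ord b dvd card (powers a)"
      by (rule ord_dvd_card[OF fin subgroup_powers[OF fin a(1)]])
    then show False using card_powers[OF fin] a b assms(2) by auto
  qed
  moreover have "cj G b a \<in> powers a"
    using index_2_normal[OF fin subgroup_powers[OF fin a(1)] _ b(1) self_in_powers[OF a(1)]] assms(3) card_powers[OF fin a(1)] a by simp
  ultimately obtain k l where kl: "k < p" "l < p" "mc G a b p k 2 l"
    using mc_of_prime_index[OF fin a(1) b(1) two_is_prime_nat] a(2) assms(3) by (auto simp: mult.commute)
  have "b [^] (2::nat) = \<one>" using b by (metis pow_ord_eq_1)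
  then have mc: "mc G a b p k 2 0" using kl(3) by (simp add: mc_def)
  have "k ^ 2 mod p = 1" using mc_exponent[OF mc] p by simp
  then have "k \<noteq> 0" by (metis mod_0 zero_neq_one zero_power2)
  have "p dvd k ^ 2 - 1" using dvd_minus_mod[of p "k ^ 2"] \<open>k ^ 2 mod p = 1\<close> by simp
  moreover have "k ^ 2 - 1 = (k - 1) * (k + 1)"
    using \<open>k \<noteq> 0\<close> by (cases k) (simp_all add: power2_eq_square)
  ultimately have "p dvd k - 1 \<or> p dvd k + 1"
    using assms(1) by (metis prime_dvd_mult_iff)
  then consider "p dvd k - 1" | "p dvd k + 1" by blast
  then have "k = 1 \<or> k = p - 1"
  proof cases
    case 1
    then show ?thesis using dvd_imp_le[of p "k - 1"] kl(1) \<open>k \<noteq> 0\<close> by linarith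
  next
    case 2
    then show ?thesis using dvd_imp_le[of p "k + 1"] kl(1) by linarith
  qed
  then show ?thesis using mc by blast
qed

lemma group_order_4:
  assumes "order G = 4"
  shows "(\<exists>a. mc G a \<one> 4 1 1 0) \<or> (\<exists>a b. mc G a b 2 1 2 0)"
proof (cases "\<exists>a\<in>carrier G. ord a = 4")
  case True
  then show ?thesis using mc_cyclic assms order_finite by (metis zero_less_numeral)
next
  case False
  have fin: "finite (carrier G)" using assms order_finite by simp
  obtain a where a: "a \<in> carrier G" "ord a = 2"
    using exists_ord_prime[OF fin two_is_prime_nat] assms by auto
  have "card (powers a) < order G" using card_powers[OF fin a(1)] a(2) assms by simp
  then obtain b where b: "b \<in> carrier G" "b \<notin> powers a"
    using exists_not_in[OF fin] subgroup.subset[OF subgroup_powers[OF fin a(1)]] by metis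
  have "cj G b a \<in> powers a"
    using index_2_normal[OF fin subgroup_powers[OF fin a(1)] _ b(1) self_in_powers[OF a(1)]] assms card_powers[OF fin a(1)] a by simp
  then obtain k l where kl: "k < 2" "mc G a b 2 k 2 l"
    using mc_of_prime_index[OF fin a(1) b(1) two_is_prime_nat] a b assms by auto
  have "k ^ 2 mod 2 = 1" using mc_exponent[OF kl(2)] by simp
  moreover have "k = 0 \<or> k = 1" using kl(1) by auto
  ultimately have k: "k = 1" by auto
  have "ord b dvd 2 ^ 2" using ord_dvd[OF b(1)] assms by simp
  then obtain i where "i \<le> 2" "ord b = 2 ^ i" using divides_primepow_nat[OF two_is_prime_nat] by blast
  then have "ord b dvd 2" using False b(1) by (auto simp: le_Suc_eq numeral_2_eq_2)
  then have "b [^] (2::nat) = \<one>" using b(1) pow_eq_id by simp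
  then have "mc G a b 2 1 2 0" using kl(2) k by (simp add: mc_def)
  then show ?thesis by blast
qed

lemma group_order_9:
  assumes "order G = 9"
  shows "(\<exists>a. mc G a \<one> 9 1 1 0) \<or> (\<exists>a b. mc G a b 3 1 3 0)"
proof (cases "\<exists>a\<in>carrier G. ord a = 9")
  case True
  then show ?thesis using mc_cyclic assms order_finite by (metis zero_less_numeral)
next
  case False
  have fin: "finite (carrier G)" using assms order_finite by simp
  have p3: "prime (3::nat)" by simp
  obtain a where a: "a \<in> carrier G" "ord a = 3"
    using exists_ord_prime[OF fin p3] assms by auto
  have "card (powers a) < order G" using card_powers[OF fin a(1)] a(2) assms by simp
  then obtain b where b: "b \<in> carrier G" "b \<notin> powers a"
    using exists_not_in[OF fin] subgroup.subset[OF subgroup_powers[OF fin a(1)]] by metis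
  have r3: "r = 3" if "r dvd 3" "3 mod 3 = r mod 3" for r :: nat
    using that dvd_imp_le[OF that(1)] by (auto simp: mod_eq_0_iff_dvd intro: dvd_antisym)
  have "cj G b a \<in> powers a"
    by (rule cj_in_powers[OF fin a(1) b(1) p3, where e = 1 and m = 3]) (use a assms r3 in auto)
  then obtain k l where kl: "k < 3" "mc G a b 3 k 3 l"
    using mc_of_prime_index[OF fin a(1) b(1) p3] a b assms by auto
  have "k ^ 3 mod 3 = 1" using mc_exponent[OF kl(2)] by simp
  moreover have "k = 0 \<or> k = 1 \<or> k = 2" using kl(1) by auto
  ultimately have k: "k = 1" by auto
  have "ord b dvd 3 ^ 2" using ord_dvd[OF b(1)] assms by simp
  then obtain i where "i \<le> 2" "ord b = 3 ^ i" using divides_primepow_nat[OF p3] by blast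
  then have "ord b dvd 3" using False b(1) by (auto simp: le_Suc_eq numeral_2_eq_2)
  then have "b [^] (3::nat) = \<one>" using b(1) pow_eq_id by simp
  then have "mc G a b 3 1 3 0" using kl(2) k by (simp add: mc_def)
  then show ?thesis by blast
qed

text \<open>The Sylow 5-subgroup is normal, as 1 and 3 differ modulo 5, and only
  \<open>k = 1\<close> has a cube congruent to 1 modulo 5. The group appears as a product of groups
  of orders 5 and 3 rather than with a generator of order 15.\<close>

lemma group_order_15:
  assumes "order G = 15"
  shows "\<exists>a b. mc G a b 5 1 3 0"
proof -
  have fin: "finite (carrier G)" using assms order_finite by simp
  have p: "prime (3::nat)" "prime (5::nat)" by simp_all
  obtain a where a: "a \<in> carrier G" "ord a = 5"
    using exists_ord_prime[OF fin p(2)] assms by auto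
  obtain b where b: "b \<in> carrier G" "ord b = 3"
    using exists_ord_prime[OF fin p(1)] assms by auto
  have "b \<notin> powers a"
  proof
    assume "b \<in> powers a"
    then have "ord b dvd card (powers a)"
      by (rule ord_dvd_card[OF fin subgroup_powers[OF fin a(1)]])
    then show False using card_powers[OF fin] a b by auto
  qed
  have r3: "r = 3" if "r dvd 3" "3 mod 5 = r mod 5" for r :: nat
    using that dvd_imp_le[OF that(1)] by auto
  have "cj G b a \<in> powers a"
    by (rule cj_in_powers[OF fin a(1) b(1) p(2), where e = 1 and m = 3]) (use a assms r3 in auto)
  then obtain k l where kl: "k < 5" "mc G a b 5 k 3 l"
    using mc_of_prime_index[OF fin a(1) b(1) p(1)] a assms \<open>b \<notin> powers a\<close> by auto
  have "k ^ 3 mod 5 = 1" using mc_exponent[OF kl(2)] by simp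
  moreover have "k = 0 \<or> k = 1 \<or> k = 2 \<or> k = 3 \<or> k = 4" using kl(1) by auto
  ultimately have k: "k = 1" by auto
  have "b [^] (3::nat) = \<one>" using b by (metis pow_ord_eq_1)
  then have "mc G a b 5 1 3 0" using kl(2) k by (simp add: mc_def)
  then show ?thesis by blast
qed

lemma cj_comm: "\<forall>x\<in>carrier G. x [^] (2::nat) = \<one> \<Longrightarrow> x \<in> carrier G \<Longrightarrow> y \<in> carrier G \<Longrightarrow> cj G x y = y"
proof -
  assume sq: "\<forall>x\<in>carrier G. x [^] (2::nat) = \<one>" and xy: "x \<in> carrier G" "y \<in> carrier G"
  have "inv (x \<otimes> y) = x \<otimes> y" "inv x = x" "inv y = y" using sq xy pow2_inv by simp_all
  then have "y \<otimes> x = x \<otimes> y" using xy by (simp add: inv_mult_group)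
  then show ?thesis using xy by (simp add: cj_eq_iff)
qed

text \<open>Exponent 2 forces commutativity, so any \<open>a\<close>, \<open>s\<close>,
  \<open>t\<close> chosen successively outside the subgroup reached so far form a basis.\<close>

lemma tri_elementary:
  assumes "order G = 8" "\<forall>x\<in>carrier G. x [^] (2::nat) = \<one>"
  shows "\<exists>a s t. tri G a s t 2 1 1"
proof -
  have fin: "finite (carrier G)" using assms order_finite by simp
  have "\<exists>a\<in>carrier G. a \<notin> {\<one>}" by (rule exists_not_in[OF fin]) (use assms in auto)
  then obtain a where a: "a \<in> carrier G" "a \<noteq> \<one>" by auto
  have "card {\<one>, a} \<le> 2" by (simp add: card_insert_if)
  then have "\<exists>s\<in>carrier G. s \<notin> {\<one>, a}" using a assms(1) by (intro exists_not_in[OF fin]) auto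
  then obtain s where s: "s \<in> carrier G" "s \<noteq> \<one>" "s \<noteq> a" by auto
  let ?H = "{\<one>, a, s, a \<otimes> s}"
  have comm: "x \<otimes> y = y \<otimes> x" if "x \<in> carrier G" "y \<in> carrier G" for x y
    using cj_comm[OF assms(2) that] that by (simp add: cj_eq_iff)
  have sq: "x \<otimes> x = \<one>" if "x \<in> carrier G" for x
    using assms(2) that by (simp add: numeral_2_eq_2)
  have sq': "x \<otimes> (x \<otimes> y) = y" if "x \<in> carrier G" "y \<in> carrier G" for x y
    using sq that by (simp add: m_assoc[symmetric])
  have H: "subgroup ?H G"
  proof (rule finite_subgroupI)
    fix x y assume "x \<in> ?H" "y \<in> ?H"
    moreover have "s \<otimes> a = a \<otimes> s" using comm a s by simp
    moreover have "s \<otimes> (a \<otimes> s) = a" using comm[of a s] sq' a s by simp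
    ultimately show "x \<otimes> y \<in> ?H"
      using a s sq sq' by (auto simp: m_assoc)
  qed (use a s in auto)
  have "a \<otimes> s \<noteq> \<one>" using sq a s by (metis l_cancel_one' r_one sq' one_closed)
  moreover have "a \<otimes> s \<noteq> a" "a \<otimes> s \<noteq> s" using a s by simp_all
  ultimately have cardH: "card ?H = 4" using a s by auto
  have "\<exists>t\<in>carrier G. t \<notin> ?H" using a s cardH assms(1) by (intro exists_not_in[OF fin]) auto
  then obtain t where t: "t \<in> carrier G" "t \<notin> ?H" by blast
  have car: "carrier G \<subseteq> {a [^] i \<otimes> s [^] j \<otimes> t [^] l | i j l. i < (2::nat) \<and> j < (2::nat) \<and> l < (2::nat)}"
  proof
    fix x assume x: "x \<in> carrier G"
    define l :: nat where "l = (if x \<in> ?H then 0 else 1)"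
    have "x \<otimes> inv (t [^] l) \<in> ?H"
      using index_2_cover[OF fin H _ t x] cardH assms(1) t(1) x by (auto simp: l_def)
    moreover have "\<exists>i j. h = a [^] i \<otimes> s [^] j \<and> i < (2::nat) \<and> j < (2::nat)" if "h \<in> ?H" for h
    proof -
      have "\<exists>i\<in>{0,1::nat}. \<exists>j\<in>{0,1::nat}. h = a [^] i \<otimes> s [^] j" using that a s by auto
      then show ?thesis by force
    qed
    ultimately obtain i j where ij: "x \<otimes> inv (t [^] l) = a [^] i \<otimes> s [^] j" "i < (2::nat)" "j < (2::nat)" by blast
    then have "x \<otimes> inv (t [^] l) \<otimes> t [^] l = a [^] i \<otimes> s [^] j \<otimes> t [^] l" by simp
    then have "x = a [^] i \<otimes> s [^] j \<otimes> t [^] l" using x t by (simp add: m_assoc)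
    moreover have "l < 2" by (simp add: l_def)
    ultimately show "x \<in> {a [^] i \<otimes> s [^] j \<otimes> t [^] l | i j l. i < (2::nat) \<and> j < (2::nat) \<and> l < (2::nat)}"
      using ij by blast
  qed
  have "tri G a s t 2 1 1"
    unfolding tri_def using a s t assms cj_comm[OF assms(2)] car by simp
  then show ?thesis by blast
qed

text \<open>The outcomes are the cyclic group, the product of cyclic groups of orders 4 and 2, the
  dihedral group, the quaternion group and the elementary abelian group. An element \<open>a\<close>
  of order 4 has index two, which makes its powers normal.\<close>

lemma group_order_8:
  assumes "order G = 8"
  shows "(\<exists>a. mc G a \<one> 8 1 1 0) \<or> (\<exists>a b. mc G a b 4 1 2 0) \<or> (\<exists>a b. mc G a b 4 3 2 0) \<or>
    (\<exists>a b. mc G a b 4 3 2 2) \<or> (\<exists>a s t. tri G a s t 2 1 1)"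
proof (cases "\<exists>a\<in>carrier G. ord a = 8")
  case True
  then show ?thesis using mc_cyclic assms order_finite by (metis zero_less_numeral)
next
  case no8: False
  have fin: "finite (carrier G)" using assms order_finite by simp
  have ords: "ord x = 1 \<or> ord x = 2 \<or> ord x = 4" if "x \<in> carrier G" for x
  proof -
    have "ord x dvd 2 ^ 3" using ord_dvd[OF that] assms by simp
    then obtain i where "i \<le> 3" "ord x = 2 ^ i" using divides_primepow_nat[OF two_is_prime_nat] by blast
    then show ?thesis using no8 that by (auto simp: le_Suc_eq numeral_3_eq_3)
  qed
  show ?thesis
  proof (cases "\<exists>a\<in>carrier G. ord a = 4")
    case False
    have "x [^] (2::nat) = \<one>" if "x \<in> carrier G" for x
      using ords[OF that] False that by (auto simp: pow_eq_id)
    then show ?thesis using tri_elementary[OF assms] by blast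
  next
    case True
    then obtain a where a: "a \<in> carrier G" "ord a = 4" by blast
    have "card (powers a) < order G" using card_powers[OF fin a(1)] a(2) assms by simp
    then obtain b where b: "b \<in> carrier G" "b \<notin> powers a"
      using exists_not_in[OF fin] subgroup.subset[OF subgroup_powers[OF fin a(1)]] by metis
    have aa: "a \<in> powers a" using a(1) by (rule self_in_powers)
    have data: "\<exists>k l. (k = 1 \<or> k = 3) \<and> (l = 0 \<or> l = 2) \<and> mc G a b 4 k 2 l"
      if b: "b \<in> carrier G" "b \<notin> powers a" for b
    proof -
      have "cj G b a \<in> powers a"
        using index_2_normal[OF fin subgroup_powers[OF fin a(1)] _ b(1) aa] assms card_powers[OF fin a(1)] a by simp
      then obtain k l where kl: "k < 4" "l < 4" "mc G a b 4 k 2 l"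
        using mc_of_prime_index[OF fin a(1) b(1) two_is_prime_nat] a b assms by auto
      have "k ^ 2 mod 4 = 1" using mc_exponent[OF kl(3)] by simp
      moreover have "k = 0 \<or> k = 1 \<or> k = 2 \<or> k = 3" using kl(1) by auto
      ultimately have k: "k = 1 \<or> k = 3" by auto
      \<comment> \<open>No element of order 8 remains, so the fourth power of \<open>b\<close> is
        trivial; as its square is \<open>a [^] l\<close>, the exponent \<open>l\<close> must be
        even.\<close>
      have "b [^] (4::nat) = \<one>" using ords[OF b(1)] b(1) by (auto simp: pow_eq_id)
      moreover have "b [^] (4::nat) = (b [^] (2::nat)) [^] (2::nat)" using b(1) by (simp add: nat_pow_pow)
      moreover have "b [^] (2::nat) = a [^] l" using kl(3) by (simp add: mc_def)
      ultimately have "a [^] (l * 2) = a [^] (0::nat)" using a(1) by (simp add: nat_pow_pow)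
      then have "l * 2 mod 4 = 0" using mc_pow_eq_iff[OF kl(3), of "l * 2" 0] by simp
      moreover have "l = 0 \<or> l = 1 \<or> l = 2 \<or> l = 3" using kl(2) by auto
      ultimately have "l = 0 \<or> l = 2" by auto
      then show ?thesis using k kl(3) by blast
    qed
    obtain k l where kl: "k = 1 \<or> k = 3" "l = 0 \<or> l = 2" "mc G a b 4 k 2 l" using data[OF b] by blast
    show ?thesis
    proof (cases "k = 1 \<and> l = 2")
      case False
      then show ?thesis using kl by blast
    next
      case True
      have ab: "cj G b a = a" "b [^] (2::nat) = a [^] (2::nat)" using kl(3) True a(1) by (simp_all add: mc_def)
      \<comment> \<open>In the commuting case with b^2 = a^2 the element \<open>b\<close> is
        replaced by a b, whose square is a^4 = 1. So this case is again the product of cyclic groups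
        of orders 4 and 2.\<close>
      define c where "c = a \<otimes> b"
      have c: "c \<in> carrier G" using a b by (simp add: c_def)
      have "c \<notin> powers a"
      proof
        assume "c \<in> powers a"
        then have "inv a \<otimes> c \<in> powers a"
          using aa subgroup_powers[OF fin a(1)] by (simp add: subgroup.m_closed subgroup.m_inv_closed)
        then show False using a b by (simp add: c_def m_assoc[symmetric])
      qed
      then obtain k' l' where kl': "l' = 0 \<or> l' = 2" "mc G a c 4 k' 2 l'" using data[OF c] by blast
      have "b \<otimes> a = a \<otimes> b" using ab(1) a b by (simp add: cj_eq_iff)
      then have "cj G c a = a" and "c [^] (2::nat) = a [^] (2::nat) \<otimes> b [^] (2::nat)"
        using a b by (simp_all add: c_def cj_eq_iff m_assoc pow_mult_distrib)
      moreover have "a [^] (2::nat) \<otimes> b [^] (2::nat) = a [^] (4::nat)" using a ab(2) by (simp add: nat_pow_mult)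
      moreover have "a [^] (4::nat) = \<one>" using a by (metis pow_ord_eq_1)
      ultimately have "mc G a c 4 1 2 0" using kl'(2) by (simp add: mc_def)
      then show ?thesis by blast
    qed
  qed
qed

end

subsection \<open>Affine groups over the integers modulo \<open>N\<close>\<close>

text \<open>The pair \<open>(u, v)\<close> stands for the map \<open>x \<mapsto> u x + v\<close>.\<close>

definition aff :: "int \<Rightarrow> int set \<Rightarrow> (int \<times> int) monoid"
  where "aff N U = \<lparr>carrier = U \<times> {0..<N},
    monoid.mult = (\<lambda>x y. (fst x * fst y mod N, (snd x + fst x * snd y) mod N)), one = (1, 0)\<rparr>"

lemma carrier_aff [simp]: "carrier (aff N U) = U \<times> {0..<N}"
  and mult_aff [simp]: "x \<otimes>\<^bsub>aff N U\<^esub> y = (fst x * fst y mod N, (snd x + fst x * snd y) mod N)"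
  and one_aff [simp]: "\<one>\<^bsub>aff N U\<^esub> = (1, 0)"
  by (simp_all add: aff_def)

lemma group_aff:
  assumes "N > 1" "1 \<in> U" "U \<subseteq> {0..<N}" "\<And>u v. u \<in> U \<Longrightarrow> v \<in> U \<Longrightarrow> u * v mod N \<in> U"
    "\<And>u. u \<in> U \<Longrightarrow> \<exists>v\<in>U. v * u mod N = 1"
  shows "group (aff N U)"
proof (rule groupI)
  fix x assume "x \<in> carrier (aff N U)"
  then obtain u v where x: "x = (u, v)" "u \<in> U" "0 \<le> v" "v < N" by auto
  then have u: "0 \<le> u" "u < N" using assms(3) by auto
  show "\<one>\<^bsub>aff N U\<^esub> \<otimes>\<^bsub>aff N U\<^esub> x = x" using x u by simp
  obtain w where w: "w \<in> U" "w * u mod N = 1" using assms(5) x(2) by blast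
  have "(- w * v mod N + w * v) mod N = 0" by (simp add: mod_simps)
  then show "\<exists>y\<in>carrier (aff N U). y \<otimes>\<^bsub>aff N U\<^esub> x = \<one>\<^bsub>aff N U\<^esub>"
    using w x assms(1) by (intro bexI[where x = "(w, - w * v mod N)"]) auto
  fix y assume "y \<in> carrier (aff N U)"
  then show "x \<otimes>\<^bsub>aff N U\<^esub> y \<in> carrier (aff N U)" using x assms(1,4) by auto
  fix z assume "z \<in> carrier (aff N U)"
  have mods: "(p mod N + q mod N * r) mod N = (p + q * r) mod N" "(p + q * (r mod N)) mod N = (p + q * r) mod N" for p q r :: int
    by (metis mod_add_left_eq mod_add_right_eq mod_mult_left_eq mod_mult_right_eq)+
  have "x \<otimes>\<^bsub>aff N U\<^esub> y \<otimes>\<^bsub>aff N U\<^esub> z = (fst x * fst y * fst z mod N, (snd x + fst x * snd y + fst x * fst y * snd z) mod N)"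
    by (simp add: mods mod_mult_left_eq)
  moreover have "x \<otimes>\<^bsub>aff N U\<^esub> (y \<otimes>\<^bsub>aff N U\<^esub> z) = (fst x * (fst y * fst z) mod N, (snd x + fst x * (snd y + fst y * snd z)) mod N)"
    by (simp add: mods mod_mult_right_eq)
  ultimately show "x \<otimes>\<^bsub>aff N U\<^esub> y \<otimes>\<^bsub>aff N U\<^esub> z = x \<otimes>\<^bsub>aff N U\<^esub> (y \<otimes>\<^bsub>aff N U\<^esub> z)"
    by (simp add: algebra_simps)
qed (use assms in auto)

lemma order_aff: "finite U \<Longrightarrow> order (aff N U) = card U * nat N"
  by (simp add: order_def card_cartesian_product)

lemma pow_aff_translation:
  assumes "N > 1"
  shows "(1, v) [^]\<^bsub>aff N U\<^esub> (i::nat) = (1, (int i * v) mod N)"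
proof (induction i)
  case (Suc i)
  then show ?case using assms by (simp add: mod_simps algebra_simps)
qed simp

lemma pow_aff_linear:
  assumes "N > 1"
  shows "(u, 0) [^]\<^bsub>aff N U\<^esub> (i::nat) = (u ^ i mod N, 0)"
proof (induction i)
  case (Suc i)
  then show ?case by (simp add: mod_simps algebra_simps)
qed (use assms in simp)

lemma cj_aff_iff:
  assumes "group (aff N U)" "x \<in> U \<times> {0..<N}" "y \<in> U \<times> {0..<N}" "z \<in> U \<times> {0..<N}"
  shows "cj (aff N U) x y = z \<longleftrightarrow> x \<otimes>\<^bsub>aff N U\<^esub> y = z \<otimes>\<^bsub>aff N U\<^esub> x"
  using group.cj_eq_iff[OF assms(1)] assms(2-4) by simp

lemma aff_decompose:
  assumes "N > 1" "(w, v) \<in> U \<times> {0..<N}" "U \<subseteq> {0..<N}"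
  shows "(1, 1) [^]\<^bsub>aff N U\<^esub> nat v \<otimes>\<^bsub>aff N U\<^esub> (w, 0) = (w, v)"
  using assms by (auto simp: pow_aff_translation simp del: pow_nat)

text \<open>\<open>a\<close> is the translation by 1 and \<open>b\<close> the multiplication by
  \<open>u\<close>; conjugation by \<open>b\<close> turns the translation by 1 into the one by
  \<open>u\<close>. \<open>U\<close> is the cyclic group generated by the unit
  \<open>u\<close>.\<close>

lemma mc_aff:
  assumes "group (aff (int n) U)" "n > 1" "u \<in> U" "U \<subseteq> {0..<int n}" "(1::int) \<in> U"
    "U = (\<lambda>j. u ^ j mod int n) ` {..<m}" "card U = m" "u ^ m mod int n = 1" "m > 0"
  shows "mc (aff (int n) U) (1, 1) (u, 0) n (nat u) m 0"
proof -
  have N: "int n > 1" using assms(2) by simp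
  have u: "0 \<le> u" "u < int n" using assms(3,4) by auto
  have "finite U" using assms(6) by simp
  then have ord: "order (aff (int n) U) = n * m" using assms(7) by (simp add: order_aff)
  have "cj (aff (int n) U) (u, 0) (1, 1) = (1, u)"
    using assms u by (subst cj_aff_iff) auto
  then have cj: "cj (aff (int n) U) (u, 0) (1, 1) = (1, 1) [^]\<^bsub>aff (int n) U\<^esub> nat u"
    using N u by (simp add: pow_aff_translation del: pow_nat)
  have car: "carrier (aff (int n) U) \<subseteq> {(1, 1) [^]\<^bsub>aff (int n) U\<^esub> i \<otimes>\<^bsub>aff (int n) U\<^esub> (u, 0) [^]\<^bsub>aff (int n) U\<^esub> j | i j. i < n \<and> j < m}"
  proof
    fix x assume "x \<in> carrier (aff (int n) U)"
    then obtain w v where x: "x = (w, v)" "(w, v) \<in> U \<times> {0..<int n}" by auto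
    then obtain j where j: "j < m" "w = u ^ j mod int n" using assms(6) by blast
    have "x = (1, 1) [^]\<^bsub>aff (int n) U\<^esub> nat v \<otimes>\<^bsub>aff (int n) U\<^esub> (u, 0) [^]\<^bsub>aff (int n) U\<^esub> j"
      using aff_decompose[OF N x(2) assms(4)] N x(1) j(2) by (simp only: pow_aff_linear)
    moreover have "nat v < n" using x(2) by auto
    ultimately show "x \<in> {(1, 1) [^]\<^bsub>aff (int n) U\<^esub> i \<otimes>\<^bsub>aff (int n) U\<^esub> (u, 0) [^]\<^bsub>aff (int n) U\<^esub> j | i j. i < n \<and> j < m}"
      using j(1) by blast
  qed
  show ?thesis
    unfolding mc_def using assms N ord cj car by (simp add: pow_aff_linear pow_aff_translation)
qed

lemma minus_one_squared_mod:
  assumes "n > 2"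
  shows "(int n - 1) * (int n - 1) mod int n = 1"
proof -
  have "(int n - 1) * (int n - 1) = 1 + int n * (int n - 2)" by (simp add: algebra_simps)
  then show ?thesis using assms by simp
qed

lemma group_aff_2:
  assumes "n > 2"
  shows "group (aff (int n) {1, int n - 1})"
proof (rule group_aff)
  have "(int n - 1) mod int n = int n - 1" using assms by (intro mod_pos_pos_trivial) auto
  then show "\<And>u v. u \<in> {1, int n - 1} \<Longrightarrow> v \<in> {1, int n - 1} \<Longrightarrow> u * v mod int n \<in> {1, int n - 1}"
    using minus_one_squared_mod[OF assms] assms by auto
  show "\<And>u. u \<in> {1, int n - 1} \<Longrightarrow> \<exists>v\<in>{1, int n - 1}. v * u mod int n = 1"
    using minus_one_squared_mod[OF assms] assms by auto
qed (use assms in auto)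

text \<open>These serve as models of \<open>H\<^sub>1\<close>, \<open>H\<^sub>2\<close> and
  \<open>H\<^sub>3\<close>; the last one is the ambient group in which the dicyclic group of order
  12 is found. There 5 is -1 modulo 3 and 1 modulo 4.\<close>

lemma group_aff_8_13: "group (aff 8 {1, 3})"
  and group_aff_8: "group (aff 8 {1, 3, 5, 7})"
  and group_aff_9: "group (aff 9 {1, 4, 7})"
  and group_aff_12: "group (aff 12 {1, 5})"
  by (rule group_aff; auto)+

lemma mc_aff_2:
  assumes "n > 2"
  shows "mc (aff (int n) {1, int n - 1}) (1, 1) (int n - 1, 0) n (n - 1) 2 0"
proof -
  have "(int n - 1) mod int n = int n - 1" using assms by (intro mod_pos_pos_trivial) auto
  then have U: "{1, int n - 1} = (\<lambda>j. (int n - 1) ^ j mod int n) ` {..<2}"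
    using assms by (auto simp: numeral_2_eq_2 lessThan_Suc)
  have "mc (aff (int n) {1, int n - 1}) (1, 1) (int n - 1, 0) n (nat (int n - 1)) 2 0"
  proof (rule mc_aff[OF _ _ _ _ _ U])
    show "(int n - 1) ^ 2 mod int n = 1"
      using minus_one_squared_mod[OF assms] by (simp add: power2_eq_square)
  qed (use assms in \<open>auto intro: group_aff_2\<close>)
  moreover have "nat (int n - 1) = n - 1" by simp
  ultimately show ?thesis by simp
qed

lemma mc_aff_8_13: "mc (aff 8 {1, 3}) (1, 1) (3, 0) 8 3 2 0"
proof -
  have "mc (aff (int 8) {1, 3}) (1, 1) (3, 0) 8 (nat 3) 2 0"
  proof (rule mc_aff)
    show "{1, 3} = (\<lambda>j. 3 ^ j mod int 8) ` {..<2}" by (auto simp: numeral_2_eq_2 lessThan_Suc)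
  qed (use group_aff_8_13 in auto)
  then show ?thesis by simp
qed

lemma mc_aff_9: "mc (aff 9 {1, 4, 7}) (1, 1) (7, 0) 9 7 3 0"
proof -
  have "mc (aff (int 9) {1, 4, 7}) (1, 1) (7, 0) 9 (nat 7) 3 0"
  proof (rule mc_aff)
    show "{1, 4, 7} = (\<lambda>j. 7 ^ j mod int 9) ` {..<3}" by (auto simp: numeral_3_eq_3 lessThan_Suc)
  qed (use group_aff_9 in auto)
  then show ?thesis by simp
qed

text \<open>The full affine group modulo 8 is the holomorph of the cyclic group of order 8; each of
  its four units is uniquely 3^j 5^l with exponents below 2.\<close>

lemma tri_aff_8: "tri (aff 8 {1, 3, 5, 7}) (1, 1) (3, 0) (5, 0) 8 3 5"
proof -
  let ?A = "aff 8 {1, 3, 5, 7}"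
  have "carrier ?A \<subseteq> {(1, 1) [^]\<^bsub>?A\<^esub> i \<otimes>\<^bsub>?A\<^esub> (3, 0) [^]\<^bsub>?A\<^esub> j \<otimes>\<^bsub>?A\<^esub> (5, 0) [^]\<^bsub>?A\<^esub> l | i j l. i < (8::nat) \<and> j < (2::nat) \<and> l < (2::nat)}"
  proof
    fix x assume "x \<in> carrier ?A"
    then obtain w v where x: "x = (w, v)" "(w, v) \<in> {1, 3, 5, 7} \<times> {0..<8::int}" by auto
    have "\<exists>j\<in>{0,1::nat}. \<exists>l\<in>{0,1::nat}. w = 3 ^ j * 5 ^ l mod 8" using x(2) by auto
    then obtain j l where jl0: "j \<in> {0,1::nat}" "l \<in> {0,1::nat}" and w: "w = 3 ^ j * 5 ^ l mod 8" by blast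
    have jl: "j < 2" "l < 2" using jl0 by auto
    have "x = (1, 1) [^]\<^bsub>?A\<^esub> nat v \<otimes>\<^bsub>?A\<^esub> (3, 0) [^]\<^bsub>?A\<^esub> j \<otimes>\<^bsub>?A\<^esub> (5, 0) [^]\<^bsub>?A\<^esub> l"
      using x w by (auto simp: pow_aff_translation pow_aff_linear mod_simps simp del: pow_nat)
    moreover have "nat v < 8" using x(2) by auto
    ultimately show "x \<in> {(1, 1) [^]\<^bsub>?A\<^esub> i \<otimes>\<^bsub>?A\<^esub> (3, 0) [^]\<^bsub>?A\<^esub> j \<otimes>\<^bsub>?A\<^esub> (5, 0) [^]\<^bsub>?A\<^esub> l | i j l. i < (8::nat) \<and> j < (2::nat) \<and> l < (2::nat)}"
      using jl by blast
  qed
  then show ?thesis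
    unfolding tri_def using group_aff_8
    by (auto simp: pow_aff_translation pow_aff_linear order_aff cj_aff_iff)
qed

section \<open>Direct products and cyclic groups\<close>

lemma pow_DirProd:
  "x [^]\<^bsub>G \<times>\<times> H\<^esub> (n::nat) = (fst x [^]\<^bsub>G\<^esub> n, snd x [^]\<^bsub>H\<^esub> n)"
  by (induction n) (simp_all add: mult_DirProd')

lemma cj_DirProd:
  assumes "group G" "group H" "x \<in> carrier G \<times> carrier H" "y \<in> carrier G \<times> carrier H"
  shows "cj (G \<times>\<times> H) x y = (cj G (fst x) (fst y), cj H (snd x) (snd y))"
  using assms by (auto simp: cj_def mult_DirProd')

lemma (in comm_group) cj_trivial: "x \<in> carrier G \<Longrightarrow> y \<in> carrier G \<Longrightarrow> cj G x y = y"
  by (simp add: cj_eq_iff m_comm)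

lemma order_DirProd: "order (G \<times>\<times> H) = order G * order H"
  by (simp add: order_def card_cartesian_product)

lemma order_integer_mod_group: "n > 0 \<Longrightarrow> order (integer_mod_group n) = n"
  by (simp add: order_def carrier_integer_mod_group)

lemma cj_integer_mod_group:
  "x \<in> carrier (integer_mod_group n) \<Longrightarrow> y \<in> carrier (integer_mod_group n) \<Longrightarrow> cj (integer_mod_group n) x y = y"
  by (rule comm_group.cj_trivial) simp_all

text \<open>The generator is written \<open>1 mod int n\<close> so that \<open>n = 1\<close>, where
  the only element is 0, is included.\<close>

lemma mc_integer_mod_group:
  assumes "n > 0"
  shows "mc (integer_mod_group n) (1 mod int n) 0 n 1 1 0"
proof -
  let ?Z = "integer_mod_group n"
  have "carrier ?Z \<subseteq> {(1 mod int n) [^]\<^bsub>?Z\<^esub> i \<otimes>\<^bsub>?Z\<^esub> 0 [^]\<^bsub>?Z\<^esub> j | i j. i < n \<and> j < (1::nat)}"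
  proof
    fix x assume "x \<in> carrier ?Z"
    then have x: "0 \<le> x" "x < int n" using assms by (auto simp: carrier_integer_mod_group)
    have "x = (1 mod int n) [^]\<^bsub>?Z\<^esub> nat x \<otimes>\<^bsub>?Z\<^esub> 0 [^]\<^bsub>?Z\<^esub> (0::nat)"
      using x by (simp add: mod_simps del: pow_nat)
    moreover have "nat x < n" using x by auto
    ultimately show "x \<in> {(1 mod int n) [^]\<^bsub>?Z\<^esub> i \<otimes>\<^bsub>?Z\<^esub> 0 [^]\<^bsub>?Z\<^esub> j | i j. i < n \<and> j < (1::nat)}" by blast
  qed
  then show ?thesis
    unfolding mc_def using assms by (auto simp: order_integer_mod_group carrier_integer_mod_group cj_integer_mod_group mod_simps)
qed

lemma mc_DirProd_cyclic:
  assumes "n > 1" "m > 1"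
  shows "mc (integer_mod_group m \<times>\<times> integer_mod_group n) (0, 1) (1, 0) n 1 m 0"
proof -
  let ?Z = "integer_mod_group m \<times>\<times> integer_mod_group n"
  have "carrier ?Z \<subseteq> {(0, 1) [^]\<^bsub>?Z\<^esub> i \<otimes>\<^bsub>?Z\<^esub> (1, 0) [^]\<^bsub>?Z\<^esub> j | i j. i < n \<and> j < m}"
  proof
    fix x assume "x \<in> carrier ?Z"
    then obtain u v where x: "x = (u, v)" "0 \<le> u" "u < int m" "0 \<le> v" "v < int n"
      using assms by (auto simp: carrier_integer_mod_group)
    have "x = (0, 1) [^]\<^bsub>?Z\<^esub> nat v \<otimes>\<^bsub>?Z\<^esub> (1, 0) [^]\<^bsub>?Z\<^esub> nat u"
      using x by (simp add: pow_DirProd del: pow_nat)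
    moreover have "nat v < n" "nat u < m" using x by auto
    ultimately show "x \<in> {(0, 1) [^]\<^bsub>?Z\<^esub> i \<otimes>\<^bsub>?Z\<^esub> (1, 0) [^]\<^bsub>?Z\<^esub> j | i j. i < n \<and> j < m}" by blast
  qed
  then show ?thesis
    unfolding mc_def using assms
    by (simp add: DirProd_group order_DirProd order_integer_mod_group pow_DirProd carrier_integer_mod_group cj_DirProd cj_integer_mod_group)
qed

text \<open>The cyclic factor of order 2 plays the role of \<open>t\<close> and acts trivially,
  hence the last exponent 1.\<close>

lemma tri_DirProd_aff_8: "tri (integer_mod_group 2 \<times>\<times> aff 8 {1, 3}) (0, 1, 1) (0, 3, 0) (1, 1, 0) 8 3 1"
proof -
  let ?Z = "integer_mod_group 2 \<times>\<times> aff 8 {1, 3}"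
  have "carrier ?Z \<subseteq> {(0, 1, 1) [^]\<^bsub>?Z\<^esub> i \<otimes>\<^bsub>?Z\<^esub> (0, 3, 0) [^]\<^bsub>?Z\<^esub> j \<otimes>\<^bsub>?Z\<^esub> (1, 1, 0) [^]\<^bsub>?Z\<^esub> l | i j l. i < (8::nat) \<and> j < (2::nat) \<and> l < (2::nat)}"
  proof
    fix x assume "x \<in> carrier ?Z"
    then obtain e w v where x: "x = (e, w, v)" "0 \<le> e" "e < 2" "(w, v) \<in> {1, 3} \<times> {0..<8::int}"
      by (auto simp: carrier_integer_mod_group)
    have "\<exists>j\<in>{0,1::nat}. w = 3 ^ j mod 8" using x(4) by auto
    then obtain j where j0: "j \<in> {0,1::nat}" "w = 3 ^ j mod 8" by blast
    have j: "j < 2" using j0 by auto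
    have "x = (0, 1, 1) [^]\<^bsub>?Z\<^esub> nat v \<otimes>\<^bsub>?Z\<^esub> (0, 3, 0) [^]\<^bsub>?Z\<^esub> j \<otimes>\<^bsub>?Z\<^esub> (1, 1, 0) [^]\<^bsub>?Z\<^esub> nat e"
      using x j0(2) by (auto simp: pow_DirProd pow_aff_translation pow_aff_linear mod_simps simp del: pow_nat)
    moreover have "nat v < 8" "nat e < 2" using x by auto
    ultimately show "x \<in> {(0, 1, 1) [^]\<^bsub>?Z\<^esub> i \<otimes>\<^bsub>?Z\<^esub> (0, 3, 0) [^]\<^bsub>?Z\<^esub> j \<otimes>\<^bsub>?Z\<^esub> (1, 1, 0) [^]\<^bsub>?Z\<^esub> l | i j l. i < (8::nat) \<and> j < (2::nat) \<and> l < (2::nat)}"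
      using j by blast
  qed
  then show ?thesis
    unfolding tri_def using group_aff_8_13
    by (simp add: DirProd_group order_DirProd order_integer_mod_group order_aff pow_DirProd carrier_integer_mod_group
      cj_DirProd cj_integer_mod_group pow_aff_translation pow_aff_linear cj_aff_iff)
qed


subsection \<open>Groups containing all groups of a given order\<close>

text \<open>They split \<open>i < n\<close> for a numeral \<open>n\<close> into finitely many cases,
  so that the kernel condition of \<open>mc_embeds\<close> and \<open>tri_embeds\<close> is checked
  by computation.\<close>

lemmas small_nat = numeral_eq_Suc less_Suc_eq

lemma all_embed_cyclic:
  assumes "\<And>K :: nat monoid. group K \<Longrightarrow> order K = n \<Longrightarrow> \<exists>a b. mc K a b n 1 1 0" "n > 0"
  shows "all_embed n (integer_mod_group n)"
  unfolding all_embed_def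
proof (intro allI impI, elim conjE)
  fix K :: "nat monoid" assume K: "group K" "order K = n"
  then obtain a b where mc: "mc K a b n 1 1 0" using assms(1) by blast
  have "K \<cong> integer_mod_group n" by (rule mc_iso[OF mc mc_integer_mod_group[OF assms(2)]])
  moreover have "embeds (integer_mod_group n) (integer_mod_group n)"
    by (rule embedsI[where \<phi> = id]) (simp_all add: hom_def)
  ultimately show "embeds K (integer_mod_group n)" by (rule embeds_iso_left)
qed

lemma all_embed_prime: "prime p \<Longrightarrow> all_embed p (integer_mod_group p)"
  using group.group_prime_order prime_gt_0_nat by (intro all_embed_cyclic) blast+

lemma all_embed_1: "all_embed 1 (integer_mod_group 1)"
proof (rule all_embed_cyclic)
  fix K :: "nat monoid" assume K: "group K" "order K = 1"
  then have "carrier K = {\<one>\<^bsub>K\<^esub>}" using group.order_one_triv_iff[of K] by blast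
  then have "mc K \<one>\<^bsub>K\<^esub> \<one>\<^bsub>K\<^esub> 1 1 1 0" using K
    by (simp add: mc_def group.cj_one monoid.nat_pow_one group.is_monoid)
  then show "\<exists>a b. mc K a b 1 1 1 0" by blast
qed simp

lemma all_embed_15: "all_embed 15 (integer_mod_group 15)"
  unfolding all_embed_def
proof (intro allI impI, elim conjE)
  fix K :: "nat monoid" assume "group K" "order K = 15"
  then obtain a b where mc: "mc K a b 5 1 3 0" using group.group_order_15 by blast
  \<comment> \<open>Modulo 15 the element 3 has order 5 and the element 5 has order 3.\<close>
  show "embeds K (integer_mod_group 15)"
    by (rule mc_embeds[OF mc, where x = 3 and y = 5])
      (auto simp: carrier_integer_mod_group cj_integer_mod_group small_nat)
qed

text \<open>The translation by 2 has order \<open>p\<close>. The central translation by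
  \<open>p\<close> completes it to the cyclic group of order 2p, the reflection to the dihedral
  group.\<close>

lemma all_embed_2p_aff:
  assumes "p \<in> {3, 5, 7}"
  shows "all_embed (2 * p) (aff (int (2 * p)) {1, int (2 * p) - 1})"
  unfolding all_embed_def
proof (intro allI impI, elim conjE)
  have p: "prime p" "odd p" "p > 2" using assms by auto
  let ?A = "aff (int (2 * p)) {1, int (2 * p) - 1}"
  have A: "group ?A" using group_aff_2[of "2 * p"] p by simp
  fix K :: "nat monoid" assume "group K" "order K = 2 * p"
  then obtain a b k where k: "k = 1 \<or> k = p - 1" "mc K a b p k 2 0" using group.group_order_2p p by blast
  have x: "(1, 2) \<in> carrier ?A" using p by simp
  show "embeds K ?A"
  proof (cases "k = 1")
    case True
    then have mc: "mc K a b p 1 2 0" using k by simp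
    show ?thesis
      by (rule mc_embeds[OF mc A x, where y = "(1, int p)"])
        (use assms A in \<open>auto simp: pow_aff_translation cj_aff_iff small_nat\<close>)
  next
    case False
    then have mc: "mc K a b p (p - 1) 2 0" using k by simp
    show ?thesis
      by (rule mc_embeds[OF mc A x, where y = "(int (2 * p) - 1, 0)"])
        (use assms A in \<open>auto simp: pow_aff_translation pow_aff_linear cj_aff_iff small_nat\<close>)
  qed
qed

text \<open>In the affine group the translation by 2 commutes with the multiplication by 3, because
  3 * 2 = 2 modulo 4; together they give the four-group.\<close>

lemma all_embed_4:
  "all_embed 4 (integer_mod_group 2 \<times>\<times> integer_mod_group 4)" (is ?A)
  "all_embed 4 (aff 4 {1, 3})" (is ?B)
proof -
  have B: "group (aff 4 {1, 3})" using group_aff_2[of 4] by simp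
  have "embeds K (integer_mod_group 2 \<times>\<times> integer_mod_group 4) \<and> embeds K (aff 4 {1, 3})"
    if "group K" "order K = 4" for K :: "nat monoid"
    using group.group_order_4[OF that]
  proof (elim disjE exE)
    fix a assume mc: "mc K a \<one>\<^bsub>K\<^esub> 4 1 1 0"
    have "embeds K (integer_mod_group 2 \<times>\<times> integer_mod_group 4)"
      by (rule mc_embeds[OF mc, where x = "(0, 1)" and y = "(0, 0)"])
        (auto simp: DirProd_group carrier_integer_mod_group cj_integer_mod_group pow_DirProd cj_DirProd small_nat)
    moreover have "embeds K (aff 4 {1, 3})"
      by (rule mc_embeds[OF mc B, where x = "(1, 1)" and y = "(1, 0)"])
        (use B in \<open>auto simp: pow_aff_translation cj_aff_iff small_nat\<close>)
    ultimately show ?thesis by blast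
  next
    fix a b assume mc: "mc K a b 2 1 2 0"
    have "embeds K (integer_mod_group 2 \<times>\<times> integer_mod_group 4)"
      by (rule mc_embeds[OF mc, where x = "(1, 0)" and y = "(0, 2)"])
        (auto simp: DirProd_group carrier_integer_mod_group cj_integer_mod_group pow_DirProd cj_DirProd small_nat)
    moreover have "embeds K (aff 4 {1, 3})"
      by (rule mc_embeds[OF mc B, where x = "(1, 2)" and y = "(3, 0)"])
        (use B in \<open>auto simp: pow_aff_translation pow_aff_linear cj_aff_iff small_nat\<close>)
    ultimately show ?thesis by blast
  qed
  then show ?A ?B by (auto simp: all_embed_def)
qed

text \<open>Multiplication by 4 fixes 3 modulo 9, so it commutes with the translation by 3 and both
  have order 3.\<close>

lemma all_embed_9:
  "all_embed 9 (integer_mod_group 3 \<times>\<times> integer_mod_group 9)" (is ?A)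
  "all_embed 9 (aff 9 {1, 4, 7})" (is ?B)
proof -
  note B = group_aff_9
  have "embeds K (integer_mod_group 3 \<times>\<times> integer_mod_group 9) \<and> embeds K (aff 9 {1, 4, 7})"
    if "group K" "order K = 9" for K :: "nat monoid"
    using group.group_order_9[OF that]
  proof (elim disjE exE)
    fix a assume mc: "mc K a \<one>\<^bsub>K\<^esub> 9 1 1 0"
    have "embeds K (integer_mod_group 3 \<times>\<times> integer_mod_group 9)"
      by (rule mc_embeds[OF mc, where x = "(0, 1)" and y = "(0, 0)"])
        (auto simp: DirProd_group carrier_integer_mod_group cj_integer_mod_group pow_DirProd cj_DirProd small_nat)
    moreover have "embeds K (aff 9 {1, 4, 7})"
      by (rule mc_embeds[OF mc B, where x = "(1, 1)" and y = "(1, 0)"])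
        (use B in \<open>auto simp: pow_aff_translation cj_aff_iff small_nat\<close>)
    ultimately show ?thesis by blast
  next
    fix a b assume mc: "mc K a b 3 1 3 0"
    have "embeds K (integer_mod_group 3 \<times>\<times> integer_mod_group 9)"
      by (rule mc_embeds[OF mc, where x = "(1, 0)" and y = "(0, 3)"])
        (auto simp: DirProd_group carrier_integer_mod_group cj_integer_mod_group pow_DirProd cj_DirProd small_nat)
    moreover have "embeds K (aff 9 {1, 4, 7})"
      by (rule mc_embeds[OF mc B, where x = "(1, 3)" and y = "(4, 0)"])
        (use B in \<open>auto simp: pow_aff_translation pow_aff_linear cj_aff_iff small_nat\<close>)
    ultimately show ?thesis by blast
  qed
  then show ?A ?B by (auto simp: all_embed_def)
qed

text \<open>The witnesses rest on the translation by 2, of order 4. Multiplication by 5 fixes 2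
  modulo 8 and multiplication by 3 negates it; the map (3, 1) negates it as well, but squares to the
  translation by 4, which gives the quaternion group. All units fix 4, which gives the elementary
  abelian group. In the direct product the extra factor of order 2 replaces multiplication by
  5.\<close>

lemma all_embed_8:
  "all_embed 8 (integer_mod_group 2 \<times>\<times> aff 8 {1, 3})" (is "all_embed 8 ?A")
  "all_embed 8 (aff 8 {1, 3, 5, 7})" (is "all_embed 8 ?B")
proof -
  note B = group_aff_8 and A' = group_aff_8_13
  have A: "group ?A" using A' by (simp add: DirProd_group)
  note sA = pow_aff_translation pow_aff_linear cj_aff_iff pow_DirProd cj_DirProd
    carrier_integer_mod_group cj_integer_mod_group small_nat
  note sB = pow_aff_translation pow_aff_linear cj_aff_iff small_nat
  have "embeds K ?A \<and> embeds K ?B"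
    if "group K" "order K = 8" for K :: "nat monoid"
    using group.group_order_8[OF that]
  proof (elim disjE exE)
    fix a assume mc: "mc K a \<one>\<^bsub>K\<^esub> 8 1 1 0"
    have "embeds K ?A"
      by (rule mc_embeds[OF mc A, where x = "(0, 1, 1)" and y = "(0, 1, 0)"]) (use A' in \<open>auto simp: sA\<close>)
    moreover have "embeds K ?B"
      by (rule mc_embeds[OF mc B, where x = "(1, 1)" and y = "(1, 0)"]) (use B in \<open>auto simp: sB\<close>)
    ultimately show ?thesis by blast
  next
    fix a b assume mc: "mc K a b 4 1 2 0"
    have "embeds K ?A"
      by (rule mc_embeds[OF mc A, where x = "(0, 1, 2)" and y = "(1, 1, 0)"]) (use A' in \<open>auto simp: sA\<close>)
    moreover have "embeds K ?B"
      by (rule mc_embeds[OF mc B, where x = "(1, 2)" and y = "(5, 0)"]) (use B in \<open>auto simp: sB\<close>)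
    ultimately show ?thesis by blast
  next
    fix a b assume mc: "mc K a b 4 3 2 0"
    have "embeds K ?A"
      by (rule mc_embeds[OF mc A, where x = "(0, 1, 2)" and y = "(0, 3, 0)"]) (use A' in \<open>auto simp: sA\<close>)
    moreover have "embeds K ?B"
      by (rule mc_embeds[OF mc B, where x = "(1, 2)" and y = "(3, 0)"]) (use B in \<open>auto simp: sB\<close>)
    ultimately show ?thesis by blast
  next
    fix a b assume mc: "mc K a b 4 3 2 2"
    have "embeds K ?A"
      by (rule mc_embeds[OF mc A, where x = "(0, 1, 2)" and y = "(0, 3, 1)"]) (use A' in \<open>auto simp: sA\<close>)
    moreover have "embeds K ?B"
      by (rule mc_embeds[OF mc B, where x = "(1, 2)" and y = "(3, 1)"]) (use B in \<open>auto simp: sB\<close>)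
    ultimately show ?thesis by blast
  next
    fix a s t assume tri: "tri K a s t 2 1 1"
    have "embeds K ?A"
      by (rule tri_embeds[OF tri A, where x = "(0, 1, 4)" and y = "(0, 3, 0)" and z = "(1, 1, 0)"]) (use A' in \<open>auto simp: sA\<close>)
    moreover have "embeds K ?B"
      by (rule tri_embeds[OF tri B, where x = "(1, 4)" and y = "(3, 0)" and z = "(5, 0)"]) (use B in \<open>auto simp: sB\<close>)
    ultimately show ?thesis by blast
  qed
  then show "all_embed 8 ?A" "all_embed 8 ?B" by (auto simp: all_embed_def)
qed

subsection \<open>Elements supplied by embedded groups\<close>

lemma inj_hom_ord:
  assumes "group K" "group G" "\<phi> \<in> hom K G" "inj_on \<phi> (carrier K)" "x \<in> carrier K"
  shows "group.ord G (\<phi> x) = group.ord K x"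
proof -
  interpret group_hom K G \<phi> using assms by (simp add: group_hom_def group_hom_axioms_def)
  have "\<phi> x [^]\<^bsub>G\<^esub> n = \<one>\<^bsub>G\<^esub> \<longleftrightarrow> x [^]\<^bsub>K\<^esub> n = \<one>\<^bsub>K\<^esub>" for n :: nat
    using assms(4,5) hom_nat_pow[OF assms(5), of n] hom_one
    by (metis G.nat_pow_closed G.one_closed inj_onD)
  then have "\<forall>n. group.ord G (\<phi> x) dvd n \<longleftrightarrow> group.ord K x dvd n"
    using G.pow_eq_id H.pow_eq_id assms(5) by simp
  then show ?thesis by (meson dvd_antisym dvd_refl)
qed

lemma hom_cj:
  assumes "group K" "group G" "\<phi> \<in> hom K G" "x \<in> carrier K" "y \<in> carrier K"
  shows "\<phi> (cj K x y) = cj G (\<phi> x) (\<phi> y)"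
proof -
  interpret group_hom K G \<phi> using assms by (simp add: group_hom_def group_hom_axioms_def)
  show ?thesis using assms by (simp add: cj_def)
qed

lemma all_embed_hom:
  assumes "all_embed n G" "group G" "group K" "order K = n" "n > 0"
  obtains \<phi> where "\<phi> \<in> hom K G" "inj_on \<phi> (carrier K)"
  using embedsE[OF all_embedD[OF assms(1,3,4,5)] assms(2)] by blast

lemma ord_integer_mod_group:
  assumes "n > 0"
  shows "group.ord (integer_mod_group n) (1 mod int n) = n"
proof -
  have "(1 mod int n) [^]\<^bsub>integer_mod_group n\<^esub> m = \<one>\<^bsub>integer_mod_group n\<^esub> \<longleftrightarrow> n dvd m" for m :: nat
    by (simp add: mod_simps mod_eq_0_iff_dvd)
  then show ?thesis
    using group.ord_unique[OF group_integer_mod_group, of "1 mod int n" n] assms by (simp add: carrier_integer_mod_group)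
qed

lemma all_embed_ord:
  assumes "all_embed n G" "group G" "n > 0"
  obtains a where "a \<in> carrier G" "group.ord G a = n"
proof -
  obtain \<phi> where \<phi>: "\<phi> \<in> hom (integer_mod_group n) G" "inj_on \<phi> (carrier (integer_mod_group n))"
    using all_embed_hom[OF assms(1,2) group_integer_mod_group order_integer_mod_group[OF assms(3)] assms(3)] .
  have 1: "1 mod int n \<in> carrier (integer_mod_group n)" using assms(3) by (simp add: carrier_integer_mod_group)
  have "group.ord G (\<phi> (1 mod int n)) = n"
    using inj_hom_ord[OF group_integer_mod_group assms(2) \<phi> 1] ord_integer_mod_group[OF assms(3)] by simp
  moreover have "\<phi> (1 mod int n) \<in> carrier G" using hom_in_carrier[OF \<phi>(1) 1] .
  ultimately show thesis using that by blast
qed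

section \<open>Products of subgroups that meet trivially\<close>

context group
begin

text \<open>Multiplication is injective on A x B. This gives lower bounds for the order of
  \<open>G\<close>, and in the case of equality a factorization of every element.\<close>

lemma disjoint_product:
  assumes "finite (carrier G)" "subgroup A G" "subgroup B G" "A \<inter> B \<subseteq> {\<one>}"
  shows "card A * card B \<le> order G"
    and "card A * card B = order G \<Longrightarrow> g \<in> carrier G \<Longrightarrow> \<exists>a\<in>A. \<exists>b\<in>B. g = a \<otimes> b"
proof -
  interpret A: subgroup A G by fact
  interpret B: subgroup B G by fact
  let ?f = "\<lambda>(a, b). a \<otimes> b"
  have "inj_on ?f (A \<times> B)"
  proof (rule inj_onI, clarify)
    fix a b a' b' assume h: "a \<in> A" "b \<in> B" "a' \<in> A" "b' \<in> B" "a \<otimes> b = a' \<otimes> b'"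
    have c: "a \<in> carrier G" "b \<in> carrier G" "a' \<in> carrier G" "b' \<in> carrier G" using h by simp_all
    have "inv a' \<otimes> a = inv a' \<otimes> (a \<otimes> b) \<otimes> inv b" using c by (simp add: m_assoc)
    also have "\<dots> = b' \<otimes> inv b" unfolding h(5) using c by (simp add: m_assoc[symmetric])
    finally have eq: "inv a' \<otimes> a = b' \<otimes> inv b" .
    have "inv a' \<otimes> a \<in> A" "b' \<otimes> inv b \<in> B" using h by auto
    then have "inv a' \<otimes> a = \<one>" using assms(4) eq by auto
    then have "a = a'" using c inv_solve_left'[of \<one> a' a] by simp
    moreover have "b = b'" using calculation h(5) c by simp
    ultimately show "a = a' \<and> b = b'" by simp
  qed
  then have c: "card (?f ` (A \<times> B)) = card A * card B" by (simp add: card_image card_cartesian_product)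
  have sub: "?f ` (A \<times> B) \<subseteq> carrier G" by auto
  show "card A * card B \<le> order G" using card_mono[OF assms(1) sub] c by (simp add: order_def)
  assume "card A * card B = order G" "g \<in> carrier G"
  then have "?f ` (A \<times> B) = carrier G" using c sub assms(1) by (intro card_subset_eq) (auto simp: order_def)
  then have "g \<in> ?f ` (A \<times> B)" using \<open>g \<in> carrier G\<close> by simp
  then obtain p where "p \<in> A \<times> B" "g = ?f p" by blast
  then have "fst p \<in> A" "snd p \<in> B" "g = fst p \<otimes> snd p" by auto
  then show "\<exists>a\<in>A. \<exists>b\<in>B. g = a \<otimes> b" by blast
qed

lemma powers_Int_prime:
  assumes "finite (carrier G)" "t \<in> carrier G" "prime q" "t [^] q = \<one>" "subgroup H G" "t \<notin> H"
  shows "H \<inter> powers t \<subseteq> {\<one>}" and "ord t = q"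
proof -
  have "t \<noteq> \<one>" using assms(5,6) subgroup.one_closed by blast
  then have "ord t \<noteq> 1" using ord_eq_1[OF assms(2)] by simp
  moreover have "ord t dvd q" using assms(2,4) pow_eq_id by simp
  ultimately show ordt: "ord t = q" using assms(3) by (metis prime_nat_iff)
  have P: "subgroup (powers t) G" using subgroup_powers[OF assms(1,2)] .
  have I: "subgroup (H \<inter> powers t) G" using subgroups_Inter_pair[OF assms(5) P] .
  have "card (H \<inter> powers t) dvd q"
    using card_dvd_subgroup[OF I P] card_powers[OF assms(1,2)] ordt by simp
  then consider "card (H \<inter> powers t) = 1" | "card (H \<inter> powers t) = q"
    using assms(3) by (metis prime_nat_iff)
  then show "H \<inter> powers t \<subseteq> {\<one>}"
  proof cases
    case 1
    then obtain x where "H \<inter> powers t = {x}" by (auto simp: card_1_singleton_iff)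
    then show ?thesis using subgroup.one_closed[OF I] by simp
  next
    case 2
    have "finite (powers t)" using subgroup.subset[OF P] assms(1) finite_subset by blast
    then have "H \<inter> powers t = powers t"
      using 2 card_powers[OF assms(1,2)] ordt by (intro card_subset_eq) auto
    then show ?thesis using self_in_powers[OF assms(2)] assms(6) by blast
  qed
qed

text \<open>A cyclic group has at most \<open>p\<close> solutions of x^p = 1, namely the powers of
  \<open>a [^] m\<close>.\<close>

lemma powers_exponent_subset:
  assumes "finite (carrier G)" "a \<in> carrier G" "ord a = p * m"
  shows "{x \<in> powers a. x [^] p = \<one>} \<subseteq> (\<lambda>j. a [^] (m * j)) ` {..<p}"
proof
  fix x assume "x \<in> {x \<in> powers a. x [^] p = \<one>}"
  then obtain i where i: "x = a [^] (i::nat)" "a [^] (i * p) = \<one>"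
    using assms(2) by (auto simp: nat_pow_pow)
  have pos: "p * m > 0" using finite_ord_pos[OF assms(1,2)] assms(3) by simp
  have "p * m dvd i * p" using i(2) assms(2,3) pow_eq_id by simp
  then have "m dvd i" using pos by (simp add: mult.commute)
  then obtain j where j: "i = m * j" by auto
  have "a [^] i = a [^] (m * (j mod p))"
    using pow_eq_iff_mod[OF assms(1,2), of i "m * (j mod p)"] j assms(3) by (simp add: mult.commute[of p m] flip: mult_mod_right)
  moreover have "j mod p < p" using pos by simp
  ultimately show "x \<in> (\<lambda>j. a [^] (m * j)) ` {..<p}" using i(1) by blast
qed

lemma mem_index_2_square:
  assumes "finite (carrier G)" "subgroup H G" "order G = 2 * card H" "x \<in> carrier G"
  shows "x \<otimes> x \<in> H"
proof (cases "x \<in> H")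
  case True
  then show ?thesis using assms(2) by (simp add: subgroup.m_closed)
next
  case False
  then have "inv x \<notin> H" using assms(2,4) by (metis inv_inv subgroup.m_inv_closed)
  then show ?thesis using index_2_cover[OF assms(1-3) _ _ assms(4) False, of "inv x"] assms(4) by simp
qed

end


subsection \<open>Orders 4, 2p and 9\<close>

text \<open>The image of \<open>K\<close> consists of more than \<open>p\<close> solutions of x^p =
  1, and the powers of \<open>a\<close> have room for at most \<open>p\<close> of them.\<close>

lemma exists_outside:
  assumes G: "group G" "finite (carrier G)" and a: "a \<in> carrier G" "group.ord G a = p * m"
    and K: "group K" "\<phi> \<in> hom K G" "inj_on \<phi> (carrier K)" "order K > p" "\<And>x. x \<in> carrier K \<Longrightarrow> x [^]\<^bsub>K\<^esub> p = \<one>\<^bsub>K\<^esub>"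
  shows "\<exists>t\<in>carrier G. t [^]\<^bsub>G\<^esub> p = \<one>\<^bsub>G\<^esub> \<and> t \<notin> range (\<lambda>i::nat. a [^]\<^bsub>G\<^esub> i)"
proof (rule ccontr)
  interpret group G by fact
  interpret \<phi>: group_hom K G \<phi> using G(1) K(1,2) by (simp add: group_hom_def group_hom_axioms_def)
  assume no: "\<not> ?thesis"
  have pw: "\<phi> x [^]\<^bsub>G\<^esub> p = \<one>\<^bsub>G\<^esub>" if "x \<in> carrier K" for x
    using K(5)[OF that] \<phi>.hom_nat_pow[OF that, of p] \<phi>.hom_one by simp
  then have sub: "\<phi> ` carrier K \<subseteq> {x \<in> powers a. x [^]\<^bsub>G\<^esub> p = \<one>\<^bsub>G\<^esub>}"
    using no by (auto simp: image_iff)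
  then have "\<phi> ` carrier K \<subseteq> (\<lambda>j. a [^]\<^bsub>G\<^esub> (m * j)) ` {..<p}"
    using powers_exponent_subset[OF G(2) a] by (rule order_trans)
  then have "card (\<phi> ` carrier K) \<le> card ((\<lambda>j. a [^]\<^bsub>G\<^esub> (m * j)) ` {..<p})"
    by (intro card_mono) auto
  also have "\<dots> \<le> p" using card_image_le[of "{..<p}" "\<lambda>j. a [^]\<^bsub>G\<^esub> (m * j)"] by simp
  finally show False using K(3,4) by (simp add: card_image order_def)
qed

lemma pow_DirProd_integer_mod_group:
  "x \<in> carrier (integer_mod_group p \<times>\<times> integer_mod_group p) \<Longrightarrow> x [^]\<^bsub>integer_mod_group p \<times>\<times> integer_mod_group p\<^esub> p = \<one>\<^bsub>integer_mod_group p \<times>\<times> integer_mod_group p\<^esub>"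
  by (simp add: pow_DirProd)

text \<open>\<open>a\<close> comes from the cyclic group of order p^2 and \<open>t\<close> from the
  elementary abelian one; the powers of \<open>t\<close> have prime order and meet those of
  \<open>a\<close> trivially, so the product has p^3 elements.\<close>

lemma all_embed_square:
  assumes "group G" "finite (carrier G)" "all_embed (p ^ 2) G" "prime p"
  obtains a t where "a \<in> carrier G" "group.ord G a = p ^ 2" "t \<in> carrier G" "t [^]\<^bsub>G\<^esub> p = \<one>\<^bsub>G\<^esub>"
    "t \<notin> range (\<lambda>i::nat. a [^]\<^bsub>G\<^esub> i)" "p ^ 3 \<le> order G"
proof -
  interpret group G by fact
  have p: "p > 1" using prime_gt_1_nat[OF assms(4)] .
  then have p2: "p ^ 2 > 0" by simp
  obtain a where a: "a \<in> carrier G" "ord a = p ^ 2" using all_embed_ord[OF assms(3,1) p2] .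
  let ?E = "integer_mod_group p \<times>\<times> integer_mod_group p"
  have E: "group ?E" "order ?E = p ^ 2"
    using p by (simp_all add: DirProd_group order_DirProd order_integer_mod_group power2_eq_square)
  obtain \<phi> where \<phi>: "\<phi> \<in> hom ?E G" "inj_on \<phi> (carrier ?E)"
    using all_embed_hom[OF assms(3,1) E p2] .
  have "order ?E > p" using E(2) p by (simp add: power2_eq_square)
  then obtain t where t: "t \<in> carrier G" "t [^]\<^bsub>G\<^esub> p = \<one>\<^bsub>G\<^esub>" "t \<notin> powers a"
    using exists_outside[OF assms(1,2) a(1) _ E(1) \<phi> _ pow_DirProd_integer_mod_group] a(2) power2_eq_square by metis
  have A: "subgroup (powers a) G" "subgroup (powers t) G" using subgroup_powers[OF assms(2)] a(1) t(1) by auto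
  have "card (powers a) * card (powers t) \<le> order G"
    using disjoint_product(1)[OF assms(2) A] powers_Int_prime(1)[OF assms(2) t(1) assms(4) t(2) A(1) t(3)] by blast
  moreover have "card (powers a) * card (powers t) = p ^ 3"
    using card_powers[OF assms(2)] a t(1) powers_Int_prime(2)[OF assms(2) t(1) assms(4) t(2) A(1) t(3)]
    by (simp add: power2_eq_square power3_eq_cube)
  ultimately show thesis using that a t by auto
qed

lemma order_4_bound:
  assumes "group G" "finite (carrier G)" "all_embed 4 G"
  shows "8 \<le> order G"
proof -
  have "all_embed (2 ^ 2) G" using assms(3) by simp
  from all_embed_square[OF assms(1,2) this two_is_prime_nat] show ?thesis by auto
qed

lemma order_4_unique:
  assumes "group G" "finite (carrier G)" "all_embed 4 G" "order G = 8"
  shows "G \<cong> integer_mod_group 2 \<times>\<times> integer_mod_group 4 \<or> G \<cong> aff 4 {1, 3}"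
proof -
  interpret group G by fact
  have "all_embed (2 ^ 2) G" using assms(3) by simp
  then obtain a t where a: "a \<in> carrier G" "ord a = 2 ^ 2" and t: "t \<in> carrier G" "t [^]\<^bsub>G\<^esub> (2::nat) = \<one>\<^bsub>G\<^esub>" "t \<notin> powers a"
    using all_embed_square[OF assms(1,2) _ two_is_prime_nat] by metis
  have "cj G t a \<in> powers a"
    using index_2_normal[OF assms(2) subgroup_powers[OF assms(2) a(1)] _ t(1) self_in_powers[OF a(1)]]
      card_powers[OF assms(2) a(1)] a(2) assms(4) by simp
  then obtain k l where kl: "k < 4" "mc G a t 4 k 2 l"
    using mc_of_prime_index[OF assms(2) a(1) t(1) two_is_prime_nat] a(2) assms(4) t(3) by auto
  then have mc: "mc G a t 4 k 2 0" using t(2) by (simp add: mc_def)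
  have "k ^ 2 mod 4 = 1" using mc_exponent[OF mc] by simp
  moreover have "k = 0 \<or> k = 1 \<or> k = 2 \<or> k = 3" using kl(1) by auto
  ultimately have "k = 1 \<or> k = 3" by auto
  then show ?thesis
  proof
    assume "k = 1"
    then have "G \<cong> integer_mod_group 2 \<times>\<times> integer_mod_group 4"
      using mc by (intro mc_iso[OF _ mc_DirProd_cyclic]) simp_all
    then show ?thesis ..
  next
    assume "k = 3"
    moreover have "mc (aff 4 {1, 3}) (1, 1) (3, 0) 4 3 2 0" using mc_aff_2[of 4] by simp
    ultimately have "G \<cong> aff 4 {1, 3}" using mc by (blast intro: mc_iso)
    then show ?thesis ..
  qed
qed

lemma order_9_bound:
  assumes "group G" "finite (carrier G)" "all_embed 9 G"
  shows "27 \<le> order G"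
proof -
  have "all_embed (3 ^ 2) G" "prime (3::nat)" using assms(3) by simp_all
  from all_embed_square[OF assms(1,2) this] show ?thesis by auto
qed

text \<open>The powers of \<open>a\<close> have index 3 in a 3-group, hence are normal. The cube
  roots of 1 modulo 9 are 1, 4 and 7; the last two describe the same group with a different
  generator.\<close>

lemma order_9_unique:
  assumes "group G" "finite (carrier G)" "all_embed 9 G" "order G = 27"
  shows "G \<cong> integer_mod_group 3 \<times>\<times> integer_mod_group 9 \<or> G \<cong> aff 9 {1, 4, 7}"
proof -
  interpret group G by fact
  have e: "all_embed (3 ^ 2) G" and p3: "prime (3::nat)" using assms(3) by simp_all
  then obtain a t where a: "a \<in> carrier G" "ord a = 3 ^ 2" and t: "t \<in> carrier G" "t [^]\<^bsub>G\<^esub> (3::nat) = \<one>\<^bsub>G\<^esub>" "t \<notin> powers a"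
    using all_embed_square[OF assms(1,2)] by metis
  have r3: "r = 3" if "r dvd 3" "3 mod 3 = r mod 3" for r :: nat
    using that dvd_imp_le[OF that(1)] by (auto simp: mod_eq_0_iff_dvd intro: dvd_antisym)
  have data: "\<exists>k. (k = 1 \<or> k = 4 \<or> k = 7) \<and> mc G a t 9 k 3 0"
    if t: "t \<in> carrier G" "t [^]\<^bsub>G\<^esub> (3::nat) = \<one>\<^bsub>G\<^esub>" "t \<notin> powers a" for t
  proof -
    have "cj G t a \<in> powers a"
      by (rule cj_in_powers[OF assms(2) a(1) t(1) p3 a(2), where m = 3]) (use a assms(4) r3 in auto)
    then obtain k l where kl: "k < 9" "mc G a t 9 k 3 l"
      using mc_of_prime_index[OF assms(2) a(1) t(1) p3] a(2) assms(4) t(3) by auto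
    then have mc: "mc G a t 9 k 3 0" using t(2) by (simp add: mc_def)
    have "k ^ 3 mod 9 = 1" using mc_exponent[OF mc] by simp
    moreover have "k \<in> {0,1,2,3,4,5,6,7,8}" using kl(1) by auto
    ultimately have "k = 1 \<or> k = 4 \<or> k = 7" by auto
    then show ?thesis using mc by blast
  qed
  have iso7: "G \<cong> aff 9 {1, 4, 7}" if "mc G a t 9 7 3 0" for t using mc_iso[OF that mc_aff_9] .
  obtain k where k: "k = 1 \<or> k = 4 \<or> k = 7" "mc G a t 9 k 3 0" using data[OF t] by blast
  from k(1) show ?thesis
  proof (elim disjE)
    assume "k = 1"
    then have "G \<cong> integer_mod_group 3 \<times>\<times> integer_mod_group 9"
      using k(2) by (intro mc_iso[OF _ mc_DirProd_cyclic]) simp_all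
    then show ?thesis ..
  next
    assume "k = 7"
    then show ?thesis using k(2) iso7 by simp
  next
    assume k4: "k = 4"
    \<comment> \<open>The square of \<open>t\<close> acts with exponent 4 * 4 = 16, which is 7
      modulo 9.\<close>
    let ?t = "t [^]\<^bsub>G\<^esub> (2::nat)"
    have t4: "?t [^]\<^bsub>G\<^esub> (2::nat) = t"
      using t pow_mod[OF t(1,2), of 4] by (simp add: nat_pow_pow)
    have "?t \<notin> powers a"
    proof
      assume "?t \<in> powers a"
      then have "?t [^]\<^bsub>G\<^esub> (2::nat) \<in> powers a" by (rule subgroup_pow_closed[OF subgroup_powers[OF assms(2) a(1)]])
      then show False using t4 t(3) by simp
    qed
    moreover have "?t [^]\<^bsub>G\<^esub> (3::nat) = \<one>\<^bsub>G\<^esub>" using t pow_mod[OF t(1,2), of 6] by (simp add: nat_pow_pow)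
    ultimately obtain k' where mc': "mc G a ?t 9 k' 3 0" using data[of ?t] t(1) by auto
    have "cj G t a = a [^]\<^bsub>G\<^esub> (4::nat)" using k(2) k4 by (simp add: mc_def)
    then have "cj G ?t a = a [^]\<^bsub>G\<^esub> (16::nat)" using a(1) t(1) by (simp add: numeral_2_eq_2 cj_cj cj_pow nat_pow_pow)
    also have "\<dots> = a [^]\<^bsub>G\<^esub> (7::nat)" using mc_pow_eq_iff[OF mc', of 16 7] by simp
    finally have "mc G a ?t 9 7 3 0" using mc' by (simp add: mc_def)
    then show ?thesis using iso7 by blast
  qed
qed

text \<open>\<open>a\<close> comes from the cyclic group, \<open>c\<close> and \<open>r\<close> from
  the dihedral group of order 2p. Only their failure to commute is recorded, which is enough to
  exclude an abelian \<open>G\<close>.\<close>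

lemma order_2p_data:
  assumes "group G" "all_embed (2 * p) G" "p > 2" "odd p"
  obtains a c r where "a \<in> carrier G" "group.ord G a = 2 * p" "c \<in> carrier G" "r \<in> carrier G"
    "c [^]\<^bsub>G\<^esub> p = \<one>\<^bsub>G\<^esub>" "r [^]\<^bsub>G\<^esub> (2::nat) = \<one>\<^bsub>G\<^esub>" "cj G r c \<noteq> c"
proof -
  interpret group G by fact
  obtain a where a: "a \<in> carrier G" "ord a = 2 * p" using all_embed_ord[OF assms(2,1)] assms(3) by auto
  let ?D = "aff (int p) {1, int p - 1}"
  have mc: "mc ?D (1, 1) (int p - 1, 0) p (p - 1) 2 0" using mc_aff_2[OF assms(3)] .
  then have D: "group ?D" "order ?D = 2 * p" by (simp_all add: mc_def)
  obtain \<phi> where \<phi>: "\<phi> \<in> hom ?D G" "inj_on \<phi> (carrier ?D)" using all_embed_hom[OF assms(2,1) D] assms(3) by auto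
  interpret \<phi>: group_hom ?D G \<phi> using D(1) \<phi>(1) by (simp add: group_hom_def group_hom_axioms_def assms(1))
  let ?c = "(1, 1) :: int \<times> int" and ?r = "(int p - 1, 0) :: int \<times> int"
  have m: "?c \<in> carrier ?D" "?r \<in> carrier ?D" "?c [^]\<^bsub>?D\<^esub> p = \<one>\<^bsub>?D\<^esub>" "?r [^]\<^bsub>?D\<^esub> (2::nat) = \<one>\<^bsub>?D\<^esub>"
    "cj ?D ?r ?c = ?c [^]\<^bsub>?D\<^esub> (p - 1)"
    using mc unfolding mc_def by (simp_all del: one_aff)
  have "?c [^]\<^bsub>?D\<^esub> (p - 1) \<noteq> ?c [^]\<^bsub>?D\<^esub> (1::nat)"
    using mc_pow_eq_iff[OF mc, of "p - 1" 1] assms(3) by simp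
  then have "cj ?D ?r ?c \<noteq> ?c" using m(1,5) group.is_monoid[OF D(1)] by (simp add: monoid.nat_pow_eone)
  moreover have "cj ?D ?r ?c \<in> carrier ?D" using group.cj_closed[OF D(1) m(2,1)] .
  ultimately have "\<phi> (cj ?D ?r ?c) \<noteq> \<phi> ?c" using \<phi>(2) m(1) by (metis inj_onD)
  then have "cj G (\<phi> ?r) (\<phi> ?c) \<noteq> \<phi> ?c" using hom_cj[OF D(1) assms(1) \<phi>(1) m(2,1)] by simp
  moreover have "\<phi> ?c [^]\<^bsub>G\<^esub> p = \<one>\<^bsub>G\<^esub>" "\<phi> ?r [^]\<^bsub>G\<^esub> (2::nat) = \<one>\<^bsub>G\<^esub>"
    using \<phi>.hom_nat_pow[OF m(1), of p] \<phi>.hom_nat_pow[OF m(2), of 2] m(3,4) \<phi>.hom_one by metis+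
  ultimately show thesis using that[OF a] \<phi>.hom_closed m(1,2) by blast
qed

text \<open>The order is a multiple of 2p; if it were 2p itself, \<open>G\<close> would be cyclic
  and \<open>c\<close> and \<open>r\<close> would commute.\<close>

lemma order_2p_bound:
  assumes "group G" "finite (carrier G)" "all_embed (2 * p) G" "p > 2" "odd p"
  shows "4 * p \<le> order G"
proof -
  interpret group G by fact
  obtain a c r where a: "a \<in> carrier G" "ord a = 2 * p" and c: "c \<in> carrier G" "r \<in> carrier G" "cj G r c \<noteq> c"
    using order_2p_data[OF assms(1,3-5)] by metis
  have "2 * p dvd order G" using ord_dvd[OF a(1)] a(2) by simp
  then obtain q where q: "order G = 2 * p * q" by auto
  have "q \<noteq> 0" using q assms(2) order_gt_0_iff_finite by (metis mult_0_right not_gr_zero)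
  moreover have "q \<noteq> 1"
  proof
    assume "q = 1"
    then have "powers a = carrier G"
      using q a card_powers[OF assms(2) a(1)] assms(2) by (intro card_subset_eq) (auto simp: order_def)
    then have "r \<otimes>\<^bsub>G\<^esub> c = c \<otimes>\<^bsub>G\<^esub> r" using powers_commute[OF a(1)] c by simp
    then show False using c by (simp add: cj_eq_iff)
  qed
  ultimately have "2 * p * 2 \<le> order G" unfolding q by (intro mult_le_mono2) simp
  then show ?thesis by simp
qed

lemma order_2p_unique:
  assumes "group G" "finite (carrier G)" "all_embed (2 * p) G" "order G = 4 * p" "p \<in> {3, 5, 7}"
  shows "G \<cong> aff (int (2 * p)) {1, int (2 * p) - 1}"
proof -
  interpret group G by fact
  have p: "p > 2" "odd p" using assms(5) by auto
  obtain a c r where a: "a \<in> carrier G" "ord a = 2 * p" and c: "c \<in> carrier G" "r \<in> carrier G"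
    "c [^]\<^bsub>G\<^esub> p = \<one>\<^bsub>G\<^esub>" "r [^]\<^bsub>G\<^esub> (2::nat) = \<one>\<^bsub>G\<^esub>" "cj G r c \<noteq> c"
    using order_2p_data[OF assms(1,3) p] by metis
  have A: "subgroup (powers a) G" using subgroup_powers[OF assms(2) a(1)] .
  have ind: "order G = 2 * card (powers a)" using card_powers[OF assms(2) a(1)] a(2) assms(4) by simp
  \<comment> \<open>Squares lie in a subgroup of index two. As \<open>c\<close> has odd exponent
    \<open>p\<close>, it is a power of its own square, namely the one with exponent (p + 1) /
    2.\<close>
  have "c \<otimes>\<^bsub>G\<^esub> c \<in> powers a" using mem_index_2_square[OF assms(2) A ind c(1)] .
  then have "(c \<otimes>\<^bsub>G\<^esub> c) [^]\<^bsub>G\<^esub> ((p + 1) div 2) \<in> powers a" by (rule subgroup_pow_closed[OF A])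
  moreover have "(c \<otimes>\<^bsub>G\<^esub> c) [^]\<^bsub>G\<^esub> ((p + 1) div 2) = c [^]\<^bsub>G\<^esub> (2 * ((p + 1) div 2))"
    using c(1) nat_pow_pow[OF c(1), of 2 "(p + 1) div 2"] by (simp add: numeral_2_eq_2)
  moreover have "2 * ((p + 1) div 2) = p + 1" using p(2) by simp
  moreover have "c [^]\<^bsub>G\<^esub> (p + 1) = c" using c by simp
  ultimately have cA: "c \<in> powers a" by metis
  have rA: "r \<notin> powers a"
  proof
    assume "r \<in> powers a"
    then have "r \<otimes>\<^bsub>G\<^esub> c = c \<otimes>\<^bsub>G\<^esub> r" using powers_commute[OF a(1)] cA by blast
    then show False using c by (simp add: cj_eq_iff)
  qed
  have "cj G r a \<in> powers a" using index_2_normal[OF assms(2) A ind c(2) self_in_powers[OF a(1)]] .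
  then obtain k l where kl: "k < 2 * p" "mc G a r (2 * p) k 2 l"
    using mc_of_prime_index[OF assms(2) a(1) c(2) two_is_prime_nat] a(2) assms(4) rA by auto
  then have mc: "mc G a r (2 * p) k 2 0" using c(4) by (simp add: mc_def)
  have "k ^ 2 mod (2 * p) = 1" using mc_exponent[OF mc] p(1) by simp
  then have "k = 1 \<or> k = 2 * p - 1"
  proof -
    consider "p = 3" | "p = 5" | "p = 7" using assms(5) by auto
    then show ?thesis
    proof cases
      case 1
      then have "k \<in> {0,1,2,3,4,5}" using kl(1) by auto
      then show ?thesis using 1 \<open>k ^ 2 mod (2 * p) = 1\<close> by auto
    next
      case 2
      then have "k \<in> {0,1,2,3,4,5,6,7,8,9}" using kl(1) by auto
      then show ?thesis using 2 \<open>k ^ 2 mod (2 * p) = 1\<close> by auto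
    next
      case 3
      then have "k \<in> {0,1,2,3,4,5,6,7,8,9,10,11,12,13}" using kl(1) by simp arith
      then show ?thesis using 3 \<open>k ^ 2 mod (2 * p) = 1\<close> by auto
    qed
  qed
  \<comment> \<open>With \<open>k = 1\<close> the element \<open>r\<close> would centralize all
    powers of \<open>a\<close>, among them \<open>c\<close>.\<close>
  moreover have "k \<noteq> 1"
  proof
    assume "k = 1"
    then have "cj G r a = a" using mc a(1) by (simp add: mc_def)
    then have "cj G r (a [^]\<^bsub>G\<^esub> i) = a [^]\<^bsub>G\<^esub> i" for i :: nat using a(1) c(2) by (simp add: cj_pow)
    then show False using cA c(5) by auto
  qed
  ultimately have "k = 2 * p - 1" by simp
  then have "mc G a r (2 * p) (2 * p - 1) 2 0" using mc by simp
  moreover have "2 * p > 2" using p(1) by simp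
  ultimately show ?thesis by (rule mc_iso[OF _ mc_aff_2])
qed

subsection \<open>Order 8\<close>

text \<open>For 8 and 3 this is the quaternion group, for 12 and 5 the dicyclic group of order 12: a
  map with linear part \<open>u\<close> and odd translation part squares to the translation by N /
  2. Inside an affine group the group laws are inherited and everything is arithmetic modulo
  \<open>N\<close>.\<close>

definition quat :: "int \<Rightarrow> int \<Rightarrow> (int \<times> int) set"
  where "quat N u = {x \<in> {1, u} \<times> {0..<N}. even (snd x) \<longleftrightarrow> fst x = 1}"

lemma mod_even: "even (x mod 8) \<longleftrightarrow> even x" "even (x mod 12) \<longleftrightarrow> even x" for x :: int
  by presburger+

lemma quat_8: "subgroup (quat 8 3) (aff 8 {1, 3})" "card (quat 8 3) = 8"
proof -
  show "subgroup (quat 8 3) (aff 8 {1, 3})"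
    by (rule group.finite_subgroupI[OF group_aff_8_13])
      (auto simp: quat_def mod_even intro: finite_subset[of _ "{1, 3} \<times> {0..<8}"])
  have "quat 8 3 = {(1, 0), (1, 2), (1, 4), (1, 6), (3, 1), (3, 3), (3, 5), (3, 7)}" (is "_ = ?S")
  proof
    show "quat 8 3 \<subseteq> ?S"
    proof
      fix x assume "x \<in> quat 8 3"
      then have "(fst x = 1 \<or> fst x = 3) \<and> snd x \<in> {0,1,2,3,4,5,6,7} \<and> (even (snd x) \<longleftrightarrow> fst x = 1)"
        unfolding quat_def by (simp add: mem_Times_iff) presburger
      then show "x \<in> ?S" by (cases x) auto
    qed
  qed (auto simp: quat_def)
  then show "card (quat 8 3) = 8" by simp
qed

context group
begin

text \<open>\<open>s\<close> and \<open>t\<close> generate a four-group that meets the powers of \<open>a\<close> trivially.\<close>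

definition four_pair :: "'a \<Rightarrow> 'a \<Rightarrow> 'a \<Rightarrow> bool"
  where "four_pair a s t \<longleftrightarrow> s \<in> carrier G \<and> t \<in> carrier G \<and> s \<otimes> s = \<one> \<and> t \<otimes> t = \<one> \<and> s \<otimes> t = t \<otimes> s \<and>
    s \<notin> powers a \<and> t \<notin> powers a \<and> s \<otimes> t \<notin> powers a"

lemma four_pair_swap: "four_pair a s t \<Longrightarrow> four_pair a t s"
  by (auto simp: four_pair_def)

lemma four_pair_mult:
  assumes "four_pair a s t"
  shows "four_pair a s (s \<otimes> t)"
proof -
  have st: "s \<in> carrier G" "t \<in> carrier G" "s \<otimes> s = \<one>" "t \<otimes> t = \<one>" "s \<otimes> t = t \<otimes> s"
    using assms by (auto simp: four_pair_def)
  have 1: "s \<otimes> (s \<otimes> t) = t" using st(1-4) by (simp add: m_assoc[symmetric])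
  have "s \<otimes> t \<otimes> s = s \<otimes> (t \<otimes> s)" using st(1-4) by (simp add: m_assoc)
  then have 2: "s \<otimes> t \<otimes> s = t" using 1 st(5) by metis
  have "s \<otimes> t \<otimes> (s \<otimes> t) = (s \<otimes> t \<otimes> s) \<otimes> t" using st(1-4) by (simp add: m_assoc)
  then have 3: "s \<otimes> t \<otimes> (s \<otimes> t) = \<one>" using 2 st(4) by metis
  show ?thesis using assms 1 2 3 unfolding four_pair_def by (metis m_closed)
qed

text \<open>Any two of the three involutions generate the same four-group. This freedom is used in
  \<open>order_8_normal\<close> to bring the exponents of the action into standard form.\<close>

lemma four_pair_mult':
  assumes "four_pair a s t"
  shows "four_pair a (s \<otimes> t) s" "four_pair a (s \<otimes> t) t" "four_pair a t (s \<otimes> t)"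
proof -
  show "four_pair a (s \<otimes> t) s" using four_pair_swap[OF four_pair_mult[OF assms]] .
  have "four_pair a t (t \<otimes> s)" using four_pair_mult[OF four_pair_swap[OF assms]] .
  moreover have "t \<otimes> s = s \<otimes> t" using assms by (simp add: four_pair_def)
  ultimately show "four_pair a t (s \<otimes> t)" by simp
  then show "four_pair a (s \<otimes> t) t" by (rule four_pair_swap)
qed

lemma four_pair_subgroup:
  assumes "finite (carrier G)" "a \<in> carrier G" "four_pair a s t"
  shows "subgroup {\<one>, s, t, s \<otimes> t} G" "card {\<one>, s, t, s \<otimes> t} = 4" "powers a \<inter> {\<one>, s, t, s \<otimes> t} \<subseteq> {\<one>}"
proof -
  have st: "s \<in> carrier G" "t \<in> carrier G" "s \<otimes> s = \<one>" "t \<otimes> t = \<one>" "s \<otimes> t = t \<otimes> s"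
    "s \<notin> powers a" "t \<notin> powers a" "s \<otimes> t \<notin> powers a"
    using assms(3) by (auto simp: four_pair_def)
  note m = four_pair_mult[OF assms(3)] four_pair_mult'[OF assms(3)]
  show "subgroup {\<one>, s, t, s \<otimes> t} G"
  proof (rule finite_subgroupI)
    fix x y assume xy: "x \<in> {\<one>, s, t, s \<otimes> t}" "y \<in> {\<one>, s, t, s \<otimes> t}"
    have "s \<otimes> (s \<otimes> t) = t" "t \<otimes> (s \<otimes> t) = s" "(s \<otimes> t) \<otimes> s = t" "(s \<otimes> t) \<otimes> t = s" "(s \<otimes> t) \<otimes> (s \<otimes> t) = \<one>"
    proof -
      show 1: "s \<otimes> (s \<otimes> t) = t" using st(1-4) by (simp add: m_assoc[symmetric])
      show 2: "(s \<otimes> t) \<otimes> t = s" using st(1-4) by (simp add: m_assoc)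
      show "t \<otimes> (s \<otimes> t) = s" "(s \<otimes> t) \<otimes> s = t" "(s \<otimes> t) \<otimes> (s \<otimes> t) = \<one>"
        using m 1 2 unfolding four_pair_def by metis+
    qed
    then show "x \<otimes> y \<in> {\<one>, s, t, s \<otimes> t}" using xy st by auto
  qed (use st in auto)
  have one: "\<one> \<in> powers a" using assms(2) by (intro image_eqI[where x = 0]) auto
  have "\<one> \<noteq> s" "\<one> \<noteq> t" "\<one> \<noteq> s \<otimes> t" "s \<noteq> t"
    using st one by metis+
  moreover from this have "s \<noteq> s \<otimes> t" "t \<noteq> s \<otimes> t" using st(1,2) by auto
  ultimately have "distinct [\<one>, s, t, s \<otimes> t]" by simp
  then have "card (set [\<one>, s, t, s \<otimes> t]) = length [\<one>, s, t, s \<otimes> t]" by (rule distinct_card)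
  then show "card {\<one>, s, t, s \<otimes> t} = 4" by simp
  show "powers a \<inter> {\<one>, s, t, s \<otimes> t} \<subseteq> {\<one>}"
  proof
    fix x assume "x \<in> powers a \<inter> {\<one>, s, t, s \<otimes> t}"
    then have "x \<in> powers a" "x = \<one> \<or> x = s \<or> x = t \<or> x = s \<otimes> t" by simp_all
    then show "x \<in> {\<one>}" using st(6-8) by (metis singletonI)
  qed
qed

lemma four_pair_bound:
  assumes "finite (carrier G)" "a \<in> carrier G" "ord a = 8" "four_pair a s t"
  shows "32 \<le> order G"
    and "order G = 32 \<Longrightarrow> g \<in> carrier G \<Longrightarrow> \<exists>i::nat. \<exists>b\<in>{\<one>, s, t, s \<otimes> t}. g = a [^] i \<otimes> b"
proof -
  note B = four_pair_subgroup[OF assms(1,2,4)]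
  have A: "subgroup (powers a) G" "card (powers a) = 8"
    using subgroup_powers[OF assms(1,2)] card_powers[OF assms(1,2)] assms(3) by simp_all
  show "32 \<le> order G" using disjoint_product(1)[OF assms(1) A(1) B(1,3)] A(2) B(2) by simp
  assume "order G = 32" "g \<in> carrier G"
  then show "\<exists>i::nat. \<exists>b\<in>{\<one>, s, t, s \<otimes> t}. g = a [^] i \<otimes> b"
    using disjoint_product(2)[OF assms(1) A(1) B(1,3), of g] A(2) B(2) by fastforce
qed

lemma four_pair_tri:
  assumes "finite (carrier G)" "a \<in> carrier G" "ord a = 8" "four_pair a s t" "order G = 32"
    "cj G s a = a [^] (k::nat)" "cj G t a = a [^] (k'::nat)"
  shows "tri G a s t 8 k k'"
proof -
  have st: "s \<in> carrier G" "t \<in> carrier G" "s \<otimes> s = \<one>" "t \<otimes> t = \<one>" "s \<otimes> t = t \<otimes> s"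
    using assms(4) by (auto simp: four_pair_def)
  have a8: "a [^] (8::nat) = \<one>" using assms(2,3) by (metis pow_ord_eq_1)
  have "carrier G \<subseteq> {a [^] i \<otimes> s [^] j \<otimes> t [^] l |i j l. i < (8::nat) \<and> j < (2::nat) \<and> l < (2::nat)}"
  proof
    fix g assume "g \<in> carrier G"
    then obtain i :: nat and b where g: "b \<in> {\<one>, s, t, s \<otimes> t}" "g = a [^] i \<otimes> b"
      using four_pair_bound(2)[OF assms(1-5)] by blast
    have "\<exists>j\<in>{0,1::nat}. \<exists>l\<in>{0,1::nat}. b = s [^] j \<otimes> t [^] l" using g(1) st by auto
    then obtain j l where jl: "j \<in> {0,1::nat}" "l \<in> {0,1::nat}" "b = s [^] j \<otimes> t [^] l" by blast
    have "g = a [^] (i mod 8) \<otimes> s [^] j \<otimes> t [^] l"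
      using pow_mod[OF assms(2) a8, of i] g(2) jl(3) st assms(2) by (simp add: m_assoc)
    moreover have "i mod 8 < 8" "j < 2" "l < 2" using jl by auto
    ultimately show "g \<in> {a [^] i \<otimes> s [^] j \<otimes> t [^] l |i j l. i < (8::nat) \<and> j < (2::nat) \<and> l < (2::nat)}"
      by blast
  qed
  then show ?thesis
    unfolding tri_def using assms st a8 by (simp add: numeral_2_eq_2 cj_eq_iff)
qed

lemma commute_products:
  assumes "u \<in> carrier G" "v \<in> carrier G" "u' \<in> carrier G" "v' \<in> carrier G"
    "u \<otimes> u' = u' \<otimes> u" "v \<otimes> v' = v' \<otimes> v" "u \<otimes> v' = v' \<otimes> u" "v \<otimes> u' = u' \<otimes> v"
  shows "(u \<otimes> v) \<otimes> (u' \<otimes> v') = (u' \<otimes> v') \<otimes> (u \<otimes> v)"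
proof -
  have "(u \<otimes> v) \<otimes> (u' \<otimes> v') = u \<otimes> (v \<otimes> u') \<otimes> v'" using assms(1-4) by (simp add: m_assoc)
  also have "\<dots> = (u \<otimes> u') \<otimes> (v \<otimes> v')" unfolding assms(8) using assms(1-4) by (simp add: m_assoc)
  also have "\<dots> = u' \<otimes> (u \<otimes> v') \<otimes> v" unfolding assms(5,6) using assms(1-4) by (simp add: m_assoc)
  also have "\<dots> = (u' \<otimes> v') \<otimes> (u \<otimes> v)" unfolding assms(7) using assms(1-4) by (simp add: m_assoc)
  finally show ?thesis .
qed

end

text \<open>The only nontrivial square root of \<one> among the powers of \<open>a\<close> is the
  fourth power \<open>z\<close>, so two elements of an elementary abelian \<open>F\<close> of order
  8 suffice that generate a four-group avoiding \<open>z\<close>.\<close>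

lemma all_embed_8_four_pair:
  assumes "group G" "finite (carrier G)" "all_embed 8 G"
  obtains a s t where "a \<in> carrier G" "group.ord G a = 8" "group.four_pair G a s t"
    "order G = 32 \<Longrightarrow> s \<otimes>\<^bsub>G\<^esub> a [^]\<^bsub>G\<^esub> (4::nat) = a [^]\<^bsub>G\<^esub> (4::nat) \<otimes>\<^bsub>G\<^esub> s"
    "order G = 32 \<Longrightarrow> t \<otimes>\<^bsub>G\<^esub> a [^]\<^bsub>G\<^esub> (4::nat) = a [^]\<^bsub>G\<^esub> (4::nat) \<otimes>\<^bsub>G\<^esub> t"
proof -
  interpret group G by fact
  let ?Z = "integer_mod_group 2"
  let ?E = "?Z \<times>\<times> (?Z \<times>\<times> ?Z)"
  obtain a where a: "a \<in> carrier G" "ord a = 8" using all_embed_ord[OF assms(3,1)] by auto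
  define z where "z = a [^]\<^bsub>G\<^esub> (4::nat)"
  have zc: "z \<in> carrier G" using a by (simp add: z_def)
  have E: "group ?E" "order ?E = 8" by (simp_all add: DirProd_group order_DirProd order_integer_mod_group)
  obtain \<phi> where \<phi>: "\<phi> \<in> hom ?E G" "inj_on \<phi> (carrier ?E)" using all_embed_hom[OF assms(3,1) E] by auto
  interpret \<phi>: group_hom ?E G \<phi> using E(1) \<phi>(1) by (simp add: group_hom_def group_hom_axioms_def assms(1))
  define F where "F = \<phi> ` carrier ?E"
  have F: "subgroup F G" "card F = 8"
    using \<phi>.img_is_subgroup \<phi>(2) E(2) by (simp_all add: F_def card_image order_def)
  have sqE: "x \<otimes>\<^bsub>?E\<^esub> x = \<one>\<^bsub>?E\<^esub>" if "x \<in> carrier ?E" for x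
    using that by (auto simp: carrier_integer_mod_group)
  have coE: "x \<otimes>\<^bsub>?E\<^esub> y = y \<otimes>\<^bsub>?E\<^esub> x" for x y
    by (simp add: mult_DirProd' add.commute)
  have sq: "x \<otimes>\<^bsub>G\<^esub> x = \<one>\<^bsub>G\<^esub>" if x: "x \<in> F" for x
  proof -
    obtain u where u: "u \<in> carrier ?E" "x = \<phi> u" using x unfolding F_def by blast
    show ?thesis using \<phi>.hom_mult[OF u(1) u(1)] sqE[OF u(1)] \<phi>.hom_one u(2) by simp
  qed
  have co: "x \<otimes>\<^bsub>G\<^esub> y = y \<otimes>\<^bsub>G\<^esub> x" if xy: "x \<in> F" "y \<in> F" for x y
  proof -
    obtain u v where u: "u \<in> carrier ?E" "x = \<phi> u" "v \<in> carrier ?E" "y = \<phi> v" using xy unfolding F_def by blast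
    show ?thesis using \<phi>.hom_mult[OF u(1,3)] \<phi>.hom_mult[OF u(3,1)] coE[of u v] u(2,4) by simp
  qed
  have Fc: "x \<in> carrier G" if "x \<in> F" for x using that F(1) subgroup.mem_carrier by metis
  have inA: "x = \<one>\<^bsub>G\<^esub> \<or> x = z" if "x \<in> powers a" "x \<otimes>\<^bsub>G\<^esub> x = \<one>\<^bsub>G\<^esub>" "x \<in> carrier G" for x
  proof -
    have "{x \<in> powers a. x [^]\<^bsub>G\<^esub> (2::nat) = \<one>\<^bsub>G\<^esub>} \<subseteq> (\<lambda>j. a [^]\<^bsub>G\<^esub> (4 * j)) ` {..<2::nat}"
      using powers_exponent_subset[OF assms(2) a(1), of 2 4] a(2) by simp
    moreover have "x \<in> {x \<in> powers a. x [^]\<^bsub>G\<^esub> (2::nat) = \<one>\<^bsub>G\<^esub>}" using that by (simp add: numeral_2_eq_2)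
    ultimately have "x \<in> (\<lambda>j. a [^]\<^bsub>G\<^esub> (4 * j)) ` {..<2::nat}" by blast
    then show ?thesis by (auto simp: numeral_2_eq_2 lessThan_Suc z_def)
  qed
  have big: "\<exists>x\<in>F. x \<notin> S" if "finite S" "card S < 8" for S
    using that F(2) by (metis card_mono not_le subsetI)
  have "card {\<one>\<^bsub>G\<^esub>, z} < 8" by (simp add: card_insert_if)
  then obtain s where s: "s \<in> F" "s \<noteq> \<one>\<^bsub>G\<^esub>" "s \<noteq> z" using big[of "{\<one>\<^bsub>G\<^esub>, z}"] by auto
  \<comment> \<open>Excluding s z as well keeps the product of \<open>s\<close> and \<open>t\<close>
    away from \<open>z\<close>.\<close>
  have "card {\<one>\<^bsub>G\<^esub>, z, s, s \<otimes>\<^bsub>G\<^esub> z} < 8" by (simp add: card_insert_if)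
  then obtain t where t: "t \<in> F" "t \<noteq> \<one>\<^bsub>G\<^esub>" "t \<noteq> z" "t \<noteq> s" "t \<noteq> s \<otimes>\<^bsub>G\<^esub> z"
    using big[of "{\<one>\<^bsub>G\<^esub>, z, s, s \<otimes>\<^bsub>G\<^esub> z}"] by auto
  have stF: "s \<otimes>\<^bsub>G\<^esub> t \<in> F" using F(1) s t by (simp add: subgroup.m_closed)
  have st: "s \<otimes>\<^bsub>G\<^esub> (s \<otimes>\<^bsub>G\<^esub> t) = t" using s t Fc sq by (simp add: m_assoc[symmetric])
  have "s \<otimes>\<^bsub>G\<^esub> t \<noteq> \<one>\<^bsub>G\<^esub>" using st t(4) s(1) Fc by auto
  moreover have "s \<otimes>\<^bsub>G\<^esub> t \<noteq> z" using st t(5) by auto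
  ultimately have "s \<otimes>\<^bsub>G\<^esub> t \<notin> powers a" using inA sq[OF stF] Fc[OF stF] by blast
  moreover have "s \<notin> powers a" "t \<notin> powers a" using inA sq s t Fc by blast+
  ultimately have fp: "four_pair a s t" using s t sq co Fc by (simp add: four_pair_def)
  \<comment> \<open>If \<open>F\<close> met the powers of \<open>a\<close> trivially, the product
    would have 64 elements. So \<open>z\<close> lies in the abelian group \<open>F\<close> and
    commutes with \<open>s\<close> and \<open>t\<close>.\<close>
  have zF: "z \<in> F" if "order G = 32"
  proof (rule ccontr)
    assume "z \<notin> F"
    then have "powers a \<inter> F \<subseteq> {\<one>\<^bsub>G\<^esub>}" using inA sq Fc by blast
    then have "card (powers a) * card F \<le> 32"
      using disjoint_product(1)[OF assms(2) subgroup_powers[OF assms(2) a(1)] F(1)] that by simp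
    then show False using card_powers[OF assms(2) a(1)] a(2) F(2) by simp
  qed
  show thesis using that[OF a fp] zF co s(1) t(1) unfolding z_def by blast
qed

lemma order_8_bound:
  assumes "group G" "finite (carrier G)" "all_embed 8 G"
  shows "32 \<le> order G"
  using all_embed_8_four_pair[OF assms] group.four_pair_bound(1)[OF assms(1,2)] by metis

text \<open>A quaternion subgroup of a group of order 32 meets the powers of \<open>a\<close>, again
  because 8 * 8 > 32. The intersection contains the fourth power of \<open>a\<close>, which must be
  the unique involution of the quaternion group and hence the square of both its generators.\<close>

lemma all_embed_8_quaternion:
  assumes "group G" "finite (carrier G)" "all_embed 8 G" "order G = 32" "a \<in> carrier G" "group.ord G a = 8"
  obtains x y where "x \<in> carrier G" "y \<in> carrier G" "x \<otimes>\<^bsub>G\<^esub> x = a [^]\<^bsub>G\<^esub> (4::nat)" "y \<otimes>\<^bsub>G\<^esub> y = a [^]\<^bsub>G\<^esub> (4::nat)"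
    "x \<otimes>\<^bsub>G\<^esub> y \<noteq> y \<otimes>\<^bsub>G\<^esub> x"
proof -
  interpret group G by fact
  let ?Q = "(aff 8 {1, 3})\<lparr>carrier := quat 8 3\<rparr>"
  have Q: "group ?Q" "order ?Q = 8"
    using group.subgroup_imp_group[OF group_aff_8_13 quat_8(1)] quat_8(2) by (simp_all add: order_def)
  obtain \<phi> where \<phi>: "\<phi> \<in> hom ?Q G" "inj_on \<phi> (carrier ?Q)" using all_embed_hom[OF assms(3,1) Q] by auto
  interpret \<phi>: group_hom ?Q G \<phi> using Q(1) \<phi>(1) by (simp add: group_hom_def group_hom_axioms_def assms(1))
  have F: "subgroup (\<phi> ` carrier ?Q) G" "card (\<phi> ` carrier ?Q) = 8"
    using \<phi>.img_is_subgroup \<phi>(2) Q(2) by (simp_all add: card_image order_def)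
  define z where "z = a [^]\<^bsub>G\<^esub> (4::nat)"
  have A: "subgroup (powers a) G" "card (powers a) = 8"
    using subgroup_powers[OF assms(2,5)] card_powers[OF assms(2,5)] assms(6) by simp_all
  have "\<not> powers a \<inter> \<phi> ` carrier ?Q \<subseteq> {\<one>\<^bsub>G\<^esub>}"
    using disjoint_product(1)[OF assms(2) A(1) F(1)] A(2) F(2) assms(4) by auto
  then obtain e where e: "e \<in> powers a" "e \<in> \<phi> ` carrier ?Q" "e \<noteq> \<one>\<^bsub>G\<^esub>" by blast
  then obtain i where i: "e = a [^]\<^bsub>G\<^esub> (i::nat)" by auto
  have pe: "a [^]\<^bsub>G\<^esub> m = a [^]\<^bsub>G\<^esub> n \<longleftrightarrow> m mod 8 = n mod 8" for m n :: nat
    using pow_eq_iff_mod[OF assms(2,5)] assms(6) by simp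
  have "i mod 8 \<noteq> 0"
  proof
    assume "i mod 8 = 0"
    then have "a [^]\<^bsub>G\<^esub> i = a [^]\<^bsub>G\<^esub> (0::nat)" using pe[of i 0] by (simp only: mod_0)
    then show False using i e(3) by simp
  qed
  moreover define r where "r = i mod 8"
  ultimately have "r \<in> {1, 2, 3, 4, 5, 6, 7}" by simp presburger
  \<comment> \<open>Every nonzero residue modulo 8 has a multiple equal to 4: multiply by 4, 2 or 1
    according to its 2-part.\<close>
  then have "r * 4 mod 8 = 4 \<or> r * 2 mod 8 = 4 \<or> r * 1 mod 8 = 4" by auto
  then obtain j where "i * j mod 8 = 4" unfolding r_def mod_mult_left_eq by blast
  then have "e [^]\<^bsub>G\<^esub> j = z" using pe[of "i * j" 4] i assms(5) by (simp add: z_def nat_pow_pow)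
  then have "z \<in> \<phi> ` carrier ?Q" using subgroup_pow_closed[OF F(1) e(2)] by metis
  then obtain q where q: "q \<in> carrier ?Q" "\<phi> q = z" by blast
  have "z \<otimes>\<^bsub>G\<^esub> z = \<one>\<^bsub>G\<^esub>" "z \<noteq> \<one>\<^bsub>G\<^esub>"
    using pe[of 8 0] pe[of 4 0] assms(5) by (simp_all add: z_def nat_pow_mult)
  then have "\<phi> (q \<otimes>\<^bsub>?Q\<^esub> q) = \<phi> \<one>\<^bsub>?Q\<^esub>" "\<phi> q \<noteq> \<phi> \<one>\<^bsub>?Q\<^esub>"
    using q \<phi>.hom_mult \<phi>.hom_one by metis+
  moreover have "q \<otimes>\<^bsub>?Q\<^esub> q \<in> carrier ?Q" "\<one>\<^bsub>?Q\<^esub> \<in> carrier ?Q"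
    using monoid.m_closed[OF group.is_monoid[OF Q(1)] q(1) q(1)] monoid.one_closed[OF group.is_monoid[OF Q(1)]] .
  ultimately have "q \<otimes>\<^bsub>?Q\<^esub> q = \<one>\<^bsub>?Q\<^esub>" "q \<noteq> \<one>\<^bsub>?Q\<^esub>"
    using inj_onD[OF \<phi>(2)] by blast+
  moreover have "snd q \<in> {0,1,2,3,4,5,6,7}" using q(1) by (auto simp: quat_def)
  ultimately have q14: "q = (1, 4)" using q(1) by (cases q) (auto simp: quat_def)
  have in_Q: "(1, 2) \<in> carrier ?Q" "(3, 1) \<in> carrier ?Q" by (simp_all add: quat_def)
  have "\<phi> (1, 2) \<otimes>\<^bsub>G\<^esub> \<phi> (1, 2) = z" "\<phi> (3, 1) \<otimes>\<^bsub>G\<^esub> \<phi> (3, 1) = z"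
    using \<phi>.hom_mult[OF in_Q(1) in_Q(1)] \<phi>.hom_mult[OF in_Q(2) in_Q(2)] q(2) q14 by simp_all
  moreover have "\<phi> (1, 2) \<otimes>\<^bsub>G\<^esub> \<phi> (3, 1) \<noteq> \<phi> (3, 1) \<otimes>\<^bsub>G\<^esub> \<phi> (1, 2)"
  proof
    assume "\<phi> (1, 2) \<otimes>\<^bsub>G\<^esub> \<phi> (3, 1) = \<phi> (3, 1) \<otimes>\<^bsub>G\<^esub> \<phi> (1, 2)"
    then have "\<phi> (3, 3) = \<phi> (3, 7)"
      using \<phi>.hom_mult[OF in_Q(1) in_Q(2)] \<phi>.hom_mult[OF in_Q(2) in_Q(1)] by simp
    then have "(3, 3) = (3::int, 7::int)" by (rule inj_onD[OF \<phi>(2)]) (simp_all add: quat_def)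
    then show False by simp
  qed
  ultimately show thesis using that \<phi>.hom_closed in_Q unfolding z_def by blast
qed

text \<open>The units 5 and 25 = 5 * 5 fix the even residues. These are the exponents that occur for
  products of elements acting with exponents 1 or 5.\<close>

lemma mod_8_twice:
  fixes n :: nat
  shows "5 * (2 * n) mod 8 = 2 * n mod 8" "25 * (2 * n) mod 8 = 2 * n mod 8"
proof -
  have "5 * (2 * n) = 2 * n + 8 * n" "25 * (2 * n) = 2 * n + 8 * (6 * n)" by simp_all
  then show "5 * (2 * n) mod 8 = 2 * n mod 8" "25 * (2 * n) mod 8 = 2 * n mod 8"
    by (simp_all only: mod_mult_self2)
qed

lemma mod_8_even:
  fixes m :: nat
  shows "(m + 1 * m) mod 8 = 4 \<Longrightarrow> even m" "(m + 5 * m) mod 8 = 4 \<Longrightarrow> even m" "(m + 25 * m) mod 8 = 4 \<Longrightarrow> even m"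
proof -
  have *: "even m" if "2 * x mod 8 = 4" "odd m \<longleftrightarrow> odd x" for x :: nat
    using that by presburger
  show "(m + 1 * m) mod 8 = 4 \<Longrightarrow> even m" using *[of m] by (simp add: mult_2)
  show "(m + 5 * m) mod 8 = 4 \<Longrightarrow> even m" using *[of "3 * m"] by simp
  show "(m + 25 * m) mod 8 = 4 \<Longrightarrow> even m" using *[of "13 * m"] by simp
qed

section \<open>Order 32: the powers of an element of order 8 times a four-group\<close>

context group
begin

lemma four_pair_comm:
  assumes "four_pair a s t" "b \<in> {\<one>, s, t, s \<otimes> t}" "b' \<in> {\<one>, s, t, s \<otimes> t}"
  shows "b \<otimes> b' = b' \<otimes> b" "b \<otimes> b = \<one>" "b \<in> carrier G"
proof -
  note m = assms(1) four_pair_mult[OF assms(1)] four_pair_mult'[OF assms(1)]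
  have st: "s \<in> carrier G" "t \<in> carrier G" "s \<otimes> s = \<one>" "t \<otimes> t = \<one>" "s \<otimes> t = t \<otimes> s"
    "(s \<otimes> t) \<otimes> (s \<otimes> t) = \<one>" "(s \<otimes> t) \<otimes> s = s \<otimes> (s \<otimes> t)" "(s \<otimes> t) \<otimes> t = t \<otimes> (s \<otimes> t)"
    using m unfolding four_pair_def by metis+
  then show "b \<in> carrier G" using assms(2) by auto
  show "b \<otimes> b = \<one>" using assms(2) st(1-4,6) by (elim insertE) simp_all
  have "b = \<one> \<or> b = s \<or> b = t \<or> b = s \<otimes> t" "b' = \<one> \<or> b' = s \<or> b' = t \<or> b' = s \<otimes> t"
    using assms(2,3) by auto
  then show "b \<otimes> b' = b' \<otimes> b" using st by (metis l_one m_closed r_one)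
qed

text \<open>For an involution \<open>b\<close> conjugation needs no inverse. It is used to find the
  elements u b whose square is the fourth power of \<open>a\<close>.\<close>

lemma square_of_product:
  assumes "u \<in> carrier G" "b \<in> carrier G" "b \<otimes> b = \<one>"
  shows "(u \<otimes> b) \<otimes> (u \<otimes> b) = u \<otimes> cj G b u"
proof -
  have "inv b = b" using assms inv_equality by metis
  then show ?thesis using assms by (simp add: cj_def m_assoc)
qed

text \<open>The powers of \<open>a\<close> have even index 4, so their index in the normalizer is
  even too. A normalizing element outside them factors as \<open>a [^] i\<close> times
  \<open>b\<close> in the four-group, and this \<open>b\<close> becomes the first generator.\<close>

lemma normalizing_four_pair:
  assumes fin: "finite (carrier G)" and a: "a \<in> carrier G" "ord a = 8" and fp: "four_pair a s t" and o: "order G = 32"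
    and z: "s \<otimes> z = z \<otimes> s" "t \<otimes> z = z \<otimes> t" "z \<in> carrier G"
  obtains s' t' where "four_pair a s' t'" "s' \<otimes> z = z \<otimes> s'" "t' \<otimes> z = z \<otimes> t'" "cj G s' a \<in> powers a"
proof -
  let ?A = "powers a"
  have A: "subgroup ?A G" "card ?A = 8" using subgroup_powers[OF fin a(1)] card_powers[OF fin a(1)] a(2) by simp_all
  have N: "subgroup (nrm G ?A) G" using nrm_subgroup[OF fin A(1)] .
  have "(order G div card ?A) mod 2 = (card (nrm G ?A) div card ?A) mod 2"
    using index_mod_nrm[OF fin two_is_prime_nat subgroup_self A(1) subgroup.subset[OF A(1)], of 3] A(2)
      subgroup.subset[OF N] by (simp add: order_def Int_absorb2)
  then have "nrm G ?A \<noteq> ?A" using o A(2) by auto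
  then obtain n where n: "n \<in> nrm G ?A" "n \<notin> ?A" using subset_nrm[OF A(1)] by blast
  then obtain i b where b: "b \<in> {\<one>, s, t, s \<otimes> t}" "n = a [^] (i::nat) \<otimes> b"
    using four_pair_bound(2)[OF fin a fp o] subgroup.mem_carrier[OF N] by blast
  have bc: "b \<in> carrier G" using four_pair_comm(3)[OF fp b(1) b(1)] .
  have ai: "a [^] i \<in> nrm G ?A" using subset_nrm[OF A(1)] by blast
  have "b = inv (a [^] i) \<otimes> n" using b(2) bc a(1) by (simp add: m_assoc[symmetric])
  then have "b \<in> nrm G ?A" using N ai n(1) by (simp add: subgroup.m_closed subgroup.m_inv_closed)
  then have ba: "cj G b a \<in> ?A" using self_in_powers[OF a(1)] unfolding nrm_def by blast
  have "b \<noteq> \<one>" using b(2) n(2) a(1) by auto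
  moreover have st: "s \<in> carrier G" "t \<in> carrier G" using fp by (auto simp: four_pair_def)
  moreover have "(s \<otimes> t) \<otimes> z = z \<otimes> (s \<otimes> t)"
    using st z by (metis m_assoc)
  ultimately show thesis
    using b(1) ba that[OF fp z(1,2)] that[OF four_pair_swap[OF fp] z(2,1)] that[OF four_pair_mult'(2)[OF fp] _ z(2)] by blast
qed

text \<open>If \<open>t\<close> moved \<open>a\<close> to a product with \<open>s\<close>, every
  element with square a^4 would be an even power of \<open>a\<close> times an element of the
  four-group commuting with the even powers concerned. All these elements commute with each other,
  against \<open>x\<close> and \<open>y\<close>.\<close>

lemma order_8_not_normal:
  assumes fin: "finite (carrier G)" and a: "a \<in> carrier G" "ord a = 8" and fp: "four_pair a s t" and o: "order G = 32"
    and tz: "t \<otimes> a [^] (4::nat) = a [^] (4::nat) \<otimes> t"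
    and xy: "x \<in> carrier G" "y \<in> carrier G" "x \<otimes> x = a [^] (4::nat)" "y \<otimes> y = a [^] (4::nat)" "x \<otimes> y \<noteq> y \<otimes> x"
    and sa: "cj G s a = a [^] (k::nat)" "k = 1 \<or> k = 3 \<or> k = 5 \<or> k = 7" and ta: "cj G t a = a [^] (i::nat) \<otimes> s"
  shows False
proof -
  let ?B = "{\<one>, s, t, s \<otimes> t}"
  have st: "s \<in> carrier G" "t \<in> carrier G" "s \<otimes> s = \<one>" "t \<otimes> t = \<one>" "s \<otimes> t = t \<otimes> s" "s \<notin> powers a"
    using fp by (auto simp: four_pair_def)
  have pe: "a [^] m = a [^] n \<longleftrightarrow> m mod 8 = n mod 8" for m n :: nat
    using pow_eq_iff_mod[OF fin a(1)] a(2) by simp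
  have cs: "cj G s (a [^] m) = a [^] (k * m)" for m :: nat
    using st a(1) sa(1) by (simp add: cj_pow nat_pow_pow)
  have css: "cj G s s = s" using st(1) by (simp add: cj_eq_iff)
  \<comment> \<open>\<open>c\<close> is the exponent by which \<open>t\<close> acts on the square of
    \<open>a\<close>; \<open>t\<close> fixes the fourth power, so twice \<open>c\<close> is 4 modulo
    8.\<close>
  define c where "c = i + k * i"
  have "cj G t (a [^] (2::nat)) = (a [^] i \<otimes> s) \<otimes> (a [^] i \<otimes> s)"
    using st a(1) ta by (simp add: cj_m numeral_2_eq_2)
  also have "\<dots> = a [^] c"
    using square_of_product[of "a [^] i" s] st a(1) cs[of i] by (simp add: c_def nat_pow_mult)
  finally have t2: "cj G t (a [^] (2::nat)) = a [^] c" .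
  have ct: "cj G t (a [^] (2 * n)) = a [^] (c * n)" for n :: nat
    using t2 st a(1) cj_pow[of t "a [^] (2::nat)" n] by (simp add: nat_pow_pow)
  have "cj G t (a [^] (4::nat)) = a [^] (4::nat)" using tz st a(1) by (simp add: cj_eq_iff)
  then have c4: "c * 2 mod 8 = 4" using ct[of 2] pe[of "c * 2" 4] by simp
  then have c: "c mod 8 = 2 \<or> c mod 8 = 6" by presburger
  \<comment> \<open>For \<open>k = 3\<close> or \<open>k = 7\<close> the number \<open>c\<close> is
    a multiple of 4, so twice \<open>c\<close> vanishes modulo 8.\<close>
  have k: "k = 1 \<or> k = 5"
  proof (rule ccontr)
    assume "\<not> ?thesis"
    then have "c * 2 = 8 * i \<or> c * 2 = 8 * (2 * i)" using sa(2) by (auto simp: c_def)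
    then show False using c4 by auto
  qed
  have no_s: False if "a [^] p \<otimes> s = a [^] q" for p q :: nat
  proof -
    have "s = inv (a [^] p) \<otimes> a [^] q" using that[symmetric] st a(1) by (simp add: m_assoc[symmetric])
    also have "\<dots> \<in> powers a" using subgroup_powers[OF fin a(1)] by (simp add: subgroup.m_closed subgroup.m_inv_closed)
    finally show False using st(6) by simp
  qed
  have cst: "cj G (s \<otimes> t) g = cj G s (cj G t g)" if "g \<in> carrier G" for g using st(1,2) that by (simp add: cj_cj)
  \<comment> \<open>For odd exponents of \<open>a\<close> the square is either a power with the
    wrong exponent or contains a factor \<open>s\<close>, which \<open>no_s\<close>
    excludes.\<close>
  have form: "\<exists>n b. b \<in> ?B \<and> g = a [^] (2 * n :: nat) \<otimes> b \<and> (b \<in> {t, s \<otimes> t} \<longrightarrow> c mod 8 = 2)"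
    if g: "g \<in> carrier G" "g \<otimes> g = a [^] (4::nat)" for g
  proof -
    obtain m b where b: "b \<in> ?B" "g = a [^] (m::nat) \<otimes> b" using four_pair_bound(2)[OF fin a fp o g(1)] by blast
    have gg: "a [^] m \<otimes> cj G b (a [^] m) = a [^] (4::nat)"
      using g(2) square_of_product[of "a [^] m" b] four_pair_comm(2,3)[OF fp b(1) b(1)] a(1) b(2) by simp
    show ?thesis
    proof (cases "even m")
      case True
      then obtain n where n: "m = 2 * n" by auto
      have "c mod 8 = 2" if bt: "b \<in> {t, s \<otimes> t}"
      proof (rule ccontr)
        assume "c mod 8 \<noteq> 2"
        \<comment> \<open>If \<open>c\<close> is 6 modulo 8, then \<open>t\<close> and s t invert
          the even powers of \<open>a\<close>, so the square of a product with them is trivial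
          instead of a^4.\<close>
        then have c6: "c mod 8 = 6" using c by simp
        define d where "d = c div 8"
        have cd: "c = 8 * d + 6" using c6 by (simp add: d_def) presburger
        have "2 * n + c * n = 8 * (d * n + n)" by (simp add: cd algebra_simps)
        then have 1: "(2 * n + c * n) mod 8 = 0" by simp
        have "2 * n + 5 * (c * n) = 8 * (5 * (d * n) + 4 * n)" by (simp add: cd algebra_simps)
        then have "(2 * n + 5 * (c * n)) mod 8 = 0" by simp
        then have 2: "(2 * n + k * (c * n)) mod 8 = 0" using k 1 by auto
        from bt show False
        proof (elim insertE)
          assume "b = t"
          then show False using gg ct[of n] n a(1) 1 pe[of "2 * n + c * n" 4] by (simp add: nat_pow_mult)
        next
          assume "b = s \<otimes> t"
          then show False using gg ct[of n] cst[of "a [^] m"] cs[of "c * n"] n a(1) 2 pe[of "2 * n + k * (c * n)" 4]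
            by (simp add: nat_pow_mult)
        qed simp
      qed
      then show ?thesis using b n by blast
    next
      case False
      then obtain n where n: "m = 2 * n + 1" by (elim oddE)
      have tm: "cj G t (a [^] m) = a [^] (c * n + i) \<otimes> s"
        using n st a(1) ct[of n] ta by (simp add: cj_m m_assoc[symmetric] nat_pow_mult)
      have False using b(1)
      proof (elim insertE)
        assume "b = \<one>"
        then have "(m + m) mod 8 = 4" using gg a(1) pe[of "m + m" 4] by (simp add: nat_pow_mult)
        then have "even m" by presburger
        then show False using False by simp
      next
        assume "b = s"
        then have "(m + k * m) mod 8 = 4" using gg cs[of m] a(1) pe[of "m + k * m" 4] by (simp add: nat_pow_mult)
        then have "even m" using k mod_8_even[of m] by (elim disjE) auto
        then show False using False by simp
      next
        assume "b = t"
        then have "a [^] (m + (c * n + i)) \<otimes> s = a [^] (4::nat)"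
          using gg tm a(1) st by (simp add: nat_pow_mult m_assoc[symmetric])
        then show False by (rule no_s)
      next
        assume "b = s \<otimes> t"
        then have "a [^] m \<otimes> cj G s (a [^] (c * n + i) \<otimes> s) = a [^] (4::nat)"
          using gg tm cst[of "a [^] m"] a(1) by simp
        then have "a [^] (m + k * (c * n + i)) \<otimes> s = a [^] (4::nat)"
          using a(1) st cs[of "c * n + i"] by (simp add: cj_m css nat_pow_mult m_assoc[symmetric])
        then show False by (rule no_s)
      qed simp
      then show ?thesis ..
    qed
  qed
  obtain n b where b: "b \<in> ?B" "x = a [^] (2 * n :: nat) \<otimes> b" "b \<in> {t, s \<otimes> t} \<longrightarrow> c mod 8 = 2" using form[OF xy(1,3)] by (elim exE conjE)
  obtain n' b' where b': "b' \<in> ?B" "y = a [^] (2 * n' :: nat) \<otimes> b'" "b' \<in> {t, s \<otimes> t} \<longrightarrow> c mod 8 = 2" using form[OF xy(2,4)] by (elim exE conjE)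
  have cb: "b \<otimes> a [^] (2 * n) = a [^] (2 * n) \<otimes> b"
    if b: "b \<in> ?B" "b \<in> {t, s \<otimes> t} \<longrightarrow> c mod 8 = 2" for b and n :: nat
  proof -
    have s2: "cj G s (a [^] (2 * n)) = a [^] (2 * n)" for n :: nat
      using cs[of "2 * n"] pe[of "k * (2 * n)" "2 * n"] k mod_8_twice(1)[of n] by auto
    have t2: "cj G t (a [^] (2 * n)) = a [^] (2 * n)" if "c mod 8 = 2"
    proof -
      define d where "d = c div 8"
      have "c = 8 * d + 2" using that by (simp add: d_def) presburger
      then have "c * n = 8 * (d * n) + 2 * n" by (simp add: algebra_simps)
      then have "c * n mod 8 = 2 * n mod 8" by simp
      then show ?thesis using ct[of n] pe[of "c * n" "2 * n"] by simp
    qed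
    have "cj G b (a [^] (2 * n)) = a [^] (2 * n)"
      using b s2 t2 cst[of "a [^] (2 * n)"] a(1) by auto
    then show ?thesis using four_pair_comm(3)[OF fp b(1) b(1)] a(1) by (simp add: cj_eq_iff)
  qed
  have "x \<otimes> y = y \<otimes> x"
    unfolding b(2) b'(2)
    using four_pair_comm[OF fp b(1) b'(1)] four_pair_comm(3)[OF fp b'(1) b(1)] cb[OF b(1,3)] cb[OF b'(1,3)] a(1)
    by (intro commute_products) (simp_all add: nat_pow_mult add.commute)
  then show False using xy(5) by simp
qed

text \<open>The four-group acts on the powers of \<open>a\<close> through the units 1, 3, 5, 7. If
  the image lies in {1, 5} or {1, 7}, the elements with square a^4 commute; otherwise a basis of the
  four-group can be chosen with exponents 3 and 1 or 5.\<close>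

lemma order_8_normal:
  assumes fin: "finite (carrier G)" and a: "a \<in> carrier G" "ord a = 8" and fp: "four_pair a s t" and o: "order G = 32"
    and xy: "x \<in> carrier G" "y \<in> carrier G" "x \<otimes> x = a [^] (4::nat)" "y \<otimes> y = a [^] (4::nat)" "x \<otimes> y \<noteq> y \<otimes> x"
    and sa: "cj G s a = a [^] (k::nat)" "k = 1 \<or> k = 3 \<or> k = 5 \<or> k = 7"
    and ta: "cj G t a = a [^] (i::nat)" "i = 1 \<or> i = 3 \<or> i = 5 \<or> i = 7"
  shows "\<exists>s t k'. (k' = 1 \<or> k' = 5) \<and> tri G a s t 8 3 k'"
proof -
  let ?B = "{\<one>, s, t, s \<otimes> t}"
  have st: "s \<in> carrier G" "t \<in> carrier G" "s \<otimes> s = \<one>" "t \<otimes> t = \<one>" "s \<otimes> t = t \<otimes> s" "s \<notin> powers a"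
    using fp by (auto simp: four_pair_def)
  have pe: "a [^] m = a [^] n \<longleftrightarrow> m mod 8 = n mod 8" for m n :: nat
    using pow_eq_iff_mod[OF fin a(1)] a(2) by simp
  have sta: "cj G (s \<otimes> t) a = a [^] (k * i)"
    using st a(1) sa(1) ta(1) by (simp add: cj_cj cj_pow nat_pow_pow mult.commute)
  have sta': "cj G (s \<otimes> t) a = a [^] r" if "k * i mod 8 = r mod 8" for r :: nat
    using sta that pe by simp
  note tri = four_pair_tri[OF fin a _ o]
  note m = four_pair_swap[OF fp] four_pair_mult[OF fp] four_pair_mult'[OF fp]
  have kap: "\<exists>r. cj G b a = a [^] r \<and> r \<in> {1, k, i, k * i}" if "b \<in> ?B" for b
    using that a(1) sa(1) ta(1) sta by (auto intro: exI[of _ "1::nat"])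
  have form: "\<exists>m b r. b \<in> ?B \<and> g = a [^] (m::nat) \<otimes> b \<and> cj G b a = a [^] r \<and> r \<in> {1, k, i, k * i} \<and> (m + r * m) mod 8 = 4"
    if g: "g \<in> carrier G" "g \<otimes> g = a [^] (4::nat)" for g
  proof -
    obtain m b where b: "b \<in> ?B" "g = a [^] (m::nat) \<otimes> b" using four_pair_bound(2)[OF fin a fp o g(1)] by blast
    obtain r where r: "cj G b a = a [^] r" "r \<in> {1, k, i, k * i}" using kap[OF b(1)] by blast
    have bc: "b \<otimes> b = \<one>" "b \<in> carrier G" using four_pair_comm(2,3)[OF fp b(1) b(1)] by auto
    have "a [^] m \<otimes> cj G b (a [^] m) = a [^] (4::nat)"
      using g(2) square_of_product[of "a [^] m" b] bc a(1) b(2) by simp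
    then have "a [^] (m + r * m) = a [^] (4::nat)" using bc a(1) r(1) by (simp add: cj_pow nat_pow_pow nat_pow_mult)
    then show ?thesis using pe[of "m + r * m" 4] b r by auto
  qed
  \<comment> \<open>It suffices that every exponent \<open>r\<close> occurring in a square root of
    a^4 fixes every power of \<open>a\<close> occurring in such a root.\<close>
  have comm: False
    if ev: "\<And>m r. r \<in> {1, k, i, k * i} \<Longrightarrow> (m + r * m) mod 8 = 4 \<Longrightarrow>
      (\<forall>m' r'. r' \<in> {1, k, i, k * i} \<longrightarrow> (m' + r' * m') mod 8 = 4 \<longrightarrow> r * m' mod 8 = m' mod 8)"
  proof -
    obtain m b r where b: "b \<in> ?B" "x = a [^] (m::nat) \<otimes> b" "cj G b a = a [^] r" "r \<in> {1, k, i, k * i}" "(m + r * m) mod 8 = 4"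
      using form[OF xy(1,3)] by blast
    obtain m' b' r' where b': "b' \<in> ?B" "y = a [^] (m'::nat) \<otimes> b'" "cj G b' a = a [^] r'" "r' \<in> {1, k, i, k * i}" "(m' + r' * m') mod 8 = 4"
      using form[OF xy(2,4)] by blast
    have bc: "b \<in> carrier G" "b' \<in> carrier G" "b \<otimes> b' = b' \<otimes> b"
      using four_pair_comm[OF fp b(1) b'(1)] four_pair_comm(3)[OF fp b'(1) b(1)] by auto
    have "r * m' mod 8 = m' mod 8" "r' * m mod 8 = m mod 8"
      using ev[OF b(4,5)] b'(4,5) ev[OF b'(4,5)] b(4,5) by blast+
    then have fixed: "a [^] (r * m') = a [^] m'" "a [^] (r' * m) = a [^] m" using pe by blast+
    have "cj G b (a [^] m') = a [^] m'"
      using bc a(1) b(3) fixed by (simp add: cj_pow nat_pow_pow)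
    moreover have "cj G b' (a [^] m) = a [^] m"
      using bc a(1) b'(3) fixed by (simp add: cj_pow nat_pow_pow)
    ultimately have "x \<otimes> y = y \<otimes> x"
      unfolding b(2) b'(2) using bc a(1)
      by (intro commute_products) (simp_all add: cj_eq_iff nat_pow_mult add.commute)
    then show False using xy(5) by simp
  qed
  \<comment> \<open>With units 1 and 5 only, the exponent \<open>m'\<close> in a square root is
    even, and 5 fixes even residues modulo 8.\<close>
  have A: False if "k \<in> {1, 5}" "i \<in> {1, 5}"
  proof (rule comm, intro allI impI)
    fix m r m' r' :: nat
    assume "r \<in> {1, k, i, k * i}" "r' \<in> {1, k, i, k * i}" "(m' + r' * m') mod 8 = 4"
    then have r: "r = 1 \<or> r = 5 \<or> r = 25" and r': "r' = 1 \<or> r' = 5 \<or> r' = 25" "(m' + r' * m') mod 8 = 4"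
      using that by auto
    have "even m'" using r' mod_8_even[of m'] by (elim disjE) auto
    then obtain n where "m' = 2 * n" by auto
    then show "r * m' mod 8 = m' mod 8" using r mod_8_twice[of n] by (elim disjE) auto
  qed
  \<comment> \<open>For an inverting \<open>b\<close> the product a^m b squares to \<one>, so
    exponent 7 does not occur in a square root of a^4; 49 acts like 1.\<close>
  have B: False if "k \<in> {1, 7}" "i \<in> {1, 7}"
  proof (rule comm, intro allI impI)
    fix m r m' r' :: nat
    assume "r \<in> {1, k, i, k * i}" "(m + r * m) mod 8 = 4"
    then have r: "r = 1 \<or> r = 7 \<or> r = 49" "(m + r * m) mod 8 = 4" using that by auto
    have "(m + 7 * m) mod 8 = 0" by simp
    then have "r = 1 \<or> r = 49" using r by auto
    moreover have "49 * m' = m' + 8 * (6 * m')" by simp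
    then have "49 * m' mod 8 = m' mod 8" by (simp only: mod_mult_self2)
    ultimately show "r * m' mod 8 = m' mod 8" by auto
  qed
  from sa(2) ta(2) show ?thesis
  proof (elim disjE)
    assume "k = 1" "i = 3"
    then show ?thesis using tri[OF m(1) ta(1) sa(1)] by auto
  next
    assume "k = 3" "i = 1"
    then show ?thesis using tri[OF fp sa(1) ta(1)] by auto
  next
    \<comment> \<open>In the remaining cases the product of the two involutions, acting with
      exponent \<open>k * i\<close> modulo 8, replaces one or both of the original
      generators.\<close>
    assume h: "k = 3" "i = 3"
    then show ?thesis using tri[OF m(2) sa(1) sta'[of 1]] by auto
  next
    assume "k = 3" "i = 5"
    then show ?thesis using tri[OF fp sa(1) ta(1)] by auto
  next
    assume h: "k = 3" "i = 7"
    then show ?thesis using tri[OF m(2) sa(1) sta'[of 5]] by auto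
  next
    assume "k = 5" "i = 3"
    then show ?thesis using tri[OF m(1) ta(1) sa(1)] by auto
  next
    assume h: "k = 5" "i = 7"
    then show ?thesis using tri[OF m(3) sta'[of 3] sa(1)] by auto
  next
    assume h: "k = 7" "i = 3"
    then show ?thesis using tri[OF m(5) ta(1) sta'[of 5]] by auto
  next
    assume h: "k = 7" "i = 5"
    then show ?thesis using tri[OF m(4) sta'[of 3] ta(1)] by auto
  qed (use A B in simp_all)
qed

end

text \<open>After \<open>s\<close> has been made to normalize the powers of \<open>a\<close>, the
  component of the conjugate of \<open>a\<close> by \<open>t\<close> in the four-group is shown to
  be trivial. Then \<open>order_8_normal\<close> gives the normal form.\<close>

lemma order_8_unique:
  assumes "group G" "finite (carrier G)" "all_embed 8 G" "order G = 32"
  shows "G \<cong> integer_mod_group 2 \<times>\<times> aff 8 {1, 3} \<or> G \<cong> aff 8 {1, 3, 5, 7}"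
proof -
  interpret group G by fact
  obtain a s0 t0 where a: "a \<in> carrier G" "ord a = 8" and fp0: "four_pair a s0 t0"
    "s0 \<otimes>\<^bsub>G\<^esub> a [^]\<^bsub>G\<^esub> (4::nat) = a [^]\<^bsub>G\<^esub> (4::nat) \<otimes>\<^bsub>G\<^esub> s0"
    "t0 \<otimes>\<^bsub>G\<^esub> a [^]\<^bsub>G\<^esub> (4::nat) = a [^]\<^bsub>G\<^esub> (4::nat) \<otimes>\<^bsub>G\<^esub> t0"
    using all_embed_8_four_pair[OF assms(1-3)] assms(4) by metis
  obtain x y where xy: "x \<in> carrier G" "y \<in> carrier G" "x \<otimes>\<^bsub>G\<^esub> x = a [^]\<^bsub>G\<^esub> (4::nat)" "y \<otimes>\<^bsub>G\<^esub> y = a [^]\<^bsub>G\<^esub> (4::nat)"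
    "x \<otimes>\<^bsub>G\<^esub> y \<noteq> y \<otimes>\<^bsub>G\<^esub> x"
    using all_embed_8_quaternion[OF assms a] .
  obtain s t where fp: "four_pair a s t" and tz: "t \<otimes>\<^bsub>G\<^esub> a [^]\<^bsub>G\<^esub> (4::nat) = a [^]\<^bsub>G\<^esub> (4::nat) \<otimes>\<^bsub>G\<^esub> t"
    and sA: "cj G s a \<in> powers a"
    using normalizing_four_pair[OF assms(2) a fp0(1) assms(4) fp0(2,3) nat_pow_closed[OF a(1)]] by blast
  have st: "s \<in> carrier G" "t \<in> carrier G" "s \<otimes>\<^bsub>G\<^esub> s = \<one>\<^bsub>G\<^esub>" "t \<otimes>\<^bsub>G\<^esub> t = \<one>\<^bsub>G\<^esub>" "s \<otimes>\<^bsub>G\<^esub> t = t \<otimes>\<^bsub>G\<^esub> s"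
    "s \<notin> powers a" "t \<notin> powers a" "s \<otimes>\<^bsub>G\<^esub> t \<notin> powers a"
    using fp by (auto simp: four_pair_def)
  have a8: "a [^]\<^bsub>G\<^esub> (8::nat) = \<one>\<^bsub>G\<^esub>" using a by (metis pow_ord_eq_1)
  have pe: "a [^]\<^bsub>G\<^esub> m = a [^]\<^bsub>G\<^esub> n \<longleftrightarrow> m mod 8 = n mod 8" for m n :: nat
    using pow_eq_iff_mod[OF assms(2) a(1)] a(2) by simp
  \<comment> \<open>An involution acts by an exponent whose square is 1 modulo 8, that is, by an odd
    one.\<close>
  have unit: "\<exists>k. (k = 1 \<or> k = 3 \<or> k = 5 \<or> k = 7) \<and> cj G b a = a [^]\<^bsub>G\<^esub> (k::nat)"
    if b: "b \<in> carrier G" "b \<otimes>\<^bsub>G\<^esub> b = \<one>\<^bsub>G\<^esub>" "cj G b a \<in> powers a" for b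
  proof -
    obtain k where k: "k < 8" "cj G b a = a [^]\<^bsub>G\<^esub> (k::nat)" using b(3) powers_eq[OF a(1) a8] by auto
    have "a [^]\<^bsub>G\<^esub> (k * k) = cj G b (cj G b a)" using k b a(1) by (simp add: cj_pow nat_pow_pow)
    also have "\<dots> = a [^]\<^bsub>G\<^esub> (1::nat)" using b(1,2) a(1) by (simp add: cj_cj[symmetric])
    finally have "k * k mod 8 = 1" using pe[of "k * k" 1] by simp
    moreover have "k \<in> {0, 1, 2, 3, 4, 5, 6, 7}" using k(1) by simp presburger
    ultimately have "k = 1 \<or> k = 3 \<or> k = 5 \<or> k = 7" by auto
    then show ?thesis using k(2) by blast
  qed
  obtain k where k: "k = 1 \<or> k = 3 \<or> k = 5 \<or> k = 7" "cj G s a = a [^]\<^bsub>G\<^esub> (k::nat)" using unit[OF st(1,3) sA] by blast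
  have A: "subgroup (powers a) G" using subgroup_powers[OF assms(2) a(1)] .
  have tc: "cj G t a = t \<otimes>\<^bsub>G\<^esub> a \<otimes>\<^bsub>G\<^esub> t" using st inv_equality[of t t] by (simp add: cj_def)
  obtain i b where b: "b \<in> {\<one>\<^bsub>G\<^esub>, s, t, s \<otimes>\<^bsub>G\<^esub> t}" "cj G t a = a [^]\<^bsub>G\<^esub> (i::nat) \<otimes>\<^bsub>G\<^esub> b"
    using four_pair_bound(2)[OF assms(2) a fp assms(4) cj_closed[OF st(2) a(1)]] by blast
  \<comment> \<open>If the component were \<open>t\<close>, cancelling \<open>t\<close> would
    express \<open>t\<close> as a power of \<open>a\<close>; the component s t leads to s t being
    such a power in the same way.\<close>
  have "b \<noteq> t"
  proof
    assume "b = t"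
    then have "t \<otimes>\<^bsub>G\<^esub> a = a [^]\<^bsub>G\<^esub> i" using b(2) tc st a(1) by simp
    then have "t = a [^]\<^bsub>G\<^esub> i \<otimes>\<^bsub>G\<^esub> inv\<^bsub>G\<^esub> a" using st a(1) by (simp add: inv_solve_right)
    also have "\<dots> \<in> powers a" using A self_in_powers[OF a(1)] by (simp add: subgroup.m_closed subgroup.m_inv_closed)
    finally show False using st(7) by simp
  qed
  moreover have "b \<noteq> s \<otimes>\<^bsub>G\<^esub> t"
  proof
    assume "b = s \<otimes>\<^bsub>G\<^esub> t"
    then have "t \<otimes>\<^bsub>G\<^esub> a \<otimes>\<^bsub>G\<^esub> t = (a [^]\<^bsub>G\<^esub> i \<otimes>\<^bsub>G\<^esub> s) \<otimes>\<^bsub>G\<^esub> t" using b(2) tc st a(1) by (simp add: m_assoc)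
    then have eq: "t \<otimes>\<^bsub>G\<^esub> a = a [^]\<^bsub>G\<^esub> i \<otimes>\<^bsub>G\<^esub> s" using st a(1) by simp
    have "s \<otimes>\<^bsub>G\<^esub> t \<otimes>\<^bsub>G\<^esub> a = s \<otimes>\<^bsub>G\<^esub> (a [^]\<^bsub>G\<^esub> i \<otimes>\<^bsub>G\<^esub> s)" using eq st(1,2) a(1) by (simp add: m_assoc)
    also have "\<dots> = cj G s (a [^]\<^bsub>G\<^esub> i)" using st inv_equality[of s s] a(1) by (simp add: cj_def m_assoc)
    also have "\<dots> = a [^]\<^bsub>G\<^esub> (k * i)" using st a(1) k(2) by (simp add: cj_pow nat_pow_pow)
    finally have "s \<otimes>\<^bsub>G\<^esub> t = a [^]\<^bsub>G\<^esub> (k * i) \<otimes>\<^bsub>G\<^esub> inv\<^bsub>G\<^esub> a" using st(1,2) a(1) by (simp add: inv_solve_right)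
    also have "\<dots> \<in> powers a" using A self_in_powers[OF a(1)] by (simp add: subgroup.m_closed subgroup.m_inv_closed)
    finally show False using st(8) by simp
  qed
  moreover have "b \<noteq> s"
    using order_8_not_normal[OF assms(2) a fp assms(4) tz xy k(2,1), of i] b(2) by blast
  ultimately have "b = \<one>\<^bsub>G\<^esub>" using b(1) by blast
  then have "cj G t a \<in> powers a" using b(2) a(1) by simp
  then obtain j where j: "j = 1 \<or> j = 3 \<or> j = 5 \<or> j = 7" "cj G t a = a [^]\<^bsub>G\<^esub> (j::nat)" using unit[OF st(2,4)] by blast
  obtain s' t' k' where tri: "k' = 1 \<or> k' = 5" "tri G a s' t' 8 3 k'"
    using order_8_normal[OF assms(2) a fp assms(4) xy k(2,1) j(2,1)] by blast
  from tri(1) show ?thesis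
  proof
    assume "k' = 1"
    then have "tri G a s' t' 8 3 1" using tri(2) by simp
    then have "G \<cong> integer_mod_group 2 \<times>\<times> aff 8 {1, 3}" by (rule tri_iso[OF _ tri_DirProd_aff_8])
    then show ?thesis ..
  next
    assume "k' = 5"
    then have "tri G a s' t' 8 3 5" using tri(2) by simp
    then have "G \<cong> aff 8 {1, 3, 5, 7}" by (rule tri_iso[OF _ tri_aff_8])
    then show ?thesis ..
  qed
qed

subsection \<open>Permutation representations on cosets\<close>

context group
begin

text \<open>The action on the cosets of \<open>H\<close>, numbered by \<open>e\<close> to match the
  points of \<open>sym_group\<close>. The second conclusion says that the kernel lies in every
  conjugate of \<open>H\<close>.\<close>

lemma coset_perm_hom:
  assumes fin: "finite (carrier G)" and H: "subgroup H G" and m: "order G = m * card H"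
  obtains \<phi> where "\<phi> \<in> hom G (sym_group m)"
    "\<And>g x. g \<in> carrier G \<Longrightarrow> \<phi> g = id \<Longrightarrow> x \<in> carrier G \<Longrightarrow> cj G x g \<in> H"
proof -
  interpret H: subgroup H G by fact
  let ?E = "rcosets H"
  have "card ?E * card H = order G" using lagrange[OF H] .
  moreover have "card H > 0" using subgroup.finite_imp_card_positive[OF H fin] .
  ultimately have cE: "card ?E = m" using m by simp
  have finE: "finite ?E" using fin H by (metis rcosets_part_G finite_UnionD)
  obtain e where e: "bij_betw e {1..m} ?E"
    using ex_bij_betw_nat_finite_1[OF finE] cE by blast
  define e' where "e' = inv_into {1..m} e"
  have e': "e' C \<in> {1..m}" "e (e' C) = C" if "C \<in> ?E" for C
    using that e inv_into_into[of C e "{1..m}"] f_inv_into_f[of C e "{1..m}"] unfolding e'_def bij_betw_def by blast+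
  have ee: "e i \<in> ?E" "e' (e i) = i" if "i \<in> {1..m}" for i
    using that e unfolding e'_def by (auto simp: bij_betw_def)
  have cl: "C #> x \<in> ?E" if C: "C \<in> ?E" "x \<in> carrier G" for C x
  proof -
    obtain g where "g \<in> carrier G" "C = H #> g" using C(1) unfolding RCOSETS_def by blast
    then show ?thesis using C(2) H.subset by (simp add: coset_mult_assoc rcosetsI)
  qed
  have sub: "C \<subseteq> carrier G" if "C \<in> ?E" for C using H.rcosets_carrier[OF is_group that] .
  define \<phi> where "\<phi> g = (\<lambda>i. if i \<in> {1..m} then e' (e i #> inv g) else i)" for g
  have \<phi>in: "\<phi> g i \<in> {1..m}" if "g \<in> carrier G" "i \<in> {1..m}" for g i
    using that ee e' cl by (simp add: \<phi>_def)
  have \<phi>m: "\<phi> (g \<otimes> h) = \<phi> g \<circ> \<phi> h" if "g \<in> carrier G" "h \<in> carrier G" for g h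
  proof
    fix i
    show "\<phi> (g \<otimes> h) i = (\<phi> g \<circ> \<phi> h) i"
    proof (cases "i \<in> {1..m}")
      case True
      have "e i #> inv (g \<otimes> h) = (e i #> inv h) #> inv g"
        using that sub[OF ee(1)[OF True]] by (simp add: coset_mult_assoc inv_mult_group)
      moreover have "e (e' (e i #> inv h)) = e i #> inv h" "e' (e i #> inv h) \<in> {1..m}"
        using e' cl ee(1)[OF True] that by simp_all
      ultimately show ?thesis using True by (simp add: \<phi>_def)
    qed (auto simp: \<phi>_def)
  qed
  have \<phi>1: "\<phi> \<one> = id"
  proof
    fix i show "\<phi> \<one> i = id i" using ee sub by (auto simp: \<phi>_def)
  qed
  have perm: "\<phi> g permutes {1..m}" if g: "g \<in> carrier G" for g
  proof (rule bij_imp_permutes)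
    have "\<phi> g \<circ> \<phi> (inv g) = id" "\<phi> (inv g) \<circ> \<phi> g = id"
      using \<phi>m[OF g inv_closed[OF g]] \<phi>m[OF inv_closed[OF g] g] g \<phi>1 by simp_all
    then have "\<phi> g (\<phi> (inv g) i) = i" "\<phi> (inv g) (\<phi> g i) = i" for i by (metis comp_apply id_apply)+
    then show "bij_betw (\<phi> g) {1..m} {1..m}"
      using \<phi>in g by (intro bij_betwI[where g = "\<phi> (inv g)"]) auto
  qed (auto simp: \<phi>_def)
  have "\<phi> \<in> hom G (sym_group m)"
    using perm \<phi>m by (simp add: hom_def sym_group_def)
  moreover have "cj G x g \<in> H" if g: "g \<in> carrier G" "\<phi> g = id" "x \<in> carrier G" for g x
  proof -
    have C: "H #> x \<in> ?E" using g(3) by (rule rcosetsI[OF H.subset])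
    have "\<phi> g (e' (H #> x)) = e' (H #> x)" using g(2) by simp
    then have "e' (H #> x #> inv g) = e' (H #> x)" using e'[OF C] by (simp add: \<phi>_def)
    then have "H #> x #> inv g = H #> x" using e'(2)[OF C] e'(2)[OF cl[OF C inv_closed[OF g(1)]]] by metis
    moreover have "H #> x #> inv g #> g = H #> x"
      using g H.subset by (simp add: coset_mult_assoc m_assoc)
    ultimately have "H #> x #> g = H #> x" by simp
    \<comment> \<open>\<open>fixed_coset_iff\<close> speaks of a subgroup, so the fixed coset is
      carried from \<open>g\<close> to all its powers.\<close>
    then have fixed: "H #> x #> q = H #> x" if "q \<in> powers g" for q
    proof -
      obtain i where "q = g [^] (i::nat)" using \<open>q \<in> powers g\<close> by blast
      moreover have "H #> x #> g [^] (i::nat) = H #> x" for i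
      proof (induction i)
        case 0
        then show ?case using g H.subset r_coset_subset_G by simp
      next
        case (Suc i)
        have "H #> x #> g [^] Suc i = (H #> x #> g [^] i) #> g"
          using g H.subset by (simp add: coset_mult_assoc m_assoc)
        then show ?case using Suc \<open>H #> x #> g = H #> x\<close> by simp
      qed
      ultimately show ?thesis by simp
    qed
    then show "cj G x g \<in> H"
      using fixed_coset_iff[OF subgroup_powers[OF fin g(1)] H g(3)] self_in_powers[OF g(1)] by blast
  qed
  ultimately show thesis by (rule that)
qed

lemma coprime_subgroups:
  assumes "finite (carrier G)" "subgroup H G" "subgroup K G" "coprime (card H) (card K)" "x \<in> H" "x \<in> K"
  shows "x = \<one>"
proof -
  have x: "x \<in> carrier G" using assms(2,5) by (rule subgroup.mem_carrier)
  have "ord x dvd 1" using ord_dvd_card[OF assms(1,2,5)] ord_dvd_card[OF assms(1,3,6)] assms(4)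
    by (metis coprime_common_divisor_nat nat_dvd_1_iff_1)
  then show ?thesis using ord_eq_1[OF x] by simp
qed

text \<open>The actions on 3 and on 4 cosets are combined; an element in both kernels has all its
  conjugates in \<open>H\<close> and in \<open>K\<close>.\<close>

lemma embeds_sym_3_4:
  assumes fin: "finite (carrier G)" and H: "subgroup H G" "order G = 3 * card H" "subgroup K G" "order G = 4 * card K"
    and core: "\<And>g. g \<in> carrier G \<Longrightarrow> (\<And>x. x \<in> carrier G \<Longrightarrow> cj G x g \<in> H \<and> cj G x g \<in> K) \<Longrightarrow> g = \<one>"
  shows "embeds G (sym_group 3 \<times>\<times> sym_group 4)"
proof -
  obtain \<phi> where \<phi>: "\<phi> \<in> hom G (sym_group 3)"
    "\<And>g x. g \<in> carrier G \<Longrightarrow> \<phi> g = id \<Longrightarrow> x \<in> carrier G \<Longrightarrow> cj G x g \<in> H"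
    by (rule coset_perm_hom[OF fin H(1,2)]) blast
  obtain \<psi> where \<psi>: "\<psi> \<in> hom G (sym_group 4)"
    "\<And>g x. g \<in> carrier G \<Longrightarrow> \<psi> g = id \<Longrightarrow> x \<in> carrier G \<Longrightarrow> cj G x g \<in> K"
    by (rule coset_perm_hom[OF fin H(3,4)]) blast
  have P: "group (sym_group 3 \<times>\<times> sym_group 4)" by (intro DirProd_group sym_group_is_group)
  have h: "(\<lambda>x. (\<phi> x, \<psi> x)) \<in> hom G (sym_group 3 \<times>\<times> sym_group 4)"
    using \<phi>(1) \<psi>(1) by (simp add: hom_paired)
  interpret h: group_hom G "sym_group 3 \<times>\<times> sym_group 4" "\<lambda>x. (\<phi> x, \<psi> x)"
    using P h by (simp add: group_hom_def group_hom_axioms_def is_group)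
  have "g = \<one>" if "g \<in> carrier G" "(\<phi> g, \<psi> g) = \<one>\<^bsub>sym_group 3 \<times>\<times> sym_group 4\<^esub>" for g
    using that core \<phi>(2) \<psi>(2) by (simp add: sym_group_one)
  then have "inj_on (\<lambda>x. (\<phi> x, \<psi> x)) (carrier G)" using h.inj_on_one_iff by blast
  then show ?thesis using embedsI[OF is_group P h] by blast
qed

end

text \<open>A Sylow 2-subgroup has index 3 and a Sylow 3-subgroup index 4. Their orders are coprime,
  so the two coset actions together are faithful.\<close>

lemma all_embed_12: "all_embed 12 (sym_group 3 \<times>\<times> sym_group 4)"
  unfolding all_embed_def
proof (intro allI impI, elim conjE)
  fix K :: "nat monoid" assume K: "group K" "order K = 12"
  interpret group K by fact
  have fin: "finite (carrier K)" using K(2) order_finite by simp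
  obtain H where H: "subgroup H K" "card H = 2 ^ 2"
    using sylow_thm[OF two_is_prime_nat K(1) _ fin, of 2 3] K(2) by auto
  have p3: "prime (3::nat)" by simp
  obtain D where D: "subgroup D K" "card D = 3 ^ 1"
    using sylow_thm[OF p3 K(1) _ fin, of 1 4] K(2) by auto
  have "g = \<one>\<^bsub>K\<^esub>" if "g \<in> carrier K" "\<And>x. x \<in> carrier K \<Longrightarrow> cj K x g \<in> H \<and> cj K x g \<in> D" for g
  proof (rule coprime_subgroups[OF fin H(1) D(1)])
    show "coprime (card H) (card D)" using H(2) D(2) by (simp add: coprime_iff_gcd_eq_1 gcd_red_nat[of 4 3])
    show "g \<in> H" "g \<in> D" using that(2)[of "\<one>\<^bsub>K\<^esub>"] that(1) by simp_all
  qed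
  then show "embeds K (sym_group 3 \<times>\<times> sym_group 4)"
    using H D K(2) by (intro embeds_sym_3_4[OF fin H(1) _ D(1)]) auto
qed

lemma order_sym_3_4: "order (sym_group 3 \<times>\<times> sym_group 4) = 144"
  by (simp add: order_DirProd order_def[of "sym_group _"] sym_group_card_carrier fact_numeral)


subsection \<open>Elements of the groups of order 12\<close>

lemma quat_12: "subgroup (quat 12 5) (aff 12 {1, 5})" "card (quat 12 5) = 12"
proof -
  show "subgroup (quat 12 5) (aff 12 {1, 5})"
    by (rule group.finite_subgroupI[OF group_aff_12])
      (auto simp: quat_def mod_even intro: finite_subset[of _ "{1, 5} \<times> {0..<12}"])
  have "quat 12 5 = {(1, 0), (1, 2), (1, 4), (1, 6), (1, 8), (1, 10), (5, 1), (5, 3), (5, 5), (5, 7), (5, 9), (5, 11)}" (is "_ = ?S")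
  proof
    show "quat 12 5 \<subseteq> ?S"
    proof
      fix x assume "x \<in> quat 12 5"
      then have "(fst x = 1 \<or> fst x = 5) \<and> snd x \<in> {0,1,2,3,4,5,6,7,8,9,10,11} \<and> (even (snd x) \<longleftrightarrow> fst x = 1)"
        unfolding quat_def by (simp add: mem_Times_iff) presburger
      then show "x \<in> ?S" by (cases x) auto
    qed
  qed (auto simp: quat_def)
  then show "card (quat 12 5) = 12" by simp
qed

text \<open>What Sylow conjugacy says about elements of order 3, kept separate from the size of
  \<open>S\<close>: it holds for Sylow 3-subgroups of either order and trivially for the whole
  carrier.\<close>

definition absorbs_order_3 :: "('a, 'm) monoid_scheme \<Rightarrow> 'a set \<Rightarrow> bool"
  where "absorbs_order_3 G S \<longleftrightarrow> (\<forall>x\<in>carrier G. x [^]\<^bsub>G\<^esub> (3::nat) = \<one>\<^bsub>G\<^esub> \<longrightarrow> (\<exists>g\<in>carrier G. cj G g x \<in> S))"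

context group
begin

text \<open>An embedding followed by a conjugation of \<open>G\<close> is again an embedding, so the
  image of \<open>k\<close> may be moved into \<open>S\<close>.\<close>

lemma embed_absorbed:
  assumes "all_embed 12 G" "absorbs_order_3 G S" "group K" "order K = 12" "k \<in> carrier K" "k [^]\<^bsub>K\<^esub> (3::nat) = \<one>\<^bsub>K\<^esub>"
  obtains \<phi> where "\<phi> \<in> hom K G" "inj_on \<phi> (carrier K)" "\<phi> k \<in> S"
proof -
  obtain \<phi> where \<phi>: "\<phi> \<in> hom K G" "inj_on \<phi> (carrier K)"
    using all_embed_hom[OF assms(1) is_group assms(3,4)] by auto
  interpret \<phi>: group_hom K G \<phi> using assms(3) \<phi>(1) by (simp add: group_hom_def group_hom_axioms_def is_group)
  have k: "\<phi> k \<in> carrier G" "\<phi> k [^] (3::nat) = \<one>"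
    using \<phi>.hom_closed[OF assms(5)] \<phi>.hom_nat_pow[OF assms(5), of 3] assms(6) \<phi>.hom_one by simp_all
  then obtain g where g: "g \<in> carrier G" "cj G g (\<phi> k) \<in> S" using assms(2) unfolding absorbs_order_3_def by blast
  have "(\<lambda>x. cj G g (\<phi> x)) \<in> hom K G"
    using g(1) by (auto simp: hom_def cj_m)
  moreover have "inj_on (\<lambda>x. cj G g (\<phi> x)) (carrier K)"
    using g(1) \<phi>(2) by (auto simp: inj_on_def)
  ultimately show thesis using that g(2) by blast
qed

text \<open>Modulo 12 the element 4 has order 3 and the element 3 has order 4; they provide
  \<open>e\<close> and \<open>f\<close>.\<close>

lemma cyclic_12_data:
  assumes "all_embed 12 G" "absorbs_order_3 G S"
  obtains e f where "e \<in> S" "e \<in> carrier G" "f \<in> carrier G" "e [^] (3::nat) = \<one>" "e \<noteq> \<one>" "f [^] (4::nat) = \<one>" "f [^] (2::nat) \<noteq> \<one>"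
    "cj G f e = e"
proof -
  let ?K = "integer_mod_group 12"
  have m: "4 \<in> carrier ?K" "3 \<in> carrier ?K" "8 \<in> carrier ?K" "6 \<in> carrier ?K" by (simp_all add: carrier_integer_mod_group)
  obtain \<phi> where \<phi>: "\<phi> \<in> hom ?K G" "inj_on \<phi> (carrier ?K)" "\<phi> 4 \<in> S"
    by (rule embed_absorbed[OF assms, of ?K 4]) (use m in \<open>simp_all add: order_integer_mod_group\<close>)
  interpret \<phi>: group_hom ?K G \<phi> using \<phi>(1) by (simp add: group_hom_def group_hom_axioms_def is_group)
  have one: "\<phi> 0 = \<one>" using \<phi>.hom_one by simp
  have "\<phi> 4 [^] (3::nat) = \<one>" "\<phi> 3 [^] (4::nat) = \<one>" "\<phi> 3 [^] (2::nat) = \<phi> 6"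
    using \<phi>.hom_nat_pow[OF m(1), of 3] \<phi>.hom_nat_pow[OF m(2), of 4] \<phi>.hom_nat_pow[OF m(2), of 2] one by simp_all
  moreover have "\<phi> 4 \<noteq> \<phi> 0" "\<phi> 6 \<noteq> \<phi> 0" using \<phi>(2) m by (simp_all add: inj_on_eq_iff)
  moreover have "cj G (\<phi> 3) (\<phi> 4) = \<phi> 4"
    using hom_cj[OF group_integer_mod_group is_group \<phi>(1) m(2,1)] m by (simp add: cj_integer_mod_group)
  ultimately show thesis using that[OF \<phi>(3), of "\<phi> 3"] \<phi>.hom_closed m one by simp
qed

text \<open>As \<one> has only itself as a power, \<open>four_pair \<one> q r\<close> just says that
  \<open>q\<close> and \<open>r\<close> generate a four-group.\<close>

lemma cyclic_2_6_data:
  assumes "all_embed 12 G" "absorbs_order_3 G S"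
  obtains e q r where "e \<in> S" "e \<in> carrier G" "q \<in> carrier G" "r \<in> carrier G" "e \<noteq> \<one>"
    "four_pair \<one> q r" "cj G q e = e" "cj G r e = e"
proof -
  let ?K = "integer_mod_group 2 \<times>\<times> integer_mod_group 6"
  have K: "group ?K" "order ?K = 12" by (simp_all add: DirProd_group order_DirProd order_integer_mod_group)
  have m: "(0, 2) \<in> carrier ?K" "(1, 0) \<in> carrier ?K" "(0, 3) \<in> carrier ?K" "(1, 3) \<in> carrier ?K" "(0, 0) \<in> carrier ?K"
    by (simp_all add: carrier_integer_mod_group)
  obtain \<phi> where \<phi>: "\<phi> \<in> hom ?K G" "inj_on \<phi> (carrier ?K)" "\<phi> (0, 2) \<in> S"
    by (rule embed_absorbed[OF assms K, of "(0, 2)"]) (use m in \<open>simp_all add: pow_DirProd\<close>)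
  interpret \<phi>: group_hom ?K G \<phi> using \<phi>(1) K by (simp add: group_hom_def group_hom_axioms_def is_group)
  have one: "\<phi> (0, 0) = \<one>" using \<phi>.hom_one by simp
  have "\<phi> (0, 2) \<noteq> \<phi> (0, 0)" "\<phi> (1, 0) \<noteq> \<phi> (0, 0)" "\<phi> (0, 3) \<noteq> \<phi> (0, 0)" "\<phi> (1, 3) \<noteq> \<phi> (0, 0)"
    using m by (simp_all only: inj_on_eq_iff[OF \<phi>(2)]) simp_all
  moreover have "\<phi> (1, 0) \<otimes> \<phi> (0, 3) = \<phi> (1, 3)" "\<phi> (0, 3) \<otimes> \<phi> (1, 0) = \<phi> (1, 3)"
    "\<phi> (1, 0) \<otimes> \<phi> (1, 0) = \<phi> (0, 0)" "\<phi> (0, 3) \<otimes> \<phi> (0, 3) = \<phi> (0, 0)"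
    using \<phi>.hom_mult[OF m(2,3)] \<phi>.hom_mult[OF m(3,2)] \<phi>.hom_mult[OF m(2,2)] \<phi>.hom_mult[OF m(3,3)] by simp_all
  moreover have "cj G (\<phi> (1, 0)) (\<phi> (0, 2)) = \<phi> (0, 2)" "cj G (\<phi> (0, 3)) (\<phi> (0, 2)) = \<phi> (0, 2)"
    using hom_cj[OF K(1) is_group \<phi>(1) m(2,1)] hom_cj[OF K(1) is_group \<phi>(1) m(3,1)] m
    by (simp_all add: cj_DirProd cj_integer_mod_group carrier_integer_mod_group)
  ultimately show thesis using that[OF \<phi>(3), of "\<phi> (1, 0)" "\<phi> (0, 3)"] \<phi>.hom_closed m one by (auto simp: four_pair_def)
qed

text \<open>In affine maps modulo 6 the rotation of order 3 is the translation by 2, the central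
  involution \<open>z\<close> the translation by 3 and \<open>r\<close> a reflection.\<close>

lemma dihedral_12_data:
  assumes "all_embed 12 G" "absorbs_order_3 G S"
  obtains e r z where "e \<in> S" "e \<in> carrier G" "r \<in> carrier G" "z \<in> carrier G" "e [^] (3::nat) = \<one>" "e \<noteq> \<one>"
    "four_pair \<one> r z" "cj G r e = e [^] (2::nat)" "cj G z e = e"
proof -
  let ?K = "aff 6 {1, 5}"
  have K: "group ?K" "order ?K = 12" using group_aff_2[of 6] by (simp_all add: order_aff)
  have m: "(1, 2) \<in> carrier ?K" "(5, 0) \<in> carrier ?K" "(1, 3) \<in> carrier ?K" "(5, 3) \<in> carrier ?K" "(1, 0) \<in> carrier ?K" "(1, 4) \<in> carrier ?K"
    by simp_all
  obtain \<phi> where \<phi>: "\<phi> \<in> hom ?K G" "inj_on \<phi> (carrier ?K)" "\<phi> (1, 2) \<in> S"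
    by (rule embed_absorbed[OF assms K, of "(1, 2)"]) (simp_all add: pow_aff_translation)
  interpret \<phi>: group_hom ?K G \<phi> using \<phi>(1) K by (simp add: group_hom_def group_hom_axioms_def is_group)
  have one: "\<phi> (1, 0) = \<one>" using \<phi>.hom_one by simp
  have "\<phi> (1, 2) \<noteq> \<phi> (1, 0)" "\<phi> (5, 0) \<noteq> \<phi> (1, 0)" "\<phi> (1, 3) \<noteq> \<phi> (1, 0)" "\<phi> (5, 3) \<noteq> \<phi> (1, 0)"
    using m by (simp_all only: inj_on_eq_iff[OF \<phi>(2)]) simp_all
  moreover have "\<phi> (5, 0) \<otimes> \<phi> (1, 3) = \<phi> (5, 3)" "\<phi> (1, 3) \<otimes> \<phi> (5, 0) = \<phi> (5, 3)"
    "\<phi> (5, 0) \<otimes> \<phi> (5, 0) = \<phi> (1, 0)" "\<phi> (1, 3) \<otimes> \<phi> (1, 3) = \<phi> (1, 0)"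
    using \<phi>.hom_mult[OF m(2,3)] \<phi>.hom_mult[OF m(3,2)] \<phi>.hom_mult[OF m(2,2)] \<phi>.hom_mult[OF m(3,3)] by simp_all
  moreover have "cj ?K (5, 0) (1, 2) = (1, 4)" "cj ?K (1, 3) (1, 2) = (1, 2)"
    using K(1) by (simp_all add: cj_aff_iff)
  then have "cj G (\<phi> (5, 0)) (\<phi> (1, 2)) = \<phi> (1, 4)" "cj G (\<phi> (1, 3)) (\<phi> (1, 2)) = \<phi> (1, 2)"
    using hom_cj[OF K(1) is_group \<phi>(1) m(2,1)] hom_cj[OF K(1) is_group \<phi>(1) m(3,1)] by simp_all
  moreover have "\<phi> (1, 2) [^] (2::nat) = \<phi> (1, 4)" "\<phi> (1, 2) [^] (3::nat) = \<phi> (1, 0)"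
    using \<phi>.hom_nat_pow[OF m(1), of 2] \<phi>.hom_nat_pow[OF m(1), of 3] by (simp_all add: pow_aff_translation)
  ultimately show thesis using that[OF \<phi>(3), of "\<phi> (5, 0)" "\<phi> (1, 3)"] \<phi>.hom_closed m one by (auto simp: four_pair_def)
qed

lemma dicyclic_12_data:
  assumes "all_embed 12 G" "absorbs_order_3 G S"
  obtains e f where "e \<in> S" "e \<in> carrier G" "f \<in> carrier G" "e [^] (3::nat) = \<one>" "e \<noteq> \<one>"
    "f [^] (4::nat) = \<one>" "f [^] (2::nat) \<noteq> \<one>" "cj G f e = e [^] (2::nat)"
proof -
  let ?A = "aff 12 {1, 5}"
  let ?K = "?A\<lparr>carrier := quat 12 5\<rparr>"
  interpret A: group ?A by (rule group_aff_12)
  have K: "group ?K" "order ?K = 12"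
    using A.subgroup_imp_group[OF quat_12(1)] quat_12(2) by (simp_all add: order_def)
  have m: "(1, 4) \<in> carrier ?K" "(5, 1) \<in> carrier ?K" "(1, 6) \<in> carrier ?K" "(1, 8) \<in> carrier ?K" "(1, 0) \<in> carrier ?K"
    by (simp_all add: quat_def)
  have p: "(1, 4) [^]\<^bsub>?K\<^esub> (2::nat) = (1, 8)" "(1, 4) [^]\<^bsub>?K\<^esub> (3::nat) = (1, 0)"
    "(5, 1) [^]\<^bsub>?K\<^esub> (2::nat) = (1, 6)" "(5, 1) [^]\<^bsub>?K\<^esub> (4::nat) = (1, 0)"
    by (simp_all add: numeral_eq_Suc)
  obtain \<phi> where \<phi>: "\<phi> \<in> hom ?K G" "inj_on \<phi> (carrier ?K)" "\<phi> (1, 4) \<in> S"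
    by (rule embed_absorbed[OF assms K m(1)]) (use p in simp)
  interpret \<phi>: group_hom ?K G \<phi> using \<phi>(1) K by (simp add: group_hom_def group_hom_axioms_def is_group)
  have one: "\<phi> (1, 0) = \<one>" using \<phi>.hom_one by simp
  have "\<phi> (1, 4) \<noteq> \<phi> (1, 0)" "\<phi> (1, 6) \<noteq> \<phi> (1, 0)"
    using m by (simp_all only: inj_on_eq_iff[OF \<phi>(2)]) simp_all
  moreover have "cj ?A (5, 1) (1, 4) = (1, 8)" by (simp add: cj_aff_iff[OF A.is_group])
  then have "cj ?K (5, 1) (1, 4) = (1, 8)" using A.cj_sub[OF quat_12(1), of "(5, 1)"] m(2) by simp
  then have "cj G (\<phi> (5, 1)) (\<phi> (1, 4)) = \<phi> (1, 8)"
    using hom_cj[OF K(1) is_group \<phi>(1) m(2,1)] by simp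
  moreover have "\<phi> (1, 4) [^] (2::nat) = \<phi> (1, 8)" "\<phi> (1, 4) [^] (3::nat) = \<phi> (1, 0)"
    "\<phi> (5, 1) [^] (2::nat) = \<phi> (1, 6)" "\<phi> (5, 1) [^] (4::nat) = \<phi> (1, 0)"
    using \<phi>.hom_nat_pow[OF m(1), of 2] \<phi>.hom_nat_pow[OF m(1), of 3] \<phi>.hom_nat_pow[OF m(2), of 2] \<phi>.hom_nat_pow[OF m(2), of 4] p
    by simp_all
  ultimately show thesis using that[OF \<phi>(3), of "\<phi> (5, 1)"] \<phi>.hom_closed m one by simp
qed

text \<open>\<open>d\<close> is a three-cycle, and \<open>v\<close>, \<open>w\<close> and their
  product are the double transpositions, which \<open>d\<close> permutes cyclically. Only the
  relations between \<open>d\<close> and \<open>v\<close> are exported.\<close>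

lemma alternating_12_data:
  assumes "all_embed 12 G" "absorbs_order_3 G S"
  obtains d v where "d \<in> S" "d \<in> carrier G" "v \<in> carrier G" "d [^] (3::nat) = \<one>" "d \<noteq> \<one>"
    "v \<noteq> \<one>" "v \<otimes> v = \<one>" "cj G d v \<noteq> v" "v \<otimes> cj G d v = cj G d v \<otimes> v" "cj G d (cj G d v) = v \<otimes> cj G d v"
proof -
  let ?K = "alt_group 4"
  define v :: "nat \<Rightarrow> nat" where "v = Transposition.transpose 1 2 \<circ> Transposition.transpose 3 4"
  define w :: "nat \<Rightarrow> nat" where "w = Transposition.transpose 1 4 \<circ> Transposition.transpose 2 3"
  define d :: "nat \<Rightarrow> nat" where "d = Transposition.transpose 1 2 \<circ> Transposition.transpose 2 3"
  have K: "group ?K" "order ?K = 12"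
    using alt_group_is_group alt_group_card_carrier[of 4] by (simp_all add: order_def fact_numeral)
  have ev: "evenperm (Transposition.transpose i j \<circ> Transposition.transpose k l)" if "i \<noteq> j" "k \<noteq> l" for i j k l :: nat
    using that by (simp add: evenperm_comp permutation_swap_id evenperm_swap)
  have m: "v \<in> carrier ?K" "w \<in> carrier ?K" "d \<in> carrier ?K"
    unfolding alt_group_carrier v_def w_def d_def
    by (auto intro!: permutes_compose permutes_swap_id ev)
  have mul: "x \<otimes>\<^bsub>?K\<^esub> y = x \<circ> y" for x y by (simp add: alt_group_mult)
  have one: "\<one>\<^bsub>?K\<^esub> = id" by (simp add: alt_group_one)
  have vv: "v \<circ> v = id" "v \<circ> w = w \<circ> v" "d \<circ> v = w \<circ> d" "d \<circ> w = (v \<circ> w) \<circ> d" "d \<circ> d \<circ> d = id"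
    by (auto simp: fun_eq_iff v_def w_def d_def Transposition.transpose_def)
  have ne: "v \<noteq> id" "d \<noteq> id" "w \<noteq> v"
  proof -
    have "v 1 = 2" "w 1 = 4" "d 1 = 2" by (simp_all add: v_def w_def d_def Transposition.transpose_def)
    then show "v \<noteq> id" "d \<noteq> id" "w \<noteq> v" by auto
  qed
  have "d [^]\<^bsub>?K\<^esub> (3::nat) = id"
    using vv(5) by (simp add: numeral_3_eq_3 mul one)
  then have d3: "d [^]\<^bsub>?K\<^esub> (3::nat) = \<one>\<^bsub>?K\<^esub>" by (simp add: one)
  obtain \<phi> where \<phi>: "\<phi> \<in> hom ?K G" "inj_on \<phi> (carrier ?K)" "\<phi> d \<in> S"
    by (rule embed_absorbed[OF assms K m(3) d3])
  interpret \<phi>: group_hom ?K G \<phi> using \<phi>(1) K by (simp add: group_hom_def group_hom_axioms_def is_group)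
  have vw: "v \<otimes>\<^bsub>?K\<^esub> w \<in> carrier ?K" using K(1) m by (simp add: group.is_monoid monoid.m_closed)
  have "cj ?K d v = w" "cj ?K d w = v \<otimes>\<^bsub>?K\<^esub> w"
    using group.cj_eq_iff[OF K(1) m(3,1,2)] group.cj_eq_iff[OF K(1) m(3,2) vw] vv(3,4) by (simp_all add: mul)
  then have c: "cj G (\<phi> d) (\<phi> v) = \<phi> w" "cj G (\<phi> d) (\<phi> w) = \<phi> v \<otimes> \<phi> w"
    using hom_cj[OF K(1) is_group \<phi>(1) m(3,1)] hom_cj[OF K(1) is_group \<phi>(1) m(3,2)] m by simp_all
  have id: "id \<in> carrier ?K" using one group.is_monoid[OF K(1)] monoid.one_closed by metis
  have "\<phi> d \<noteq> \<one>" "\<phi> v \<noteq> \<one>" "\<phi> w \<noteq> \<phi> v"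
    using ne m id \<phi>.hom_one inj_on_eq_iff[OF \<phi>(2)] one by metis+
  moreover have "\<phi> v \<otimes> \<phi> v = \<one>" "\<phi> v \<otimes> \<phi> w = \<phi> w \<otimes> \<phi> v" "\<phi> d [^] (3::nat) = \<one>"
    using \<phi>.hom_mult[OF m(1,1)] \<phi>.hom_mult[OF m(1,2)] \<phi>.hom_mult[OF m(2,1)] vv(1,2) \<phi>.hom_one
      \<phi>.hom_nat_pow[OF m(3), of 3] d3 by (simp_all add: mul one)
  ultimately show thesis using that[OF \<phi>(3), of "\<phi> v"] \<phi>.hom_closed m c by simp
qed

lemma centralizer_subgroup:
  assumes "finite (carrier G)" "x \<in> carrier G"
  shows "subgroup {g \<in> carrier G. cj G g x = x} G"
proof (rule finite_subgroupI)
  show "\<And>x' y. x' \<in> {g \<in> carrier G. cj G g x = x} \<Longrightarrow> y \<in> {g \<in> carrier G. cj G g x = x} \<Longrightarrow>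
      x' \<otimes> y \<in> {g \<in> carrier G. cj G g x = x}"
    using assms(2) by (simp add: cj_cj)
qed (use assms in auto)

lemma ord_prime_power:
  assumes "x \<in> carrier G" "x [^] (p ^ 2 :: nat) = \<one>" "x [^] p \<noteq> \<one>" "prime p"
  shows "ord x = p ^ 2"
proof -
  have "ord x dvd p ^ 2" using assms(1,2) by (simp add: pow_eq_id)
  then obtain i where i: "i \<le> 2" "ord x = p ^ i" using divides_primepow_nat[OF assms(4)] by blast
  have "\<not> ord x dvd p" using assms(1,3) by (simp add: pow_eq_id)
  then have "i \<noteq> 0" "i \<noteq> 1" using i(2) by (metis one_dvd power_0, metis dvd_refl power_one_right)
  then show ?thesis using i by (metis One_nat_def le_Suc_eq le_zero_eq numeral_2_eq_2)
qed

lemma ord_prime: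
  assumes "x \<in> carrier G" "x [^] p = \<one>" "x \<noteq> \<one>" "prime p"
  shows "ord x = p"
proof -
  have "ord x dvd p" using assms(1,2) by (simp add: pow_eq_id)
  moreover have "ord x \<noteq> 1" using assms(1,3) ord_eq_1 by simp
  ultimately show ?thesis using assms(4) by (metis One_nat_def prime_nat_iff)
qed

lemma subgroup_pair_involution:
  assumes "four_pair \<one> q r"
  shows "q \<noteq> \<one>" "r \<noteq> \<one>" "q \<otimes> r \<noteq> \<one>" "q \<noteq> r" "q \<in> carrier G" "r \<in> carrier G" "q \<otimes> q = \<one>" "r \<otimes> r = \<one>"
proof -
  have o: "\<one> \<in> powers \<one>" by (rule self_in_powers[OF one_closed])
  show "q \<in> carrier G" "r \<in> carrier G" "q \<otimes> q = \<one>" "r \<otimes> r = \<one>"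
    using assms by (simp_all add: four_pair_def)
  show n: "q \<noteq> \<one>" "r \<noteq> \<one>" "q \<otimes> r \<noteq> \<one>" using assms o unfolding four_pair_def by metis+
  show "q \<noteq> r" using n \<open>r \<otimes> r = \<one>\<close> by blast
qed

text \<open>Otherwise the powers of \<open>f\<close> would be a Sylow 2-subgroup of \<open>M\<close>
  and some conjugate of the four-group would lie in them; but a cyclic group of order 4 has only one
  involution.\<close>

lemma eight_dvd:
  assumes fin: "finite (carrier G)" and M: "subgroup M G" and f: "f \<in> M" "f [^] (4::nat) = \<one>" "f [^] (2::nat) \<noteq> \<one>"
    and qr: "q \<in> M" "r \<in> M" "four_pair \<one> q r"
  shows "8 dvd card M"
proof (rule ccontr)
  assume n8: "\<not> 8 dvd card M"
  interpret M: subgroup M G by fact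
  have fG: "f \<in> carrier G" using f(1) by simp
  have "f [^] (2 ^ 2 :: nat) = \<one>" using f(2) by simp
  from ord_prime_power[OF fG this f(3) two_is_prime_nat] have o: "ord f = 4" by simp
  then have "4 dvd card M" using ord_dvd_card[OF fin M f(1)] by simp
  then have odd: "\<not> 2 dvd card M div card (powers f)"
    using n8 card_powers[OF fin fG] o by (auto elim!: dvdE)
  note Q = four_pair_subgroup[OF fin one_closed qr(3)]
  have "\<exists>g\<in>M. \<forall>x\<in>{\<one>, q, r, q \<otimes> r}. cj G g x \<in> powers f"
    by (rule conj_into_within[where e = 2, OF fin two_is_prime_nat M Q(1) _ _ subgroup_powers[OF fin fG] powers_subset_subgroup[OF M f(1)] odd])
      (use Q(2) qr(1,2) in \<open>auto simp: power2_eq_square\<close>)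
  then obtain g where g: "g \<in> M" "cj G g q \<in> powers f" "cj G g r \<in> powers f" by blast
  note qr' = subgroup_pair_involution[OF qr(3)]
  have uniq: "y = f [^] (2::nat)" if "y \<in> powers f" "y \<otimes> y = \<one>" "y \<noteq> \<one>" for y
  proof -
    obtain i where i: "y = f [^] (i::nat)" using \<open>y \<in> powers f\<close> by blast
    then have "f [^] (i + i) = \<one>" "f [^] i \<noteq> \<one>" using that(2,3) fG by (simp_all add: nat_pow_mult)
    then have "4 dvd i + i" "\<not> 4 dvd i" using o pow_eq_id[OF fG] by auto
    then have "i mod 4 = 2 mod 4" by presburger
    then show ?thesis using i pow_eq_iff_mod[OF fin fG, of i 2] o by simp
  qed
  have gG: "g \<in> carrier G" using g(1) by simp
  have sq: "cj G g x \<otimes> cj G g x = \<one>" if "x \<in> carrier G" "x \<otimes> x = \<one>" for x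
    using cj_m[OF gG that(1,1)] that(2) gG by simp
  have "cj G g q = f [^] (2::nat)" "cj G g r = f [^] (2::nat)"
    by (rule uniq; use g gG qr' sq in simp)+
  then show False using qr'(4-6) gG by (metis cj_inj)
qed

text \<open>For \<open>y\<close> in a subgroup normalized by \<open>n\<close> this splits the square
  of a product into its two components; it is applied to factorizations over \<open>V\<close> and
  over \<open>S\<close>.\<close>

lemma four_pair_product:
  assumes "y \<in> carrier G" "n \<in> carrier G"
  shows "(y \<otimes> n) \<otimes> (y \<otimes> n) = (y \<otimes> cj G n y) \<otimes> (n \<otimes> n)"
proof -
  have "n \<otimes> y = cj G n y \<otimes> n" using cj_eq_iff[of n y "cj G n y"] assms by simp
  then have "n \<otimes> (y \<otimes> n) = cj G n y \<otimes> (n \<otimes> n)" using assms by (metis m_assoc cj_closed)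
  then show ?thesis using assms by (simp add: m_assoc)
qed

end

section \<open>A subgroup isomorphic to A_4 and its four-group\<close>

locale alternating_4 = group G for G (structure) +
  fixes d v
  assumes fin: "finite (carrier G)"
    and d: "d \<in> carrier G" "d [^] (3::nat) = \<one>" "d \<noteq> \<one>"
    and v: "v \<in> carrier G" "v \<noteq> \<one>" "v \<otimes> v = \<one>"
    and dv: "cj G d v \<noteq> v" "v \<otimes> cj G d v = cj G d v \<otimes> v" "cj G d (cj G d v) = v \<otimes> cj G d v"
begin

definition V where "V = {\<one>, v, cj G d v, v \<otimes> cj G d v}"

lemma four_pair_V: "four_pair \<one> v (cj G d v)"
proof -
  have p: "powers \<one> = {\<one>}" by auto
  have "cj G d v \<otimes> cj G d v = \<one>" using cj_m[OF d(1) v(1,1)] v(3) d(1) by simp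
  moreover have "v \<otimes> cj G d v \<noteq> \<one>"
  proof
    assume "v \<otimes> cj G d v = \<one>"
    then have "v \<otimes> cj G d v = v \<otimes> v" using v by simp
    then show False using dv(1) v(1) d(1) by simp
  qed
  ultimately show ?thesis using v d dv by (simp add: four_pair_def p)
qed

lemma V_subgroup: "subgroup V G" "card V = 4"
  unfolding V_def by (rule four_pair_subgroup[OF fin one_closed four_pair_V])+

lemma V_comm: "x \<in> V \<Longrightarrow> y \<in> V \<Longrightarrow> x \<otimes> y = y \<otimes> x"
  by (rule four_pair_comm(1)[OF four_pair_V, folded V_def])

lemma V_sq: "x \<in> V \<Longrightarrow> x \<otimes> x = \<one>"
  by (rule four_pair_comm(2)[OF four_pair_V, folded V_def])

lemma V_closed [simp]: "x \<in> V \<Longrightarrow> x \<in> carrier G"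
  using V_subgroup(1) by (rule subgroup.mem_carrier)

lemma V_m: "x \<in> V \<Longrightarrow> y \<in> V \<Longrightarrow> x \<otimes> y \<in> V"
  using V_subgroup(1) by (rule subgroup.m_closed)

lemma V_v: "v \<in> V"
  unfolding V_def by blast

lemma V_inv: "x \<in> V \<Longrightarrow> inv x = x"
  by (rule inv_equality) (simp_all add: V_sq)

lemma d_3: "x \<in> carrier G \<Longrightarrow> cj G d (cj G d (cj G d x)) = x"
proof -
  assume x: "x \<in> carrier G"
  have "d \<otimes> d \<otimes> d = \<one>" using d(1,2) by (simp add: numeral_3_eq_3)
  then have "cj G (d \<otimes> d \<otimes> d) x = x" using x by simp
  then show ?thesis using x d(1) by (simp add: cj_cj)
qed

text \<open>The three nontrivial elements of \<open>V\<close> are permuted cyclically by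
  \<open>d\<close> and multiply to \<one>, which makes the third conjugate the product of the first
  two.\<close>

lemma d_V: "x \<in> V \<Longrightarrow> cj G d x \<in> V"
  and d_V_mult: "x \<in> V \<Longrightarrow> cj G d (cj G d x) = x \<otimes> cj G d x"
proof -
  define w where "w = cj G d v"
  have "cj G d v \<in> V" unfolding V_def by blast
  then have ww: "w \<otimes> w = \<one>" unfolding w_def by (rule V_sq)
  have w: "w \<in> carrier G" "cj G d v = w"
    using v(1) d(1) by (simp_all add: w_def)
  have w: "w \<in> carrier G" "cj G d v = w" "cj G d w = v \<otimes> w" "w \<otimes> w = \<one>" "w \<otimes> v = v \<otimes> w"
    by (rule w(1), rule w(2), rule dv(3)[folded w_def], rule ww, rule dv(2)[folded w_def, symmetric])
  have vw: "cj G d (v \<otimes> w) = v" using d_3[OF v(1)] w by simp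
  have "w \<otimes> (v \<otimes> w) = (v \<otimes> w) \<otimes> w" using w(1,5) v(1) m_assoc by metis
  then have q: "w \<otimes> (v \<otimes> w) = v" using w(1,4) v(1) by (simp add: m_assoc)
  have "v \<otimes> w \<otimes> v = v \<otimes> (v \<otimes> w)" using w(1,5) v(1) m_assoc by metis
  then have q': "v \<otimes> w \<otimes> v = w" using w(1) v(1,3) by (simp add: m_assoc[symmetric])
  have V: "V = {\<one>, v, w, v \<otimes> w}" unfolding V_def w_def by (rule HOL.refl)
  have "cj G d x \<in> V \<and> cj G d (cj G d x) = x \<otimes> cj G d x" if "x \<in> V" for x
  proof -
    have "x = \<one> \<or> x = v \<or> x = w \<or> x = v \<otimes> w" using that unfolding V by blast
    moreover have "\<one> \<in> V" "v \<in> V" "w \<in> V" "v \<otimes> w \<in> V" unfolding V by blast+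
    moreover have "cj G d \<one> = \<one>" "\<one> = \<one> \<otimes> \<one>" using d(1) by simp_all
    ultimately show ?thesis using w(2,3) vw q q' by metis
  qed
  then show "x \<in> V \<Longrightarrow> cj G d x \<in> V" "x \<in> V \<Longrightarrow> cj G d (cj G d x) = x \<otimes> cj G d x" by blast+
qed

lemma d_fix_V:
  assumes "x \<in> V" "cj G d x = x"
  shows "x = \<one>"
proof -
  have "cj G d (cj G d x) = x" using assms(2) by simp
  then show ?thesis using d_V_mult[OF assms(1)] V_sq[OF assms(1)] unfolding assms(2) by metis
qed

lemma V_orbit:
  assumes "x \<in> V" "x \<noteq> \<one>"
  shows "\<exists>i\<in>{0,1,2::nat}. cj G (d [^] i) v = x"
proof -
  have "cj G (d [^] (0::nat)) v = v" "cj G (d [^] (1::nat)) v = cj G d v" "cj G (d [^] (2::nat)) v = v \<otimes> cj G d v"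
    using d(1) v(1) dv(3) by (simp, simp, simp add: numeral_2_eq_2 cj_cj del: dv)
  then show ?thesis using assms unfolding V_def by blast
qed

text \<open>Each \<open>x\<close> in \<open>V\<close> is a commutator of another element of
  \<open>V\<close> with \<open>d\<close>. Facts about \<open>d\<close> and its conjugates thereby
  become facts about \<open>V\<close>.\<close>

lemma V_commutator:
  assumes "x \<in> V"
  shows "cj G (cj G d x) d \<otimes> inv d = x"
proof -
  let ?z = "cj G d x"
  have z: "?z \<in> V" using assms by (rule d_V)
  have "cj G ?z d \<otimes> inv d = ?z \<otimes> cj G d (inv ?z)"
    using z d(1) V_closed[OF z] by (simp add: cj_def m_assoc)
  also have "\<dots> = cj G d (cj G d ?z)" using V_inv[OF z] d_V_mult[OF z] by simp
  also have "\<dots> = x" using d_3 assms by simp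
  finally show ?thesis .
qed

text \<open>The commutator of \<open>x\<close> and \<open>d\<close> equals x (d x d^-1) and lies in
  both \<open>M\<close> and \<open>V\<close>, so it is trivial; then \<open>d\<close> fixes
  \<open>x\<close>, and it fixes only \<one> in \<open>V\<close>.\<close>

lemma V_moves_d:
  assumes M: "subgroup M G" "d \<in> M" "M \<inter> V \<subseteq> {\<one>}" and x: "x \<in> V" "cj G x d \<in> M"
  shows "x = \<one>"
proof -
  have "cj G x d \<otimes> inv d = x \<otimes> cj G d (inv x)"
    using x d(1) V_closed[OF x(1)] by (simp add: cj_def m_assoc)
  also have "\<dots> = x \<otimes> cj G d x" using V_inv[OF x(1)] by simp
  finally have e: "cj G x d \<otimes> inv d = x \<otimes> cj G d x" .
  have "cj G x d \<otimes> inv d \<in> M" using M x by (simp add: subgroup.m_closed subgroup.m_inv_closed)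
  moreover have "cj G x d \<otimes> inv d \<in> V" using e x V_m d_V by simp
  ultimately have "x \<otimes> cj G d x = x \<otimes> x" using e M(3) V_sq[OF x(1)] by auto
  then have "cj G d x = x" using x d(1) by simp
  then show ?thesis using d_fix_V x(1) by blast
qed

lemma V_Int_odd:
  assumes "subgroup M G" "odd (card M)"
  shows "M \<inter> V \<subseteq> {\<one>}"
proof
  fix x assume "x \<in> M \<inter> V"
  moreover have "coprime (card M) (card V)"
    using assms(2) V_subgroup(2) coprime_power_right_iff[of "card M" 2 2] by (simp add: odd_iff_mod_2_eq_one coprime_right_2_iff_odd)
  ultimately show "x \<in> {\<one>}" using coprime_subgroups[OF fin assms(1) V_subgroup(1)] by blast
qed

lemma V_Int_nrm:
  assumes M: "subgroup M G" "d \<in> M" "odd (card M)"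
  shows "V \<inter> nrm G M \<subseteq> {\<one>}"
proof
  fix x assume "x \<in> V \<inter> nrm G M"
  then have "x \<in> V" "cj G x d \<in> M" using M(2) by (simp_all add: nrm_def)
  then show "x \<in> {\<one>}" using V_moves_d[OF M(1,2) V_Int_odd[OF M(1,3)]] by blast
qed

end

context group
begin

lemma ord_3:
  assumes "x \<in> carrier G" "x [^] (3::nat) = \<one>" "x \<noteq> \<one>"
  shows "ord x = 3"
  by (rule ord_prime[OF assms]) simp

lemma order_3_powers:
  assumes fin: "finite (carrier G)" and T: "subgroup T G" "card T = 3" and x: "x \<in> T" "x \<noteq> \<one>"
  shows "powers x = T" "x [^] (3::nat) = \<one>"
proof -
  have xG: "x \<in> carrier G" using T(1) x(1) by (rule subgroup.mem_carrier)
  have "ord x dvd 3" using ord_dvd_card[OF fin T(1) x(1)] T(2) by simp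
  then show 1: "x [^] (3::nat) = \<one>" using xG by (simp add: pow_eq_id)
  have "card (powers x) = card T" using card_powers[OF fin xG] ord_3[OF xG 1 x(2)] T(2) by simp
  moreover have "finite T" using T(2) by (simp add: card_ge_0_finite)
  ultimately show "powers x = T" using powers_subset_subgroup[OF T(1) x(1)] card_subset_eq by metis
qed

lemma proper_divisor_le:
  fixes a b :: nat
  assumes "a dvd b" "a < b"
  shows "2 * a \<le> b"
proof -
  obtain k where k: "b = a * k" using assms(1) by blast
  then have "k \<ge> 2" using assms(2) by (cases "k = 0 \<or> k = 1") auto
  then show ?thesis using k by simp
qed

lemma cj_powers_fix:
  assumes "g \<in> carrier G" "x \<in> carrier G" "cj G g x = x" "y \<in> powers x"
  shows "cj G g y = y"
  using assms by (auto simp: cj_pow)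

lemma square_neq:
  assumes "e \<in> carrier G" "e \<noteq> \<one>"
  shows "e [^] (2::nat) \<noteq> e"
  using assms by (simp add: numeral_2_eq_2)

lemma eight_dvd_order_12:
  assumes fin: "finite (carrier G)" and host: "all_embed 12 G" "absorbs_order_3 G S"
  shows "8 dvd order G" "3 dvd order G"
proof -
  have c: "subgroup (carrier G) G" by (rule subgroup_self)
  obtain e f where ef: "e \<in> carrier G" "e [^] (3::nat) = \<one>" "e \<noteq> \<one>" "f \<in> carrier G" "f [^] (4::nat) = \<one>" "f [^] (2::nat) \<noteq> \<one>"
    by (rule cyclic_12_data[OF host])
  obtain q r where qr: "q \<in> carrier G" "r \<in> carrier G" "four_pair \<one> q r"
    by (rule cyclic_2_6_data[OF host])
  show "8 dvd order G"
    using eight_dvd[OF fin c ef(4-6) qr] by (simp add: order_def)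
  show "3 dvd order G"
    using ord_dvd[OF ef(1)] ord_3[OF ef(1-3)] by simp
qed

end

context alternating_4
begin

text \<open>This disposes of Sylow 3-subgroups of order 3. The normalizer has at most 144 / 4 = 36
  elements. The centralizer of \<open>d\<close> has order divisible by 24, through an element of
  order 4, a four-group and \<open>d\<close> itself. An element of the dihedral group inverting the
  powers of \<open>d\<close> makes the normalizer strictly larger, hence of order at least
  48.\<close>

lemma powers_not_absorbing:
  assumes host: "all_embed 12 G" and le: "order G \<le> 144" and into: "absorbs_order_3 G (powers d)"
  shows False
proof -
  have od: "ord d = 3" using d by (rule ord_3)
  have P: "subgroup (powers d) G" "card (powers d) = 3" "d \<in> powers d"
    using subgroup_powers[OF fin d(1)] card_powers[OF fin d(1)] od self_in_powers[OF d(1)] by simp_all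
  let ?N = "nrm G (powers d)"
  let ?C = "{g \<in> carrier G. cj G g d = d}"
  have N: "subgroup ?N G" by (rule nrm_subgroup[OF fin P(1)])
  have C: "subgroup ?C G" by (rule centralizer_subgroup[OF fin d(1)])
  have "V \<inter> ?N \<subseteq> {\<one>}" using V_Int_nrm[OF P(1) P(3)] P(2) by simp
  from disjoint_product(1)[OF fin V_subgroup(1) N this] have cN: "card ?N \<le> 36" using V_subgroup(2) le by simp
  \<comment> \<open>The embedded groups supply different elements \<open>e\<close> of order 3, but
    each of them generates the same subgroup as \<open>d\<close>.\<close>
  have gen: "cj G g d = d" if "g \<in> carrier G" "e \<in> powers d" "e \<noteq> \<one>" "cj G g e = e" for g e
  proof (rule cj_powers_fix[OF that(1) _ that(4)])
    show "e \<in> carrier G" using P(1) that(2) by (rule subgroup.mem_carrier)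
    show "d \<in> powers e" using order_3_powers(1)[OF fin P(1,2) that(2,3)] P(3) by simp
  qed
  obtain e f where ef: "e \<in> powers d" "e \<noteq> \<one>" "f \<in> carrier G" "f [^] (4::nat) = \<one>" "f [^] (2::nat) \<noteq> \<one>" "cj G f e = e"
    by (rule cyclic_12_data[OF host into])
  obtain e' q r where qr: "e' \<in> powers d" "e' \<noteq> \<one>" "q \<in> carrier G" "r \<in> carrier G" "four_pair \<one> q r" "cj G q e' = e'" "cj G r e' = e'"
    by (rule cyclic_2_6_data[OF host into])
  have "f \<in> ?C" "q \<in> ?C" "r \<in> ?C" using ef qr gen by blast+
  then have 8: "8 dvd card ?C" using eight_dvd[OF fin C _ ef(4,5) _ _ qr(5)] by blast
  have "d \<in> ?C" using d(1) by (simp add: cj_def m_assoc)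
  then have "3 dvd card ?C" using ord_dvd_card[OF fin C] unfolding od[symmetric] by blast
  with 8 have 24: "24 dvd card ?C" by presburger
  have CN: "?C \<subseteq> ?N"
    using cj_powers_fix[of _ d] d(1) by (auto simp: nrm_def)
  obtain e s where es: "e \<in> powers d" "e \<in> carrier G" "e \<noteq> \<one>" "s \<in> carrier G" "cj G s e = e [^] (2::nat)"
    by (rule dihedral_12_data[OF host into])
  have ep: "powers e = powers d" using order_3_powers(1)[OF fin P(1,2) es(1,3)] .
  have "cj G s x \<in> powers d" if x: "x \<in> powers e" for x
  proof -
    obtain i where "x = e [^] (i::nat)" using x by blast
    then have "cj G s x = (e [^] (2::nat)) [^] i" using es by (simp add: cj_pow)
    then show ?thesis using subgroup_pow_closed[OF P(1)] es(1) by simp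
  qed
  then have sN: "s \<in> ?N" using es(4) ep by (simp add: nrm_def)
  have "cj G s e \<noteq> e" using square_neq[OF es(2,3)] es(5) by simp
  moreover have "cj G s e = e" if "s \<in> ?C" using that cj_powers_fix[OF es(4) d(1) _ es(1)] by blast
  ultimately have "?C \<noteq> ?N" using sN by blast
  then have "card ?C < card ?N"
    using CN fin by (intro psubset_card_mono) (auto simp: nrm_def)
  moreover have "card ?C dvd card ?N" by (rule card_dvd_subgroup[OF C N CN])
  moreover have "card ?C \<ge> 24" using 24 subgroup.finite_imp_card_positive[OF C fin] by (rule dvd_imp_le)
  ultimately show False using proper_divisor_le[of "card ?C" "card ?N"] cN by linarith
qed

end

section \<open>Groups of order 9 are abelian; factorizations inside a subgroup\<close>

context group
begin

lemma mc_commute: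
  assumes "mc G a b n 1 m l" "x \<in> carrier G" "y \<in> carrier G"
  shows "x \<otimes> y = y \<otimes> x"
proof -
  have ab: "a \<in> carrier G" "b \<in> carrier G" "cj G b a = a"
    and car: "carrier G \<subseteq> {a [^] i \<otimes> b [^] j | i j. i < n \<and> j < m}" and pos: "order G > 0"
    using assms(1) by (simp_all add: mc_def)
  have fin: "finite (carrier G)" using pos by (rule order_finite)
  have *: "carrier G \<subseteq> {g \<in> carrier G. cj G g z = z}" (is "_ \<subseteq> ?C")
    if "z \<in> carrier G" "cj G a z = z" "cj G b z = z" for z
  proof
    have C: "subgroup ?C G" using fin that(1) by (rule centralizer_subgroup)
    have m: "a \<in> ?C" "b \<in> ?C" using ab that by simp_all
    fix g assume "g \<in> carrier G"
    then obtain i j where g: "g = a [^] (i::nat) \<otimes> b [^] (j::nat)" using car by blast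
    show "g \<in> ?C" unfolding g
      by (rule subgroup.m_closed[OF C subgroup_pow_closed[OF C m(1)] subgroup_pow_closed[OF C m(2)]])
  qed
  have self: "cj G z z = z" if "z \<in> carrier G" for z using that by (simp add: cj_eq_iff)
  have "cj G g a = a" if "g \<in> carrier G" for g using *[OF ab(1) self[OF ab(1)] ab(3)] that by blast
  then have "cj G a x = x" using cj_fix_sym[OF assms(2) ab(1)] assms(2) by blast
  moreover have "cj G g b = b" if "g \<in> carrier G" for g
    using *[OF ab(2) cj_fix_sym[OF ab(2,1,3)] self[OF ab(2)]] that by blast
  then have "cj G b x = x" using cj_fix_sym[OF assms(2) ab(2)] assms(2) by blast
  ultimately have "cj G y x = x" using *[OF assms(2)] assms(3) by blast
  then show ?thesis using assms by (simp add: cj_eq_iff)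
qed

lemma order_9_commute:
  assumes "subgroup S G" "card S = 9" "x \<in> S" "y \<in> S"
  shows "x \<otimes> y = y \<otimes> x"
proof -
  interpret S: group "G\<lparr>carrier := S\<rparr>" using assms(1) by (rule subgroup_imp_group)
  have "order (G\<lparr>carrier := S\<rparr>) = 9" using assms(2) by (simp add: order_def)
  from S.group_order_9[OF this] obtain a b n m where "mc (G\<lparr>carrier := S\<rparr>) a b n 1 m 0" by blast
  from S.mc_commute[OF this] show ?thesis using assms(3,4) by simp
qed

lemma disjoint_product_within:
  assumes fin: "finite (carrier G)" and M: "subgroup M G" and A: "subgroup A G" "A \<subseteq> M" and B: "subgroup B G" "B \<subseteq> M"
    and AB: "A \<inter> B \<subseteq> {\<one>}" "card A * card B = card M" and g: "g \<in> M"
  shows "\<exists>a\<in>A. \<exists>b\<in>B. g = a \<otimes> b"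
proof -
  interpret M: group "G\<lparr>carrier := M\<rparr>" using M by (rule subgroup_imp_group)
  have f: "finite (carrier (G\<lparr>carrier := M\<rparr>))" using fin subgroup.subset[OF M] finite_subset by simp
  show ?thesis
    using M.disjoint_product(2)[OF f subgroup_incl[OF A(1) M A(2)] subgroup_incl[OF B(1) M B(2)], of g] AB g
    by (simp add: order_def)
qed

lemma coprime_Int:
  assumes "finite (carrier G)" "subgroup H G" "subgroup K G" "coprime (card H) (card K)"
  shows "H \<inter> K \<subseteq> {\<one>}"
  using coprime_subgroups[OF assms] by blast

end

text \<open>The case of a Sylow 3-subgroup of order 9, with \<open>d\<close> moved into it by
  conjugation.\<close>

locale order_12_host = alternating_4 +
  fixes S
  assumes host: "all_embed 12 G" and le: "order G \<le> 144" and into: "absorbs_order_3 G S"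
    and S: "subgroup S G" "card S = 9" "d \<in> S"
begin

lemma S_closed [simp]: "x \<in> S \<Longrightarrow> x \<in> carrier G"
  using S(1) by (rule subgroup.mem_carrier)

lemma S_comm: "x \<in> S \<Longrightarrow> y \<in> S \<Longrightarrow> x \<otimes> y = y \<otimes> x"
  using order_9_commute[OF S(1,2)] .

lemma S_fix: "x \<in> S \<Longrightarrow> y \<in> S \<Longrightarrow> cj G x y = y"
  using S_comm[of x y] by (simp add: cj_eq_iff)

lemma S_m: "x \<in> S \<Longrightarrow> y \<in> S \<Longrightarrow> x \<otimes> y \<in> S"
  using S(1) by (rule subgroup.m_closed)

lemma S_inv: "x \<in> S \<Longrightarrow> inv x \<in> S"
  using S(1) by (rule subgroup.m_inv_closed)

lemma ord_S: "x \<in> S \<Longrightarrow> ord x dvd 9"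
  using ord_dvd_card[OF fin S(1), of x] S(2) by simp

lemma order_cases: "order G = 72 \<or> order G = 144"
proof -
  have "9 dvd order G" using card_dvd_order[OF S(1)] S(2) by simp
  moreover have "8 dvd order G" by (rule eight_dvd_order_12[OF fin host into])
  ultimately have "9 * 8 dvd order G" by (intro divides_mult) (simp_all add: coprime_iff_gcd_eq_1 gcd_red_nat[of 9 8])
  then obtain k where k: "order G = 72 * k" by auto
  have "order G > 0" using fin by (simp add: order_gt_0_iff_finite)
  then have "k = 1 \<or> k = 2" using le k by linarith
  then show ?thesis using k by auto
qed

definition N where "N = nrm G S"

lemma N_subgroup: "subgroup N G"
  unfolding N_def using fin S(1) by (rule nrm_subgroup)

lemma N_closed [simp]: "x \<in> N \<Longrightarrow> x \<in> carrier G"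
  using N_subgroup by (rule subgroup.mem_carrier)

lemma S_N: "S \<subseteq> N"
  unfolding N_def using S(1) by (rule subset_nrm)

lemma N_S: "x \<in> N \<Longrightarrow> y \<in> S \<Longrightarrow> cj G x y \<in> S"
  unfolding N_def nrm_def by blast

lemma V_S: "V \<inter> S \<subseteq> {\<one>}"
proof -
  have "odd (card S)" using S(2) by simp
  from V_Int_odd[OF S(1) this] show ?thesis by blast
qed

lemma V_N: "V \<inter> N \<subseteq> {\<one>}"
  unfolding N_def by (rule V_Int_nrm[OF S(1,3)]) (simp add: S(2))

lemma card_N_bound: "4 * card N \<le> order G"
  using disjoint_product(1)[OF fin V_subgroup(1) N_subgroup V_N] V_subgroup(2) by simp

lemma card_N_cases:
  obtains k where "card N = 9 * k" "k dvd 16" "k mod 3 = (order G div 9) mod 3" "k > 0"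
proof -
  have "9 dvd card N" using card_dvd_subgroup[OF S(1) N_subgroup S_N] S(2) by simp
  then obtain k where k: "card N = 9 * k" by blast
  have "card N dvd order G" using N_subgroup by (rule card_dvd_order)
  moreover have "order G dvd 144" using order_cases by auto
  ultimately have "9 * k dvd 144" using k by (metis dvd_trans)
  then have "9 * k dvd 9 * 16" by simp
  then have 1: "k dvd 16" by simp
  have c: "subgroup (carrier G) G" by (rule subgroup_self)
  have "card S = 3 ^ 2" using S(2) by simp
  have p: "prime (3::nat)" by simp
  have "N \<inter> carrier G = N" using N_subgroup subgroup.subset by blast
  then have 2: "(order G div 9) mod 3 = k mod 3"
    using index_mod_nrm[OF fin p c S(1) subgroup.subset[OF S(1)] \<open>card S = 3 ^ 2\<close>] k
    unfolding N_def[symmetric] by (simp add: order_def S(2))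
  have "k > 0" using subgroup.finite_imp_card_positive[OF N_subgroup fin] k by simp
  then show thesis by (rule that[OF k 1 2[symmetric]])
qed

text \<open>\<open>S\<close> has index prime to 3 in \<open>N\<close>, so a 3-element of
  \<open>N\<close> is conjugate within \<open>N\<close> to an element of \<open>S\<close>; as
  \<open>N\<close> normalizes \<open>S\<close>, conjugating back stays in \<open>S\<close>.\<close>

lemma N_ord_S:
  assumes "x \<in> N" "ord x dvd 9"
  shows "x \<in> S"
proof -
  obtain k where k: "card N = 9 * k" "k dvd 16" by (rule card_N_cases)
  have p: "prime (3::nat)" by simp
  have "ord x dvd 3 ^ 2" using assms(2) by simp
  then obtain e where e: "ord x = 3 ^ e" using divides_primepow_nat[OF p] by blast
  have "\<not> 3 dvd k"
  proof
    assume "3 dvd k"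
    then have "3 dvd (16::nat)" using k(2) by (rule dvd_trans)
    then show False by simp
  qed
  then have nd: "\<not> 3 dvd card N div card S" using k(1) S(2) by simp
  have cp: "card (powers x) = 3 ^ e" using card_powers[OF fin] assms(1) e by simp
  have "\<exists>g\<in>N. \<forall>q\<in>powers x. cj G g q \<in> S"
    using conj_into_within[OF fin p N_subgroup subgroup_powers[OF fin N_closed[OF assms(1)]] powers_subset_subgroup[OF N_subgroup assms(1)] cp S(1) S_N nd] .
  then obtain g where g: "g \<in> N" "cj G g x \<in> S" using self_in_powers[OF N_closed[OF assms(1)]] by blast
  then have "cj G (inv g) (cj G g x) \<in> S"
    using N_S subgroup.m_inv_closed[OF N_subgroup] by blast
  then show ?thesis using g(1) assms(1) by simp
qed

text \<open>If \<open>S\<close> were its own normalizer, its index in every subgroup containing it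
  would be 1 modulo 3. The centralizer \<open>?C\<close> of an element \<open>e\<close> inverted by
  some \<open>r\<close> has index 2 in the normalizer \<open>?M\<close> of its powers, so both m and
  2m would be 1 modulo 3.\<close>

lemma card_N_neq: "card N \<noteq> 9"
proof
  assume "card N = 9"
  then have NS: "N = S" using S_N S(2) fin by (metis N_closed card_subset_eq finite_subset subsetI)
  obtain e r where er: "e \<in> S" "e [^] (3::nat) = \<one>" "e \<noteq> \<one>" "r \<in> carrier G" "cj G r e = e [^] (2::nat)"
    by (rule dihedral_12_data[OF host into])
  have eG: "e \<in> carrier G" using er(1) by simp
  let ?C = "{g \<in> carrier G. cj G g e = e}"
  let ?M = "nrm G (powers e)"
  have P: "subgroup (powers e) G" "e \<in> powers e" using subgroup_powers[OF fin eG] self_in_powers[OF eG] .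
  have C: "subgroup ?C G" using fin eG by (rule centralizer_subgroup)
  have M: "subgroup ?M G" using fin P(1) by (rule nrm_subgroup)
  have SC: "S \<subseteq> ?C" using S_fix er(1) by auto
  have CM: "?C \<subseteq> ?M" using cj_powers_fix[of _ e] eG by (auto simp: nrm_def)
  have p: "prime (3::nat)" by simp
  have cS: "card S = 3 ^ 2" using S(2) by simp
  have 1: "(card M' div 9) mod 3 = 1" if "subgroup M' G" "S \<subseteq> M'" for M'
  proof -
    have "N \<inter> M' = S" using NS that(2) by blast
    then show ?thesis
      using index_mod_nrm[OF fin p that(1) S(1) that(2) cS] unfolding N_def[symmetric] by (simp add: S(2))
  qed
  have ord: "ord e = 3" using ord_3[OF eG er(2,3)] .
  have rM: "r \<in> ?M"
  proof -
    have "cj G r x \<in> powers e" if x: "x \<in> powers e" for x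
    proof -
      obtain i where "x = e [^] (i::nat)" using x by blast
      then have "cj G r x = (e [^] (2::nat)) [^] i" using er(4,5) eG by (simp add: cj_pow)
      then show ?thesis using subgroup_pow_closed[OF P(1)] P(2) by simp
    qed
    then show ?thesis using er(4) by (simp add: nrm_def)
  qed
  \<comment> \<open>An element normalizing the powers of \<open>e\<close> either fixes or inverts
    \<open>e\<close>; in the second case dividing by \<open>r\<close> gives an element of the
    centralizer.\<close>
  have "?M = ?C \<union> (\<lambda>x. x \<otimes> r) ` ?C"
  proof
    show "?C \<union> (\<lambda>x. x \<otimes> r) ` ?C \<subseteq> ?M"
      using CM rM subgroup.m_closed[OF M] by blast
    show "?M \<subseteq> ?C \<union> (\<lambda>x. x \<otimes> r) ` ?C"
    proof
      fix x assume x: "x \<in> ?M"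
      then have xG: "x \<in> carrier G" "cj G x e \<in> powers e" using P(2) unfolding nrm_def by blast+
      then obtain i where i: "cj G x e = e [^] (i::nat)" by blast
      have pe: "e [^] (i::nat) = e [^] (j::nat) \<longleftrightarrow> i mod 3 = j mod 3" for i j
        using pow_eq_iff_mod[OF fin eG] ord by simp
      have "cj G x e \<noteq> \<one>" using xG(1) eG er(3) by simp
      then have "i mod 3 \<noteq> 0" using i pe[of i 0] by simp
      then consider "i mod 3 = 1" | "i mod 3 = 2" by linarith
      then show "x \<in> ?C \<union> (\<lambda>x. x \<otimes> r) ` ?C"
      proof cases
        case 1
        then have "cj G x e = e" using i pe[of i 1] eG by simp
        then show ?thesis using xG(1) by simp
      next
        case 2
        have xe: "cj G x e = cj G r e" using i 2 pe[of i 2] er(5) by simp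
        have ie: "cj G (inv r) e = e [^] (2::nat)"
        proof -
          have "cj G r (e [^] (2::nat)) = e [^] (4::nat)" using er eG by (simp add: cj_pow nat_pow_pow)
          also have "\<dots> = e" using pe[of 4 1] eG by simp
          finally show ?thesis using er(4) eG by (metis cj_inv_cj nat_pow_closed)
        qed
        have "cj G (x \<otimes> inv r) e = cj G x (e [^] (2::nat))" using ie xG(1) er(4) eG by (simp add: cj_cj)
        also have "\<dots> = (e [^] (2::nat)) [^] (2::nat)" using xe er(5) xG(1) eG by (simp add: cj_pow)
        also have "\<dots> = e" using pe[of 4 1] eG by (simp add: nat_pow_pow)
        finally have "x \<otimes> inv r \<in> ?C" using xG(1) er(4) by simp
        moreover have "x = (x \<otimes> inv r) \<otimes> r" using xG(1) er(4) by (simp add: m_assoc)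
        ultimately show ?thesis by blast
      qed
    qed
  qed
  moreover have "?C \<inter> (\<lambda>x. x \<otimes> r) ` ?C = {}"
  proof -
    have False if x: "x \<in> carrier G" "cj G x e = e" "cj G (x \<otimes> r) e = e" for x
    proof -
      have "cj G (x \<otimes> r) e = e [^] (2::nat)" using x(1,2) er(4,5) eG by (simp add: cj_cj cj_pow)
      then show False using x(3) square_neq[OF eG er(3)] by simp
    qed
    then show ?thesis by blast
  qed
  moreover have "card ((\<lambda>x. x \<otimes> r) ` ?C) = card ?C" using er(4) by (intro card_image inj_onI) auto
  ultimately have cM: "card ?M = 2 * card ?C" using fin by (simp add: card_Un_disjoint)
  have "9 dvd card ?C" using card_dvd_subgroup[OF S(1) C SC] S(2) by simp
  then obtain m where m: "card ?C = 9 * m" by blast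
  have "m mod 3 = 1" using 1[OF C SC] m by simp
  moreover have "(2 * m) mod 3 = 1" using 1[OF M] SC CM cM m by simp
  ultimately show False by presburger
qed

text \<open>With |N| = 9k and k > 1, order 72 leaves \<open>k = 2\<close> because k is at most 2.
  For order 144 the bound is 4 and k is 1 modulo 3, so \<open>k = 4\<close>. In both cases the bound
  is attained, which gives G = V N.\<close>

lemma order_N: "order G = 4 * card N" and card_N: "card N = 18 \<or> card N = 36"
proof -
  obtain k where k: "card N = 9 * k" "k dvd 16" "k mod 3 = (order G div 9) mod 3" "k > 0" by (rule card_N_cases)
  have "k \<noteq> 1" using card_N_neq k(1) by simp
  have "order G = 4 * card N \<and> (card N = 18 \<or> card N = 36)" using order_cases
  proof
    assume o: "order G = 72"
    have "k = 2" using card_N_bound k(1,4) \<open>k \<noteq> 1\<close> o by simp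
    then show ?thesis using k(1) o by simp
  next
    assume o: "order G = 144"
    have "k \<le> 4" "k mod 3 = 1" using card_N_bound k o by simp_all
    then have "k = 4" using k(4) \<open>k \<noteq> 1\<close> by presburger
    then show ?thesis using k(1) o by simp
  qed
  then show "order G = 4 * card N" "card N = 18 \<or> card N = 36" by blast+
qed

lemma V_N_product: "g \<in> carrier G \<Longrightarrow> \<exists>y\<in>V. \<exists>n\<in>N. g = y \<otimes> n"
  using disjoint_product(2)[OF fin V_subgroup(1) N_subgroup V_N] V_subgroup(2) order_N by simp

end

context group
begin

lemma cj_of_cj:
  assumes "g \<in> carrier G" "x \<in> carrier G" "y \<in> carrier G"
  shows "cj G (cj G g x) (cj G g y) = cj G g (cj G x y)"
  using hom_cj[OF is_group is_group cj_hom[OF assms(1)] assms(2,3)] by simp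

lemma cj_involution:
  assumes "a \<in> carrier G" "s \<in> carrier G" "inv a = a"
  shows "cj G a s = (a \<otimes> cj G s a) \<otimes> s"
  using assms by (simp add: cj_def m_assoc)

end

lemma dvd_9_cases:
  fixes n :: nat
  assumes "n dvd 9"
  shows "n = 1 \<or> n = 3 \<or> n = 9"
proof -
  have "n \<le> 9" using assms by (rule dvd_imp_le) simp
  then have "n = 0 \<or> n = 1 \<or> n = 2 \<or> n = 3 \<or> n = 4 \<or> n = 5 \<or> n = 6 \<or> n = 7 \<or> n = 8 \<or> n = 9" by presburger
  then show ?thesis using assms by auto
qed

section \<open>The core of the Sylow 3-subgroup and normality of the four-group\<close>

context order_12_host
begin

lemma N_pow_S: "x \<in> N \<Longrightarrow> x [^] (9::nat) = \<one> \<Longrightarrow> x \<in> S"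
  by (rule N_ord_S) (simp_all add: pow_eq_id)

lemma S_pow: "x \<in> S \<Longrightarrow> x [^] (9::nat) = \<one>"
  using ord_S[of x] by (simp add: pow_eq_id)

lemma S_square:
  assumes "x \<in> S" "x \<otimes> x = \<one>"
  shows "x = \<one>"
proof -
  have "ord x dvd 2" using assms by (simp add: pow_eq_id numeral_2_eq_2 flip: pow_eq_id)
  moreover have "ord x dvd 9" using assms(1) by (rule ord_S)
  ultimately have "ord x dvd gcd 2 9" by (rule gcd_greatest)
  then have "ord x = 1" by (simp add: gcd_red_nat[of 2 9])
  then show ?thesis using ord_eq_1[of x] assms(1) by simp
qed

definition T where "T = {x \<in> S. \<forall>y\<in>carrier G. cj G y x \<in> S}"

lemma T_S: "x \<in> T \<Longrightarrow> x \<in> S"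
  unfolding T_def by blast

lemma T_cj_S: "x \<in> T \<Longrightarrow> g \<in> carrier G \<Longrightarrow> cj G g x \<in> S"
  unfolding T_def by blast

lemma T_normal:
  assumes x: "x \<in> T" and g: "g \<in> carrier G"
  shows "cj G g x \<in> T"
proof -
  have xG: "x \<in> carrier G" using T_S[OF x] by simp
  have "cj G y (cj G g x) \<in> S" if "y \<in> carrier G" for y
    using T_cj_S[OF x m_closed[OF that g]] cj_cj[OF that g xG] by simp
  then show ?thesis using T_cj_S[OF x g] unfolding T_def by blast
qed

lemma T_subgroup: "subgroup T G"
proof (rule finite_subgroupI)
  show "finite T" using fin T_S S_closed by (meson finite_subset subsetI)
  show "T \<subseteq> carrier G" using T_S S_closed by blast
  have "\<one> \<in> S" using S(1) by (rule subgroup.one_closed)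
  then show "\<one> \<in> T" unfolding T_def by simp
  fix x y assume "x \<in> T" "y \<in> T"
  then have xy: "x \<in> S" "y \<in> S" "\<And>g. g \<in> carrier G \<Longrightarrow> cj G g x \<in> S \<and> cj G g y \<in> S"
    using T_S T_cj_S by blast+
  then show "x \<otimes> y \<in> T" unfolding T_def by (simp add: S_m cj_m)
qed

text \<open>Otherwise \<open>S\<close> would contain the conjugate of \<open>d\<close> by
  \<open>v\<close>, which \<open>V_moves_d\<close> allows only for the trivial element of
  \<open>V\<close>.\<close>

lemma d_notin_T: "d \<notin> T"
proof
  assume "d \<in> T"
  then have "cj G v d \<in> S" using v(1) by (rule T_cj_S)
  moreover have "S \<inter> V \<subseteq> {\<one>}" using V_S by blast
  ultimately show False using V_moves_d[OF S(1,3) _ V_v] v(2) by blast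
qed

text \<open>Let \<open>G\<close> act on the 4 cosets of \<open>N\<close>. An element of
  \<open>S\<close> in the kernel has all conjugates in \<open>N\<close>, hence in \<open>S\<close>,
  so it lies in \<open>T\<close>. With trivial \<open>T\<close> the group \<open>S\<close> would
  embed in S_4, but 9 does not divide 24.\<close>

lemma card_T: "card T = 3"
proof -
  have "card T dvd 9" using card_dvd_subgroup[OF T_subgroup S(1)] T_S S(2) by auto
  moreover have "T \<subset> S" using d_notin_T S(3) T_S by blast
  then have "card T < 9" using psubset_card_mono[of S T] S(2) card_ge_0_finite[of S] by simp
  moreover have "card T \<noteq> 1"
  proof
    assume "card T = 1"
    then have T1: "T = {\<one>}" using subgroup.one_closed[OF T_subgroup] by (metis card_1_singletonE singletonD)
    obtain \<phi> where \<phi>: "\<phi> \<in> hom G (sym_group 4)"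
      "\<And>g x. g \<in> carrier G \<Longrightarrow> \<phi> g = id \<Longrightarrow> x \<in> carrier G \<Longrightarrow> cj G x g \<in> N"
      by (rule coset_perm_hom[OF fin N_subgroup order_N]) blast
    let ?S = "G\<lparr>carrier := S\<rparr>"
    have gS: "group ?S" using S(1) by (rule subgroup_imp_group)
    have h: "\<phi> \<in> hom ?S (sym_group 4)" using \<phi>(1) by (auto simp: hom_def)
    have "x = \<one>" if x: "x \<in> S" "\<phi> x = id" for x
    proof -
      have "cj G y x \<in> S" if "y \<in> carrier G" for y
        using N_pow_S[OF \<phi>(2)[OF S_closed[OF x(1)] x(2) that]] S_pow[OF x(1)] x(1) that by (simp flip: cj_pow)
      then have "x \<in> T" using x(1) unfolding T_def by blast
      then show ?thesis using T1 by simp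
    qed
    then have ker: "\<And>x. x \<in> carrier ?S \<Longrightarrow> \<phi> x = \<one>\<^bsub>sym_group 4\<^esub> \<Longrightarrow> x = \<one>\<^bsub>?S\<^esub>" by (simp add: sym_group_one)
    interpret h: group_hom ?S "sym_group 4" \<phi>
      using gS h sym_group_is_group by (simp add: group_hom_def group_hom_axioms_def)
    have "inj_on \<phi> (carrier ?S)" using ker h.inj_on_one_iff by blast
    then have "embeds ?S (sym_group 4)" using embedsI[OF gS sym_group_is_group h] by blast
    from embeds_order_dvd[OF this sym_group_is_group] show False
      using S(2) by (simp add: order_def sym_group_card_carrier fact_numeral)
  qed
  ultimately show ?thesis
    using dvd_9_cases[of "card T"] by auto
qed

text \<open>\<open>T\<close> has prime index 3 in \<open>S\<close>, so \<open>T\<close> and any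
  element of \<open>S\<close> outside it generate \<open>S\<close>.\<close>

lemma S_generated:
  assumes M: "subgroup M G" and T: "T \<subseteq> M" and e: "e \<in> M" "e \<in> S" "e \<notin> T"
  shows "S \<subseteq> M"
proof -
  have MS: "subgroup (M \<inter> S) G" using M S(1) by (rule subgroups_Inter_pair)
  have fS: "finite S" using S(2) card_ge_0_finite[of S] by simp
  have "card (M \<inter> S) dvd 9" using card_dvd_subgroup[OF MS S(1)] S(2) by simp
  moreover have "T \<subset> M \<inter> S" using T e T_S by blast
  then have "3 < card (M \<inter> S)" using psubset_card_mono[of "M \<inter> S" T] fS card_T by simp
  ultimately have "card (M \<inter> S) = 9" 
    using dvd_9_cases[of "card (M \<inter> S)"] by auto
  then have "M \<inter> S = S" using card_subset_eq[OF fS, of "M \<inter> S"] S(2) by simp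
  then show ?thesis by blast
qed

text \<open>Conjugating back by \<open>g\<close> keeps \<open>t\<close> in the abelian group
  \<open>S\<close>, where it commutes with \<open>d\<close>.\<close>

lemma T_fix_conj_d:
  assumes "t \<in> T" "g \<in> carrier G"
  shows "cj G t (cj G g d) = cj G g d"
proof -
  have tG: "t \<in> carrier G" using T_S[OF assms(1)] by simp
  let ?t = "cj G (inv g) t"
  have t': "?t \<in> S" using T_cj_S assms by simp
  have "cj G (cj G g ?t) (cj G g d) = cj G g (cj G ?t d)"
    using assms(2) t' d(1) by (intro cj_of_cj) simp_all
  then show ?thesis using tG assms(2) S_fix[OF t' S(3)] by simp
qed

text \<open>Every \<open>y\<close> in \<open>V\<close> is a commutator built from \<open>d\<close>
  and a conjugate of \<open>d\<close>, and \<open>T\<close> centralizes both.\<close>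

lemma T_fix_V:
  assumes "t \<in> T" "y \<in> V"
  shows "cj G t y = y"
proof -
  have tG: "t \<in> carrier G" using T_S[OF assms(1)] by simp
  let ?z = "cj G d y"
  have z: "?z \<in> carrier G" using d(1) assms(2) by simp
  have dd: "cj G t d = d" using S_fix[OF T_S[OF assms(1)] S(3)] .
  have "cj G t (cj G ?z d \<otimes> inv d) = cj G ?z d \<otimes> inv d"
    using T_fix_conj_d[OF assms(1) z] dd tG z d(1) by (simp add: cj_m cj_inv)
  then show ?thesis using V_commutator[OF assms(2)] by simp
qed

lemma S_nrm_V: "s \<in> S \<Longrightarrow> y \<in> V \<Longrightarrow> cj G s y \<in> V"
proof -
  have "subgroup (nrm G V) G" using fin V_subgroup(1) by (rule nrm_subgroup)
  moreover have "T \<subseteq> nrm G V" using T_fix_V T_S S_closed unfolding nrm_def by auto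
  moreover have "d \<in> nrm G V" using d_V d(1) unfolding nrm_def by blast
  ultimately have "S \<subseteq> nrm G V" using S(3) d_notin_T by (rule S_generated)
  then show "s \<in> S \<Longrightarrow> y \<in> V \<Longrightarrow> cj G s y \<in> V" unfolding nrm_def by blast
qed

text \<open>By G = V N only conjugation by \<open>n\<close> in \<open>N\<close> is in question.
  Writing \<open>y\<close> as a commutator puts its conjugate into the form b u with
  \<open>b\<close> in \<open>V\<close> and \<open>u\<close> in \<open>S\<close>; it is an
  involution, which forces \<open>u\<close> to vanish.\<close>

lemma V_normal:
  assumes "g \<in> carrier G" "y \<in> V"
  shows "cj G g y \<in> V"
proof -
  have *: "cj G n y \<in> V" if n: "n \<in> N" and y: "y \<in> V" for n y
  proof -
    let ?z = "cj G d y"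
    have z: "?z \<in> carrier G" using d(1) y by simp
    have nG: "n \<in> carrier G" and yG: "y \<in> carrier G" using n y by simp_all
    obtain a n' where an: "a \<in> V" "n' \<in> N" "n \<otimes> ?z = a \<otimes> n'" using V_N_product[OF m_closed[OF nG z]] by blast
    let ?s = "cj G n' d" let ?s' = "cj G n d"
    have s: "?s \<in> S" "?s' \<in> S" using N_S[OF an(2) S(3)] N_S[OF n S(3)] .
    have aG: "a \<in> carrier G" "n' \<in> carrier G" using an by simp_all
    have b: "a \<otimes> cj G ?s a \<in> V" (is "?b \<in> V") using V_m[OF an(1) S_nrm_V[OF s(1) an(1)]] .
    have u: "?s \<otimes> inv ?s' \<in> S" (is "?u \<in> S") using s S_m S_inv by blast
    have sG: "?s \<in> carrier G" "?s' \<in> carrier G" using s by simp_all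
    have bG: "?b \<in> carrier G" "?u \<in> carrier G" using b u by (simp_all only: V_closed S_closed)
    have "cj G n y = cj G n (cj G ?z d \<otimes> inv d)" using V_commutator[OF y] by simp
    also have "\<dots> = cj G n (cj G ?z d) \<otimes> inv ?s'" using nG z d(1) by (simp add: cj_m cj_inv)
    also have "cj G n (cj G ?z d) = cj G (a \<otimes> n') d" using an(3) nG z d(1) by (metis cj_cj)
    also have "\<dots> = cj G a ?s" using aG d(1) by (simp add: cj_cj)
    also have "\<dots> = ?b \<otimes> ?s" using cj_involution[OF aG(1) sG(1) V_inv[OF an(1)]] .
    also have "?b \<otimes> ?s \<otimes> inv ?s' = ?b \<otimes> ?u" using bG sG by (simp only: m_assoc inv_closed)
    finally have eq: "cj G n y = ?b \<otimes> ?u" .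
    have "cj G n y \<otimes> cj G n y = \<one>" using cj_m[OF nG yG yG] V_sq[OF y] nG by simp
    \<comment> \<open>\<open>S\<close> normalizes \<open>V\<close>, so this equation puts the square
      of \<open>?u\<close> into the trivial intersection of \<open>V\<close> and \<open>S\<close>;
      elements of order 2 are absent from \<open>S\<close>.\<close>
    then have "(?b \<otimes> cj G ?u ?b) \<otimes> (?u \<otimes> ?u) = \<one>"
      using four_pair_product[OF bG] eq by simp
    moreover have v': "?b \<otimes> cj G ?u ?b \<in> V" using V_m[OF b S_nrm_V[OF u b]] .
    ultimately have "?u \<otimes> ?u = inv (?b \<otimes> cj G ?u ?b)"
      using bG by (metis inv_equality inv_comm m_closed V_closed)
    then have "?u \<otimes> ?u \<in> V" using V_inv[OF v'] v' by simp
    then have "?u \<otimes> ?u = \<one>" using S_m[OF u u] V_S by blast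
    then have "?u = \<one>" by (rule S_square[OF u])
    then show ?thesis using eq b bG by simp
  qed
  obtain a n where an: "a \<in> V" "n \<in> N" "g = a \<otimes> n" using V_N_product[OF assms(1)] by blast
  have n: "cj G n y \<in> V" using *[OF an(2) assms(2)] .
  have "cj G a (cj G n y) = cj G n y"
    using V_comm[OF an(1) n] an(1) n by (simp add: cj_eq_iff)
  then have "cj G g y = cj G n y" using an assms(2) by (simp add: cj_cj)
  then show ?thesis using n by simp
qed

text \<open>The elements of \<open>S\<close> that \<open>x\<close> carries into \<open>S\<close>
  form a subgroup containing \<open>T\<close> and \<open>e\<close>, hence all of
  \<open>S\<close>.\<close>

lemma N_member:
  assumes e: "e \<in> S" "e \<notin> T" and x: "x \<in> carrier G" "cj G x e \<in> S"
  shows "x \<in> N"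
proof -
  let ?M = "{s \<in> S. cj G x s \<in> S}"
  have "subgroup ?M G"
  proof (rule finite_subgroupI)
    show "finite ?M" using S(2) card_ge_0_finite[of S] by simp
    show "?M \<subseteq> carrier G" using S_closed by blast
    show "\<one> \<in> ?M" using subgroup.one_closed[OF S(1)] x(1) by simp
    show "\<And>a b. a \<in> ?M \<Longrightarrow> b \<in> ?M \<Longrightarrow> a \<otimes> b \<in> ?M" using x(1) by (simp add: cj_m S_m)
  qed
  moreover have "T \<subseteq> ?M" using T_S T_cj_S x(1) by blast
  moreover have "e \<in> ?M" using e x by blast
  ultimately have "S \<subseteq> ?M" using e by (intro S_generated)
  then show ?thesis unfolding N_def nrm_def using x(1) by blast
qed

lemma not_8_dvd_N: "\<not> 8 dvd card N"
  using card_N by auto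

text \<open>Were \<open>T\<close> central, the elements of order 3 inverted in the dihedral and
  dicyclic groups would lie outside \<open>T\<close>. By \<open>N_member\<close> a four-group and an
  element of order 4 would then lie in \<open>N\<close>, whose order is not divisible by 8.\<close>

lemma T_moved: "\<exists>g\<in>carrier G. \<exists>t\<in>T. cj G g t \<noteq> t"
proof (rule ccontr)
  assume "\<not> ?thesis"
  then have cen: "cj G g t = t" if "g \<in> carrier G" "t \<in> T" for g t using that by blast
  have notT: "e \<notin> T" if e: "e \<in> S" "e \<noteq> \<one>" "g \<in> carrier G" "cj G g e = e [^] (2::nat)" for e g
  proof
    assume "e \<in> T"
    then have "e [^] (2::nat) = e" using cen e(3,4) by metis
    then show False using square_neq[OF S_closed[OF e(1)] e(2)] by blast
  qed
  have sq: "e [^] (2::nat) \<in> S" if "e \<in> S" for e using subgroup_pow_closed[OF S(1) that] .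
  obtain e r z where e: "e \<in> S" "e \<noteq> \<one>" "r \<in> carrier G" "z \<in> carrier G" "four_pair \<one> r z" "cj G r e = e [^] (2::nat)" "cj G z e = e"
    by (rule dihedral_12_data[OF host into])
  have eT: "e \<notin> T" by (rule notT[OF e(1,2,3,6)])
  have rz: "r \<in> N" "z \<in> N" using N_member[OF e(1) eT] e sq by simp_all
  obtain e' f where f: "e' \<in> S" "e' \<noteq> \<one>" "f \<in> carrier G" "f [^] (4::nat) = \<one>" "f [^] (2::nat) \<noteq> \<one>" "cj G f e' = e' [^] (2::nat)"
    by (rule dicyclic_12_data[OF host into])
  have "f \<in> N" using N_member[OF f(1) notT[OF f(1,2,3,6)] f(3)] f(6) sq[OF f(1)] by simp
  from eight_dvd[OF fin N_subgroup this f(4,5) rz e(5)] show False using not_8_dvd_N by blast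
qed

lemma VN_one:
  assumes "y \<in> V" "n \<in> N" "y \<otimes> n = \<one>"
  shows "n = \<one>"
proof -
  have "n \<otimes> y = \<one>" using assms by (simp add: inv_comm)
  then have "inv y = n" using assms by (intro inv_equality) simp_all
  then have "n \<in> V" using V_inv[OF assms(1)] assms(1) by simp
  then show ?thesis using assms(2) V_N by blast
qed

end

section \<open>A generator of the core and the elements fixing it\<close>

locale order_12_host_c = order_12_host +
  fixes c
  assumes c: "c \<in> T" "c \<noteq> \<one>"
begin

lemma cS: "c \<in> S" and cG: "c \<in> carrier G" 
  using T_S[OF c(1)] by simp_all

lemma powers_T: "t \<in> T \<Longrightarrow> t \<noteq> \<one> \<Longrightarrow> powers t = T"
  and T_3: "t \<in> T \<Longrightarrow> t [^] (3::nat) = \<one>"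
  using order_3_powers[OF fin T_subgroup card_T] by (blast, metis nat_pow_one)

lemma T_closed: "t \<in> T \<Longrightarrow> t \<in> carrier G"
  using T_S by simp

lemma T_fixed: "g \<in> carrier G \<Longrightarrow> cj G g c = c \<Longrightarrow> t \<in> T \<Longrightarrow> cj G g t = t"
  using cj_powers_fix[OF _ cG] powers_T[OF c] by blast

lemma T_fixed': "g \<in> carrier G \<Longrightarrow> t \<in> T \<Longrightarrow> t \<noteq> \<one> \<Longrightarrow> cj G g t = t \<Longrightarrow> cj G g c = c"
  using cj_powers_fix[of g t c] powers_T[of t] T_closed c(1) by blast

lemma c_cases:
  assumes g: "g \<in> carrier G"
  shows "cj G g c = c \<or> cj G g c = inv c"
proof -
  have "cj G g c \<in> powers c" using T_normal[OF c(1) g] powers_T[OF c] by simp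
  then obtain i where i: "cj G g c = c [^] (i::nat)" by blast
  have o: "ord c = 3" using ord_3[OF cG T_3[OF c(1)] c(2)] .
  have pe: "c [^] i = c [^] j \<longleftrightarrow> i mod 3 = j mod 3" for j :: nat
    using pow_eq_iff_mod[OF fin cG, of i j] o by simp
  have "cj G g c \<noteq> \<one>" using g cG c(2) by simp
  then have "i mod 3 \<noteq> 0" using i pe[of 0] by simp
  then consider "i mod 3 = 1" | "i mod 3 = 2" by linarith
  then show ?thesis
  proof cases
    case 1
    then show ?thesis using i pe[of 1] cG by simp
  next
    case 2
    then have "cj G g c = c [^] (2::nat)" using i pe[of 2] by simp
    moreover have "c [^] (2::nat) \<otimes> c = \<one>" using T_3[OF c(1)] by (simp add: numeral_2_eq_2 numeral_3_eq_3)
    then have "inv c = c [^] (2::nat)" using cG by (intro inv_equality) simp_all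
    ultimately show ?thesis by simp
  qed
qed

lemma inv_c_neq: "inv c \<noteq> c"
proof
  assume "inv c = c"
  then have "c \<otimes> c = \<one>" using cG by (metis r_inv)
  then show False using S_square[OF cS] c(2) by blast
qed

lemma square_fix_c: "g \<in> carrier G \<Longrightarrow> cj G (g \<otimes> g) c = c"
  using c_cases[of g] cG by (auto simp: cj_cj cj_inv)

lemma V_fix_c: "y \<in> V \<Longrightarrow> cj G y c = c"
  using cj_fix_sym[OF cG _ T_fix_V[OF c(1)]] by simp

lemma S_fix_c: "s \<in> S \<Longrightarrow> cj G s c = c"
  using S_fix cS by simp

lemma c_moved: "\<exists>g\<in>carrier G. cj G g c \<noteq> c"
  using T_moved T_fixed by blast

lemma c_moved_N: "\<exists>n\<in>N. cj G n c \<noteq> c"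
proof -
  obtain g where g: "g \<in> carrier G" "cj G g c \<noteq> c" using c_moved by blast
  obtain y n where yn: "y \<in> V" "n \<in> N" "g = y \<otimes> n" using V_N_product[OF g(1)] by blast
  have "cj G n c \<noteq> c"
  proof
    assume "cj G n c = c"
    then have "cj G g c = c" using yn V_fix_c[OF yn(1)] cG by (simp add: cj_cj)
    then show False using g(2) by blast
  qed
  then show ?thesis using yn(2) by blast
qed

text \<open>An element of order 4 excludes order 18 for \<open>N\<close>; then \<open>N\<close> is
  the product of \<open>S\<close> and the powers of \<open>f\<close>, with trivial
  intersection.\<close>

lemma N_ord_4_product:
  assumes "f \<in> N" "ord f = 4" "g \<in> N"
  shows "card N = 36" "\<exists>s\<in>S. \<exists>x\<in>powers f. g = s \<otimes> x" "S \<inter> powers f \<subseteq> {\<one>}"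
proof -
  have P: "subgroup (powers f) G" "card (powers f) = 4"
    using subgroup_powers[OF fin] card_powers[OF fin] assms(1,2) by simp_all
  have "4 dvd card N" using ord_dvd_card[OF fin N_subgroup assms(1)] assms(2) by simp
  then show c: "card N = 36" using card_N by auto
  have "coprime (card S) (card (powers f))" using S(2) P(2) by (simp add: coprime_iff_gcd_eq_1 gcd_red_nat[of 9 4])
  then show i: "S \<inter> powers f \<subseteq> {\<one>}" using coprime_Int[OF fin S(1) P(1)] by blast
  show "\<exists>s\<in>S. \<exists>x\<in>powers f. g = s \<otimes> x"
    by (rule disjoint_product_within[OF fin N_subgroup S(1) S_N P(1) powers_subset_subgroup[OF N_subgroup assms(1)] i _ assms(3)])
      (simp add: S(2) P(2) c)
qed

lemma ord_4: "f \<in> carrier G \<Longrightarrow> f [^] (4::nat) = \<one> \<Longrightarrow> f [^] (2::nat) \<noteq> \<one> \<Longrightarrow> ord f = 4"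
  using ord_prime_power[of f 2] two_is_prime_nat by simp

text \<open>The element of order 4 in the cyclic group centralizes some \<open>e\<close>, which is
  enough if \<open>e\<close> lies in \<open>T\<close>. Otherwise \<open>f\<close> lies in
  \<open>N\<close>, and the reflection \<open>r\<close> of the dihedral group must invert
  \<open>T\<close>, since else 8 would divide |N|; decomposing \<open>r\<close> shows that it
  centralizes \<open>T\<close>, a contradiction.\<close>

lemma cyclic_4_fix_c:
  obtains f where "f \<in> carrier G" "f [^] (4::nat) = \<one>" "f [^] (2::nat) \<noteq> \<one>" "cj G f c = c"
proof -
  obtain e f where ef: "e \<in> S" "e \<noteq> \<one>" "f \<in> carrier G" "f [^] (4::nat) = \<one>" "f [^] (2::nat) \<noteq> \<one>" "cj G f e = e"
    by (rule cyclic_12_data[OF host into])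
  have "e \<in> T"
  proof (rule ccontr)
    assume eT: "e \<notin> T"
    have fN: "f \<in> N" using N_member[OF ef(1) eT ef(3)] ef(1,6) by simp
    have of4: "ord f = 4" using ord_4[OF ef(3-5)] .
    obtain e' r z where e': "e' \<in> S" "e' \<noteq> \<one>" "r \<in> carrier G" "z \<in> carrier G" "four_pair \<one> r z" "cj G r e' = e' [^] (2::nat)" "cj G z e' = e'"
      by (rule dihedral_12_data[OF host into])
    have "e' \<in> T"
    proof (rule ccontr)
      assume "e' \<notin> T"
      have "r \<in> N" "z \<in> N" using N_member[OF e'(1) \<open>e' \<notin> T\<close>] e' subgroup_pow_closed[OF S(1) e'(1)] by simp_all
      from eight_dvd[OF fin N_subgroup fN ef(4,5) this e'(5)] show False using not_8_dvd_N by blast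
    qed
    have rc: "cj G r c \<noteq> c"
    proof
      assume "cj G r c = c"
      then have "cj G r e' = e'" using T_fixed[OF e'(3) _ \<open>e' \<in> T\<close>] by blast
      then show False using square_neq[OF S_closed[OF e'(1)] e'(2)] e'(6) by simp
    qed
    have rr: "r \<otimes> r = \<one>" using subgroup_pair_involution[OF e'(5)] by blast
    obtain y n where yn: "y \<in> V" "n \<in> N" "r = y \<otimes> n" using V_N_product[OF e'(3)] by blast
    have ynG: "y \<in> carrier G" "n \<in> carrier G" using yn by simp_all
    \<comment> \<open>The square of \<open>r\<close> is split along G = V N, then the square of
      \<open>n\<close> along the factorization of \<open>N\<close> into \<open>S\<close> and the
      powers of \<open>f\<close>; both factors outside \<open>V\<close> and \<open>S\<close> become
      involutions or trivial.\<close>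
    have "(y \<otimes> cj G n y) \<otimes> (n \<otimes> n) = \<one>" using four_pair_product[OF ynG] rr yn(3) by simp
    then have nn: "n \<otimes> n = \<one>"
      by (rule VN_one[OF V_m[OF yn(1) V_normal[OF ynG(2) yn(1)]] subgroup.m_closed[OF N_subgroup yn(2) yn(2)]])
    obtain s x where sx: "s \<in> S" "x \<in> powers f" "n = s \<otimes> x" using N_ord_4_product(2)[OF fN of4 yn(2)] by blast
    have P: "subgroup (powers f) G" using subgroup_powers[OF fin ef(3)] .
    have xN: "x \<in> N" using sx(2) powers_subset_subgroup[OF N_subgroup fN] by blast
    have sxG: "s \<in> carrier G" "x \<in> carrier G" using sx(1) xN by simp_all
    have s': "s \<otimes> cj G x s \<in> S" (is "?s \<in> S") using S_m[OF sx(1) N_S[OF xN sx(1)]] .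
    have "?s \<otimes> (x \<otimes> x) = \<one>" using four_pair_product[OF sxG] nn sx(3) by simp
    then have "x \<otimes> x = inv ?s" using s' sxG by (metis S_closed inv_comm inv_equality m_closed)
    then have "x \<otimes> x \<in> S" using S_inv[OF s'] by simp
    then have xx: "x \<otimes> x = \<one>" using N_ord_4_product(3)[OF fN of4 fN] subgroup.m_closed[OF P sx(2,2)] by blast
    obtain j where j: "x = f [^] (j::nat)" using sx(2) by blast
    have "f [^] (j + j) = \<one>" using xx j ef(3) by (simp add: nat_pow_mult)
    then have "4 dvd j + j" using of4 pow_eq_id[OF ef(3)] by simp
    \<comment> \<open>So \<open>x\<close> is a square of a power of \<open>f\<close>, and squares
      act trivially on the group \<open>T\<close> of order 3.\<close>
    then have "even j" by presburger
    then obtain i where "j = i + i" by (metis evenE mult_2)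
    then have "x = f [^] i \<otimes> f [^] i" using j ef(3) by (simp add: nat_pow_mult)
    then have "cj G x c = c" using square_fix_c ef(3) by simp
    then have "cj G n c = c" using sx(3) sxG cG S_fix_c[OF sx(1)] by (simp add: cj_cj)
    then have "cj G r c = c" using yn(3) ynG cG V_fix_c[OF yn(1)] by (simp add: cj_cj)
    then show False using rc by blast
  qed
  then have "cj G f c = c" using T_fixed'[OF ef(3) _ ef(2,6)] by blast
  then show thesis by (rule that[OF ef(3-5)])
qed

text \<open>Take the \<open>N\<close>-component of an element of order 4 that fixes
  \<open>c\<close>. It turns out to be an involution, and since the square of \<open>f\<close> is
  not trivial, it must move the \<open>V\<close>-component.\<close>

lemma involution_fix_c:
  obtains b y where "b \<in> N" "b \<otimes> b = \<one>" "cj G b c = c" "y \<in> V" "cj G b y \<noteq> y"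
proof -
  obtain f where f: "f \<in> carrier G" "f [^] (4::nat) = \<one>" "f [^] (2::nat) \<noteq> \<one>" "cj G f c = c"
    by (rule cyclic_4_fix_c)
  obtain y n where yn: "y \<in> V" "n \<in> N" "f = y \<otimes> n" using V_N_product[OF f(1)] by blast
  have ynG: "y \<in> carrier G" "n \<in> carrier G" using yn by simp_all
  have "cj G y (cj G n c) = c" using f(4) yn(3) ynG cG by (simp add: cj_cj)
  then have "cj G n c = cj G (inv y) c" using ynG cG by (metis cj_closed cj_inv_cj)
  then have nc: "cj G n c = c" using V_inv[OF yn(1)] V_fix_c[OF yn(1)] by simp
  let ?y = "y \<otimes> cj G n y" let ?m = "n \<otimes> n"
  have yV: "?y \<in> V" using V_m[OF yn(1) V_normal[OF ynG(2) yn(1)]] .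
  have mN: "?m \<in> N" using subgroup.m_closed[OF N_subgroup yn(2,2)] .
  have yG: "?y \<in> carrier G" "?m \<in> carrier G" using ynG by simp_all
  have ff: "f \<otimes> f = ?y \<otimes> ?m" using four_pair_product[OF ynG] yn(3) by simp
  have f2: "f \<otimes> f \<noteq> \<one>" using f(1,3) by (simp add: numeral_2_eq_2)
  have "(f \<otimes> f) \<otimes> (f \<otimes> f) = f [^] (4::nat)" using f(1) by (simp add: numeral_eq_Suc m_assoc)
  then have "(?y \<otimes> cj G ?m ?y) \<otimes> (?m \<otimes> ?m) = \<one>" using four_pair_product[OF yG] ff f(2) by simp
  then have mm: "?m \<otimes> ?m = \<one>"
    by (rule VN_one[OF V_m[OF yV V_normal[OF yG(2) yV]] subgroup.m_closed[OF N_subgroup mN mN]])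
  \<comment> \<open>If \<open>n\<close> had order 4, then \<open>N\<close> would be the product of
    \<open>S\<close> and its powers and would fix \<open>c\<close>, against
    \<open>c_moved_N\<close>.\<close>
  have m1: "?m = \<one>"
  proof (rule ccontr)
    assume "?m \<noteq> \<one>"
    then have n2: "n [^] (2::nat) \<noteq> \<one>" using ynG(2) by (simp add: numeral_2_eq_2)
    have "n [^] (4::nat) = \<one>" using mm ynG(2) by (simp add: numeral_eq_Suc m_assoc)
    then have o4: "ord n = 4" using ord_4[OF ynG(2) _ n2] by blast
    have "cj G x c = c" if x: "x \<in> N" for x
    proof -
      obtain s z where sz: "s \<in> S" "z \<in> powers n" "x = s \<otimes> z" using N_ord_4_product(2)[OF yn(2) o4 x] by blast
      have zG: "z \<in> carrier G" using sz(2) ynG(2) by auto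
      have "z \<in> {g \<in> carrier G. cj G g c = c}"
        using powers_subset_subgroup[OF centralizer_subgroup[OF fin cG], of n] sz(2) nc ynG(2) by blast
      then have "cj G z c = c" by blast
      then show ?thesis using sz(1,3) zG cG S_fix_c[OF sz(1)] by (simp add: cj_cj)
    qed
    then show False using c_moved_N by blast
  qed
  have "cj G n y \<noteq> y"
  proof
    assume "cj G n y = y"
    then have "f \<otimes> f = \<one>" using ff m1 V_sq[OF yn(1)] by simp
    then show False using f2 by blast
  qed
  then show thesis by (rule that[OF yn(2) m1 nc yn(1)])
qed

end

section \<open>An involution fixing the core but moving the four-group, and the final
  factorization\<close>

locale order_12_host_b = order_12_host_c +
  fixes b y\<^sub>0
  assumes b: "b \<in> N" "b \<otimes> b = \<one>" "cj G b c = c" and y\<^sub>0: "y\<^sub>0 \<in> V" "cj G b y\<^sub>0 \<noteq> y\<^sub>0"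
begin

definition C where "C = {x \<in> N. cj G x c = c}"

lemma bG: "b \<in> carrier G" using b(1) by simp

lemma b_neq_one: "b \<noteq> \<one>"
  using y\<^sub>0 by auto

lemma C_N: "x \<in> C \<Longrightarrow> x \<in> N"
  and C_c: "x \<in> C \<Longrightarrow> cj G x c = c"
  and C_I: "x \<in> N \<Longrightarrow> cj G x c = c \<Longrightarrow> x \<in> C"
  unfolding C_def by blast+

lemma C_subgroup: "subgroup C G"
proof (rule finite_subgroupI)
  show "finite C" "C \<subseteq> carrier G" using fin C_N N_closed by (meson finite_subset subsetI)+
  show "\<one> \<in> C" by (rule C_I) (use subgroup.one_closed[OF N_subgroup] cG in simp_all)
  fix x z assume "x \<in> C" "z \<in> C"
  then have xz: "x \<in> N" "z \<in> N" "cj G x c = c" "cj G z c = c" using C_N C_c by blast+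
  then have "cj G (x \<otimes> z) c = c" using cG by (simp add: cj_cj)
  then show "x \<otimes> z \<in> C" using subgroup.m_closed[OF N_subgroup xz(1,2)] by (intro C_I)
qed

lemma S_C: "S \<subseteq> C"
  using S_N S_fix_c C_I by blast

lemma b_C: "b \<in> C"
  using b(1,3) by (rule C_I)

lemma ord_b: "ord b = 2"
  by (rule ord_prime[OF bG _ b_neq_one two_is_prime_nat]) (use b(2) bG in \<open>simp add: numeral_2_eq_2\<close>)

text \<open>The order of \<open>C\<close> is a multiple of 18, while \<open>C\<close> is a proper
  subgroup of \<open>N\<close> because some element of \<open>N\<close> moves
  \<open>c\<close>.\<close>

lemma card_C: "card C = 18" and card_N_36: "card N = 36"
proof -
  have "9 dvd card C" using card_dvd_subgroup[OF S(1) C_subgroup S_C] S(2) by simp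
  moreover have "2 dvd card C" using ord_dvd_card[OF fin C_subgroup b_C] ord_b by simp
  ultimately have "18 dvd card C" by presburger
  moreover have "C \<subseteq> N" "C \<noteq> N" using C_N C_c c_moved_N by blast+
  then have "card C < card N" using fin by (intro psubset_card_mono) (meson N_closed finite_subset subsetI, blast)
  moreover have "card C > 0" by (rule subgroup.finite_imp_card_positive[OF C_subgroup fin])
  ultimately show "card C = 18" "card N = 36" using card_N by (auto elim!: dvdE)
qed

lemma C_cases:
  assumes "x \<in> C"
  shows "x \<in> S \<or> (\<exists>s\<in>S. x = s \<otimes> b)"
proof -
  have P: "subgroup (powers b) G" "card (powers b) = 2" "powers b \<subseteq> C"
    using subgroup_powers[OF fin bG] card_powers[OF fin bG] ord_b powers_subset_subgroup[OF C_subgroup b_C] by simp_all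
  have "coprime (card S) (card (powers b))" using S(2) P(2) by simp
  then have "S \<inter> powers b \<subseteq> {\<one>}" by (rule coprime_Int[OF fin S(1) P(1)])
  then obtain s z where sz: "s \<in> S" "z \<in> powers b" "x = s \<otimes> z"
    using disjoint_product_within[OF fin C_subgroup S(1) S_C P(1,3) _ _ assms] S(2) P(2) card_C by auto
  obtain i where i: "z = b [^] (i::nat)" using sz(2) by blast
  have "z = \<one> \<or> z = b"
    using pow_eq_iff_mod[OF fin bG, of i 0] pow_eq_iff_mod[OF fin bG, of i 1] ord_b bG i by (cases "even i") (auto simp: odd_iff_mod_2_eq_one)
  then show ?thesis using sz by auto
qed

lemma S_centralizing_V:
  assumes "x \<in> S" "\<And>y. y \<in> V \<Longrightarrow> cj G x y = y"
  shows "x \<in> T"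
proof (rule ccontr)
  assume x: "x \<notin> T"
  let ?M = "{g \<in> carrier G. cj G g v = v}"
  have "subgroup ?M G" using fin v(1) by (rule centralizer_subgroup)
  moreover have "T \<subseteq> ?M" using T_fix_V V_v T_closed by blast
  moreover have "x \<in> ?M" using assms V_v by simp
  ultimately have "S \<subseteq> ?M" using assms(1) x by (rule S_generated)
  then show False using S(3) dv(1) by blast
qed

text \<open>If x = s b centralizes \<open>V\<close>, then \<open>b\<close> acts on \<open>V\<close>
  as the inverse of \<open>s\<close>. As \<open>b\<close> is an involution, the square of that
  inverse acts trivially, so the odd order of \<open>s\<close> makes the action of \<open>b\<close>
  trivial, against the choice of \<open>y\<^sub>0\<close>.\<close>

lemma C_centralizing_V:
  assumes x: "x \<in> C" and fx: "\<And>y. y \<in> V \<Longrightarrow> cj G x y = y"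
  shows "x \<in> T"
proof (cases "x \<in> S")
  case False
  then obtain s where s: "s \<in> S" "x = s \<otimes> b" using C_cases[OF x] by blast
  let ?s = "inv s"
  have s': "?s \<in> S" using S_inv[OF s(1)] .
  have sG: "s \<in> carrier G" "?s \<in> carrier G" using s(1) by simp_all
  have bs: "cj G b y = cj G ?s y" if "y \<in> V" for y
  proof -
    have "cj G s (cj G b y) = y" using fx[OF that] s(2) sG bG that by (simp add: cj_cj)
    then show ?thesis using sG bG that by (metis V_closed cj_closed cj_inv_cj)
  qed
  have "cj G (?s \<otimes> ?s) y = y" if "y \<in> V" for y
  proof -
    have "y = cj G b (cj G b y)" using b(2) bG that by (simp flip: cj_cj)
    also have "\<dots> = cj G ?s (cj G ?s y)" using bs[OF V_normal[OF bG that]] bs[OF that] by simp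
    finally show ?thesis using sG that by (simp add: cj_cj)
  qed
  then have "?s \<otimes> ?s \<in> T" by (intro S_centralizing_V S_m s')
  \<comment> \<open>The fifth power of a square is the tenth power, which is the element itself
    because ninth powers in \<open>S\<close> are trivial.\<close>
  then have "(?s \<otimes> ?s) [^] (5::nat) \<in> T" by (rule subgroup_pow_closed[OF T_subgroup])
  moreover have "(?s \<otimes> ?s) [^] (5::nat) = ?s [^] (9::nat) \<otimes> ?s"
    using sG by (simp add: numeral_eq_Suc m_assoc)
  ultimately have "?s \<in> T" using S_pow[OF s'] sG by simp
  then have "cj G b y\<^sub>0 = y\<^sub>0" using bs[OF y\<^sub>0(1)] T_fix_V y\<^sub>0(1) by simp
  then show ?thesis using y\<^sub>0(2) by blast
qed (use S_centralizing_V fx in blast)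

text \<open>The powers of \<open>d\<close> are transitive on the involutions of \<open>V\<close> and
  centralize \<open>T\<close>, so \<open>g\<close> can be corrected to fix \<open>v\<close> without
  changing its action on \<open>c\<close>.\<close>

lemma fix_v:
  assumes "g \<in> N"
  obtains g' where "g' \<in> N" "cj G g' v = v" "cj G g' c = cj G g c" "\<exists>s\<in>S. g = s \<otimes> g'"
proof -
  have gG: "g \<in> carrier G" using assms by simp
  have "cj G g v \<in> V" "cj G g v \<noteq> \<one>" using V_normal[OF gG V_v] gG v by simp_all
  then obtain i where i: "cj G (d [^] (i::nat)) v = cj G g v" using V_orbit by blast
  let ?s = "d [^] i"
  have s: "?s \<in> S" using subgroup_pow_closed[OF S(1,3)] .
  have sG: "?s \<in> carrier G" "inv ?s \<in> carrier G" using s by simp_all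
  have "inv ?s \<otimes> g \<in> N" using S_N S_inv[OF s] assms subgroup.m_closed[OF N_subgroup] by blast
  moreover have "cj G (inv ?s) (cj G g v) = v" unfolding i[symmetric] using sG v(1) by simp
  then have "cj G (inv ?s \<otimes> g) v = v" using cj_cj[OF sG(2) gG v(1)] by simp
  moreover have "cj G g c \<in> S" using T_cj_S[OF c(1) gG] .
  then have "cj G (inv ?s) (cj G g c) = cj G g c" using S_fix[OF S_inv[OF s]] by blast
  then have "cj G (inv ?s \<otimes> g) c = cj G g c" using cj_cj[OF sG(2) gG cG] by simp
  moreover have "g = ?s \<otimes> (inv ?s \<otimes> g)" using sG gG by (simp flip: m_assoc)
  ultimately show thesis using that s by blast
qed

lemma fix_v_cases:
  assumes "g \<in> carrier G" "cj G g v = v"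
  shows "(\<forall>y\<in>V. cj G g y = y) \<or> cj G g (cj G d v) = v \<otimes> cj G d v"
proof -
  let ?w = "cj G d v"
  have w: "?w \<in> V" "?w \<in> carrier G" using d_V[OF V_v] by simp_all
  have "cj G g ?w \<in> V" using V_normal[OF assms(1) w(1)] .
  moreover have "cj G g ?w \<noteq> \<one>" using assms(1) w(2) d(1) v(1,2) by simp
  moreover have "cj G g ?w \<noteq> v"
  proof
    assume "cj G g ?w = v"
    then have "?w = v" using assms w(2) v(1) by (metis cj_inj)
    then show False using dv(1) by blast
  qed
  ultimately have "cj G g ?w = ?w \<or> cj G g ?w = v \<otimes> ?w" unfolding V_def by blast
  moreover have "\<forall>y\<in>V. cj G g y = y" if "cj G g ?w = ?w"
  proof -
    have "cj G g (v \<otimes> ?w) = v \<otimes> ?w" using assms that v(1) w(2) by (simp add: cj_m)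
    then show ?thesis using assms that cj_one[OF assms(1)] unfolding V_def by blast
  qed
  ultimately show ?thesis by blast
qed

text \<open>After correction both \<open>b'\<close> and \<open>n'\<close> fix \<open>v\<close>, and
  \<open>b'\<close> swaps the other two involutions while fixing \<open>c\<close>. If
  \<open>n'\<close>, which inverts \<open>c\<close>, swaps them too, the product of both acts
  trivially on \<open>V\<close> and still inverts \<open>c\<close>.\<close>

lemma inverting_involution:
  obtains r where "r \<in> N" "r \<otimes> r = \<one>" "cj G r c = inv c" "\<And>y. y \<in> V \<Longrightarrow> cj G r y = y"
proof -
  let ?w = "cj G d v"
  have wG: "?w \<in> carrier G" using d(1) v(1) by simp
  obtain b' where b': "b' \<in> N" "cj G b' v = v" "cj G b' c = cj G b c" "\<exists>s\<in>S. b = s \<otimes> b'" by (rule fix_v[OF b(1)])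
  have "\<not> (\<forall>y\<in>V. cj G b' y = y)"
  proof
    assume "\<forall>y\<in>V. cj G b' y = y"
    then have "b' \<in> T" using b' b(3) by (intro C_centralizing_V C_I) simp_all
    then have "b \<in> S" using b'(4) T_S S_m by blast
    then show False using S_square b(2) b_neq_one by blast
  qed
  then have bw: "cj G b' ?w = v \<otimes> ?w" using fix_v_cases[OF N_closed[OF b'(1)] b'(2)] by blast
  obtain n where n: "n \<in> N" "cj G n c \<noteq> c" using c_moved_N by blast
  obtain n' where n': "n' \<in> N" "cj G n' v = v" "cj G n' c = cj G n c" by (rule fix_v[OF n(1)])
  have n'c: "cj G n' c = inv c" using c_cases[of n] n n'(3) by simp
  have "\<exists>r\<in>N. cj G r c = inv c \<and> (\<forall>y\<in>V. cj G r y = y)"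
  proof (cases "\<forall>y\<in>V. cj G n' y = y")
    case True
    then show ?thesis using n'(1) n'c by blast
  next
    case False
    then have nw: "cj G n' ?w = v \<otimes> ?w" using fix_v_cases[OF N_closed[OF n'(1)] n'(2)] by blast
    have G: "b' \<in> carrier G" "n' \<in> carrier G" using b'(1) n'(1) by simp_all
    have r: "b' \<otimes> n' \<in> N" using subgroup.m_closed[OF N_subgroup b'(1) n'(1)] .
    have "cj G (b' \<otimes> n') c = cj G b' (inv c)" using cj_cj[OF G cG] n'c by simp
    also have "\<dots> = inv c" using cj_inv[OF G(1) cG] b'(3) b(3) by simp
    finally have rc: "cj G (b' \<otimes> n') c = inv c" .
    have rv: "cj G (b' \<otimes> n') v = v" using cj_cj[OF G v(1)] n'(2) b'(2) by simp
    have "cj G (b' \<otimes> n') ?w = cj G b' (v \<otimes> ?w)" using cj_cj[OF G wG] nw by simp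
    also have "\<dots> = v \<otimes> (v \<otimes> ?w)" using cj_m[OF G(1) v(1) wG] b'(2) bw by simp
    also have "\<dots> = (v \<otimes> v) \<otimes> ?w" using m_assoc[OF v(1,1) wG] by simp
    also have "\<dots> = ?w" using v(3) wG by simp
    finally have rw: "cj G (b' \<otimes> n') ?w = ?w" .
    have "v \<otimes> ?w \<noteq> ?w" using v(1,2) wG by simp
    then have "\<forall>y\<in>V. cj G (b' \<otimes> n') y = y" using fix_v_cases[OF N_closed[OF r] rv] rw by metis
    then show ?thesis using r rc by blast
  qed
  then obtain r where r: "r \<in> N" "cj G r c = inv c" "\<And>y. y \<in> V \<Longrightarrow> cj G r y = y" by blast
  have rG: "r \<in> carrier G" using r(1) by simp
  have "cj G (r \<otimes> r) y = y" if "y \<in> V" for y using cj_cj[OF rG rG V_closed[OF that]] r(3)[OF that] by simp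
  then have rr: "r \<otimes> r \<in> T"
    using C_centralizing_V[OF C_I[OF subgroup.m_closed[OF N_subgroup r(1,1)] square_fix_c[OF rG]]] by blast
  \<comment> \<open>The square of \<open>r\<close> lies in \<open>T\<close> and commutes with
    \<open>r\<close>, but \<open>r\<close> fixes no nontrivial element of \<open>T\<close>.\<close>
  have "r \<otimes> r = \<one>"
  proof (rule ccontr)
    assume "r \<otimes> r \<noteq> \<one>"
    moreover have "cj G r (r \<otimes> r) = r \<otimes> r" using rG by (simp add: cj_eq_iff m_assoc)
    ultimately have "cj G r c = c" using T_fixed'[OF rG rr] by blast
    then show False using r(2) inv_c_neq by simp
  qed
  then show thesis using that r by blast
qed

text \<open>The centralizer of \<open>r\<close> gets index 3 by a Frattini argument with
  \<open>T\<close>: every conjugate of \<open>r\<close> is already a conjugate under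
  \<open>T\<close>. It is then paired with \<open>N\<close>, which has index 4.\<close>

lemma host_iso: "order G = 144" "G \<cong> sym_group 3 \<times>\<times> sym_group 4"
proof -
  show o: "order G = 144" using order_N card_N_36 by simp
  obtain r where r: "r \<in> N" "r \<otimes> r = \<one>" "cj G r c = inv c" "\<And>y. y \<in> V \<Longrightarrow> cj G r y = y"
    by (rule inverting_involution) blast
  have rG: "r \<in> carrier G" using r(1) by simp
  have inv_r: "inv r = r" using r(2) rG by (intro inv_equality)
  have rT: "cj G r t = inv t" if t: "t \<in> T" for t
  proof -
    obtain i where "t = c [^] (i::nat)" using t powers_T[OF c] by blast
    then show ?thesis using r(3) rG cG by (simp add: cj_pow nat_pow_inv)
  qed
  let ?C = "{g \<in> carrier G. cj G g r = r}"
  have C: "subgroup ?C G" using fin rG by (rule centralizer_subgroup)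
  have TC: "T \<inter> ?C \<subseteq> {\<one>}"
  proof
    fix t assume t: "t \<in> T \<inter> ?C"
    then have "cj G r t = t" using cj_fix_sym[OF _ rG, of t] T_closed by blast
    then have "t = \<one>" using T_fixed'[OF rG, of t] r(3) inv_c_neq t by auto
    then show "t \<in> {\<one>}" by simp
  qed
  have prod: "\<exists>s\<in>T. \<exists>x\<in>?C. g = s \<otimes> x" if g: "g \<in> carrier G" for g
  proof -
    obtain y n where yn: "y \<in> V" "n \<in> N" "g = y \<otimes> n" using V_N_product[OF g] by blast
    have G: "y \<in> carrier G" "n \<in> carrier G" using yn by simp_all
    let ?q = "cj G n r"
    have qN: "?q \<in> N"
      using yn(2) r(1) unfolding cj_def by (intro subgroup.m_closed[OF N_subgroup] subgroup.m_inv_closed[OF N_subgroup])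
    have qG: "?q \<in> carrier G" using qN by simp
    have qV: "cj G ?q z = z" if z: "z \<in> V" for z
    proof -
      let ?z = "cj G (inv n) z"
      have z': "?z \<in> V" using V_normal[OF inv_closed[OF G(2)] z] .
      have "cj G ?q (cj G n ?z) = cj G n (cj G r ?z)" using cj_of_cj[OF G(2) rG V_closed[OF z']] .
      then show ?thesis using r(4)[OF z'] G(2) z by simp
    qed
    have "cj G ?q y = y" using qV[OF yn(1)] .
    then have "cj G y ?q = ?q" using cj_fix_sym[OF qG G(1)] by blast
    then have gq: "cj G g r = ?q" using yn(3) cj_cj[OF G rG] by simp
    have qc: "cj G ?q c = inv c"
    proof -
      let ?c = "cj G (inv n) c"
      have c': "?c \<in> T" using T_normal[OF c(1)] G(2) by simp
      have "cj G ?q (cj G n ?c) = cj G n (cj G r ?c)" using cj_of_cj[OF G(2) rG T_closed[OF c']] .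
      also have "\<dots> = inv (cj G n ?c)" using rT[OF c'] cj_inv[OF G(2) T_closed[OF c']] by simp
      finally show ?thesis using G(2) cG by simp
    qed
    \<comment> \<open>Both \<open>?q\<close> and \<open>r\<close> invert \<open>c\<close> and
      centralize \<open>V\<close>, so their product centralizes \<open>T\<close> and
      \<open>V\<close> and lies in \<open>T\<close>.\<close>
    let ?t = "?q \<otimes> r"
    have "cj G ?t c = cj G ?q (inv c)" using cj_cj[OF qG rG cG] r(3) by simp
    also have "\<dots> = c" using cj_inv[OF qG cG] qc cG by simp
    finally have "?t \<in> C" using C_I subgroup.m_closed[OF N_subgroup qN r(1)] by blast
    moreover have "cj G ?t z = z" if "z \<in> V" for z
      using cj_cj[OF qG rG V_closed[OF that]] r(4)[OF that] qV[OF that] by simp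
    ultimately have tT: "?t \<in> T" by (rule C_centralizing_V)
    define t where "t = ?t"
    have tG: "t \<in> carrier G" using T_closed[OF tT] by (simp add: t_def)
    have qt: "?q = t \<otimes> r" unfolding t_def using qG rG r(2) by (simp add: m_assoc)
    \<comment> \<open>Since \<open>r\<close> inverts \<open>t\<close>, conjugating \<open>r\<close>
      by t^2 gives t^4 r, which is t r because t^3 is trivial; so t^2 is the element of
      \<open>T\<close> sought.\<close>
    let ?s = "t \<otimes> t"
    have sT: "?s \<in> T" using subgroup.m_closed[OF T_subgroup tT tT] by (simp add: t_def)
    have sG: "?s \<in> carrier G" "inv ?s \<in> carrier G" using tG by simp_all
    have "cj G r (inv ?s) = ?s" using rT[OF subgroup.m_inv_closed[OF T_subgroup sT]] sG by simp
    then have rs: "r \<otimes> inv ?s = ?s \<otimes> r" using cj_eq_iff[OF rG sG(2,1)] by simp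
    have "cj G ?s r = ?s \<otimes> (r \<otimes> inv ?s)" using sG rG by (simp add: cj_def m_assoc)
    also have "\<dots> = (?s \<otimes> ?s) \<otimes> r" unfolding rs using m_assoc[OF sG(1,1) rG] by simp
    also have "?s \<otimes> ?s = t [^] (3::nat) \<otimes> t" using tG by (simp add: numeral_3_eq_3 m_assoc)
    also have "\<dots> = t" using T_3[OF tT] tG by (simp add: t_def)
    finally have "cj G ?s r = cj G g r" using qt gq by simp
    then have "cj G (inv ?s \<otimes> g) r = r" using cj_cj[OF sG(2) g rG] sG(1) rG by (metis cj_inv_cj)
    then have "inv ?s \<otimes> g \<in> ?C" using sG(2) g by simp
    moreover have "g = ?s \<otimes> (inv ?s \<otimes> g)" using sG g by (simp flip: m_assoc)
    ultimately show ?thesis using sT by blast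
  qed
  have "carrier G \<subseteq> (\<lambda>(s, x). s \<otimes> x) ` (T \<times> ?C)"
  proof
    fix g assume "g \<in> carrier G"
    then obtain s x where "s \<in> T" "x \<in> ?C" "g = s \<otimes> x" using prod by blast
    then show "g \<in> (\<lambda>(s, x). s \<otimes> x) ` (T \<times> ?C)" by (intro image_eqI[of _ _ "(s, x)"]) simp_all
  qed
  moreover have fTC: "finite (T \<times> ?C)" using fin T_closed by (metis C finite_SigmaI rev_finite_subset subgroup.subset subsetI)
  ultimately have "order G \<le> card (T \<times> ?C)" unfolding order_def by (meson card_image_le card_mono finite_imageI le_trans)
  moreover have "3 * card ?C \<le> order G" using disjoint_product(1)[OF fin T_subgroup C TC] card_T by simp
  ultimately have oC: "order G = 3 * card ?C" using card_T by (simp add: card_cartesian_product)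
  \<comment> \<open>Such a \<open>g\<close> commutes with \<open>r\<close> and with its conjugate
    c^2 r, hence with \<open>c\<close>. For \<open>y\<close> in \<open>V\<close> the commutator with
    \<open>g\<close> lies in \<open>V\<close> and in \<open>N\<close>, so \<open>g\<close>
    centralizes \<open>V\<close> as well; this puts it into \<open>T\<close>, where only \<one>
    commutes with \<open>r\<close>.\<close>
  have core: "g = \<one>" if g: "g \<in> carrier G" and all: "\<And>x. x \<in> carrier G \<Longrightarrow> cj G x g \<in> ?C \<and> cj G x g \<in> N" for g
  proof -
    have gN: "g \<in> N" and gr: "cj G g r = r" using all[OF one_closed] g by simp_all
    have "cj G (cj G (inv c) g) r = r" using all[of "inv c"] cG by simp
    then have "cj G c (cj G (cj G (inv c) g) r) = cj G c r" by simp
    moreover have "cj G (cj G c (cj G (inv c) g)) (cj G c r) = cj G c (cj G (cj G (inv c) g) r)"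
      using cj_of_cj[of c "cj G (inv c) g" r] cG g rG by simp
    ultimately have g2: "cj G g (cj G c r) = cj G c r" using cG g by simp
    have ri: "r \<otimes> inv c = c \<otimes> r" using cj_eq_iff[OF rG, of "inv c" c] rT[of "inv c"] subgroup.m_inv_closed[OF T_subgroup c(1)] cG by simp
    have "cj G c r = c \<otimes> (r \<otimes> inv c)" using cG rG by (simp add: cj_def m_assoc)
    also have "\<dots> = (c \<otimes> c) \<otimes> r" unfolding ri using cG rG by (simp add: m_assoc)
    finally have "cj G g ((c \<otimes> c) \<otimes> r) = (c \<otimes> c) \<otimes> r" using g2 by simp
    then have "cj G g (c \<otimes> c) \<otimes> r = (c \<otimes> c) \<otimes> r" using cj_m[OF g m_closed[OF cG cG] rG] gr by simp
    then have "cj G g (c \<otimes> c) = c \<otimes> c" using g cG rG by simp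
    moreover have "c \<otimes> c \<in> T" "c \<otimes> c \<noteq> \<one>"
      using subgroup.m_closed[OF T_subgroup c(1,1)] S_square[OF cS] c(2) by blast+
    ultimately have gc: "cj G g c = c" using T_fixed'[OF g] by blast
    have gV: "cj G g y = y" if y: "y \<in> V" for y
    proof -
      have yG: "y \<in> carrier G" using y by simp
      have "cj G y g \<otimes> inv g \<in> N"
        using all[OF yG] gN by (meson N_subgroup subgroup.m_closed subgroup.m_inv_closed)
      moreover have e: "cj G y g \<otimes> inv g = y \<otimes> cj G g (inv y)" using yG g by (simp add: cj_def m_assoc)
      have "cj G g (inv y) = cj G g y" using V_inv[OF y] by simp
      then have e: "cj G y g \<otimes> inv g = y \<otimes> cj G g y" using e by simp
      moreover have "y \<otimes> cj G g y \<in> V" using V_m[OF y V_normal[OF g y]] .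
      ultimately have "y \<otimes> cj G g y = y \<otimes> y" using V_N V_sq[OF y] by auto
      then show ?thesis using yG g by simp
    qed
    have "g \<in> T" using C_centralizing_V[OF C_I[OF gN gc] gV] .
    then show ?thesis using TC g gr by blast
  qed
  have "embeds G (sym_group 3 \<times>\<times> sym_group 4)"
    by (rule embeds_sym_3_4[OF fin C oC N_subgroup order_N core])
  moreover have gr: "group (sym_group 3 \<times>\<times> sym_group 4)" by (intro DirProd_group sym_group_is_group)
  moreover have "finite (carrier (sym_group 3 \<times>\<times> sym_group 4))"
    by (rule group.order_finite[OF gr]) (simp add: order_sym_3_4)
  ultimately show "G \<cong> sym_group 3 \<times>\<times> sym_group 4" using embeds_iso o order_sym_3_4 by metis
qed

end

context group
begin

lemma sylow_3_absorbs:
  assumes fin: "finite (carrier G)" and m: "order G = 3 ^ a * m" "\<not> 3 dvd m"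
  obtains S where "subgroup S G" "card S = 3 ^ a" "absorbs_order_3 G S"
proof -
  have p: "prime (3::nat)" by simp
  obtain S where S: "subgroup S G" "card S = 3 ^ a" using sylow_thm[OF p is_group m(1) fin] by blast
  have "card (rcosets S) * card S = order G" using lagrange[OF S(1)] .
  then have "card (rcosets S) = m" using m(1) S(2) by simp
  then have nd: "\<not> 3 dvd card (rcosets S)" using m(2) by simp
  have "\<exists>g\<in>carrier G. cj G g x \<in> S" if x: "x \<in> carrier G" "x [^] (3::nat) = \<one>" for x
  proof -
    have "ord x dvd 3 ^ 1" using x by (simp add: pow_eq_id)
    then obtain e where "ord x = 3 ^ e" using divides_primepow_nat[OF p] by blast
    then have "card (powers x) = 3 ^ e" using card_powers[OF fin x(1)] by simp
    from conj_into[OF fin p subgroup_powers[OF fin x(1)] this S(1) nd]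
    show ?thesis using self_in_powers[OF x(1)] by blast
  qed
  then show thesis using that[OF S] unfolding absorbs_order_3_def by blast
qed

end

text \<open>The bound and the uniqueness are obtained together: any order up to 144 is assumed, and
  144 comes out. If 9 does not divide the order, the Sylow 3-subgroup consists of the powers of
  \<open>d\<close> and \<open>powers_not_absorbing\<close> applies.\<close>

lemma order_12_unique:
  assumes "group G" "finite (carrier G)" "all_embed 12 G" "order G \<le> 144"
  shows "order G = 144 \<and> G \<cong> sym_group 3 \<times>\<times> sym_group 4"
proof -
  interpret group G by fact
  have pos: "order G > 0" using assms(2) by (simp add: order_gt_0_iff_finite)
  have data: "\<exists>d v. d \<in> S \<and> alternating_4 G d v" if into: "absorbs_order_3 G S" for S
  proof -
    obtain d v where "d \<in> S" "d \<in> carrier G" "v \<in> carrier G" "d [^]\<^bsub>G\<^esub> (3::nat) = \<one>\<^bsub>G\<^esub>" "d \<noteq> \<one>\<^bsub>G\<^esub>"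
      "v \<noteq> \<one>\<^bsub>G\<^esub>" "v \<otimes>\<^bsub>G\<^esub> v = \<one>\<^bsub>G\<^esub>" "cj G d v \<noteq> v" "v \<otimes>\<^bsub>G\<^esub> cj G d v = cj G d v \<otimes>\<^bsub>G\<^esub> v"
      "cj G d (cj G d v) = v \<otimes>\<^bsub>G\<^esub> cj G d v"
      by (rule alternating_12_data[OF assms(3) into])
    then have "d \<in> S \<and> alternating_4 G d v"
      using assms(2) is_group by (simp add: alternating_4_def alternating_4_axioms_def)
    then show ?thesis by blast
  qed
  have 3: "3 dvd order G"
  proof -
    have "absorbs_order_3 G (carrier G)" unfolding absorbs_order_3_def by (auto intro: bexI[of _ "\<one>\<^bsub>G\<^esub>"])
    from eight_dvd_order_12(2)[OF assms(2,3) this] show ?thesis .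
  qed
  show ?thesis
  proof (cases "9 dvd order G")
    case False
    obtain m where m: "order G = 3 ^ 1 * m" using 3 by auto
    have "\<not> 3 dvd m" using False m by (auto elim!: dvdE)
    then obtain S where S: "subgroup S G" "card S = 3 ^ 1" "absorbs_order_3 G S" by (rule sylow_3_absorbs[OF assms(2) m])
    obtain d v where dS: "d \<in> S" and a: "alternating_4 G d v" using data[OF S(3)] by blast
    have "powers d = S" using order_3_powers(1)[OF assms(2) S(1) _ dS] S(2) alternating_4.d(3)[OF a] by simp
    then show ?thesis using alternating_4.powers_not_absorbing[OF a assms(3,4)] S(3) by simp
  next
    case True
    have "absorbs_order_3 G (carrier G)" unfolding absorbs_order_3_def by (auto intro: bexI[of _ "\<one>\<^bsub>G\<^esub>"])
    then have "8 dvd order G" by (rule eight_dvd_order_12(1)[OF assms(2,3)])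
    then have "72 dvd order G" using True by presburger
    then obtain k where k: "order G = 72 * k" by auto
    have "k = 1 \<or> k = 2" using assms(4) pos k by linarith
    \<comment> \<open>Divisibility by 72 and the bound 144 leave no factor 27, so the Sylow
      3-subgroup has order exactly 9.\<close>
    then have m: "order G = 3 ^ 2 * (8 * k)" "\<not> 3 dvd 8 * k" using k by auto
    obtain S where S: "subgroup S G" "card S = 3 ^ 2" "absorbs_order_3 G S" by (rule sylow_3_absorbs[OF assms(2) m])
    obtain d v where d: "d \<in> S" "alternating_4 G d v" using data[OF S(3)] by blast
    have "order_12_host G d v S"
      using d assms(3,4) S by (simp add: order_12_host_def order_12_host_axioms_def)
    then interpret h: order_12_host G d v S .
    obtain c where c: "c \<in> h.T" "c \<noteq> \<one>\<^bsub>G\<^esub>" using h.T_moved cj_one by metis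
    interpret h: order_12_host_c G d v S c by unfold_locales (use c in auto)
    obtain b y where b: "b \<in> h.N" "b \<otimes>\<^bsub>G\<^esub> b = \<one>\<^bsub>G\<^esub>" "cj G b c = c" "y \<in> h.V" "cj G b y \<noteq> y"
      by (rule h.involution_fix_c)
    interpret h: order_12_host_b G d v S c b y by unfold_locales (use b in auto)
    show ?thesis using h.host_iso by blast
  qed
qed


subsection \<open>The classification\<close>

lemma is_iso_finite:
  assumes "G \<cong> M" "group G" "finite (carrier M)"
  shows "finite (carrier G)" "order G = order M"
  using assms(1,3) iso_finite iso_same_card[OF assms(1)] by (auto simp: order_def)

lemma least_order_all_embedI:
  assumes G: "group G" and L: "group L" "order L = N" "N > 0" "all_embed n L" "G \<cong> L"
    and bound: "\<And>H :: nat monoid. group H \<Longrightarrow> finite (carrier H) \<Longrightarrow> all_embed n H \<Longrightarrow> N \<le> order H"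
  shows "least_order_all_embed n G"
proof -
  have f: "finite (carrier L)" using group.order_finite[OF L(1)] L(2,3) by simp
  note G' = is_iso_finite[OF L(5) G f]
  have "L \<cong> G" using group.iso_sym[OF G L(5)] .
  then have "all_embed n G" using L(4) embeds_iso_right[OF L(1) G] unfolding all_embed_def by blast
  then show ?thesis using G' G L(2) bound unfolding least_order_all_embed_def by auto
qed

lemma least_order_all_embed_order:
  assumes "least_order_all_embed n G" "group M" "order M = N" "N > 0" "all_embed n M"
    and bound: "finite (carrier G) \<Longrightarrow> all_embed n G \<Longrightarrow> N \<le> order G"
  shows "group G \<and> finite (carrier G) \<and> all_embed n G \<and> order G = N"
proof -
  have "finite (carrier M)" using group.order_finite[OF assms(2)] assms(3,4) by simp
  from least_order_le[OF assms(1,2) this assms(5)] show ?thesis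
    using assms(1,3) bound by (auto simp: least_order_all_embed_def)
qed

text \<open>A row with a single group uses it for both \<open>M\<close> and \<open>M'\<close>. The
  bound is assumed at two types: minimality compares with groups on \<open>nat\<close>, the order of
  \<open>G\<close> itself concerns its own element type.\<close>

lemma least_order_all_embed_iff:
  fixes G :: "'a monoid"
  assumes G: "group G" and N: "N > 0"
    and M: "group M" "order M = N" "all_embed n M"
    and M': "group M'" "order M' = N" "all_embed n M'"
    and bound: "\<And>H :: nat monoid. group H \<Longrightarrow> finite (carrier H) \<Longrightarrow> all_embed n H \<Longrightarrow> N \<le> order H"
    and G_bound: "group G \<Longrightarrow> finite (carrier G) \<Longrightarrow> all_embed n G \<Longrightarrow> N \<le> order G"
    and unique: "group G \<Longrightarrow> finite (carrier G) \<Longrightarrow> all_embed n G \<Longrightarrow> order G = N \<Longrightarrow> G \<cong> M \<or> G \<cong> M'"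
  shows "least_order_all_embed n G \<longleftrightarrow> G \<cong> M \<or> G \<cong> M'"
proof
  assume "least_order_all_embed n G"
  from least_order_all_embed_order[OF this M(1,2) N M(3) G_bound[OF G]] show "G \<cong> M \<or> G \<cong> M'"
    using unique by blast
next
  assume "G \<cong> M \<or> G \<cong> M'"
  then show "least_order_all_embed n G"
    using least_order_all_embedI[OF G M(1,2) N M(3) _ bound] least_order_all_embedI[OF G M'(1,2) N M'(3) _ bound] by blast
qed

lemma integer_mod_order_le:
  assumes "n > 0" "group H" "finite (carrier H)" "all_embed n H"
  shows "n \<le> order H" "order H = n \<Longrightarrow> H \<cong> integer_mod_group n"
proof -
  have o: "order (integer_mod_group n) = n" using assms(1) by (simp add: order_integer_mod_group)
  have e: "embeds (integer_mod_group n) H" by (rule all_embedD[OF assms(4) group_integer_mod_group o assms(1)])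
  show "n \<le> order H"
    using embeds_order_dvd[OF e assms(2)] o monoid.order_gt_0_iff_finite[OF group.is_monoid[OF assms(2)]] assms(3)
    by (simp add: dvd_imp_le)
  assume "order H = n"
  then have "integer_mod_group n \<cong> H" using embeds_iso[OF e assms(2,3)] o by simp
  then show "H \<cong> integer_mod_group n" by (rule group.iso_sym[OF group_integer_mod_group])
qed

lemma least_order_all_embed_cyclic:
  fixes G :: "'a monoid"
  assumes G: "group G" and n: "n > 0" "all_embed n (integer_mod_group n)"
  shows "least_order_all_embed n G \<longleftrightarrow> G \<cong> integer_mod_group n"
proof -
  have "least_order_all_embed n G \<longleftrightarrow> G \<cong> integer_mod_group n \<or> G \<cong> integer_mod_group n"
    by (rule least_order_all_embed_iff[OF G n(1) group_integer_mod_group _ n(2) group_integer_mod_group _ n(2)])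
      (use n(1) integer_mod_order_le in \<open>auto simp: order_integer_mod_group\<close>)
  then show ?thesis by simp
qed

lemma iso_cong_right:
  assumes "group P" "P \<cong> M"
  shows "G \<cong> P \<longleftrightarrow> G \<cong> M"
proof
  assume "G \<cong> P"
  then show "G \<cong> M" by (rule iso_trans[OF _ assms(2)])
next
  assume "G \<cong> M"
  then show "G \<cong> P" by (rule iso_trans[OF _ group.iso_sym[OF assms]])
qed

lemma dihedral_group_aff_iso:
  assumes "n > 2"
  shows "G \<cong> dihedral_group n \<longleftrightarrow> G \<cong> aff (int n) {1, int n - 1}"
proof (rule iso_cong_right)
  show "group (dihedral_group n)" by (simp add: dihedral_group_def Let_def group_presented_group)
  show "dihedral_group n \<cong> aff (int n) {1, int n - 1}" by (rule dihedral_group_iso[OF mc_aff_2[OF assms]])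
qed

lemma group_H\<^sub>1: "group H\<^sub>1"
  by (simp add: H\<^sub>1_def Let_def group_presented_group)

lemma H\<^sub>1_aff_iso: "G \<cong> integer_mod_group 2 \<times>\<times> H\<^sub>1 \<longleftrightarrow> G \<cong> integer_mod_group 2 \<times>\<times> aff 8 {1, 3}"
proof (rule iso_cong_right)
  show "group (integer_mod_group 2 \<times>\<times> H\<^sub>1)" by (intro DirProd_group group_integer_mod_group group_H\<^sub>1)
  show "integer_mod_group 2 \<times>\<times> H\<^sub>1 \<cong> integer_mod_group 2 \<times>\<times> aff 8 {1, 3}"
    by (rule group.DirProd_iso_trans[OF group_integer_mod_group iso_refl H\<^sub>1_iso[OF mc_aff_8_13]])
qed

lemma H\<^sub>2_aff_iso: "G \<cong> H\<^sub>2 \<longleftrightarrow> G \<cong> aff 8 {1, 3, 5, 7}"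
  by (rule iso_cong_right[OF _ H\<^sub>2_iso[OF tri_aff_8]]) (simp add: H\<^sub>2_def Let_def group_presented_group)

lemma H\<^sub>3_aff_iso: "G \<cong> H\<^sub>3 \<longleftrightarrow> G \<cong> aff 9 {1, 4, 7}"
  by (rule iso_cong_right[OF _ H\<^sub>3_iso[OF mc_aff_9]]) (simp add: H\<^sub>3_def Let_def group_presented_group)

lemma least_order_all_embed_4:
  fixes G :: "'a monoid"
  assumes "group G"
  shows "least_order_all_embed 4 G \<longleftrightarrow> G \<cong> integer_mod_group 2 \<times>\<times> integer_mod_group 4 \<or> G \<cong> dihedral_group 4"
proof -
  have "group (aff 4 {1, 3})" using group_aff_2[of 4] by simp
  then have "least_order_all_embed 4 G \<longleftrightarrow> G \<cong> integer_mod_group 2 \<times>\<times> integer_mod_group 4 \<or> G \<cong> aff 4 {1, 3}"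
    by (intro least_order_all_embed_iff[OF assms, where N = 8] all_embed_4 order_4_bound order_4_unique)
      (simp_all add: DirProd_group order_DirProd order_integer_mod_group order_aff)
  then show ?thesis using dihedral_group_aff_iso[of 4 G] by simp
qed

lemma least_order_all_embed_8:
  fixes G :: "'a monoid"
  assumes "group G"
  shows "least_order_all_embed 8 G \<longleftrightarrow> G \<cong> integer_mod_group 2 \<times>\<times> H\<^sub>1 \<or> G \<cong> H\<^sub>2"
  unfolding H\<^sub>1_aff_iso H\<^sub>2_aff_iso
  by (intro least_order_all_embed_iff[OF assms, where N = 32] all_embed_8 order_8_bound order_8_unique group_aff_8)
    (simp_all add: DirProd_group group_aff_8_13 order_DirProd order_integer_mod_group order_aff)

lemma least_order_all_embed_9:
  fixes G :: "'a monoid"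
  assumes "group G"
  shows "least_order_all_embed 9 G \<longleftrightarrow> G \<cong> integer_mod_group 3 \<times>\<times> integer_mod_group 9 \<or> G \<cong> H\<^sub>3"
  unfolding H\<^sub>3_aff_iso
  by (intro least_order_all_embed_iff[OF assms, where N = 27] all_embed_9 order_9_bound order_9_unique group_aff_9)
    (simp_all add: DirProd_group order_DirProd order_integer_mod_group order_aff)

lemma least_order_all_embed_2p:
  fixes G :: "'a monoid"
  assumes "group G" "p \<in> {3, 5, 7}"
  shows "least_order_all_embed (2 * p) G \<longleftrightarrow> G \<cong> dihedral_group (2 * p)"
proof -
  have p: "p > 2" "odd p" "2 * p > 2" "4 * p > 0" using assms(2) by auto
  let ?A = "aff (int (2 * p)) {1, int (2 * p) - 1}"
  have A: "group ?A" "order ?A = 4 * p" "all_embed (2 * p) ?A"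
    using group_aff_2[OF p(3)] all_embed_2p_aff[OF assms(2)] p by (simp_all add: order_aff)
  have "least_order_all_embed (2 * p) G \<longleftrightarrow> G \<cong> ?A \<or> G \<cong> ?A"
    by (rule least_order_all_embed_iff[OF assms(1) p(4) A A])
      (use order_2p_bound[OF _ _ _ p(1,2)] order_2p_unique[OF _ _ _ _ assms(2)] in blast)+
  then show ?thesis using dihedral_group_aff_iso[OF p(3), of G] by simp
qed

lemma least_order_all_embed_12:
  fixes G :: "'a monoid"
  assumes "group G"
  shows "least_order_all_embed 12 G \<longleftrightarrow> G \<cong> sym_group 3 \<times>\<times> sym_group 4"
proof -
  let ?M = "sym_group 3 \<times>\<times> sym_group 4"
  have M: "group ?M" by (intro DirProd_group sym_group_is_group)
  have "144 \<le> order H" if "group H" "finite (carrier H)" "all_embed 12 H" for H :: "nat monoid"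
    using order_12_unique[OF that] by linarith
  moreover have "144 \<le> order G" if "group G" "finite (carrier G)" "all_embed 12 G"
    using order_12_unique[OF that] by linarith
  moreover have "G \<cong> ?M" if "group G" "finite (carrier G)" "all_embed 12 G" "order G = 144"
    using order_12_unique[OF that(1-3)] that(4) by simp
  ultimately have "least_order_all_embed 12 G \<longleftrightarrow> G \<cong> ?M \<or> G \<cong> ?M"
    by (intro least_order_all_embed_iff[OF assms _ M order_sym_3_4 all_embed_12 M order_sym_3_4 all_embed_12])
      simp_all
  then show ?thesis by simp
qed

text \<open>A center with at most one nontrivial element is transported along an isomorphism; this
  invariant separates the two groups for \<open>n = 8\<close>.\<close>

lemma iso_center:
  assumes "G \<cong> K" "group G" "group K"
    and K: "\<And>x y. x \<in> carrier K \<Longrightarrow> y \<in> carrier K \<Longrightarrow> (\<And>z. z \<in> carrier K \<Longrightarrow> cj K z x = x) \<Longrightarrow>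
      (\<And>z. z \<in> carrier K \<Longrightarrow> cj K z y = y) \<Longrightarrow> x = \<one>\<^bsub>K\<^esub> \<or> y = \<one>\<^bsub>K\<^esub> \<or> x = y"
    and x: "x \<in> carrier G" "\<And>z. z \<in> carrier G \<Longrightarrow> cj G z x = x"
    and y: "y \<in> carrier G" "\<And>z. z \<in> carrier G \<Longrightarrow> cj G z y = y"
  shows "x = \<one>\<^bsub>G\<^esub> \<or> y = \<one>\<^bsub>G\<^esub> \<or> x = y"
proof -
  obtain \<phi> where "\<phi> \<in> iso G K" using assms(1) unfolding is_iso_def by blast
  then have \<phi>: "\<phi> \<in> hom G K" "inj_on \<phi> (carrier G)" "\<phi> ` carrier G = carrier K"
    by (auto simp: iso_def bij_betw_def)
  interpret group_hom G K \<phi> using assms(2,3) \<phi>(1) by (simp add: group_hom_def group_hom_axioms_def)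
  have c: "cj K z (\<phi> u) = \<phi> u" if u: "u \<in> carrier G" "\<And>z. z \<in> carrier G \<Longrightarrow> cj G z u = u" and z: "z \<in> carrier K" for u z
  proof -
    obtain z' where "z' \<in> carrier G" "z = \<phi> z'" using z \<phi>(3) by blast
    then show ?thesis using hom_cj[OF assms(2,3) \<phi>(1) _ u(1), of z'] u by simp
  qed
  have "\<phi> x = \<one>\<^bsub>K\<^esub> \<or> \<phi> y = \<one>\<^bsub>K\<^esub> \<or> \<phi> x = \<phi> y"
    by (rule K) (use x y c in \<open>auto intro: hom_closed\<close>)
  then show ?thesis using \<phi>(2) x(1) y(1) hom_one by (metis G.one_closed inj_on_eq_iff)
qed


lemma iso_noncommuting:
  assumes "G \<cong> K" "group G" "\<And>x y. x \<in> carrier G \<Longrightarrow> y \<in> carrier G \<Longrightarrow> cj G x y = y" "group K" "x \<in> carrier K" "y \<in> carrier K" "cj K x y \<noteq> y"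
  shows False
proof -
  obtain \<phi> where "\<phi> \<in> iso G K" using assms(1) unfolding is_iso_def by blast
  then have \<phi>: "\<phi> \<in> hom G K" "\<phi> ` carrier G = carrier K" by (auto simp: iso_def bij_betw_def)
  obtain x' y' where xy: "x' \<in> carrier G" "y' \<in> carrier G" "x = \<phi> x'" "y = \<phi> y'" using assms(5,6) \<phi>(2) by blast
  have "cj K x y = \<phi> (cj G x' y')" using hom_cj[OF assms(2,4) \<phi>(1) xy(1,2)] xy(3,4) by simp
  then show False using assms(3)[OF xy(1,2)] xy(4) assms(7) by simp
qed

lemma not_iso_4: "\<not> integer_mod_group 2 \<times>\<times> integer_mod_group 4 \<cong> dihedral_group 4"
proof
  assume "integer_mod_group 2 \<times>\<times> integer_mod_group 4 \<cong> dihedral_group 4"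
  then have i: "integer_mod_group 2 \<times>\<times> integer_mod_group 4 \<cong> aff 4 {1, 3}" by (simp add: dihedral_group_aff_iso)
  have A: "group (aff 4 {1, 3})" using group_aff_2[of 4] by simp
  show False
    by (rule iso_noncommuting[OF i _ _ A, of "(3, 0)" "(1, 1)"])
      (auto simp: cj_aff_iff[OF A] DirProd_group cj_DirProd cj_integer_mod_group)
qed

lemma not_iso_9: "\<not> integer_mod_group 3 \<times>\<times> integer_mod_group 9 \<cong> H\<^sub>3"
proof
  assume "integer_mod_group 3 \<times>\<times> integer_mod_group 9 \<cong> H\<^sub>3"
  then have i: "integer_mod_group 3 \<times>\<times> integer_mod_group 9 \<cong> aff 9 {1, 4, 7}" unfolding H\<^sub>3_aff_iso .
  show False
    by (rule iso_noncommuting[OF i _ _ group_aff_9, of "(4, 0)" "(1, 1)"])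
      (auto simp: cj_aff_iff[OF group_aff_9] DirProd_group cj_DirProd cj_integer_mod_group)
qed

text \<open>Commuting with the translation by 1 forces linear part 1, and commuting with
  multiplication by 3 forces 2v = 0 modulo 8.\<close>

lemma center_aff_8:
  assumes "x \<in> carrier (aff 8 {1, 3, 5, 7})" "\<And>z. z \<in> carrier (aff 8 {1, 3, 5, 7}) \<Longrightarrow> cj (aff 8 {1, 3, 5, 7}) z x = x"
  shows "x = (1, 0) \<or> x = (1, 4)"
proof -
  have x: "fst x \<in> {1, 3, 5, 7}" "snd x \<in> {0, 1, 2, 3, 4, 5, 6, 7}" using assms(1) by (auto simp: mem_Times_iff)
  have c: "cj (aff 8 {1, 3, 5, 7}) (1, 1) x = x" "cj (aff 8 {1, 3, 5, 7}) (3, 0) x = x" using assms(2) by simp_all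
  show ?thesis using x c assms(1) by (cases x) (auto simp: cj_aff_iff[OF group_aff_8])
qed

lemma center_aff_8_13:
  assumes "z \<in> carrier (aff 8 {1, 3})"
  shows "cj (aff 8 {1, 3}) z (1, 0) = (1, 0)" "cj (aff 8 {1, 3}) z (1, 4) = (1, 4)"
proof -
  have e: "(y + 12) mod 8 = (4 + y) mod 8" for y :: int
    using mod_add_self2[of "4 + y" 8] by (simp add: algebra_simps)
  show "cj (aff 8 {1, 3}) z (1, 0) = (1, 0)" "cj (aff 8 {1, 3}) z (1, 4) = (1, 4)"
    using assms e by (auto simp: cj_aff_iff[OF group_aff_8_13] add.commute)
qed

text \<open>In the direct product the generator of the factor of order 2 and the translation by 4
  are two different central involutions.\<close>

lemma not_iso_8: "\<not> integer_mod_group 2 \<times>\<times> H\<^sub>1 \<cong> H\<^sub>2"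
proof
  let ?P = "integer_mod_group 2 \<times>\<times> H\<^sub>1" and ?A = "integer_mod_group 2 \<times>\<times> aff 8 {1, 3}"
  assume "?P \<cong> H\<^sub>2"
  then have "?P \<cong> aff 8 {1, 3, 5, 7}" unfolding H\<^sub>2_aff_iso .
  moreover have P: "group ?P" by (intro DirProd_group group_integer_mod_group group_H\<^sub>1)
  have "?P \<cong> ?A" by (rule iffD1[OF H\<^sub>1_aff_iso iso_refl])
  then have "?A \<cong> ?P" by (rule group.iso_sym[OF P])
  ultimately have i: "?A \<cong> aff 8 {1, 3, 5, 7}" by (rule iso_trans[rotated])
  have A: "group ?A" by (simp add: DirProd_group group_aff_8_13)
  have m: "(1, (1, 0)) \<in> carrier ?A" "(0, (1, 4)) \<in> carrier ?A" by (simp_all add: carrier_integer_mod_group)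
  have "(1, (1, 0)) = \<one>\<^bsub>?A\<^esub> \<or> (0, (1, 4)) = \<one>\<^bsub>?A\<^esub> \<or> (1::int, (1::int, 0::int)) = (0, (1, 4))"
  proof (rule iso_center[OF i A group_aff_8 _ m(1) _ m(2)])
    fix z assume z: "z \<in> carrier ?A"
    obtain p q where pq: "z = (p, q)" by (cases z)
    have p: "p \<in> carrier (integer_mod_group 2)" and q: "q \<in> carrier (aff 8 {1, 3})" using z unfolding pq DirProd_def by simp_all
    have m': "(1::int) \<in> carrier (integer_mod_group 2)" "(0::int) \<in> carrier (integer_mod_group 2)"
      "(1, 0) \<in> carrier (aff 8 {1, 3})" "(1, 4) \<in> carrier (aff 8 {1, 3})" by (simp_all add: carrier_integer_mod_group)
    show "cj ?A z (1, (1, 0)) = (1, (1, 0))" "cj ?A z (0, (1, 4)) = (0, (1, 4))"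
      using cj_DirProd[OF group_integer_mod_group group_aff_8_13, of z 2 "(1, (1, 0))"]
        cj_DirProd[OF group_integer_mod_group group_aff_8_13, of z 2 "(0, (1, 4))"]
        center_aff_8_13[OF q] m' cj_integer_mod_group[OF p] p q unfolding pq by (simp_all only: fst_conv snd_conv mem_Sigma_iff simp_thms)
  next
    fix x y assume "x \<in> carrier (aff 8 {1, 3, 5, 7})" "y \<in> carrier (aff 8 {1, 3, 5, 7})"
      "\<And>z. z \<in> carrier (aff 8 {1, 3, 5, 7}) \<Longrightarrow> cj (aff 8 {1, 3, 5, 7}) z x = x"
      "\<And>z. z \<in> carrier (aff 8 {1, 3, 5, 7}) \<Longrightarrow> cj (aff 8 {1, 3, 5, 7}) z y = y"
    then have "x = (1, 0) \<or> x = (1, 4)" "y = (1, 0) \<or> y = (1, 4)" using center_aff_8[of x] center_aff_8[of y] by blast+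
    then show "x = \<one>\<^bsub>aff 8 {1, 3, 5, 7}\<^esub> \<or> y = \<one>\<^bsub>aff 8 {1, 3, 5, 7}\<^esub> \<or> x = y" by auto
  qed
  then show False by simp
qed

theorem theorem3:
  fixes G :: "'a monoid"
  assumes "group G"
  shows
    "(least_order_all_embed 1 G \<longleftrightarrow> G \<cong> integer_mod_group 1) \<and>
     (least_order_all_embed 2 G \<longleftrightarrow> G \<cong> integer_mod_group 2) \<and>
     (least_order_all_embed 3 G \<longleftrightarrow> G \<cong> integer_mod_group 3) \<and>
     (least_order_all_embed 4 G \<longleftrightarrow> G \<cong> integer_mod_group 2 \<times>\<times> integer_mod_group 4 \<or> G \<cong> dihedral_group 4) \<and>
     (least_order_all_embed 5 G \<longleftrightarrow> G \<cong> integer_mod_group 5) \<and>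
     (least_order_all_embed 6 G \<longleftrightarrow> G \<cong> dihedral_group 6) \<and>
     (least_order_all_embed 7 G \<longleftrightarrow> G \<cong> integer_mod_group 7) \<and>
     (least_order_all_embed 8 G \<longleftrightarrow> G \<cong> integer_mod_group 2 \<times>\<times> H\<^sub>1 \<or> G \<cong> H\<^sub>2) \<and>
     (least_order_all_embed 9 G \<longleftrightarrow> G \<cong> integer_mod_group 3 \<times>\<times> integer_mod_group 9 \<or> G \<cong> H\<^sub>3) \<and>
     (least_order_all_embed 10 G \<longleftrightarrow> G \<cong> dihedral_group 10) \<and>
     (least_order_all_embed 11 G \<longleftrightarrow> G \<cong> integer_mod_group 11) \<and>
     (least_order_all_embed 12 G \<longleftrightarrow> G \<cong> sym_group 3 \<times>\<times> sym_group 4) \<and>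
     (least_order_all_embed 13 G \<longleftrightarrow> G \<cong> integer_mod_group 13) \<and>
     (least_order_all_embed 14 G \<longleftrightarrow> G \<cong> dihedral_group 14) \<and>
     (least_order_all_embed 15 G \<longleftrightarrow> G \<cong> integer_mod_group 15) \<and>
     \<not> integer_mod_group 2 \<times>\<times> integer_mod_group 4 \<cong> dihedral_group 4 \<and>
     \<not> integer_mod_group 2 \<times>\<times> H\<^sub>1 \<cong> H\<^sub>2 \<and>
     \<not> integer_mod_group 3 \<times>\<times> integer_mod_group 9 \<cong> H\<^sub>3"
proof -
  have p: "prime (2::nat)" "prime (3::nat)" "prime (5::nat)" "prime (7::nat)" "prime (11::nat)" "prime (13::nat)" by simp_all
  have cyc: "least_order_all_embed q G \<longleftrightarrow> G \<cong> integer_mod_group q" if "prime q" for q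
    by (rule least_order_all_embed_cyclic[OF assms prime_gt_0_nat[OF that] all_embed_prime[OF that]])
  have "least_order_all_embed 1 G \<longleftrightarrow> G \<cong> integer_mod_group 1"
    by (rule least_order_all_embed_cyclic[OF assms _ all_embed_1]) simp
  moreover have "least_order_all_embed 15 G \<longleftrightarrow> G \<cong> integer_mod_group 15"
    by (rule least_order_all_embed_cyclic[OF assms _ all_embed_15]) simp
  moreover have "least_order_all_embed 6 G \<longleftrightarrow> G \<cong> dihedral_group 6" "least_order_all_embed 10 G \<longleftrightarrow> G \<cong> dihedral_group 10"
    "least_order_all_embed 14 G \<longleftrightarrow> G \<cong> dihedral_group 14"
    using least_order_all_embed_2p[OF assms, of 3] least_order_all_embed_2p[OF assms, of 5] least_order_all_embed_2p[OF assms, of 7]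
    by simp_all
  ultimately show ?thesis
    by (intro conjI cyc[OF p(1)] cyc[OF p(2)] cyc[OF p(3)] cyc[OF p(4)] cyc[OF p(5)] cyc[OF p(6)]
        least_order_all_embed_4[OF assms] least_order_all_embed_8[OF assms] least_order_all_embed_9[OF assms]
        least_order_all_embed_12[OF assms] not_iso_4 not_iso_8 not_iso_9)
qed

end
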